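(* Let $A=kC_n/J^t$ with $n\ge 1$, $t\ge 2$ be a selfinjective Nakayama algebra, and put $d=\gcd(n,t)$. Then: (1) The category $A\text{-}\mathrm{mod}$ admits an exceptional Hovey triple if and only if $d\ge 2$ and $t\ge 3$. (2) Assume that $d\ge 2$ and $t\ge 3$. Put $R=d\mathbb Z/n\mathbb Z\subseteq \mathbb Z/n\mathbb Z$ and $P=\bigoplus_{1\le i\le n}M_{i,t}$. Then $(\mathcal C,\mathcal F,\mathcal W)$ is an exceptional Hovey triple in $A\text{-}\mathrm{mod}$, where $$\mathcal C=\operatorname{add}\Big(P\oplus\bigoplus_{i\notin R,\ 1\le l<t}M_{i,l}\Big),\qquad \mathcal F=\operatorname{add}\Big(P\oplus\bigoplus_{i+l-1\notin R,\ 1\le l<t}M_{i,l}\Big),$$ $$\mathcal W=\operatorname{add}\Big(P\oplus\bigoplus_{i\in R}(M_{i,1}\oplus M_{i+1,t-1})\Big).$$ Moreover, this Hovey triple is of Type I if and only if $d=2$, and of Type II if and only if $d\ge 3$.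
   Context: $k$ is an algebraically closed field. $C_n$ is the cyclic quiver with vertices $1,\dots,n$ (indices in $\mathbb Z/n\mathbb Z$) and one arrow $a_{i+1}:i\to i+1$ for each $i\in\mathbb Z/n\mathbb Z$; $J$ is the ideal of the path algebra $kC_n$ generated by the arrows. $A\text{-}\mathrm{mod}$ is the category of finitely generated left $A$-modules; left modules are identified with representations of the quiver with relations. $S_i$ is the simple module at $i$. $M_{i,l}$ denotes the indecomposable (uniserial) $A$-module with top $S_i$ and length $l$; its composition factors from top to socle are $S_i,S_{i+1},\dots,S_{i+l-1}$. The $M_{i,l}$ with $i\in\mathbb Z/n\mathbb Z$, $1\le l\le t$, are all the indecomposable $A$-modules; the $M_{i,t}$ are the indecomposable projective(-injective) ones. For a module $M$, $\operatorname{add}M$ is the full subcategory of direct summands of finite direct sums of copies of $M$. For an abelian category $\mathcal A$ and a class $\mathcal L$ of objects, $\mathcal L^\perp=\{Z:\mathrm{Ext}^1(L,Z)=0\ \forall L\in\mathcal L\}$ and ${}^\perp\mathcal L=\{Z:\mathrm{Ext}^1(Z,L)=0\ \forall L\in\mathcal L\}$. A cotorsion pair is a pair $(\mathcal X,\mathcal Y)$ of classes with $\mathcal X^\perp=\mathcal Y$ and ${}^\perp\mathcal Y=\mathcal X$. It is complete if every object $M$ admits short exact sequences $0\to Y\to X\to M\to0$ and $0\to M\to Y'\to X'\to 0$ with $X,X'\in\mathcal X$, $Y,Y'\in\mathcal Y$. A subcategory is thick if it is closed under direct summands and, for every short exact sequence, contains all three terms as soon as it contains two of them. A Hovey triple in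 $\mathcal A$ is a triple $(\mathcal C,\mathcal F,\mathcal W)$ of classes of objects such that $(\mathcal C\cap\mathcal W,\mathcal F)$ and $(\mathcal C,\mathcal F\cap\mathcal W)$ are complete cotorsion pairs and $\mathcal W$ is thick. The extension-closed full subcategory $\mathcal C\cap\mathcal F$ carries the exact structure of short exact sequences of $\mathcal A$ with all terms in $\mathcal C\cap\mathcal F$. An exact category is Frobenius if it has enough projective objects, enough injective objects, and its projective and injective objects coincide. $(\mathcal B,\mathcal P)$ is a Frobenius pair if $\mathcal B$ is Frobenius and $\mathcal P$ is the full subcategory $\mathcal P(\mathcal B)$ of its projective(-injective) objects. A Hovey triple $(\mathcal C,\mathcal F,\mathcal W)$ is exceptional if $(\mathcal C\cap\mathcal F,\mathcal C\cap\mathcal F\cap\mathcal W)$ is not a Frobenius pair; an exceptional one is of Type I if $\mathcal C\cap\mathcal F$ is Frobenius (but $\mathcal P(\mathcal C\cap\mathcal F)\neq\mathcal C\cap\mathcal F\cap\mathcal W$), and of Type II if $\mathcal C\cap\mathcal F$ is not Frobenius. *)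

theory Defs
  imports
    "HOL-Computational_Algebra.Polynomial"
    "Graph_Theory.Arc_Walk"
    "HOL-Algebra.Ideal_Product"
    "HOL-Algebra.QuotRing"
    "HOL-Algebra.Module"
begin

section \<open>The algebra \<open>k C\<^sub>n / J\<^sup>t\<close>\<close>

text \<open>
  A quiver is a \<^type>\<open>pre_digraph\<close>. A path is a pair of its start vertex and its list of
  arrows, in the order in which they are traversed; the trivial path at \<open>u\<close> is \<open>(u, [])\<close>.
\<close>

definition paths :: "('v, 'a) pre_digraph \<Rightarrow> ('v \<times> 'a list) set" where
  "paths Q = {(u, p). \<exists>v. pre_digraph.awalk Q u p v}"

text \<open>
  Paths multiply like maps: \<open>q p\<close> is "first \<open>p\<close>, then \<open>q\<close>". Thus a left module is a covariant
  representation, an arrow \<open>i \<rightarrow> j\<close> acting as a map from the space at \<open>i\<close> to the space at \<open>j\<close>.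
  In \<open>x y\<close> the coefficient of a path is therefore a sum over its decompositions into an initial
  part, taken from \<open>y\<close>, and a final part, taken from \<open>x\<close>.
\<close>

definition path_algebra :: "('v, 'a) pre_digraph \<Rightarrow> ('v \<times> 'a list \<Rightarrow> 'k::field) ring" where
  "path_algebra Q = \<lparr>
     carrier = {x. finite {p. x p \<noteq> 0} \<and> {p. x p \<noteq> 0} \<subseteq> paths Q},
     monoid.mult = (\<lambda>x y (u, p). \<Sum>j\<le>length p.
       x (pre_digraph.awlast Q u (take j p), drop j p) * y (u, take j p)),
     one = (\<lambda>(u, p). if u \<in> verts Q \<and> p = [] then 1 else 0),
     zero = (\<lambda>_. 0),
     add = (\<lambda>x y p. x p + y p)\<rparr>"

definition arrow_ideal :: "('v, 'a) pre_digraph \<Rightarrow> ('v \<times> 'a list \<Rightarrow> 'k::field) set" where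
  "arrow_ideal Q = genideal (path_algebra Q)
     {\<lambda>p. if p = (tail Q a, [a]) then 1 else 0 | a. a \<in> arcs Q}"

text \<open>
  Residues modulo \<open>n\<close> are represented by \<open>0, \<dots>, n - 1\<close>, so the vertex \<open>n\<close> is \<open>0\<close>. An arrow is
  named after its source.
\<close>

definition cyclic_quiver :: "nat \<Rightarrow> (nat, nat) pre_digraph" where
  "cyclic_quiver n =
     \<lparr>verts = {..<n}, arcs = {..<n}, tail = (\<lambda>i. i), head = (\<lambda>i. (i + 1) mod n)\<rparr>"

type_synonym 'k nak = "(nat \<times> nat list \<Rightarrow> 'k) set"

definition nakayama_algebra :: "nat \<Rightarrow> nat \<Rightarrow> 'k::field nak ring" where
  "nakayama_algebra n t =
     path_algebra (cyclic_quiver n) Quot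
       (arrow_ideal (cyclic_quiver n) [^]\<^bsub>ideals_set (path_algebra (cyclic_quiver n))\<^esub> t)"


section \<open>Finitely generated left modules\<close>

text \<open>
  The library locale \<^locale>\<open>module\<close> is restricted to commutative rings. The record type
  \<^type>\<open>module\<close> is reused; its fields \<open>mult\<close> and \<open>one\<close> play no role.
\<close>

locale left_module = R?: ring R + M?: abelian_group M for R (structure) and M (structure) +
  assumes smult_closed:
      "\<lbrakk>a \<in> carrier R; x \<in> carrier M\<rbrakk> \<Longrightarrow> a \<odot>\<^bsub>M\<^esub> x \<in> carrier M"
    and smult_l_distr:
      "\<lbrakk>a \<in> carrier R; b \<in> carrier R; x \<in> carrier M\<rbrakk> \<Longrightarrow>
        (a \<oplus>\<^bsub>R\<^esub> b) \<odot>\<^bsub>M\<^esub> x = a \<odot>\<^bsub>M\<^esub> x \<oplus>\<^bsub>M\<^esub> b \<odot>\<^bsub>M\<^esub> x"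
    and smult_r_distr:
      "\<lbrakk>a \<in> carrier R; x \<in> carrier M; y \<in> carrier M\<rbrakk> \<Longrightarrow>
        a \<odot>\<^bsub>M\<^esub> (x \<oplus>\<^bsub>M\<^esub> y) = a \<odot>\<^bsub>M\<^esub> x \<oplus>\<^bsub>M\<^esub> a \<odot>\<^bsub>M\<^esub> y"
    and smult_assoc:
      "\<lbrakk>a \<in> carrier R; b \<in> carrier R; x \<in> carrier M\<rbrakk> \<Longrightarrow>
        (a \<otimes>\<^bsub>R\<^esub> b) \<odot>\<^bsub>M\<^esub> x = a \<odot>\<^bsub>M\<^esub> (b \<odot>\<^bsub>M\<^esub> x)"
    and smult_one:
      "x \<in> carrier M \<Longrightarrow> \<one>\<^bsub>R\<^esub> \<odot>\<^bsub>M\<^esub> x = x"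

definition finitely_generated :: "'r ring \<Rightarrow> ('r, 'm) module \<Rightarrow> bool" where
  "finitely_generated R M \<longleftrightarrow>
     (\<exists>S. finite S \<and> S \<subseteq> carrier M \<and> (\<forall>N. submodule N R M \<and> S \<subseteq> N \<longrightarrow> N = carrier M))"

text \<open>
  The objects of \<open>R\<close>-mod whose underlying set lies in the type \<open>'m\<close>. If \<open>'m\<close> is large enough for
  every finitely generated module to have an isomorphic copy in it, this is \<open>R\<close>-mod up to
  equivalence.
\<close>

definition fg_mods :: "'r ring \<Rightarrow> ('r, 'm) module set" where
  "fg_mods R = {M. left_module R M \<and> finitely_generated R M}"

definition lhom :: "'r ring \<Rightarrow> ('r, 'm) module \<Rightarrow> ('r, 'n) module \<Rightarrow> ('m \<Rightarrow> 'n) set" where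
  "lhom R M N = {f. f \<in> carrier M \<rightarrow> carrier N \<and>
     (\<forall>x\<in>carrier M. \<forall>y\<in>carrier M. f (x \<oplus>\<^bsub>M\<^esub> y) = f x \<oplus>\<^bsub>N\<^esub> f y) \<and>
     (\<forall>a\<in>carrier R. \<forall>x\<in>carrier M. f (a \<odot>\<^bsub>M\<^esub> x) = a \<odot>\<^bsub>N\<^esub> f x)}"

definition mod_iso :: "'r ring \<Rightarrow> ('r, 'm) module \<Rightarrow> ('r, 'n) module \<Rightarrow> bool" where
  "mod_iso R M N \<longleftrightarrow> (\<exists>f\<in>lhom R M N. bij_betw f (carrier M) (carrier N))"

definition short_exact ::
  "'r ring \<Rightarrow> ('r, 'm) module \<Rightarrow> ('m \<Rightarrow> 'm) \<Rightarrow> ('r, 'm) module \<Rightarrow> ('m \<Rightarrow> 'm) \<Rightarrow> ('r, 'm) module \<Rightarrow> bool"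
  where
  "short_exact R X f Y g Z \<longleftrightarrow>
     f \<in> lhom R X Y \<and> g \<in> lhom R Y Z \<and> inj_on f (carrier X) \<and> g ` carrier Y = carrier Z \<and>
     f ` carrier X = {y \<in> carrier Y. g y = \<zero>\<^bsub>Z\<^esub>}"

definition direct_sum2 :: "('r, 'm) module \<Rightarrow> ('r, 'n) module \<Rightarrow> ('r, 'm \<times> 'n) module"
    (infixr \<open>\<oplus>\<^sub>m\<close> 65) where
  "M \<oplus>\<^sub>m N = \<lparr>
     carrier = carrier M \<times> carrier N,
     monoid.mult = undefined, one = undefined,
     zero = (\<zero>\<^bsub>M\<^esub>, \<zero>\<^bsub>N\<^esub>),
     add = (\<lambda>(x, y) (x', y'). (x \<oplus>\<^bsub>M\<^esub> x', y \<oplus>\<^bsub>N\<^esub> y')),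
     smult = (\<lambda>a (x, y). (a \<odot>\<^bsub>M\<^esub> x, a \<odot>\<^bsub>N\<^esub> y))\<rparr>"

definition direct_sum :: "'i set \<Rightarrow> ('i \<Rightarrow> ('r, 'm) module) \<Rightarrow> ('r, 'i \<Rightarrow> 'm) module" where
  "direct_sum I X = \<lparr>
     carrier = {f \<in> (\<Pi>\<^sub>E i\<in>I. carrier (X i)). finite {i\<in>I. f i \<noteq> \<zero>\<^bsub>X i\<^esub>}},
     monoid.mult = undefined, one = undefined,
     zero = (\<lambda>i\<in>I. \<zero>\<^bsub>X i\<^esub>),
     add = (\<lambda>f g. \<lambda>i\<in>I. f i \<oplus>\<^bsub>X i\<^esub> g i),
     smult = (\<lambda>a f. \<lambda>i\<in>I. a \<odot>\<^bsub>X i\<^esub> f i)\<rparr>"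

definition direct_summand :: "'r ring \<Rightarrow> ('r, 'm) module \<Rightarrow> ('r, 'n) module \<Rightarrow> bool" where
  "direct_summand R X Y \<longleftrightarrow> (\<exists>X' :: ('r, 'm) module \<in> fg_mods R. mod_iso R (X \<oplus>\<^sub>m X') Y)"

definition add_class :: "'r ring \<Rightarrow> ('r, 'n) module \<Rightarrow> ('r, 'm) module set" where
  "add_class R M = {X \<in> fg_mods R. \<exists>m::nat. direct_summand R X (direct_sum {..<m} (\<lambda>_. M))}"


section \<open>The indecomposable modules \<open>M\<^bsub>i,l\<^esub>\<close>\<close>

text \<open>
  The standard model: a basis \<open>m\<^sub>0, \<dots>, m\<^bsub>l-1\<^esub>\<close> with \<open>m\<^sub>j\<close> at the vertex \<open>i + j\<close>, each arrow
  leaving \<open>i + j\<close> sending \<open>m\<^sub>j\<close> to \<open>m\<^bsub>j+1\<^esub>\<close> (and \<open>m\<^bsub>l-1\<^esub>\<close> to \<open>0\<close>). An element \<open>\<Sum>\<^sub>j v\<^sub>j m\<^sub>j\<close> is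
  its coefficient function \<open>v\<close>. \<open>cyc_path n u r\<close> is the path of length \<open>r\<close> starting at \<open>u\<close>.
\<close>

definition cyc_path :: "nat \<Rightarrow> nat \<Rightarrow> nat \<Rightarrow> nat \<times> nat list" where
  "cyc_path n u r = (u mod n, map (\<lambda>s. (u + s) mod n) [0..<r])"

definition uniserial_action ::
  "nat \<Rightarrow> nat \<Rightarrow> nat \<Rightarrow> (nat \<times> nat list \<Rightarrow> 'k::field) \<Rightarrow> (nat \<Rightarrow> 'k) \<Rightarrow> nat \<Rightarrow> 'k" where
  "uniserial_action n i l x v =
     (\<lambda>j. if j < l then \<Sum>s\<le>j. x (cyc_path n (i + s) (j - s)) * v s else 0)"

text \<open>
  A residue class modulo \<open>J\<^sup>t\<close> acts through any of its members; for \<open>l \<le> t\<close> the choice is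
  immaterial, since then \<open>J\<^sup>t\<close> acts as \<open>0\<close>.
\<close>

definition uniserial :: "nat \<Rightarrow> nat \<Rightarrow> nat \<Rightarrow> ('k::field nak, nat \<Rightarrow> 'k) module" where
  "uniserial n i l = \<lparr>
     carrier = {v. \<forall>j\<ge>l. v j = 0},
     monoid.mult = undefined, one = undefined,
     zero = (\<lambda>_. 0),
     add = (\<lambda>v w j. v j + w j),
     smult = (\<lambda>X. uniserial_action n i l (SOME x. x \<in> X))\<rparr>"


section \<open>Extensions and cotorsion pairs\<close>

text \<open>\<open>Ext\<^sup>1(Z, X)\<close> in the sense of Yoneda: equivalence classes of \<open>0 \<rightarrow> X \<rightarrow> E \<rightarrow> Z \<rightarrow> 0\<close>.\<close>

definition extensions ::
  "'r ring \<Rightarrow> ('r, 'm) module \<Rightarrow> ('r, 'm) module \<Rightarrow> (('m \<Rightarrow> 'm) \<times> ('r, 'm) module \<times> ('m \<Rightarrow> 'm)) set"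
  where
  "extensions R Z X = {(f, E, g). E \<in> fg_mods R \<and> short_exact R X f E g Z}"

definition ext_equiv ::
  "'r ring \<Rightarrow> ('r, 'm) module \<Rightarrow> ('r, 'm) module \<Rightarrow>
    ((('m \<Rightarrow> 'm) \<times> ('r, 'm) module \<times> ('m \<Rightarrow> 'm)) \<times> (('m \<Rightarrow> 'm) \<times> ('r, 'm) module \<times> ('m \<Rightarrow> 'm))) set"
  where
  "ext_equiv R Z X = {((f, E, g), (f', E', g')).
     (f, E, g) \<in> extensions R Z X \<and> (f', E', g') \<in> extensions R Z X \<and>
     (\<exists>h\<in>lhom R E E'. (\<forall>x\<in>carrier X. h (f x) = f' x) \<and> (\<forall>e\<in>carrier E. g' (h e) = g e))}"

definition Ext1 ::
  "'r ring \<Rightarrow> ('r, 'm) module \<Rightarrow> ('r, 'm) module \<Rightarrow>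
    (('m \<Rightarrow> 'm) \<times> ('r, 'm) module \<times> ('m \<Rightarrow> 'm)) set set" where
  "Ext1 R Z X = extensions R Z X // ext_equiv R Z X"

text \<open>A group is \<open>0\<close> iff it has exactly one element, so its addition (the Baer sum) is not needed.\<close>

definition Ext1_vanishes :: "'r ring \<Rightarrow> ('r, 'm) module \<Rightarrow> ('r, 'm) module \<Rightarrow> bool" where
  "Ext1_vanishes R Z X \<longleftrightarrow> is_singleton (Ext1 R Z X)"

definition right_perp :: "'r ring \<Rightarrow> ('r, 'm) module set \<Rightarrow> ('r, 'm) module set" where
  "right_perp R \<L> = {Z \<in> fg_mods R. \<forall>L\<in>\<L>. Ext1_vanishes R L Z}"

definition left_perp :: "'r ring \<Rightarrow> ('r, 'm) module set \<Rightarrow> ('r, 'm) module set" where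
  "left_perp R \<L> = {Z \<in> fg_mods R. \<forall>L\<in>\<L>. Ext1_vanishes R Z L}"

definition cotorsion_pair ::
  "'r ring \<Rightarrow> ('r, 'm) module set \<Rightarrow> ('r, 'm) module set \<Rightarrow> bool" where
  "cotorsion_pair R \<X> \<Y> \<longleftrightarrow> right_perp R \<X> = \<Y> \<and> left_perp R \<Y> = \<X>"

definition complete_cotorsion_pair ::
  "'r ring \<Rightarrow> ('r, 'm) module set \<Rightarrow> ('r, 'm) module set \<Rightarrow> bool" where
  "complete_cotorsion_pair R \<X> \<Y> \<longleftrightarrow> cotorsion_pair R \<X> \<Y> \<and>
     (\<forall>M\<in>fg_mods R.
        (\<exists>Y\<in>\<Y>. \<exists>X\<in>\<X>. \<exists>f g. short_exact R Y f X g M) \<and>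
        (\<exists>Y\<in>\<Y>. \<exists>X\<in>\<X>. \<exists>f g. short_exact R M f Y g X))"

definition thick :: "'r ring \<Rightarrow> ('r, 'm) module set \<Rightarrow> bool" where
  "thick R \<W> \<longleftrightarrow> \<W> \<subseteq> fg_mods R \<and>
     (\<forall>X\<in>fg_mods R. \<forall>Y\<in>\<W>. direct_summand R X Y \<longrightarrow> X \<in> \<W>) \<and>
     (\<forall>X\<in>fg_mods R. \<forall>Y\<in>fg_mods R. \<forall>Z\<in>fg_mods R. \<forall>f g. short_exact R X f Y g Z \<longrightarrow>
        (X \<in> \<W> \<and> Y \<in> \<W> \<longrightarrow> Z \<in> \<W>) \<and>
        (X \<in> \<W> \<and> Z \<in> \<W> \<longrightarrow> Y \<in> \<W>) \<and>
        (Y \<in> \<W> \<and> Z \<in> \<W> \<longrightarrow> X \<in> \<W>))"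

definition hovey_triple ::
  "'r ring \<Rightarrow> ('r, 'm) module set \<Rightarrow> ('r, 'm) module set \<Rightarrow> ('r, 'm) module set \<Rightarrow> bool" where
  "hovey_triple R \<C> \<F> \<W> \<longleftrightarrow>
     complete_cotorsion_pair R (\<C> \<inter> \<W>) \<F> \<and> complete_cotorsion_pair R \<C> (\<F> \<inter> \<W>) \<and> thick R \<W>"


section \<open>Frobenius pairs and exceptional Hovey triples\<close>

text \<open>
  In the following \<open>\<B>\<close> is an extension-closed class of objects, with the exact structure of all
  short exact sequences with terms in \<open>\<B>\<close>.
\<close>

definition conflation ::
  "'r ring \<Rightarrow> ('r, 'm) module set \<Rightarrow>
    ('r, 'm) module \<Rightarrow> ('m \<Rightarrow> 'm) \<Rightarrow> ('r, 'm) module \<Rightarrow> ('m \<Rightarrow> 'm) \<Rightarrow> ('r, 'm) module \<Rightarrow> bool" where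
  "conflation R \<B> X f Y g Z \<longleftrightarrow> X \<in> \<B> \<and> Y \<in> \<B> \<and> Z \<in> \<B> \<and> short_exact R X f Y g Z"

definition projectives :: "'r ring \<Rightarrow> ('r, 'm) module set \<Rightarrow> ('r, 'm) module set" where
  "projectives R \<B> = {Q \<in> \<B>. \<forall>X f Y g Z. conflation R \<B> X f Y g Z \<longrightarrow>
     (\<forall>h\<in>lhom R Q Z. \<exists>h'\<in>lhom R Q Y. \<forall>x\<in>carrier Q. g (h' x) = h x)}"

definition injectives :: "'r ring \<Rightarrow> ('r, 'm) module set \<Rightarrow> ('r, 'm) module set" where
  "injectives R \<B> = {Q \<in> \<B>. \<forall>X f Y g Z. conflation R \<B> X f Y g Z \<longrightarrow>
     (\<forall>h\<in>lhom R X Q. \<exists>h'\<in>lhom R Y Q. \<forall>x\<in>carrier X. h' (f x) = h x)}"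

definition frobenius :: "'r ring \<Rightarrow> ('r, 'm) module set \<Rightarrow> bool" where
  "frobenius R \<B> \<longleftrightarrow>
     (\<forall>Z\<in>\<B>. \<exists>X f Y g. conflation R \<B> X f Y g Z \<and> Y \<in> projectives R \<B>) \<and>
     (\<forall>X\<in>\<B>. \<exists>f Y g Z. conflation R \<B> X f Y g Z \<and> Y \<in> injectives R \<B>) \<and>
     projectives R \<B> = injectives R \<B>"

definition frobenius_pair :: "'r ring \<Rightarrow> ('r, 'm) module set \<Rightarrow> ('r, 'm) module set \<Rightarrow> bool" where
  "frobenius_pair R \<B> \<P> \<longleftrightarrow> frobenius R \<B> \<and> \<P> = projectives R \<B>"

definition exceptional ::
  "'r ring \<Rightarrow> ('r, 'm) module set \<Rightarrow> ('r, 'm) module set \<Rightarrow> ('r, 'm) module set \<Rightarrow> bool" where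
  "exceptional R \<C> \<F> \<W> \<longleftrightarrow>
     hovey_triple R \<C> \<F> \<W> \<and> \<not> frobenius_pair R (\<C> \<inter> \<F>) (\<C> \<inter> \<F> \<inter> \<W>)"

definition type_I ::
  "'r ring \<Rightarrow> ('r, 'm) module set \<Rightarrow> ('r, 'm) module set \<Rightarrow> ('r, 'm) module set \<Rightarrow> bool" where
  "type_I R \<C> \<F> \<W> \<longleftrightarrow> exceptional R \<C> \<F> \<W> \<and> frobenius R (\<C> \<inter> \<F>)"

definition type_II ::
  "'r ring \<Rightarrow> ('r, 'm) module set \<Rightarrow> ('r, 'm) module set \<Rightarrow> ('r, 'm) module set \<Rightarrow> bool" where
  "type_II R \<C> \<F> \<W> \<longleftrightarrow> exceptional R \<C> \<F> \<W> \<and> \<not> frobenius R (\<C> \<inter> \<F>)"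


section \<open>The setting\<close>

text \<open>
  Finitely generated modules over the finite-dimensional algebra \<open>k C\<^sub>n / J\<^sup>t\<close> are
  finite-dimensional over \<open>k\<close>, so all of them have isomorphic copies on subsets of \<open>nat \<Rightarrow> 'k\<close>.
\<close>

type_synonym 'k nak_mod = "('k nak, nat \<Rightarrow> 'k) module"

end

theory Submission
  imports Defs "HOL-Number_Theory.Cong"
begin

text \<open>
  All classes of modules involved are cut out by conditions of the form: at the vertex \<open>j\<close>, every
  element killed by the paths of length \<open>p\<close> is in the image of the paths of length \<open>q\<close>. Maps out of
  \<open>M\<^bsub>i,l\<^esub>\<close> lift along a surjection if its kernel satisfies such a condition, and maps into \<open>M\<^bsub>i,l\<^esub>\<close>
  extend along an injection if its cokernel does. This gives the orthogonality of the cotorsion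
  pairs; an element chase gives thickness of \<open>\<W>\<close>; and the approximations come from the sequences
  \<open>0 \<rightarrow> [c, e) \<rightarrow> [a, e) \<oplus> [c, b) \<rightarrow> [a, b) \<rightarrow> 0\<close>, where \<open>[a, b)\<close> is the uniserial module on the
  vertices \<open>a, \<dots>, b - 1\<close>. The simple module at the vertex before \<open>0\<close> is projective in \<open>\<C> \<inter> \<F>\<close> but not
  in \<open>\<W>\<close>. If \<open>d \<ge> 3\<close>, it is not injective. If \<open>d = 2\<close>, every indecomposable object of \<open>\<C> \<inter> \<F>\<close> is
  approximated by projective-injective ones, namely \<open>M\<^bsub>a,t\<^esub>\<close> and, for odd \<open>a\<close>, \<open>M\<^bsub>a,t-1\<^esub>\<close> and \<open>M\<^bsub>a,1\<^esub>\<close>.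

  Conversely, if \<open>\<W>\<close> consists of projective modules, then \<open>\<C>\<close> and \<open>\<F>\<close> contain all modules. Otherwise
  \<open>\<W>\<close> contains some \<open>M\<^bsub>i,l\<^esub>\<close> with \<open>l < t\<close>. The second syzygy turns it into \<open>M\<^bsub>i+t,l\<^esub>\<close>, so that for \<open>d = 1\<close>
  (and similarly for \<open>t = 2\<close>) all \<open>M\<^bsub>j,l\<^esub>\<close> are in \<open>\<W>\<close>; almost split sequences lead down to the simple
  modules, whence \<open>\<W>\<close> contains all modules and all conflations in \<open>\<C> \<inter> \<F>\<close> split.
\<close>

section \<open>The path algebra of the cyclic quiver\<close>

text \<open>Write \<alpha> for the sum of all arrows. Since \<alpha>^t = 0, the maps \<alpha>^r and
  \<alpha>^(t-r) in alternation form a complex on every module, and \<open>van j r (t - r)\<close>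
  says that its homology vanishes at j. By the projective resolution of U i l this homology is an
  Ext^1: \<open>van (i + l) (t - l) l X\<close> means Ext^1(U i l, X) = 0, and dually
  \<open>van j l (t - l) Z\<close>, with j the vertex before i, means Ext^1(Z, U i l) = 0. This
  explains the triple. R is the subgroup of Z/n generated by t, so it is stable under the double
  syzygy, which shifts by t. \<open>\<C>\<close> and \<open>\<F>\<close> are the left and the right
  orthogonal of the same modules, those of length t - 1 starting at i + 1 with i in R.
  \<open>\<W>\<close> is orthogonal to the U i l with i and i + l outside R; this family is stable
  under syzygies, hence \<open>\<W>\<close> is thick. The bound d \<ge> 2 leaves vertices outside R,
  and t \<ge> 3 keeps the simple module before 0 out of \<open>\<W>\<close>.\<close>

lemma sum_triangle_swap:
  fixes g :: "nat \<Rightarrow> nat \<Rightarrow> 'a::comm_monoid_add"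
  shows "(\<Sum>i\<le>N. \<Sum>k\<le>N - i. g i k) = (\<Sum>m\<le>N. \<Sum>i\<le>m. g i (m - i))"
proof -
  have "(\<Sum>i\<le>N. \<Sum>k\<le>N - i. g i k) = (\<Sum>(i, k)\<in>(SIGMA i:{..N}. {..N - i}). g i k)"
    by (rule sum.Sigma) auto
  also have "(SIGMA i:{..N}. {..N - i}) = {(i, k). i + k \<le> N}"
    by auto
  also have "(\<Sum>(i, k)\<in>{(i, k). i + k \<le> N}. g i k) = (\<Sum>m\<le>N. \<Sum>i\<le>m. g i (m - i))"
    by (rule sum.triangle_reindex_eq)
  finally show ?thesis .
qed

locale cyclic =
  fixes n :: nat
  assumes n_pos: "n \<ge> 1"
begin

section \<open>Paths of the cyclic quiver\<close>

lemma cyc_path_cong: "u mod n = v mod n \<Longrightarrow> cyc_path n u r = cyc_path n v r"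
  by (auto simp: cyc_path_def intro: mod_add_cong)

lemma length_cyc_path [simp]: "length (snd (cyc_path n u r)) = r"
  by (simp add: cyc_path_def)

lemma cyc_path_inj: "cyc_path n u r = cyc_path n v s \<longleftrightarrow> u mod n = v mod n \<and> r = s"
  using cyc_path_cong[of u v r] length_cyc_path[of u r] length_cyc_path[of v s]
  by (auto simp: cyc_path_def dest: arg_cong[of _ _ length])

lemma take_cyc_path: "j \<le> r \<Longrightarrow> take j (snd (cyc_path n u r)) = snd (cyc_path n u j)"
  by (simp add: cyc_path_def take_map)

lemma drop_cyc_path: "j \<le> r \<Longrightarrow> drop j (snd (cyc_path n u r)) = snd (cyc_path n (u + j) (r - j))"
  by (rule nth_equalityI) (auto simp: cyc_path_def add.assoc)

lemma cyc_path_Suc: "snd (cyc_path n u (Suc r)) = u mod n # snd (cyc_path n (Suc u) r)"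
  by (simp add: cyc_path_def upt_conv_Cons del: upt_Suc flip: map_Suc_upt)

text \<open>Each vertex has a single outgoing arrow, named after it, so a walk of given length from
  u must list the successive residues u, u + 1, and so on.\<close>

lemma cas_cyclic:
  assumes "u < n"
  shows "set p \<subseteq> {..<n} \<and> (\<exists>v. pre_digraph.cas (cyclic_quiver n) u p v) \<longleftrightarrow> (u, p) = cyc_path n u (length p)"
  using assms
proof (induction p arbitrary: u)
  case Nil
  then show ?case
    by (simp add: cyc_path_def pre_digraph.cas.simps)
next
  case (Cons e p)
  have "(u, e # p) = cyc_path n u (length (e # p)) \<longleftrightarrow> e = u \<and> p = snd (cyc_path n (Suc u) (length p))"
    using Cons.prems by (auto simp: prod_eq_iff cyc_path_Suc) (simp add: cyc_path_def)
  also have "p = snd (cyc_path n (Suc u) (length p)) \<longleftrightarrow> (Suc u mod n, p) = cyc_path n (Suc u mod n) (length p)"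
    using cyc_path_cong[of "Suc u" "Suc u mod n"] by (auto simp: prod_eq_iff) (auto simp: cyc_path_def)
  also have "\<dots> \<longleftrightarrow> set p \<subseteq> {..<n} \<and> (\<exists>v. pre_digraph.cas (cyclic_quiver n) (Suc u mod n) p v)"
    using Cons.IH[of "Suc u mod n"] n_pos by simp
  finally show ?case
    using Cons.prems by (auto simp: pre_digraph.cas.simps cyclic_quiver_def)
qed

lemma paths_cyclic: "paths (cyclic_quiver n) = {cyc_path n u r | u r. True}"
proof -
  have "(u, p) \<in> paths (cyclic_quiver n) \<longleftrightarrow> (\<exists>v r. (u, p) = cyc_path n v r)" for u p
  proof -
    have "(u, p) \<in> paths (cyclic_quiver n) \<longleftrightarrow> u < n \<and> (u, p) = cyc_path n u (length p)"
      using cas_cyclic[of u p]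
      by (auto simp: paths_def pre_digraph.awalk_def cyclic_quiver_def)
    also have "\<dots> \<longleftrightarrow> (\<exists>v r. (u, p) = cyc_path n v r)"
    proof
      assume "\<exists>v r. (u, p) = cyc_path n v r"
      then obtain v r where *: "(u, p) = cyc_path n v r"
        by blast
      then have "u = v mod n" "length p = r"
        by (auto simp: cyc_path_def)
      then show "u < n \<and> (u, p) = cyc_path n u (length p)"
        using * n_pos cyc_path_cong[of v u] by simp
    qed blast
    finally show ?thesis .
  qed
  then show ?thesis
    by auto
qed

lemma awlast_cyc_path:
  "pre_digraph.awlast (cyclic_quiver n) (u mod n) (snd (cyc_path n u r)) = (u + r) mod n"
proof (induction r arbitrary: u)
  case 0
  then show ?case
    by (simp add: cyc_path_def pre_digraph.awalk_verts.simps)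
next
  case (Suc r)
  from Suc[of "Suc u"] show ?case
    unfolding cyc_path_Suc
    by (auto simp: pre_digraph.awalk_verts.simps cyclic_quiver_def mod_Suc_eq
        pre_digraph.awalk_verts_non_Nil)
qed

text \<open>A path is determined by its start modulo n and its length, so elements of the path
  algebra are handled as functions of these two numbers. The start may be any natural number, which
  spares reductions modulo n.\<close>

definition coef :: "(nat \<times> nat list \<Rightarrow> 'k) \<Rightarrow> nat \<Rightarrow> nat \<Rightarrow> 'k" where
  "coef x u r = x (cyc_path n u r)"

text \<open>The inverse of \<open>coef\<close>: F is read only at starts below n, and everything
  that is not a path gets the coefficient 0.\<close>

definition mk :: "(nat \<Rightarrow> nat \<Rightarrow> 'k::zero) \<Rightarrow> nat \<times> nat list \<Rightarrow> 'k" where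
  "mk F = (\<lambda>(u, p). if u < n \<and> (u, p) = cyc_path n u (length p) then F u (length p) else 0)"

lemma coef_cong: "u mod n = v mod n \<Longrightarrow> coef x u r = coef x v r"
  by (simp add: coef_def cyc_path_cong[of u v])

lemma coef_mk [simp]: "coef (mk F) u r = F (u mod n) r"
  using n_pos by (simp add: coef_def mk_def cyc_path_def mod_add_left_eq)

section \<open>Ring structure of the path algebra in coefficients\<close>

abbreviation PA :: "(nat \<times> nat list \<Rightarrow> 'k::field) ring" where
  "PA \<equiv> path_algebra (cyclic_quiver n)"

lemma carrier_PA: "carrier PA = {x. finite {p. x p \<noteq> 0} \<and> (\<forall>p. x p \<noteq> 0 \<longrightarrow> (\<exists>u r. p = cyc_path n u r))}"
  by (auto simp: path_algebra_def paths_cyclic)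

lemma PA_eqI:
  assumes "x \<in> carrier PA" "y \<in> carrier PA" "\<And>u r. u < n \<Longrightarrow> coef x u r = coef y u r"
  shows "x = y"
proof
  fix p
  show "x p = y p"
  proof (cases "\<exists>u r. p = cyc_path n u r")
    case True
    then obtain u r where "p = cyc_path n u r"
      by blast
    then show ?thesis
      using assms(3)[of "u mod n" r] n_pos cyc_path_cong[of "u mod n" u] by (simp add: coef_def)
  next
    case False
    then have "x p = 0" "y p = 0"
      using assms(1,2) unfolding carrier_PA mem_Collect_eq by blast+
    then show ?thesis
      by simp
  qed
qed

lemma mk_closed:
  assumes "\<And>u r. F u r \<noteq> 0 \<Longrightarrow> r \<le> N"
  shows "mk F \<in> carrier PA"
proof -
  have "{p. mk F p \<noteq> 0} \<subseteq> (\<lambda>(u, r). cyc_path n u r) ` ({..<n} \<times> {..N})"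
  proof
    fix p assume "p \<in> {p. mk F p \<noteq> 0}"
    then have "fst p < n" "p = cyc_path n (fst p) (length (snd p))" "F (fst p) (length (snd p)) \<noteq> 0"
      by (auto simp: mk_def split: prod.splits if_splits)
    then show "p \<in> (\<lambda>(u, r). cyc_path n u r) ` ({..<n} \<times> {..N})"
      using assms by (intro image_eqI[of _ _ "(fst p, length (snd p))"]) auto
  qed
  then have "finite {p. mk F p \<noteq> 0}"
    by (rule finite_subset) auto
  moreover have "mk F p \<noteq> 0 \<Longrightarrow> \<exists>u r. p = cyc_path n u r" for p
    by (auto simp: mk_def split: if_splits prod.splits)
  ultimately show ?thesis
    unfolding carrier_PA mem_Collect_eq by (intro conjI allI impI)
qed

lemma coef_bound:
  assumes "x \<in> carrier PA"
  shows "\<exists>N. \<forall>u r. coef x u r \<noteq> 0 \<longrightarrow> r \<le> N"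
proof -
  have "finite ((length \<circ> snd) ` {p. x p \<noteq> 0})"
    using assms by (simp add: carrier_PA)
  then obtain N where N: "\<forall>k\<in>(length \<circ> snd) ` {p. x p \<noteq> 0}. k \<le> N"
    by (meson finite_nat_set_iff_bounded_le)
  have "r \<le> N" if "coef x u r \<noteq> 0" for u r
  proof -
    have "r \<in> (length \<circ> snd) ` {p. x p \<noteq> 0}"
      using that by (intro image_eqI[of _ _ "cyc_path n u r"]) (auto simp: coef_def)
    then show ?thesis
      using N by blast
  qed
  then show ?thesis
    by blast
qed

lemma PA_mk:
  assumes "x \<in> carrier PA"
  shows "x = mk (coef x)"
proof -
  obtain N where "\<forall>u r. coef x u r \<noteq> 0 \<longrightarrow> r \<le> N"
    using coef_bound[OF assms] by blast
  then show ?thesis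
    by (intro PA_eqI assms mk_closed) auto
qed

lemma coef_add: "coef (x \<oplus>\<^bsub>PA\<^esub> y) u r = coef x u r + coef y u r"
  by (simp add: coef_def path_algebra_def)

lemma coef_zero: "coef \<zero>\<^bsub>PA\<^esub> u r = 0"
  by (simp add: coef_def path_algebra_def)

lemma coef_one: "coef \<one>\<^bsub>PA\<^esub> u r = (if r = 0 then 1 else 0)"
  using n_pos by (simp add: coef_def path_algebra_def cyc_path_def cyclic_quiver_def)

lemma coef_mult:
  "coef (x \<otimes>\<^bsub>PA\<^esub> y) u r = (\<Sum>j\<le>r. coef x (u + j) (r - j) * coef y u j)"
proof -
  have fst_cyc: "cyc_path n v s = (v mod n, snd (cyc_path n v s))" for v s
    by (simp add: cyc_path_def)
  have "coef (x \<otimes>\<^bsub>PA\<^esub> y) u r = (\<Sum>j\<le>r.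
      x (pre_digraph.awlast (cyclic_quiver n) (u mod n) (take j (snd (cyc_path n u r))), drop j (snd (cyc_path n u r)))
       * y (u mod n, take j (snd (cyc_path n u r))))"
    unfolding coef_def by (subst fst_cyc) (simp add: path_algebra_def)
  also have "\<dots> = (\<Sum>j\<le>r. coef x (u + j) (r - j) * coef y u j)"
  proof (rule sum.cong)
    fix j assume "j \<in> {..r}"
    then show "x (pre_digraph.awlast (cyclic_quiver n) (u mod n) (take j (snd (cyc_path n u r))), drop j (snd (cyc_path n u r)))
       * y (u mod n, take j (snd (cyc_path n u r))) = coef x (u + j) (r - j) * coef y u j"
      by (simp add: take_cyc_path drop_cyc_path awlast_cyc_path coef_def flip: fst_cyc)
  qed simp
  finally show ?thesis .
qed

text \<open>The product is defined on all pairs of a vertex and a list, so its support has to be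
  shown to consist of paths: a nonzero summand splits the list into two paths, and the second starts
  where the first ends because x is evaluated at \<open>awlast\<close>.\<close>

lemma mult_off_path:
  assumes "x \<in> carrier PA" "y \<in> carrier PA" "(x \<otimes>\<^bsub>PA\<^esub> y) p \<noteq> 0"
  shows "\<exists>u r. p = cyc_path n u r"
proof -
  obtain u l where p: "p = (u, l)"
    by fastforce
  have "(\<Sum>j\<le>length l. x (pre_digraph.awlast (cyclic_quiver n) u (take j l), drop j l) * y (u, take j l)) \<noteq> 0"
    using assms(3) by (simp add: p path_algebra_def)
  then obtain j where j: "j \<le> length l" "y (u, take j l) \<noteq> 0"
      "x (pre_digraph.awlast (cyclic_quiver n) u (take j l), drop j l) \<noteq> 0"
    by (rule sum.not_neutral_contains_not_neutral) auto
  then obtain v r where v: "(u, take j l) = cyc_path n v r"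
    using assms(2) unfolding carrier_PA by blast
  then have u: "u = v mod n" "take j l = snd (cyc_path n v r)"
    by (simp_all add: cyc_path_def)
  then have r: "r = j"
    using j(1) length_cyc_path[of v r] by (metis length_take min.absorb2)
  obtain w s where w: "(pre_digraph.awlast (cyclic_quiver n) u (take j l), drop j l) = cyc_path n w s"
    using assms(1) j(3) unfolding carrier_PA by blast
  then have "(v + r) mod n = w mod n"
    using u by (simp add: awlast_cyc_path) (simp add: cyc_path_def)
  then have d: "drop j l = snd (cyc_path n (v + r) s)"
    using w cyc_path_cong[of "v + r" w s] by (simp add: prod_eq_iff)
  have "l = snd (cyc_path n v (r + s))"
    using append_take_drop_id[of j l] append_take_drop_id[of r "snd (cyc_path n v (r + s))"]
    unfolding u(2) d by (simp add: take_cyc_path drop_cyc_path)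
  then have "p = cyc_path n v (r + s)"
    using p u by (simp add: prod_eq_iff) (simp add: cyc_path_def)
  then show ?thesis
    by blast
qed

lemma PA_mult_closed:
  assumes "x \<in> carrier PA" "y \<in> carrier PA"
  shows "x \<otimes>\<^bsub>PA\<^esub> y \<in> carrier PA"
proof -
  obtain N where N: "\<forall>u r. coef x u r \<noteq> 0 \<longrightarrow> r \<le> N"
    using coef_bound[OF assms(1)] by blast
  obtain N' where N': "\<forall>u r. coef y u r \<noteq> 0 \<longrightarrow> r \<le> N'"
    using coef_bound[OF assms(2)] by blast
  have *: "r \<le> N + N'" if "coef (x \<otimes>\<^bsub>PA\<^esub> y) u r \<noteq> 0" for u r
  proof -
    from that obtain j where "j \<le> r" "coef x (u + j) (r - j) * coef y u j \<noteq> 0"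
      unfolding coef_mult by (rule sum.not_neutral_contains_not_neutral) auto
    then show ?thesis
      using N[rule_format, of "u + j" "r - j"] N'[rule_format, of u j] by fastforce
  qed
  have "{p. (x \<otimes>\<^bsub>PA\<^esub> y) p \<noteq> 0} \<subseteq> (\<lambda>(u, r). cyc_path n u r) ` ({..<n} \<times> {..N + N'})"
  proof
    fix p assume p: "p \<in> {p. (x \<otimes>\<^bsub>PA\<^esub> y) p \<noteq> 0}"
    then obtain u r where "p = cyc_path n u r"
      using mult_off_path[OF assms] by blast
    then have ur: "p = cyc_path n (u mod n) r"
      using cyc_path_cong[of u "u mod n" r] by simp
    then have "r \<le> N + N'"
      using p *[of "u mod n" r] by (simp add: coef_def)
    then show "p \<in> (\<lambda>(u, r). cyc_path n u r) ` ({..<n} \<times> {..N + N'})"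
      using ur n_pos by (intro image_eqI[of _ _ "(u mod n, r)"]) auto
  qed
  then have "finite {p. (x \<otimes>\<^bsub>PA\<^esub> y) p \<noteq> 0}"
    by (rule finite_subset) auto
  then show ?thesis
    using mult_off_path[OF assms] by (auto simp: carrier_PA)
qed

lemma PA_add_closed:
  assumes "x \<in> carrier PA" "y \<in> carrier PA"
  shows "x \<oplus>\<^bsub>PA\<^esub> y \<in> carrier PA"
proof -
  have "{p. x p + y p \<noteq> 0} \<subseteq> {p. x p \<noteq> 0} \<union> {p. y p \<noteq> 0}"
    by auto
  then have "finite {p. x p + y p \<noteq> 0}"
    using assms by (auto simp: carrier_PA intro: finite_subset)
  moreover have "\<exists>u r. p = cyc_path n u r" if "x p + y p \<noteq> 0" for p
  proof -
    have "x p \<noteq> 0 \<or> y p \<noteq> 0"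
      using that by auto
    then show ?thesis
      using assms unfolding carrier_PA by blast
  qed
  ultimately show ?thesis
    unfolding carrier_PA by (simp add: path_algebra_def)
qed

lemma PA_zero_closed: "\<zero>\<^bsub>PA\<^esub> \<in> carrier PA"
  unfolding carrier_PA by (simp add: path_algebra_def)

lemma PA_one_closed: "\<one>\<^bsub>PA\<^esub> \<in> carrier PA"
proof -
  have "\<one>\<^bsub>PA\<^esub> = mk (\<lambda>u r. if r = 0 then 1 else 0)"
    by (auto simp: path_algebra_def mk_def cyclic_quiver_def cyc_path_def fun_eq_iff)
  also have "\<dots> \<in> carrier PA"
    by (rule mk_closed[of _ 0]) (auto split: if_splits)
  finally show ?thesis .
qed

lemma PA_abelian_group: "abelian_group (PA :: (nat \<times> nat list \<Rightarrow> 'k::field) ring)"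
proof (rule abelian_groupI)
  fix x y z :: "nat \<times> nat list \<Rightarrow> 'k"
  show "x \<in> carrier PA \<Longrightarrow> y \<in> carrier PA \<Longrightarrow> x \<oplus>\<^bsub>PA\<^esub> y \<in> carrier PA"
    by (rule PA_add_closed)
  show "\<zero>\<^bsub>PA\<^esub> \<in> carrier PA"
    by (rule PA_zero_closed)
  show "x \<oplus>\<^bsub>PA\<^esub> y \<oplus>\<^bsub>PA\<^esub> z = x \<oplus>\<^bsub>PA\<^esub> (y \<oplus>\<^bsub>PA\<^esub> z)" "x \<oplus>\<^bsub>PA\<^esub> y = y \<oplus>\<^bsub>PA\<^esub> x"
      "\<zero>\<^bsub>PA\<^esub> \<oplus>\<^bsub>PA\<^esub> x = x"
    by (simp_all add: path_algebra_def add_ac)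
  assume x: "x \<in> carrier PA"
  have "(\<lambda>p. - x p) \<in> carrier PA"
    using x by (auto simp: carrier_PA)
  moreover have "(\<lambda>p. - x p) \<oplus>\<^bsub>PA\<^esub> x = \<zero>\<^bsub>PA\<^esub>"
    by (simp add: path_algebra_def)
  ultimately show "\<exists>y\<in>carrier PA. y \<oplus>\<^bsub>PA\<^esub> x = \<zero>\<^bsub>PA\<^esub>"
    by blast
qed

lemma PA_monoid: "monoid (PA :: (nat \<times> nat list \<Rightarrow> 'k::field) ring)"
proof (rule monoidI)
  fix x y z :: "nat \<times> nat list \<Rightarrow> 'k"
  assume xyz: "x \<in> carrier PA" "y \<in> carrier PA" "z \<in> carrier PA"
  show "x \<otimes>\<^bsub>PA\<^esub> y \<otimes>\<^bsub>PA\<^esub> z = x \<otimes>\<^bsub>PA\<^esub> (y \<otimes>\<^bsub>PA\<^esub> z)"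
  proof (intro PA_eqI PA_mult_closed xyz)
    fix u r
    have "coef (x \<otimes>\<^bsub>PA\<^esub> y \<otimes>\<^bsub>PA\<^esub> z) u r
      = (\<Sum>j\<le>r. \<Sum>k\<le>r - j. coef x (u + (j + k)) (r - (j + k)) * coef y (u + j) k * coef z u j)"
      by (simp add: coef_mult sum_distrib_right add.assoc)
    \<comment> \<open>Both bracketings sum over two cut points of a path; only the order in which
      they are chosen changes.\<close>
    also have "\<dots> = (\<Sum>m\<le>r. \<Sum>j\<le>m. coef x (u + m) (r - m) * coef y (u + j) (m - j) * coef z u j)"
      by (subst sum_triangle_swap) (intro sum.cong, auto)
    also have "\<dots> = coef (x \<otimes>\<^bsub>PA\<^esub> (y \<otimes>\<^bsub>PA\<^esub> z)) u r"
      by (simp add: coef_mult sum_distrib_left mult.assoc)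
    finally show "coef (x \<otimes>\<^bsub>PA\<^esub> y \<otimes>\<^bsub>PA\<^esub> z) u r = coef (x \<otimes>\<^bsub>PA\<^esub> (y \<otimes>\<^bsub>PA\<^esub> z)) u r" .
  qed
next
  fix x :: "nat \<times> nat list \<Rightarrow> 'k" assume x: "x \<in> carrier PA"
  show "\<one>\<^bsub>PA\<^esub> \<otimes>\<^bsub>PA\<^esub> x = x"
  proof (intro PA_eqI PA_mult_closed PA_one_closed x)
    fix u r
    have "coef (\<one>\<^bsub>PA\<^esub> \<otimes>\<^bsub>PA\<^esub> x) u r = (\<Sum>j\<le>r. if j = r then coef x u j else 0)"
      unfolding coef_mult coef_one by (intro sum.cong) auto
    then show "coef (\<one>\<^bsub>PA\<^esub> \<otimes>\<^bsub>PA\<^esub> x) u r = coef x u r"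
      by simp
  qed
  show "x \<otimes>\<^bsub>PA\<^esub> \<one>\<^bsub>PA\<^esub> = x"
  proof (intro PA_eqI PA_mult_closed PA_one_closed x)
    fix u r
    have "coef (x \<otimes>\<^bsub>PA\<^esub> \<one>\<^bsub>PA\<^esub>) u r = (\<Sum>j\<le>r. if j = 0 then coef x u r else 0)"
      unfolding coef_mult coef_one by (intro sum.cong) auto
    then show "coef (x \<otimes>\<^bsub>PA\<^esub> \<one>\<^bsub>PA\<^esub>) u r = coef x u r"
      by simp
  qed
qed (auto intro: PA_mult_closed PA_one_closed)

lemma PA_ring: "ring (PA :: (nat \<times> nat list \<Rightarrow> 'k::field) ring)"
proof (rule ringI[OF PA_abelian_group PA_monoid])
  fix x y z :: "nat \<times> nat list \<Rightarrow> 'k"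
  assume xyz: "x \<in> carrier PA" "y \<in> carrier PA" "z \<in> carrier PA"
  show "(x \<oplus>\<^bsub>PA\<^esub> y) \<otimes>\<^bsub>PA\<^esub> z = x \<otimes>\<^bsub>PA\<^esub> z \<oplus>\<^bsub>PA\<^esub> y \<otimes>\<^bsub>PA\<^esub> z"
    by (intro PA_eqI PA_mult_closed PA_add_closed xyz) (simp only: coef_mult coef_add distrib_left distrib_right sum.distrib)
  show "z \<otimes>\<^bsub>PA\<^esub> (x \<oplus>\<^bsub>PA\<^esub> y) = z \<otimes>\<^bsub>PA\<^esub> x \<oplus>\<^bsub>PA\<^esub> z \<otimes>\<^bsub>PA\<^esub> y"
    by (intro PA_eqI PA_mult_closed PA_add_closed xyz) (simp only: coef_mult coef_add distrib_left distrib_right sum.distrib)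
qed

end

section \<open>The truncated path algebra\<close>

context cyclic
begin

text \<open>The r-th power of the arrow ideal in terms of coefficients (\<open>Jpow_eq\<close>):
  congruence modulo it is a condition on the coefficients of short paths.\<close>

definition high :: "nat \<Rightarrow> (nat \<times> nat list \<Rightarrow> 'k::field) set" where
  "high r = {x \<in> carrier PA. \<forall>u s. s < r \<longrightarrow> coef x u s = 0}"

lemma high_mult:
  assumes "x \<in> high r" "y \<in> high s"
  shows "x \<otimes>\<^bsub>PA\<^esub> y \<in> high (r + s)"
proof -
  have "coef (x \<otimes>\<^bsub>PA\<^esub> y) u q = 0" if "q < r + s" for u q
    unfolding coef_mult
  proof (rule sum.neutral, rule ballI)
    fix j assume "j \<in> {..q}"
    then have "j < s \<or> q - j < r"
      using that by auto
    then show "coef x (u + j) (q - j) * coef y u j = 0"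
      using assms by (auto simp: high_def)
  qed
  then show ?thesis
    using assms by (auto simp: high_def PA_mult_closed)
qed

lemma high_0: "high 0 = carrier PA"
  by (simp add: high_def)

lemma high_ideal: "ideal (high r) (PA :: (nat \<times> nat list \<Rightarrow> 'k::field) ring)"
proof -
  interpret PA: ring "PA :: (nat \<times> nat list \<Rightarrow> 'k::field) ring"
    by (rule PA_ring)
  show ?thesis
  proof (rule idealI)
    show "subgroup (high r) (add_monoid (PA :: (nat \<times> nat list \<Rightarrow> 'k) ring))"
    proof (rule PA.add.subgroupI)
      fix x :: "nat \<times> nat list \<Rightarrow> 'k" assume x: "x \<in> high r"
      then have "coef (\<ominus>\<^bsub>PA\<^esub> x) u s = - coef x u s" for u s
        using coef_add[of "\<ominus>\<^bsub>PA\<^esub> x" x u s] PA.l_neg[of x]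
        by (simp add: high_def coef_zero eq_neg_iff_add_eq_0)
      then show "\<ominus>\<^bsub>PA\<^esub> x \<in> high r"
        using x by (simp add: high_def)
    next
      have "\<zero>\<^bsub>PA\<^esub> \<in> (high r :: (nat \<times> nat list \<Rightarrow> 'k) set)"
        by (simp add: high_def coef_zero)
      then show "high r \<noteq> ({} :: (nat \<times> nat list \<Rightarrow> 'k) set)"
        by blast
    qed (auto simp: high_def coef_add)
  next
    fix a x :: "nat \<times> nat list \<Rightarrow> 'k" assume "a \<in> high r" "x \<in> carrier PA"
    then show "x \<otimes>\<^bsub>PA\<^esub> a \<in> high r" "a \<otimes>\<^bsub>PA\<^esub> x \<in> high r"
      using high_mult[of x 0 a r] high_mult[of a r x 0] by (simp_all add: high_0)
  qed (rule PA_ring)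
qed

text \<open>The power \<alpha>^s of the sum \<alpha> of all arrows. Multiplied on the right by the
  idempotent at u it gives the single path of length s from u.\<close>

definition pow_arr :: "nat \<Rightarrow> nat \<times> nat list \<Rightarrow> 'k::field" where
  "pow_arr s = mk (\<lambda>u r. if r = s then 1 else 0)"

definition idem :: "nat \<Rightarrow> nat \<times> nat list \<Rightarrow> 'k::field" where
  "idem v = mk (\<lambda>u r. if r = 0 \<and> u = v mod n then 1 else 0)"

definition scal :: "'k \<Rightarrow> nat \<times> nat list \<Rightarrow> 'k::field" where
  "scal c = mk (\<lambda>u r. if r = 0 then c else 0)"

text \<open>Partial sums of the vertex idempotents. They let the decomposition of 1 into idempotents
  be used by induction on the number of summands.\<close>

definition idem_below :: "nat \<Rightarrow> nat \<times> nat list \<Rightarrow> 'k::field" where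
  "idem_below m = mk (\<lambda>u r. if r = 0 \<and> u < m then 1 else 0)"

lemma pow_arr_closed [simp]: "pow_arr s \<in> carrier PA"
  unfolding pow_arr_def by (rule mk_closed[of _ s]) (auto split: if_splits)

lemma idem_closed [simp]: "idem v \<in> carrier PA"
  unfolding idem_def by (rule mk_closed[of _ 0]) (auto split: if_splits)

lemma scal_closed [simp]: "scal c \<in> carrier PA"
  unfolding scal_def by (rule mk_closed[of _ 0]) (auto split: if_splits)

lemma idem_below_closed [simp]: "idem_below m \<in> carrier PA"
  unfolding idem_below_def by (rule mk_closed[of _ 0]) (auto split: if_splits)

lemma coef_pow_arr: "coef (pow_arr s) u r = (if r = s then 1 else 0)"
  by (simp add: pow_arr_def)

lemma coef_idem: "coef (idem v) u r = (if r = 0 \<and> u mod n = v mod n then 1 else 0)"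
  by (simp add: idem_def)

lemma coef_scal: "coef (scal c) u r = (if r = 0 then c else 0)"
  by (simp add: scal_def)

lemma coef_idem_below: "coef (idem_below m) u r = (if r = 0 \<and> u mod n < m then 1 else 0)"
  by (simp add: idem_below_def)

lemma coef_scal_mult: "coef (scal c \<otimes>\<^bsub>PA\<^esub> x) u r = c * coef x u r"
proof -
  have "coef (scal c \<otimes>\<^bsub>PA\<^esub> x) u r = (\<Sum>j\<le>r. if j = r then c * coef x u j else 0)"
    unfolding coef_mult coef_scal by (intro sum.cong) auto
  then show ?thesis
    by simp
qed

lemma coef_mult_scal: "coef (x \<otimes>\<^bsub>PA\<^esub> scal c) u r = c * coef x u r"
proof -
  have "coef (x \<otimes>\<^bsub>PA\<^esub> scal c) u r = (\<Sum>j\<le>r. if j = 0 then c * coef x u r else 0)"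
    unfolding coef_mult coef_scal by (intro sum.cong) auto
  then show ?thesis
    by simp
qed

lemma coef_mult_idem: "coef (x \<otimes>\<^bsub>PA\<^esub> idem v) u r = (if u mod n = v mod n then coef x u r else 0)"
proof -
  have "coef (x \<otimes>\<^bsub>PA\<^esub> idem v) u r = (\<Sum>j\<le>r. if j = 0 then (if u mod n = v mod n then coef x u r else 0) else 0)"
    unfolding coef_mult coef_idem by (intro sum.cong) auto
  then show ?thesis
    by simp
qed

lemma coef_idem_mult: "coef (idem v \<otimes>\<^bsub>PA\<^esub> x) u r = (if (u + r) mod n = v mod n then coef x u r else 0)"
proof -
  have "coef (idem v \<otimes>\<^bsub>PA\<^esub> x) u r = (\<Sum>j\<le>r. if j = r then (if (u + r) mod n = v mod n then coef x u r else 0) else 0)"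
    unfolding coef_mult coef_idem by (intro sum.cong) auto
  then show ?thesis
    by simp
qed

lemma coef_mult_pow_arr: "coef (x \<otimes>\<^bsub>PA\<^esub> pow_arr s) u r = (if s \<le> r then coef x (u + s) (r - s) else 0)"
proof -
  have "coef (x \<otimes>\<^bsub>PA\<^esub> pow_arr s) u r = (\<Sum>j\<le>r. if j = s then coef x (u + s) (r - s) else 0)"
    unfolding coef_mult coef_pow_arr by (intro sum.cong) auto
  then show ?thesis
    by simp
qed

lemmas coef_simps = coef_scal_mult coef_mult_scal coef_mult_idem coef_idem_mult coef_mult_pow_arr
  coef_pow_arr coef_idem coef_scal coef_add coef_one coef_zero

text \<open>These relations pass to the quotient by \<open>high t\<close>, where they become the
  calculus for all later computations in modules. An idempotent moves by r when it passes \<alpha>^r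
  because left modules are covariant representations.\<close>

lemma PA_laws:
  "scal (a + b) = scal a \<oplus>\<^bsub>PA\<^esub> scal b"
  "scal (a * b) = scal a \<otimes>\<^bsub>PA\<^esub> scal b"
  "scal 1 = \<one>\<^bsub>PA\<^esub>"
  "scal a \<otimes>\<^bsub>PA\<^esub> idem u = idem u \<otimes>\<^bsub>PA\<^esub> scal a"
  "scal a \<otimes>\<^bsub>PA\<^esub> pow_arr r = pow_arr r \<otimes>\<^bsub>PA\<^esub> scal a"
  "idem u \<otimes>\<^bsub>PA\<^esub> idem v = (if u mod n = v mod n then idem u else \<zero>\<^bsub>PA\<^esub>)"
  "pow_arr r \<otimes>\<^bsub>PA\<^esub> idem u = idem (u + r) \<otimes>\<^bsub>PA\<^esub> pow_arr r"
  "pow_arr r \<otimes>\<^bsub>PA\<^esub> pow_arr s = pow_arr (r + s)"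
  "pow_arr 0 = \<one>\<^bsub>PA\<^esub>"
  "idem_below 0 = \<zero>\<^bsub>PA\<^esub>"
  "m < n \<Longrightarrow> idem_below (Suc m) = idem_below m \<oplus>\<^bsub>PA\<^esub> idem m"
  "idem_below n = \<one>\<^bsub>PA\<^esub>"
proof -
  have shift: "(v + r) mod n = (u + r) mod n \<longleftrightarrow> v mod n = u mod n" for u v r
    using cong_add_rcancel_nat[of v r u n] by (simp add: cong_def)
  show "scal (a + b) = scal a \<oplus>\<^bsub>PA\<^esub> scal b"
    "scal (a * b) = scal a \<otimes>\<^bsub>PA\<^esub> scal b"
    "scal 1 = \<one>\<^bsub>PA\<^esub>"
    "scal a \<otimes>\<^bsub>PA\<^esub> idem u = idem u \<otimes>\<^bsub>PA\<^esub> scal a"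
    "scal a \<otimes>\<^bsub>PA\<^esub> pow_arr r = pow_arr r \<otimes>\<^bsub>PA\<^esub> scal a"
    "idem u \<otimes>\<^bsub>PA\<^esub> idem v = (if u mod n = v mod n then idem u else \<zero>\<^bsub>PA\<^esub>)"
    "pow_arr r \<otimes>\<^bsub>PA\<^esub> pow_arr s = pow_arr (r + s)"
    "pow_arr 0 = \<one>\<^bsub>PA\<^esub>"
    by (rule PA_eqI; auto simp: coef_simps PA_mult_closed PA_add_closed PA_one_closed PA_zero_closed)+
  show "pow_arr r \<otimes>\<^bsub>PA\<^esub> idem u = idem (u + r) \<otimes>\<^bsub>PA\<^esub> pow_arr r"
    by (rule PA_eqI) (auto simp: coef_simps PA_mult_closed shift)
  show "idem_below 0 = \<zero>\<^bsub>PA\<^esub>" "idem_below n = \<one>\<^bsub>PA\<^esub>"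
    by (rule PA_eqI; auto simp: coef_idem_below coef_simps PA_one_closed PA_zero_closed)+
  show "idem_below (Suc m) = idem_below m \<oplus>\<^bsub>PA\<^esub> idem m" if "m < n"
    using that by (intro PA_eqI idem_below_closed PA_add_closed idem_closed)
      (auto simp: coef_idem_below coef_simps)
qed

text \<open>A finitely supported function is a finite sum of multiples of paths; one path is removed
  from the support at each step.\<close>

lemma PA_induct [consumes 1, case_names zero add gen]:
  assumes "x \<in> carrier PA"
    and "Q \<zero>\<^bsub>PA\<^esub>"
    and "\<And>x y. \<lbrakk>x \<in> carrier PA; y \<in> carrier PA; Q x; Q y\<rbrakk> \<Longrightarrow> Q (x \<oplus>\<^bsub>PA\<^esub> y)"
    and "\<And>c r u. Q (scal c \<otimes>\<^bsub>PA\<^esub> (pow_arr r \<otimes>\<^bsub>PA\<^esub> idem u))"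
  shows "Q x"
  using assms(1)
proof (induction "card {p. x p \<noteq> 0}" arbitrary: x)
  case 0
  then have "x = \<zero>\<^bsub>PA\<^esub>"
    by (auto simp: carrier_PA path_algebra_def)
  then show ?case
    using assms(2) by simp
next
  case (Suc m)
  then obtain p where p: "x p \<noteq> 0"
    by (metis (mono_tags, lifting) card.empty empty_Collect_eq nat.distinct(1))
  then obtain u r where ur: "p = cyc_path n u r"
    using Suc.prems unfolding carrier_PA by blast
  define y where "y = scal (x p) \<otimes>\<^bsub>PA\<^esub> (pow_arr r \<otimes>\<^bsub>PA\<^esub> idem u)"
  define x' where "x' = x(p := 0)"
  have supp: "{q. x' q \<noteq> 0} = {q. x q \<noteq> 0} - {p}"
    by (auto simp: x'_def)
  have fin: "finite {q. x q \<noteq> 0}"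
    using Suc.prems by (simp add: carrier_PA)
  have x': "x' \<in> carrier PA"
    using Suc.prems fin finite_Diff[of _ "{p}"] unfolding carrier_PA mem_Collect_eq supp
    by (auto simp: x'_def)
  have "card {q. x' q \<noteq> 0} = m"
    using Suc.hyps(2) p fin by (simp add: supp)
  then have "Q x'"
    using Suc.hyps(1) x' by blast
  moreover have "Q y"
    unfolding y_def by (rule assms(4))
  moreover have y: "y \<in> carrier PA"
    unfolding y_def by (intro PA_mult_closed scal_closed pow_arr_closed idem_closed)
  moreover have "x = x' \<oplus>\<^bsub>PA\<^esub> y"
  proof (rule PA_eqI[OF Suc.prems PA_add_closed[OF x' y]])
    fix v s
    have "coef x' v s = (if v mod n = u mod n \<and> s = r then 0 else coef x v s)"
      by (simp add: coef_def x'_def ur cyc_path_inj)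
    moreover have "coef y v s = (if v mod n = u mod n \<and> s = r then coef x v s else 0)"
      using coef_cong[of v u x r] by (auto simp: y_def coef_simps) (simp add: coef_def ur)
    ultimately show "coef x v s = coef (x' \<oplus>\<^bsub>PA\<^esub> y) v s"
      by (simp add: coef_add)
  qed
  ultimately show ?case
    using assms(3) x' by metis
qed

section \<open>Powers of the arrow ideal\<close>

abbreviation J :: "(nat \<times> nat list \<Rightarrow> 'k::field) set" where
  "J \<equiv> arrow_ideal (cyclic_quiver n)"

definition Jpow :: "nat \<Rightarrow> (nat \<times> nat list \<Rightarrow> 'k::field) set" where
  "Jpow r = J [^]\<^bsub>ideals_set PA\<^esub> r"

lemma Jpow_0: "Jpow 0 = carrier PA"
  by (simp add: Jpow_def nat_pow_def ideals_set_def)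

lemma Jpow_Suc: "Jpow (Suc r) = ideal_prod PA (Jpow r) J"
  by (simp add: Jpow_def nat_pow_def ideals_set_def)

definition arr :: "nat \<Rightarrow> nat \<times> nat list \<Rightarrow> 'k::field" where
  "arr a = (\<lambda>p. if p = (a, [a]) then 1 else 0)"

lemma arr_mk: "a < n \<Longrightarrow> arr a = mk (\<lambda>u r. if r = 1 \<and> u = a then 1 else 0)"
  by (auto simp: arr_def mk_def cyc_path_def fun_eq_iff length_Suc_conv)

lemma arr_closed: "a < n \<Longrightarrow> arr a \<in> carrier PA"
  unfolding arr_mk by (rule mk_closed[of _ 1]) (auto split: if_splits)

lemma J_eq: "J = genideal PA (arr ` {..<n})"
  unfolding arrow_ideal_def
  by (rule arg_cong[of _ _ "genideal PA"]) (auto simp: cyclic_quiver_def arr_def)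

lemma J_ideal: "ideal J (PA :: (nat \<times> nat list \<Rightarrow> 'k::field) ring)"
  unfolding J_eq by (rule ring.genideal_ideal[OF PA_ring]) (auto simp: arr_closed)

lemma J_high: "J \<subseteq> (high 1 :: (nat \<times> nat list \<Rightarrow> 'k::field) set)"
proof -
  have "arr a \<in> (high 1 :: (nat \<times> nat list \<Rightarrow> 'k) set)" if "a < n" for a
    using arr_closed[OF that, where 'a = 'k] by (simp add: high_def arr_mk[OF that])
  then show ?thesis
    unfolding J_eq by (intro ring.genideal_minimal[OF PA_ring high_ideal]) auto
qed

lemma Jpow_ideal: "ideal (Jpow r) (PA :: (nat \<times> nat list \<Rightarrow> 'k::field) ring)"
proof (induction r)
  case 0
  then show ?case
    by (simp add: Jpow_0 ring.oneideal PA_ring)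
next
  case (Suc r)
  then show ?case
    by (simp add: Jpow_Suc ring.ideal_prod_is_ideal PA_ring J_ideal)
qed

lemma Jpow_high: "Jpow r \<subseteq> (high r :: (nat \<times> nat list \<Rightarrow> 'k::field) set)"
proof (induction r)
  case 0
  then show ?case
    by (simp add: Jpow_0 high_0)
next
  case (Suc r)
  show ?case
  proof
    fix x :: "nat \<times> nat list \<Rightarrow> 'k" assume "x \<in> Jpow (Suc r)"
    then have "x \<in> ideal_prod PA (Jpow r) J"
      by (simp add: Jpow_Suc)
    then show "x \<in> high (Suc r)"
    proof (induction rule: ideal_prod.induct)
      case (prod i j)
      then show ?case
        using high_mult[of i r j 1] Suc J_high by auto
    next
      case (sum s1 s2)
      then show ?case
        by (simp add: high_def PA_add_closed coef_add)
    qed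
  qed
qed

lemma pow_arr_1_J: "pow_arr 1 \<in> (J :: (nat \<times> nat list \<Rightarrow> 'k::field) set)"
proof -
  interpret J: ideal J "PA :: (nat \<times> nat list \<Rightarrow> 'k::field) ring"
    by (rule J_ideal)
  \<comment> \<open>\<open>y m\<close> is the sum of the arrows with source below m; thus
    \<open>y n\<close> is \<alpha>, and each step adds one generator of J.\<close>
  define y :: "nat \<Rightarrow> nat \<times> nat list \<Rightarrow> 'k" where "y m = mk (\<lambda>u r. if r = 1 \<and> u < m then 1 else 0)" for m
  have y_closed: "y m \<in> carrier PA" for m
    unfolding y_def by (rule mk_closed[of _ 1]) (auto split: if_splits)
  have "y m \<in> J" if "m \<le> n" for m
    using that
  proof (induction m)
    case 0
    have "y 0 = \<zero>\<^bsub>PA\<^esub>"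
      by (rule PA_eqI) (auto simp: y_closed PA_zero_closed coef_zero, auto simp: y_def)
    then show ?case
      using J.zero_closed by simp
  next
    case (Suc m)
    have m: "(arr m :: nat \<times> nat list \<Rightarrow> 'k) \<in> J"
      unfolding J_eq using Suc.prems by (intro subsetD[OF ring.genideal_self[OF PA_ring]]) (auto simp: arr_closed)
    have "y (Suc m) = y m \<oplus>\<^bsub>PA\<^esub> arr m"
      using Suc.prems by (intro PA_eqI y_closed PA_add_closed arr_closed) (auto simp: y_def coef_add arr_mk)
    then show ?case
      using Suc m J.a_closed by simp
  qed
  moreover have "pow_arr 1 = y n"
    by (rule PA_eqI) (auto simp: y_closed, auto simp: y_def coef_pow_arr)
  ultimately show ?thesis
    by simp
qed

lemma pow_arr_Jpow: "pow_arr r \<in> (Jpow r :: (nat \<times> nat list \<Rightarrow> 'k::field) set)"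
proof (induction r)
  case 0
  then show ?case
    by (simp add: Jpow_0)
next
  case (Suc r)
  have "pow_arr (Suc r) = (pow_arr r :: nat \<times> nat list \<Rightarrow> 'k) \<otimes>\<^bsub>PA\<^esub> pow_arr 1"
    by (simp add: PA_laws(8))
  then show ?case
    unfolding Jpow_Suc using Suc pow_arr_1_J by (metis ideal_prod.prod)
qed

text \<open>An element without coefficients in lengths below r can be divided by \<alpha>^r on the
  right, because each path of length at least r begins with a path of length r; and \<alpha>^r lies
  in the power of J.\<close>

lemma Jpow_eq: "Jpow r = (high r :: (nat \<times> nat list \<Rightarrow> 'k::field) set)"
proof
  show "Jpow r \<subseteq> (high r :: (nat \<times> nat list \<Rightarrow> 'k::field) set)"
    by (rule Jpow_high)
  show "high r \<subseteq> (Jpow r :: (nat \<times> nat list \<Rightarrow> 'k::field) set)"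
  proof
    fix x :: "nat \<times> nat list \<Rightarrow> 'k" assume x: "x \<in> high r"
    then have xc: "x \<in> carrier PA"
      by (simp add: high_def)
    \<comment> \<open>The shift by \<open>n * r - r\<close> is -r modulo n, written within the
      natural numbers: the coefficient of y at the path of length s from w is that of x at the path
      starting r vertices earlier, with r more arrows.\<close>
    define y where "y = mk (\<lambda>w s. coef x (w + (n * r - r)) (s + r))"
    obtain N where N: "\<forall>u s. coef x u s \<noteq> 0 \<longrightarrow> s \<le> N"
      using coef_bound[OF xc] by blast
    have y: "y \<in> carrier PA"
      unfolding y_def by (rule mk_closed[of _ N]) (use N add_leD1 in blast)
    have "x = y \<otimes>\<^bsub>PA\<^esub> pow_arr r"
    proof (intro PA_eqI xc PA_mult_closed y pow_arr_closed)
      fix u s assume "u < n"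
      have "((u + r) mod n + (n * r - r)) mod n = (u + r + (n * r - r)) mod n"
        by (simp add: mod_simps)
      also have "u + r + (n * r - r) = u + n * r"
        using n_pos by simp
      finally have "((u + r) mod n + (n * r - r)) mod n = u mod n"
        by simp
      then have "coef x ((u + r) mod n + (n * r - r)) s = coef x u s"
        by (rule coef_cong)
      then show "coef x u s = coef (y \<otimes>\<^bsub>PA\<^esub> pow_arr r) u s"
        using x by (auto simp: coef_mult_pow_arr y_def high_def)
    qed
    then show "x \<in> Jpow r"
      using ideal.I_l_closed[OF Jpow_ideal pow_arr_Jpow y] by metis
  qed
qed

end

text \<open>
  The algebra enters only through the following elements: \<open>sc c\<close> is the scalar \<open>c\<close>, \<open>ee u\<close> the
  idempotent at the vertex \<open>u\<close> (read modulo \<open>n\<close>) and \<open>al r\<close> the sum of all paths of length \<open>r\<close>.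
\<close>

locale nakayama = cyclic n for n :: nat +
  fixes t :: nat and A :: "'k::field nak ring"
  assumes t_ge_2: "t \<ge> 2"
    and A_def: "A = nakayama_algebra n t"
begin

definition cls :: "(nat \<times> nat list \<Rightarrow> 'k) \<Rightarrow> (nat \<times> nat list \<Rightarrow> 'k) set" where
  "cls x = high t +>\<^bsub>PA\<^esub> x"

lemma A_eq: "A = PA Quot high t"
  by (simp add: A_def nakayama_algebra_def flip: Jpow_def) (simp add: Jpow_eq)

sublocale A: ring A
  unfolding A_eq by (rule ideal.quotient_is_ring[OF high_ideal])

lemma cls_hom: "cls \<in> ring_hom PA A"
  using ideal.rcos_ring_hom[OF high_ideal, of t] by (simp add: A_eq cls_def[abs_def])

lemma cls_simps:
  "x \<in> carrier PA \<Longrightarrow> cls x \<in> carrier A"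
  "x \<in> carrier PA \<Longrightarrow> y \<in> carrier PA \<Longrightarrow> cls (x \<oplus>\<^bsub>PA\<^esub> y) = cls x \<oplus>\<^bsub>A\<^esub> cls y"
  "x \<in> carrier PA \<Longrightarrow> y \<in> carrier PA \<Longrightarrow> cls (x \<otimes>\<^bsub>PA\<^esub> y) = cls x \<otimes>\<^bsub>A\<^esub> cls y"
  "cls \<one>\<^bsub>PA\<^esub> = \<one>\<^bsub>A\<^esub>"
  using cls_hom by (auto simp: ring_hom_def)

lemma cls_zero:
  assumes "x \<in> high t"
  shows "cls x = \<zero>\<^bsub>A\<^esub>"
proof -
  interpret I: ideal "high t" "PA :: (nat \<times> nat list \<Rightarrow> 'k) ring"
    by (rule high_ideal)
  show ?thesis
    using I.a_rcos_const[OF assms] by (simp add: cls_def A_eq FactRing_def)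
qed

lemma cls_surj:
  assumes "X \<in> carrier A"
  obtains x where "x \<in> carrier PA" "X = cls x"
  using assms by (auto simp: A_eq FactRing_def A_RCOSETS_def' cls_def)

lemma cls_mem:
  assumes "x \<in> carrier PA" "y \<in> cls x"
  shows "y \<in> carrier PA" "s < t \<Longrightarrow> coef y u s = coef x u s"
  using assms by (auto simp: cls_def a_r_coset_def' high_def coef_add PA_add_closed)

lemma cls_self:
  assumes "x \<in> carrier PA"
  shows "x \<in> cls x"
proof -
  interpret I: ideal "high t" "PA :: (nat \<times> nat list \<Rightarrow> 'k) ring"
    by (rule high_ideal)
  show ?thesis
    using I.a_rcos_self[OF assms] by (simp add: cls_def)
qed

definition sc :: "'k \<Rightarrow> (nat \<times> nat list \<Rightarrow> 'k) set" where "sc c = cls (scal c)"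
definition ee :: "nat \<Rightarrow> (nat \<times> nat list \<Rightarrow> 'k) set" where "ee u = cls (idem u)"
definition al :: "nat \<Rightarrow> (nat \<times> nat list \<Rightarrow> 'k) set" where "al r = cls (pow_arr r)"
definition eb :: "nat \<Rightarrow> (nat \<times> nat list \<Rightarrow> 'k) set" where "eb m = cls (idem_below m)"

lemma A_closed [simp]: "sc c \<in> carrier A" "ee u \<in> carrier A" "al r \<in> carrier A" "eb m \<in> carrier A"
  by (simp_all add: sc_def ee_def al_def eb_def cls_simps)

lemma A_laws:
  "sc (a + b) = sc a \<oplus>\<^bsub>A\<^esub> sc b"
  "sc (a * b) = sc a \<otimes>\<^bsub>A\<^esub> sc b"
  "sc 1 = \<one>\<^bsub>A\<^esub>"
  "sc a \<otimes>\<^bsub>A\<^esub> ee u = ee u \<otimes>\<^bsub>A\<^esub> sc a"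
  "sc a \<otimes>\<^bsub>A\<^esub> al r = al r \<otimes>\<^bsub>A\<^esub> sc a"
  "ee u \<otimes>\<^bsub>A\<^esub> ee v = (if u mod n = v mod n then ee u else \<zero>\<^bsub>A\<^esub>)"
  "al r \<otimes>\<^bsub>A\<^esub> ee u = ee (u + r) \<otimes>\<^bsub>A\<^esub> al r"
  "al r \<otimes>\<^bsub>A\<^esub> al s = al (r + s)"
  "al 0 = \<one>\<^bsub>A\<^esub>"
  "eb 0 = \<zero>\<^bsub>A\<^esub>"
  "m < n \<Longrightarrow> eb (Suc m) = eb m \<oplus>\<^bsub>A\<^esub> ee m"
  "eb n = \<one>\<^bsub>A\<^esub>"
proof -
  have z: "cls \<zero>\<^bsub>PA\<^esub> = \<zero>\<^bsub>A\<^esub>"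
    by (rule cls_zero) (simp add: high_def PA_zero_closed coef_zero)
  note cls_simps(2,3)[symmetric, simp]
  show "sc (a + b) = sc a \<oplus>\<^bsub>A\<^esub> sc b"
    "sc (a * b) = sc a \<otimes>\<^bsub>A\<^esub> sc b"
    "sc 1 = \<one>\<^bsub>A\<^esub>"
    "sc a \<otimes>\<^bsub>A\<^esub> ee u = ee u \<otimes>\<^bsub>A\<^esub> sc a"
    "sc a \<otimes>\<^bsub>A\<^esub> al r = al r \<otimes>\<^bsub>A\<^esub> sc a"
    "ee u \<otimes>\<^bsub>A\<^esub> ee v = (if u mod n = v mod n then ee u else \<zero>\<^bsub>A\<^esub>)"
    "al r \<otimes>\<^bsub>A\<^esub> ee u = ee (u + r) \<otimes>\<^bsub>A\<^esub> al r"
    "al r \<otimes>\<^bsub>A\<^esub> al s = al (r + s)"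
    "al 0 = \<one>\<^bsub>A\<^esub>"
    "eb 0 = \<zero>\<^bsub>A\<^esub>"
    "m < n \<Longrightarrow> eb (Suc m) = eb m \<oplus>\<^bsub>A\<^esub> ee m"
    "eb n = \<one>\<^bsub>A\<^esub>"
    by (simp_all add: sc_def ee_def al_def eb_def PA_laws cls_simps(4) z)
qed

lemma al_zero: "r \<ge> t \<Longrightarrow> al r = \<zero>\<^bsub>A\<^esub>"
  unfolding al_def by (rule cls_zero) (simp add: high_def coef_pow_arr)

lemma ee_cong: "u mod n = v mod n \<Longrightarrow> ee u = ee v"
  by (simp add: ee_def idem_def)

text \<open>Reduces statements that are additive in a, such as linearity of a map or stability of a
  subspace, to products of scalars, powers of \<alpha> and idempotents.\<close>

lemma A_induct [consumes 1, case_names zero add gen]: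
  assumes "a \<in> carrier A"
    and "Q \<zero>\<^bsub>A\<^esub>"
    and "\<And>a b. \<lbrakk>a \<in> carrier A; b \<in> carrier A; Q a; Q b\<rbrakk> \<Longrightarrow> Q (a \<oplus>\<^bsub>A\<^esub> b)"
    and "\<And>c r u. Q (sc c \<otimes>\<^bsub>A\<^esub> (al r \<otimes>\<^bsub>A\<^esub> ee u))"
  shows "Q a"
proof -
  obtain x where x: "x \<in> carrier PA" "a = cls x"
    using cls_surj assms(1) by blast
  from x(1) have "Q (cls x)"
  proof (induction rule: PA_induct)
    case zero
    then show ?case
      using assms(2) cls_zero[of "\<zero>\<^bsub>PA\<^esub>"] by (simp add: high_def PA_zero_closed coef_zero)
  next
    case (add x y)
    then show ?case
      using assms(3)[of "cls x" "cls y"] by (simp add: cls_simps)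
  next
    case (gen c r u)
    then show ?case
      using assms(4)[of c r u] by (simp add: cls_simps PA_mult_closed sc_def al_def ee_def)
  qed
  then show ?thesis
    using x by simp
qed

end

section \<open>Left modules and their homomorphisms\<close>

lemma left_module_group: "left_module R M \<Longrightarrow> abelian_group M"
  by (rule left_module.axioms)

lemma (in left_module) smult_l_null:
  assumes "x \<in> carrier M"
  shows "\<zero> \<odot>\<^bsub>M\<^esub> x = \<zero>\<^bsub>M\<^esub>"
proof -
  have "\<zero> \<odot>\<^bsub>M\<^esub> x \<oplus>\<^bsub>M\<^esub> \<zero> \<odot>\<^bsub>M\<^esub> x = (\<zero> \<oplus> \<zero>) \<odot>\<^bsub>M\<^esub> x"
    by (rule smult_l_distr[symmetric]) (use assms in auto)
  then have "\<zero> \<odot>\<^bsub>M\<^esub> x \<oplus>\<^bsub>M\<^esub> \<zero> \<odot>\<^bsub>M\<^esub> x = \<zero> \<odot>\<^bsub>M\<^esub> x"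
    by simp
  then show ?thesis
    using smult_closed[OF R.zero_closed assms] M.add.r_cancel_one by blast
qed

lemma (in left_module) smult_r_null:
  assumes "a \<in> carrier R"
  shows "a \<odot>\<^bsub>M\<^esub> \<zero>\<^bsub>M\<^esub> = \<zero>\<^bsub>M\<^esub>"
proof -
  have "a \<odot>\<^bsub>M\<^esub> \<zero>\<^bsub>M\<^esub> \<oplus>\<^bsub>M\<^esub> a \<odot>\<^bsub>M\<^esub> \<zero>\<^bsub>M\<^esub> = a \<odot>\<^bsub>M\<^esub> (\<zero>\<^bsub>M\<^esub> \<oplus>\<^bsub>M\<^esub> \<zero>\<^bsub>M\<^esub>)"
    by (rule smult_r_distr[symmetric]) (use assms in auto)
  then have "a \<odot>\<^bsub>M\<^esub> \<zero>\<^bsub>M\<^esub> \<oplus>\<^bsub>M\<^esub> a \<odot>\<^bsub>M\<^esub> \<zero>\<^bsub>M\<^esub> = a \<odot>\<^bsub>M\<^esub> \<zero>\<^bsub>M\<^esub>"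
    by simp
  then show ?thesis
    using smult_closed[OF assms M.zero_closed] M.add.r_cancel_one by blast
qed

lemma (in left_module) smult_neg_one:
  assumes "x \<in> carrier M"
  shows "(\<ominus> \<one>) \<odot>\<^bsub>M\<^esub> x = \<ominus>\<^bsub>M\<^esub> x"
proof -
  have "(\<ominus> \<one>) \<odot>\<^bsub>M\<^esub> x \<oplus>\<^bsub>M\<^esub> \<one> \<odot>\<^bsub>M\<^esub> x = (\<ominus> \<one> \<oplus> \<one>) \<odot>\<^bsub>M\<^esub> x"
    by (rule smult_l_distr[symmetric]) (use assms in auto)
  then have "(\<ominus> \<one>) \<odot>\<^bsub>M\<^esub> x \<oplus>\<^bsub>M\<^esub> x = \<zero>\<^bsub>M\<^esub>"
    using assms by (simp add: smult_l_null smult_one R.l_neg)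
  then show ?thesis
    using assms smult_closed by (simp add: M.minus_equality)
qed

lemma (in left_module) smult_minus:
  assumes "a \<in> carrier R" "x \<in> carrier M" "y \<in> carrier M"
  shows "a \<odot>\<^bsub>M\<^esub> (x \<ominus>\<^bsub>M\<^esub> y) = a \<odot>\<^bsub>M\<^esub> x \<ominus>\<^bsub>M\<^esub> a \<odot>\<^bsub>M\<^esub> y"
proof -
  have "a \<odot>\<^bsub>M\<^esub> (\<ominus>\<^bsub>M\<^esub> y) \<oplus>\<^bsub>M\<^esub> a \<odot>\<^bsub>M\<^esub> y = a \<odot>\<^bsub>M\<^esub> (\<ominus>\<^bsub>M\<^esub> y \<oplus>\<^bsub>M\<^esub> y)"
    by (rule smult_r_distr[symmetric]) (use assms in auto)
  then have "a \<odot>\<^bsub>M\<^esub> (\<ominus>\<^bsub>M\<^esub> y) = \<ominus>\<^bsub>M\<^esub> (a \<odot>\<^bsub>M\<^esub> y)"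
    using assms smult_closed by (simp add: M.l_neg smult_r_null M.minus_equality)
  then show ?thesis
    using assms by (simp add: M.minus_eq smult_r_distr)
qed

section \<open>Homomorphisms of left modules\<close>

lemma lhom_closed: "f \<in> lhom R M N \<Longrightarrow> x \<in> carrier M \<Longrightarrow> f x \<in> carrier N"
  by (auto simp: lhom_def)

lemma lhom_add: "f \<in> lhom R M N \<Longrightarrow> x \<in> carrier M \<Longrightarrow> y \<in> carrier M \<Longrightarrow> f (x \<oplus>\<^bsub>M\<^esub> y) = f x \<oplus>\<^bsub>N\<^esub> f y"
  by (auto simp: lhom_def)

lemma lhom_smult: "f \<in> lhom R M N \<Longrightarrow> a \<in> carrier R \<Longrightarrow> x \<in> carrier M \<Longrightarrow> f (a \<odot>\<^bsub>M\<^esub> x) = a \<odot>\<^bsub>N\<^esub> f x"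
  by (auto simp: lhom_def)

lemma lhomI:
  assumes "\<And>x. x \<in> carrier M \<Longrightarrow> f x \<in> carrier N"
    and "\<And>x y. x \<in> carrier M \<Longrightarrow> y \<in> carrier M \<Longrightarrow> f (x \<oplus>\<^bsub>M\<^esub> y) = f x \<oplus>\<^bsub>N\<^esub> f y"
    and "\<And>a x. a \<in> carrier R \<Longrightarrow> x \<in> carrier M \<Longrightarrow> f (a \<odot>\<^bsub>M\<^esub> x) = a \<odot>\<^bsub>N\<^esub> f x"
  shows "f \<in> lhom R M N"
  using assms by (auto simp: lhom_def)

lemma lhom_zero:
  assumes "left_module R M" "left_module R N" "f \<in> lhom R M N"
  shows "f \<zero>\<^bsub>M\<^esub> = \<zero>\<^bsub>N\<^esub>"
proof -
  interpret M: left_module R M by fact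
  interpret N: left_module R N by fact
  have "f \<zero>\<^bsub>M\<^esub> = f (\<zero>\<^bsub>R\<^esub> \<odot>\<^bsub>M\<^esub> \<zero>\<^bsub>M\<^esub>)"
    by (simp add: M.smult_l_null)
  also have "\<dots> = \<zero>\<^bsub>N\<^esub>"
    using assms(3) by (simp add: lhom_smult lhom_closed N.smult_l_null)
  finally show ?thesis .
qed

lemma lhom_minus:
  assumes "left_module R M" "left_module R N" "f \<in> lhom R M N" "x \<in> carrier M" "y \<in> carrier M"
  shows "f (x \<ominus>\<^bsub>M\<^esub> y) = f x \<ominus>\<^bsub>N\<^esub> f y"
proof -
  interpret M: left_module R M by fact
  interpret N: left_module R N by fact
  have "f (x \<ominus>\<^bsub>M\<^esub> y) = f (x \<oplus>\<^bsub>M\<^esub> ((\<ominus>\<^bsub>R\<^esub> \<one>\<^bsub>R\<^esub>) \<odot>\<^bsub>M\<^esub> y))"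
    using assms by (simp add: M.smult_neg_one M.M.minus_eq)
  also have "\<dots> = f x \<oplus>\<^bsub>N\<^esub> ((\<ominus>\<^bsub>R\<^esub> \<one>\<^bsub>R\<^esub>) \<odot>\<^bsub>N\<^esub> f y)"
    using assms by (simp add: lhom_add lhom_smult M.smult_closed)
  also have "\<dots> = f x \<ominus>\<^bsub>N\<^esub> f y"
    using assms by (simp add: N.smult_neg_one N.M.minus_eq lhom_closed)
  finally show ?thesis .
qed

lemma lhom_comp: "f \<in> lhom R L M \<Longrightarrow> g \<in> lhom R M N \<Longrightarrow> (\<lambda>x. g (f x)) \<in> lhom R L N"
  by (auto simp: lhom_def Pi_iff)

lemma lhom_id: "(\<lambda>x. x) \<in> lhom R M M"
  by (auto simp: lhom_def)

lemma lhom_const_zero: "left_module R N \<Longrightarrow> (\<lambda>x. \<zero>\<^bsub>N\<^esub>) \<in> lhom R M N"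
  by (auto simp: lhom_def left_module.smult_r_null abelian_monoid.l_zero abelian_group.axioms
      abelian_monoid.zero_closed dest: left_module_group)

lemma lhom_plus:
  assumes "left_module R N" "f \<in> lhom R M N" "g \<in> lhom R M N"
  shows "(\<lambda>x. f x \<oplus>\<^bsub>N\<^esub> g x) \<in> lhom R M N"
proof -
  interpret N: left_module R N by fact
  show ?thesis
    using assms by (intro lhomI) (simp_all add: lhom_closed lhom_add lhom_smult N.smult_r_distr N.M.a_ac)
qed

lemma lhom_diff:
  assumes "left_module R N" "f \<in> lhom R M N" "g \<in> lhom R M N"
  shows "(\<lambda>x. f x \<ominus>\<^bsub>N\<^esub> g x) \<in> lhom R M N"
proof -
  interpret N: left_module R N by fact
  show ?thesis
    using assms by (intro lhomI)
      (simp_all add: lhom_closed lhom_add lhom_smult N.smult_minus, simp add: lhom_closed N.M.minus_eq N.M.minus_add N.M.a_ac)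
qed

text \<open>The axioms are equations, so they can be checked after an injective map that respects
  the operations; negatives are supplied by multiplication with -1. This serves submodules, coded
  direct sums and copies on another carrier alike.\<close>

lemma left_module_pullback:
  assumes M: "left_module R M"
    and f: "\<And>x. x \<in> carrier N \<Longrightarrow> f x \<in> carrier M" "inj_on f (carrier N)"
    and add: "\<And>x y. x \<in> carrier N \<Longrightarrow> y \<in> carrier N \<Longrightarrow> x \<oplus>\<^bsub>N\<^esub> y \<in> carrier N"
      "\<And>x y. x \<in> carrier N \<Longrightarrow> y \<in> carrier N \<Longrightarrow> f (x \<oplus>\<^bsub>N\<^esub> y) = f x \<oplus>\<^bsub>M\<^esub> f y"
    and zero: "\<zero>\<^bsub>N\<^esub> \<in> carrier N" "f \<zero>\<^bsub>N\<^esub> = \<zero>\<^bsub>M\<^esub>"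
    and smult: "\<And>a x. a \<in> carrier R \<Longrightarrow> x \<in> carrier N \<Longrightarrow> a \<odot>\<^bsub>N\<^esub> x \<in> carrier N"
      "\<And>a x. a \<in> carrier R \<Longrightarrow> x \<in> carrier N \<Longrightarrow> f (a \<odot>\<^bsub>N\<^esub> x) = a \<odot>\<^bsub>M\<^esub> f x"
  shows "left_module R N"
proof -
  interpret M: left_module R M by fact
  have eqI: "x = y" if "f x = f y" "x \<in> carrier N" "y \<in> carrier N" for x y
    using that f(2) by (simp add: inj_on_def)
  have "abelian_group N"
  proof (rule abelian_groupI)
    fix x assume x: "x \<in> carrier N"
    have "((\<ominus>\<^bsub>R\<^esub> \<one>\<^bsub>R\<^esub>) \<odot>\<^bsub>N\<^esub> x) \<oplus>\<^bsub>N\<^esub> x = \<zero>\<^bsub>N\<^esub>"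
      by (rule eqI) (use x f in \<open>simp_all add: add zero smult M.smult_neg_one M.M.l_neg\<close>)
    then show "\<exists>y\<in>carrier N. y \<oplus>\<^bsub>N\<^esub> x = \<zero>\<^bsub>N\<^esub>"
      using x smult(1) by blast
    show "\<zero>\<^bsub>N\<^esub> \<oplus>\<^bsub>N\<^esub> x = x"
      by (rule eqI) (use x f in \<open>simp_all add: add zero\<close>)
  next
    fix x y z assume "x \<in> carrier N" "y \<in> carrier N" "z \<in> carrier N"
    then show "x \<oplus>\<^bsub>N\<^esub> y \<oplus>\<^bsub>N\<^esub> z = x \<oplus>\<^bsub>N\<^esub> (y \<oplus>\<^bsub>N\<^esub> z)"
      by (intro eqI) (simp_all add: add f M.M.a_assoc)
  next
    fix x y assume "x \<in> carrier N" "y \<in> carrier N"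
    then show "x \<oplus>\<^bsub>N\<^esub> y = y \<oplus>\<^bsub>N\<^esub> x"
      by (intro eqI) (simp_all add: add f M.M.a_comm)
  qed (use add zero in auto)
  moreover have "left_module_axioms R N"
  proof (rule left_module_axioms.intro)
    fix a b x assume "a \<in> carrier R" "b \<in> carrier R" "x \<in> carrier N"
    then show "(a \<oplus>\<^bsub>R\<^esub> b) \<odot>\<^bsub>N\<^esub> x = a \<odot>\<^bsub>N\<^esub> x \<oplus>\<^bsub>N\<^esub> b \<odot>\<^bsub>N\<^esub> x" "(a \<otimes>\<^bsub>R\<^esub> b) \<odot>\<^bsub>N\<^esub> x = a \<odot>\<^bsub>N\<^esub> (b \<odot>\<^bsub>N\<^esub> x)"
      by (auto intro!: eqI simp: add smult f M.smult_l_distr M.smult_assoc)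
  next
    fix a x y assume "a \<in> carrier R" "x \<in> carrier N" "y \<in> carrier N"
    then show "a \<odot>\<^bsub>N\<^esub> (x \<oplus>\<^bsub>N\<^esub> y) = a \<odot>\<^bsub>N\<^esub> x \<oplus>\<^bsub>N\<^esub> a \<odot>\<^bsub>N\<^esub> y"
      by (auto intro!: eqI simp: add smult f M.smult_r_distr)
  next
    fix x assume "x \<in> carrier N"
    then show "\<one>\<^bsub>R\<^esub> \<odot>\<^bsub>N\<^esub> x = x"
      by (auto intro!: eqI simp: smult f M.smult_one)
  qed (use smult in auto)
  ultimately show ?thesis
    using M.R.ring_axioms by (simp add: left_module_def)
qed

subsection \<open>Finite generation\<close>

text \<open>Closure under negatives comes from multiplication by -1.\<close>

lemma submodule_iff:
  assumes "left_module R M"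
  shows "submodule N R M \<longleftrightarrow> N \<subseteq> carrier M \<and> \<zero>\<^bsub>M\<^esub> \<in> N \<and> (\<forall>x\<in>N. \<forall>y\<in>N. x \<oplus>\<^bsub>M\<^esub> y \<in> N) \<and>
    (\<forall>a\<in>carrier R. \<forall>x\<in>N. a \<odot>\<^bsub>M\<^esub> x \<in> N)"
proof -
  interpret M: left_module R M by fact
  show ?thesis
  proof
    assume "submodule N R M"
    then interpret N: submodule N R M .
    show "N \<subseteq> carrier M \<and> \<zero>\<^bsub>M\<^esub> \<in> N \<and> (\<forall>x\<in>N. \<forall>y\<in>N. x \<oplus>\<^bsub>M\<^esub> y \<in> N) \<and>
        (\<forall>a\<in>carrier R. \<forall>x\<in>N. a \<odot>\<^bsub>M\<^esub> x \<in> N)"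
      using N.subset N.one_closed N.m_closed by auto
  next
    assume N: "N \<subseteq> carrier M \<and> \<zero>\<^bsub>M\<^esub> \<in> N \<and> (\<forall>x\<in>N. \<forall>y\<in>N. x \<oplus>\<^bsub>M\<^esub> y \<in> N) \<and>
        (\<forall>a\<in>carrier R. \<forall>x\<in>N. a \<odot>\<^bsub>M\<^esub> x \<in> N)"
    have "\<ominus>\<^bsub>M\<^esub> x \<in> N" if "x \<in> N" for x
    proof -
      have x: "x \<in> carrier M"
        using N that by blast
      have "(\<ominus>\<^bsub>R\<^esub> \<one>\<^bsub>R\<^esub>) \<odot>\<^bsub>M\<^esub> x \<in> N"
        using N that by simp
      then show ?thesis
        unfolding M.smult_neg_one[OF x] .
    qed
    then have "subgroup N (add_monoid M)"
      using N by (intro M.M.add.subgroupI) auto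
    then show "submodule N R M"
      using N by (simp add: submodule_def submodule_axioms_def)
  qed
qed

text \<open>The preimages of a submodule that contains the images of the generators are submodules
  containing the generators, hence everything. Two source modules are treated at once so that sums
  as well as quotients are covered.\<close>

lemma finitely_generated_onto2:
  assumes M1: "left_module R M1" "finitely_generated R M1"
    and M2: "left_module R M2" "finitely_generated R M2"
    and N: "left_module R N" and f1: "f1 \<in> lhom R M1 N" and f2: "f2 \<in> lhom R M2 N"
    and onto: "\<And>z. z \<in> carrier N \<Longrightarrow> \<exists>x\<in>carrier M1. \<exists>y\<in>carrier M2. z = f1 x \<oplus>\<^bsub>N\<^esub> f2 y"
  shows "finitely_generated R N"
proof -
  obtain S1 where S1: "finite S1" "S1 \<subseteq> carrier M1" "\<And>L. submodule L R M1 \<Longrightarrow> S1 \<subseteq> L \<Longrightarrow> L = carrier M1"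
    using M1(2) by (auto simp: finitely_generated_def)
  obtain S2 where S2: "finite S2" "S2 \<subseteq> carrier M2" "\<And>L. submodule L R M2 \<Longrightarrow> S2 \<subseteq> L \<Longrightarrow> L = carrier M2"
    using M2(2) by (auto simp: finitely_generated_def)
  have preimage: "submodule {x \<in> carrier M. f x \<in> L} R M"
    if "left_module R M" "f \<in> lhom R M N" "submodule L R N" for M f L
  proof -
    interpret M: left_module R M by fact
    show ?thesis
      using that lhom_zero[OF that(1) N that(2)]
      unfolding submodule_iff[OF that(1)] submodule_iff[OF N]
      by (auto simp: M.smult_closed lhom_add lhom_smult)
  qed
  have "L = carrier N" if L: "submodule L R N" "f1 ` S1 \<union> f2 ` S2 \<subseteq> L" for L
  proof -
    have "{x \<in> carrier M1. f1 x \<in> L} = carrier M1"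
      by (rule S1(3)[OF preimage[OF M1(1) f1 L(1)]]) (use L S1 in auto)
    moreover have "{x \<in> carrier M2. f2 x \<in> L} = carrier M2"
      by (rule S2(3)[OF preimage[OF M2(1) f2 L(1)]]) (use L S2 in auto)
    ultimately have f_L: "f1 x \<in> L" "f2 y \<in> L" if "x \<in> carrier M1" "y \<in> carrier M2" for x y
      using that by blast+
    have "z \<in> L" if "z \<in> carrier N" for z
    proof -
      obtain x y where "x \<in> carrier M1" "y \<in> carrier M2" "z = f1 x \<oplus>\<^bsub>N\<^esub> f2 y"
        using onto[OF \<open>z \<in> carrier N\<close>] by blast
      then show ?thesis
        using f_L[of x y] L(1) unfolding submodule_iff[OF N] by blast
    qed
    then have "carrier N \<subseteq> L"
      by blast
    then show ?thesis
      using L(1) unfolding submodule_iff[OF N] by auto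
  qed
  moreover have "f1 ` S1 \<union> f2 ` S2 \<subseteq> carrier N"
    using S1 S2 f1 f2 by (auto simp: lhom_closed subset_iff)
  ultimately show ?thesis
    using S1 S2 unfolding finitely_generated_def by (intro exI[of _ "f1 ` S1 \<union> f2 ` S2"]) auto
qed

lemma finitely_generated_onto:
  assumes "left_module R M" "finitely_generated R M" "left_module R N" "f \<in> lhom R M N"
    and "f ` carrier M = carrier N"
  shows "finitely_generated R N"
proof (rule finitely_generated_onto2[OF assms(1,2) assms(1,2) assms(3,4) lhom_const_zero[OF assms(3)]])
  interpret M: left_module R M by fact
  interpret N: left_module R N by fact
  fix z assume "z \<in> carrier N"
  then obtain x where "x \<in> carrier M" "z = f x"
    using assms(5) by blast
  then show "\<exists>x\<in>carrier M. \<exists>y\<in>carrier M. z = f x \<oplus>\<^bsub>N\<^esub> \<zero>\<^bsub>N\<^esub>"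
    using lhom_closed[OF assms(4)] M.M.zero_closed by (intro bexI[of _ x] bexI[of _ "\<zero>\<^bsub>M\<^esub>"]) auto
qed

lemma fg_mods_module: "M \<in> fg_mods R \<Longrightarrow> left_module R M"
  by (simp add: fg_mods_def)

lemma fg_mods_onto:
  assumes "M \<in> fg_mods R" "left_module R N" "f \<in> lhom R M N" "f ` carrier M = carrier N"
  shows "N \<in> fg_mods R"
  using assms finitely_generated_onto[of R M N f] by (simp add: fg_mods_def)

lemma fg_mods_trivial:
  assumes "left_module R M" "carrier M = {\<zero>\<^bsub>M\<^esub>}"
  shows "M \<in> fg_mods R"
  using assms submodule_iff[OF assms(1)] unfolding fg_mods_def finitely_generated_def
  by (auto intro!: exI[of _ "{}"])

subsection \<open>Isomorphisms and retracts\<close>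

lemma mod_iso_inverse:
  assumes "left_module R M" "mod_iso R M N"
  shows "\<exists>f\<in>lhom R M N. \<exists>g\<in>lhom R N M. (\<forall>x\<in>carrier M. g (f x) = x) \<and> (\<forall>y\<in>carrier N. f (g y) = y)"
proof -
  interpret M: left_module R M by fact
  obtain f where f: "f \<in> lhom R M N" "bij_betw f (carrier M) (carrier N)"
    using assms by (auto simp: mod_iso_def)
  let ?g = "inv_into (carrier M) f"
  have g: "?g y \<in> carrier M" "f (?g y) = y" if "y \<in> carrier N" for y
    using that f(2) by (auto simp: bij_betw_def inv_into_into f_inv_into_f)
  have gf: "?g (f x) = x" if "x \<in> carrier M" for x
    using that f(2) by (auto simp: bij_betw_def)
  have "?g \<in> lhom R N M"
  proof (rule lhomI)
    fix x y assume xy: "x \<in> carrier N" "y \<in> carrier N"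
    then have "?g (f (?g x \<oplus>\<^bsub>M\<^esub> ?g y)) = ?g x \<oplus>\<^bsub>M\<^esub> ?g y"
      by (intro gf) (simp add: g)
    then show "?g (x \<oplus>\<^bsub>N\<^esub> y) = ?g x \<oplus>\<^bsub>M\<^esub> ?g y"
      using xy by (simp add: lhom_add[OF f(1)] g)
  next
    fix a x assume ax: "a \<in> carrier R" "x \<in> carrier N"
    then have "?g (f (a \<odot>\<^bsub>M\<^esub> ?g x)) = a \<odot>\<^bsub>M\<^esub> ?g x"
      by (intro gf) (simp add: g M.smult_closed)
    then show "?g (a \<odot>\<^bsub>N\<^esub> x) = a \<odot>\<^bsub>M\<^esub> ?g x"
      using ax by (simp add: lhom_smult[OF f(1)] g)
  qed (rule g)
  then show ?thesis
    using f(1) gf g(2) by blast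
qed

lemma mod_isoI:
  assumes "f \<in> lhom R M N" "g \<in> lhom R N M"
    and "\<And>x. x \<in> carrier M \<Longrightarrow> g (f x) = x" "\<And>y. y \<in> carrier N \<Longrightarrow> f (g y) = y"
  shows "mod_iso R M N"
  unfolding mod_iso_def using assms
  by (intro bexI[of _ f] bij_betw_byWitness[of _ g]) (auto simp: lhom_closed)

lemma mod_iso_sym:
  assumes "left_module R M" "mod_iso R M N"
  shows "mod_iso R N M"
proof -
  obtain f g where "f \<in> lhom R M N" "g \<in> lhom R N M"
      "\<forall>x\<in>carrier M. g (f x) = x" "\<forall>y\<in>carrier N. f (g y) = y"
    using mod_iso_inverse[OF assms] by blast
  then show ?thesis
    by (intro mod_isoI[of g R N M f]) auto
qed

lemma mod_iso_trans:
  assumes "mod_iso R L M" "mod_iso R M N"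
  shows "mod_iso R L N"
proof -
  obtain f g where "f \<in> lhom R L M" "bij_betw f (carrier L) (carrier M)"
      "g \<in> lhom R M N" "bij_betw g (carrier M) (carrier N)"
    using assms by (auto simp: mod_iso_def)
  then show ?thesis
    unfolding mod_iso_def using bij_betw_trans[of f _ _ g] lhom_comp[of f R L M g N]
    by (intro bexI[of _ "\<lambda>x. g (f x)"]) (auto simp: comp_def)
qed

text \<open>Being a summand without naming a complement: no carrier type has to be chosen for it,
  modules of different types can be compared, and transitivity is immediate.
  \<open>retract_imp_direct_summand\<close> leads back to \<open>direct_summand\<close>.\<close>

definition retract :: "'r ring \<Rightarrow> ('r, 'm) module \<Rightarrow> ('r, 'n) module \<Rightarrow> bool" where
  "retract R X Y \<longleftrightarrow> (\<exists>i\<in>lhom R X Y. \<exists>p\<in>lhom R Y X. \<forall>x\<in>carrier X. p (i x) = x)"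

lemma retract_refl: "retract R X X"
  unfolding retract_def by (intro bexI[OF _ lhom_id]) simp

lemma retract_trans:
  assumes "retract R X Y" "retract R Y Z"
  shows "retract R X Z"
proof -
  obtain i p where ip: "i \<in> lhom R X Y" "p \<in> lhom R Y X" "\<forall>x\<in>carrier X. p (i x) = x"
    using assms(1) unfolding retract_def by blast
  obtain j q where jq: "j \<in> lhom R Y Z" "q \<in> lhom R Z Y" "\<forall>x\<in>carrier Y. q (j x) = x"
    using assms(2) unfolding retract_def by blast
  have "\<forall>x\<in>carrier X. p (q (j (i x))) = x"
    using ip jq by (simp add: lhom_closed)
  then show ?thesis
    unfolding retract_def using lhom_comp[OF ip(1) jq(1)] lhom_comp[OF jq(2) ip(2)]
    by (intro bexI[of _ "\<lambda>x. j (i x)"] bexI[of _ "\<lambda>x. p (q x)"]) auto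
qed

lemma mod_iso_retract:
  assumes "left_module R M" "mod_iso R M N"
  shows "retract R M N"
  using mod_iso_inverse[OF assms] unfolding retract_def by blast

subsection \<open>Sums of two modules\<close>

lemma direct_sum2_module:
  assumes "left_module R M" "left_module R N"
  shows "left_module R (M \<oplus>\<^sub>m N)"
proof -
  interpret M: left_module R M by fact
  interpret N: left_module R N by fact
  have "abelian_group (M \<oplus>\<^sub>m N)"
  proof (rule abelian_groupI)
    fix x assume "x \<in> carrier (M \<oplus>\<^sub>m N)"
    then show "\<exists>y\<in>carrier (M \<oplus>\<^sub>m N). y \<oplus>\<^bsub>M \<oplus>\<^sub>m N\<^esub> x = \<zero>\<^bsub>M \<oplus>\<^sub>m N\<^esub>"
      by (intro bexI[of _ "(\<ominus>\<^bsub>M\<^esub> fst x, \<ominus>\<^bsub>N\<^esub> snd x)"]) (auto simp: direct_sum2_def M.M.l_neg N.M.l_neg)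
  qed (auto simp: direct_sum2_def M.M.a_ac N.M.a_ac)
  moreover have "left_module_axioms R (M \<oplus>\<^sub>m N)"
    by (rule left_module_axioms.intro)
      (auto simp: direct_sum2_def M.smult_closed N.smult_closed M.smult_l_distr N.smult_l_distr
        M.smult_r_distr N.smult_r_distr M.smult_assoc N.smult_assoc M.smult_one N.smult_one)
  ultimately show ?thesis
    using M.R.ring_axioms by (simp add: left_module_def)
qed

lemma direct_sum2_lhom:
  assumes "left_module R M" "left_module R N"
  shows "(\<lambda>x. (x, \<zero>\<^bsub>N\<^esub>)) \<in> lhom R M (M \<oplus>\<^sub>m N)" "(\<lambda>y. (\<zero>\<^bsub>M\<^esub>, y)) \<in> lhom R N (M \<oplus>\<^sub>m N)"
    "fst \<in> lhom R (M \<oplus>\<^sub>m N) M" "snd \<in> lhom R (M \<oplus>\<^sub>m N) N"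
proof -
  interpret M: left_module R M by fact
  interpret N: left_module R N by fact
  show "(\<lambda>x. (x, \<zero>\<^bsub>N\<^esub>)) \<in> lhom R M (M \<oplus>\<^sub>m N)" "(\<lambda>y. (\<zero>\<^bsub>M\<^esub>, y)) \<in> lhom R N (M \<oplus>\<^sub>m N)"
    "fst \<in> lhom R (M \<oplus>\<^sub>m N) M" "snd \<in> lhom R (M \<oplus>\<^sub>m N) N"
    by (auto intro!: lhomI simp: direct_sum2_def M.smult_r_null N.smult_r_null)
qed

lemma direct_sum2_fg:
  assumes "M \<in> fg_mods R" "N \<in> fg_mods R"
  shows "M \<oplus>\<^sub>m N \<in> fg_mods R"
proof -
  interpret M: left_module R M using assms(1) by (rule fg_mods_module)
  interpret N: left_module R N using assms(2) by (rule fg_mods_module)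
  note mods = M.left_module_axioms N.left_module_axioms
  have "finitely_generated R (M \<oplus>\<^sub>m N)"
  proof (rule finitely_generated_onto2[OF _ _ _ _ direct_sum2_module[OF mods] direct_sum2_lhom(1,2)[OF mods]])
    fix z assume "z \<in> carrier (M \<oplus>\<^sub>m N)"
    then show "\<exists>x\<in>carrier M. \<exists>y\<in>carrier N. z = (x, \<zero>\<^bsub>N\<^esub>) \<oplus>\<^bsub>M \<oplus>\<^sub>m N\<^esub> (\<zero>\<^bsub>M\<^esub>, y)"
      by (intro bexI[of _ "fst z"] bexI[of _ "snd z"]) (auto simp: direct_sum2_def)
  qed (use assms in \<open>auto simp: fg_mods_def\<close>)
  then show ?thesis
    using direct_sum2_module[OF mods] by (simp add: fg_mods_def)
qed

text \<open>
  A sum of two modules that stays in the type \<open>nat \<Rightarrow> 'k\<close>: a pair of sequences is stored as the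
  sequence with these even and odd parts.
\<close>

definition join :: "(nat \<Rightarrow> 'k) \<Rightarrow> (nat \<Rightarrow> 'k) \<Rightarrow> nat \<Rightarrow> 'k" where
  "join x y = (\<lambda>k. if even k then x (k div 2) else y (k div 2))"

definition lft :: "(nat \<Rightarrow> 'k) \<Rightarrow> nat \<Rightarrow> 'k" where "lft z = (\<lambda>k. z (2 * k))"
definition rgt :: "(nat \<Rightarrow> 'k) \<Rightarrow> nat \<Rightarrow> 'k" where "rgt z = (\<lambda>k. z (2 * k + 1))"

lemma lft_join [simp]: "lft (join x y) = x"
  by (simp add: lft_def join_def)

lemma rgt_join [simp]: "rgt (join x y) = y"
  by (simp add: rgt_def join_def)

lemma join_lft_rgt [simp]: "join (lft z) (rgt z) = z"
  by (auto simp: lft_def rgt_def join_def fun_eq_iff)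

definition bsum :: "('r, nat \<Rightarrow> 'k) module \<Rightarrow> ('r, nat \<Rightarrow> 'k) module \<Rightarrow> ('r, nat \<Rightarrow> 'k) module" where
  "bsum M N = \<lparr>
     carrier = {z. lft z \<in> carrier M \<and> rgt z \<in> carrier N},
     monoid.mult = undefined, one = undefined,
     zero = join \<zero>\<^bsub>M\<^esub> \<zero>\<^bsub>N\<^esub>,
     add = (\<lambda>z w. join (lft z \<oplus>\<^bsub>M\<^esub> lft w) (rgt z \<oplus>\<^bsub>N\<^esub> rgt w)),
     smult = (\<lambda>a z. join (a \<odot>\<^bsub>M\<^esub> lft z) (a \<odot>\<^bsub>N\<^esub> rgt z))\<rparr>"

lemma bsum_simps [simp]:
  "z \<in> carrier (bsum M N) \<longleftrightarrow> lft z \<in> carrier M \<and> rgt z \<in> carrier N"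
  "\<zero>\<^bsub>bsum M N\<^esub> = join \<zero>\<^bsub>M\<^esub> \<zero>\<^bsub>N\<^esub>"
  "z \<oplus>\<^bsub>bsum M N\<^esub> w = join (lft z \<oplus>\<^bsub>M\<^esub> lft w) (rgt z \<oplus>\<^bsub>N\<^esub> rgt w)"
  "a \<odot>\<^bsub>bsum M N\<^esub> z = join (a \<odot>\<^bsub>M\<^esub> lft z) (a \<odot>\<^bsub>N\<^esub> rgt z)"
  by (simp_all add: bsum_def)

lemma join_eq_iff [simp]: "join x y = join x' y' \<longleftrightarrow> x = x' \<and> y = y'"
  by (metis lft_join rgt_join)

lemma bsum_module:
  assumes "left_module R M" "left_module R N"
  shows "left_module R (bsum M N)"
proof -
  interpret M: left_module R M by fact
  interpret N: left_module R N by fact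
  show ?thesis
  proof (rule left_module_pullback[OF direct_sum2_module[OF assms], of _ "\<lambda>z. (lft z, rgt z)"])
    show "inj_on (\<lambda>z. (lft z, rgt z)) (carrier (bsum M N))"
      by (rule inj_onI) (metis Pair_inject join_lft_rgt)
  qed (auto simp: direct_sum2_def M.smult_closed N.smult_closed)
qed

lemma bsum_iso:
  assumes "left_module R M" "left_module R N"
  shows "mod_iso R (M \<oplus>\<^sub>m N) (bsum M N)"
proof (rule mod_isoI)
  show "(\<lambda>(x, y). join x y) \<in> lhom R (M \<oplus>\<^sub>m N) (bsum M N)"
    by (auto intro!: lhomI simp: direct_sum2_def)
  show "(\<lambda>z. (lft z, rgt z)) \<in> lhom R (bsum M N) (M \<oplus>\<^sub>m N)"
    by (auto intro!: lhomI simp: direct_sum2_def)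
qed (auto simp: direct_sum2_def)

lemma mod_iso_fg:
  assumes "M \<in> fg_mods R" "left_module R N" "mod_iso R M N"
  shows "N \<in> fg_mods R"
proof -
  obtain f where "f \<in> lhom R M N" "f ` carrier M = carrier N"
    using assms(3) by (auto simp: mod_iso_def bij_betw_def)
  then show ?thesis
    by (rule fg_mods_onto[OF assms(1,2)])
qed

lemma bsum_fg:
  assumes "M \<in> fg_mods R" "N \<in> fg_mods R"
  shows "bsum M N \<in> fg_mods R"
  using assms by (intro mod_iso_fg[OF direct_sum2_fg[OF assms] bsum_module bsum_iso] fg_mods_module)

lemma bsum_lhom:
  assumes "left_module R M" "left_module R N"
  shows "(\<lambda>x. join x \<zero>\<^bsub>N\<^esub>) \<in> lhom R M (bsum M N)" "(\<lambda>y. join \<zero>\<^bsub>M\<^esub> y) \<in> lhom R N (bsum M N)"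
    "lft \<in> lhom R (bsum M N) M" "rgt \<in> lhom R (bsum M N) N"
proof -
  interpret M: left_module R M by fact
  interpret N: left_module R N by fact
  show "(\<lambda>x. join x \<zero>\<^bsub>N\<^esub>) \<in> lhom R M (bsum M N)" "(\<lambda>y. join \<zero>\<^bsub>M\<^esub> y) \<in> lhom R N (bsum M N)"
    "lft \<in> lhom R (bsum M N) M" "rgt \<in> lhom R (bsum M N) N"
    by (auto intro!: lhomI simp: M.smult_r_null N.smult_r_null)
qed

lemma bsum_retract:
  assumes "left_module R M" "left_module R N"
  shows "retract R M (bsum M N)" "retract R N (bsum M N)"
  unfolding retract_def
  by (rule bexI[OF bexI[OF _ bsum_lhom(3)[OF assms]] bsum_lhom(1)[OF assms]], simp)
    (rule bexI[OF bexI[OF _ bsum_lhom(4)[OF assms]] bsum_lhom(2)[OF assms]], simp)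

lemma bsum_lhom_pair:
  "f \<in> lhom R L M \<Longrightarrow> g \<in> lhom R L N \<Longrightarrow> (\<lambda>x. join (f x) (g x)) \<in> lhom R L (bsum M N)"
  by (auto intro!: lhomI simp: lhom_closed lhom_add lhom_smult)

lemma bsum_lhom_sum:
  assumes "left_module R L" "f \<in> lhom R M L" "g \<in> lhom R N L"
  shows "(\<lambda>z. f (lft z) \<oplus>\<^bsub>L\<^esub> g (rgt z)) \<in> lhom R (bsum M N) L"
proof -
  interpret L: left_module R L by fact
  show ?thesis
    using assms(2,3) by (intro lhomI) (simp_all add: lhom_closed lhom_add lhom_smult L.smult_r_distr L.M.a_ac)
qed

subsection \<open>Short exact sequences\<close>

context abelian_group
begin

lemma diff_self: "x \<in> carrier G \<Longrightarrow> x \<ominus> x = \<zero>"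
  by (simp add: minus_eq r_neg)

lemma diff_eq_zero_iff:
  assumes "x \<in> carrier G" "y \<in> carrier G"
  shows "x \<ominus> y = \<zero> \<longleftrightarrow> x = y"
proof
  assume "x \<ominus> y = \<zero>"
  then have "x \<oplus> \<ominus> y = \<zero>"
    by (simp add: minus_eq)
  then have "\<ominus> (\<ominus> y) = x"
    by (rule minus_equality) (use assms in auto)
  then show "x = y"
    using assms by simp
qed (use assms in \<open>simp add: diff_self\<close>)

lemma diff_zero: "x \<in> carrier G \<Longrightarrow> x \<ominus> \<zero> = x"
  by (simp add: minus_eq)

lemma add_diff_left:
  assumes "x \<in> carrier G" "y \<in> carrier G"
  shows "(x \<oplus> y) \<ominus> x = y"
proof -
  have "(x \<oplus> y) \<ominus> x = x \<oplus> (\<ominus> x \<oplus> y)"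
    using assms by (simp add: minus_eq a_assoc a_comm[of y])
  then show ?thesis
    using assms by (simp add: r_neg2)
qed

lemma add_diff_cancel: "x \<in> carrier G \<Longrightarrow> y \<in> carrier G \<Longrightarrow> y \<oplus> (x \<ominus> y) = x"
  by (simp add: minus_eq r_neg a_lcomm)

end

lemmas (in left_module) group_simps = M.diff_self M.diff_eq_zero_iff M.diff_zero M.add_diff_cancel M.add_diff_left

lemma short_exactD:
  assumes "short_exact R X f Y g Z"
  shows "f \<in> lhom R X Y" "g \<in> lhom R Y Z" "inj_on f (carrier X)"
    "z \<in> carrier Z \<Longrightarrow> \<exists>y\<in>carrier Y. g y = z"
    "y \<in> carrier Y \<Longrightarrow> g y = \<zero>\<^bsub>Z\<^esub> \<Longrightarrow> \<exists>x\<in>carrier X. f x = y"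
    "x \<in> carrier X \<Longrightarrow> g (f x) = \<zero>\<^bsub>Z\<^esub>"
  subgoal using assms by (simp add: short_exact_def)
  subgoal using assms by (simp add: short_exact_def)
  subgoal using assms by (simp add: short_exact_def)
  subgoal using assms by (metis (no_types, lifting) imageE short_exact_def)
  subgoal using assms by (metis (mono_tags, lifting) imageE mem_Collect_eq short_exact_def)
  subgoal using assms by (metis (mono_tags, lifting) imageI mem_Collect_eq short_exact_def)
  done

lemma short_exactI:
  assumes "f \<in> lhom R X Y" "g \<in> lhom R Y Z" "inj_on f (carrier X)"
    and "\<And>z. z \<in> carrier Z \<Longrightarrow> \<exists>y\<in>carrier Y. g y = z"
    and "\<And>y. y \<in> carrier Y \<Longrightarrow> g y = \<zero>\<^bsub>Z\<^esub> \<Longrightarrow> \<exists>x\<in>carrier X. f x = y"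
    and "\<And>x. x \<in> carrier X \<Longrightarrow> g (f x) = \<zero>\<^bsub>Z\<^esub>"
  shows "short_exact R X f Y g Z"
proof -
  have "g ` carrier Y = carrier Z"
    using assms(4) lhom_closed[OF assms(2)] by blast
  moreover have "f ` carrier X = {y \<in> carrier Y. g y = \<zero>\<^bsub>Z\<^esub>}"
    using assms(5,6) lhom_closed[OF assms(1)] by blast
  ultimately show ?thesis
    using assms(1-3) by (simp add: short_exact_def)
qed

text \<open>The universal property of f as a kernel of g.\<close>

lemma short_exact_kernel_lhom:
  assumes se: "short_exact R X f Y g Z" and X: "left_module R X"
    and h: "h \<in> lhom R E Y" "\<And>e. e \<in> carrier E \<Longrightarrow> g (h e) = \<zero>\<^bsub>Z\<^esub>" and E: "left_module R E"
  shows "\<exists>h'\<in>lhom R E X. \<forall>e\<in>carrier E. f (h' e) = h e"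
proof -
  interpret X: left_module R X by fact
  interpret E: left_module R E by fact
  note f = short_exactD(1)[OF se]
  define h' where "h' e = inv_into (carrier X) f (h e)" for e
  have h': "h' e \<in> carrier X" "f (h' e) = h e" if "e \<in> carrier E" for e
  proof -
    obtain x where "x \<in> carrier X" "f x = h e"
      using short_exactD(5)[OF se lhom_closed[OF h(1) \<open>e \<in> carrier E\<close>] h(2)[OF \<open>e \<in> carrier E\<close>]] by auto
    then have "h e \<in> f ` carrier X"
      by (metis imageI)
    then show "h' e \<in> carrier X" "f (h' e) = h e"
      by (simp_all add: h'_def inv_into_into f_inv_into_f)
  qed
  have eqI: "x = y" if "x \<in> carrier X" "y \<in> carrier X" "f x = f y" for x y
    using that short_exactD(3)[OF se] by (simp add: inj_on_def)
  have "h' \<in> lhom R E X"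
  proof (rule lhomI)
    fix x y assume "x \<in> carrier E" "y \<in> carrier E"
    then show "h' (x \<oplus>\<^bsub>E\<^esub> y) = h' x \<oplus>\<^bsub>X\<^esub> h' y"
      by - (rule eqI, simp_all add: h' lhom_add[OF f] lhom_add[OF h(1)])
  next
    fix a x assume "a \<in> carrier R" "x \<in> carrier E"
    then show "h' (a \<odot>\<^bsub>E\<^esub> x) = a \<odot>\<^bsub>X\<^esub> h' x"
      by - (rule eqI, simp_all add: h' lhom_smult[OF f] lhom_smult[OF h(1)] X.smult_closed E.smult_closed)
  qed (rule h')
  then show ?thesis
    using h' by (intro bexI[of _ h']) auto
qed

text \<open>The universal property of g as a cokernel of f: two preimages of an element differ by an
  element of the image of f, so the choice made by s does not affect h.\<close>

lemma short_exact_quotient_lhom: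
  assumes se: "short_exact R X f Y g Z" and mods: "left_module R Y" "left_module R Z" "left_module R N"
    and h: "h \<in> lhom R Y N" "\<And>x. x \<in> carrier X \<Longrightarrow> h (f x) = \<zero>\<^bsub>N\<^esub>"
  shows "\<exists>h'\<in>lhom R Z N. \<forall>y\<in>carrier Y. h' (g y) = h y"
proof -
  interpret Y: left_module R Y by fact
  interpret Z: left_module R Z by fact
  interpret N: left_module R N by fact
  note g = short_exactD(2)[OF se]
  define s where "s z = inv_into (carrier Y) g z" for z
  have s: "s z \<in> carrier Y" "g (s z) = z" if "z \<in> carrier Z" for z
  proof -
    obtain y where "y \<in> carrier Y" "g y = z"
      using short_exactD(4)[OF se \<open>z \<in> carrier Z\<close>] by auto
    then have "z \<in> g ` carrier Y"
      by (metis imageI)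
    then show "s z \<in> carrier Y" "g (s z) = z"
      by (simp_all add: s_def inv_into_into f_inv_into_f)
  qed
  have eq: "h y = h y'" if "y \<in> carrier Y" "y' \<in> carrier Y" "g y = g y'" for y y'
  proof -
    have gz: "g (y \<ominus>\<^bsub>Y\<^esub> y') = \<zero>\<^bsub>Z\<^esub>"
      using that by (simp add: lhom_minus[OF mods(1,2) g] lhom_closed[OF g] Z.group_simps)
    have "y \<ominus>\<^bsub>Y\<^esub> y' \<in> carrier Y"
      using that by simp
    from short_exactD(5)[OF se this gz] obtain x where "x \<in> carrier X" "f x = y \<ominus>\<^bsub>Y\<^esub> y'"
      by (rule bexE)
    then have "h (y \<ominus>\<^bsub>Y\<^esub> y') = \<zero>\<^bsub>N\<^esub>"
      using h(2)[of x] by simp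
    then show ?thesis
      using that by (simp add: lhom_minus[OF mods(1,3) h(1)] lhom_closed[OF h(1)] N.group_simps)
  qed
  define h' where "h' z = h (s z)" for z
  have h': "h' (g y) = h y" if "y \<in> carrier Y" for y
    unfolding h'_def using that by - (rule eq, simp_all add: s lhom_closed[OF g])
  have "h' \<in> lhom R Z N"
  proof (rule lhomI)
    fix x y assume xy: "x \<in> carrier Z" "y \<in> carrier Z"
    then have "h' (g (s x \<oplus>\<^bsub>Y\<^esub> s y)) = h (s x) \<oplus>\<^bsub>N\<^esub> h (s y)"
      by (subst h') (simp_all add: s lhom_add[OF h(1)])
    then show "h' (x \<oplus>\<^bsub>Z\<^esub> y) = h' x \<oplus>\<^bsub>N\<^esub> h' y"
      using xy by (simp add: s lhom_add[OF g]) (simp add: h'_def)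
  next
    fix a x assume ax: "a \<in> carrier R" "x \<in> carrier Z"
    then have "h' (g (a \<odot>\<^bsub>Y\<^esub> s x)) = a \<odot>\<^bsub>N\<^esub> h (s x)"
      by (subst h') (simp_all add: s lhom_smult[OF h(1)] Y.smult_closed)
    then show "h' (a \<odot>\<^bsub>Z\<^esub> x) = a \<odot>\<^bsub>N\<^esub> h' x"
      using ax by (simp add: s lhom_smult[OF g]) (simp add: h'_def)
  qed (simp add: h'_def s lhom_closed[OF h(1)])
  then show ?thesis
    using h' by (intro bexI[of _ h']) auto
qed

text \<open>The map that subtracts \<open>s (g y)\<close> from y has its values in the kernel of g,
  hence factors through f.\<close>

lemma section_imp_retraction:
  assumes se: "short_exact R X f Y g Z" and mods: "left_module R X" "left_module R Y" "left_module R Z"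
    and s: "s \<in> lhom R Z Y" "\<And>z. z \<in> carrier Z \<Longrightarrow> g (s z) = z"
  shows "\<exists>r\<in>lhom R Y X. (\<forall>x\<in>carrier X. r (f x) = x) \<and> (\<forall>y\<in>carrier Y. f (r y) = y \<ominus>\<^bsub>Y\<^esub> s (g y))"
proof -
  interpret Y: left_module R Y by fact
  interpret Z: left_module R Z by fact
  note g = short_exactD(2)[OF se] and f = short_exactD(1)[OF se]
  let ?h = "\<lambda>y. y \<ominus>\<^bsub>Y\<^esub> s (g y)"
  have h: "?h \<in> lhom R Y Y"
    by (rule lhom_diff[OF mods(2) lhom_id lhom_comp[OF g s(1)]])
  have gh: "g (?h y) = \<zero>\<^bsub>Z\<^esub>" if "y \<in> carrier Y" for y
    using that by (simp add: lhom_minus[OF mods(2,3) g] s lhom_closed[OF g] lhom_closed[OF s(1)] Z.group_simps)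
  from short_exact_kernel_lhom[OF se mods(1) h gh mods(2)]
  obtain r where r: "r \<in> lhom R Y X" "\<forall>y\<in>carrier Y. f (r y) = ?h y"
    by (rule bexE)
  have "r (f x) = x" if "x \<in> carrier X" for x
  proof -
    have "f (r (f x)) = f x \<ominus>\<^bsub>Y\<^esub> s \<zero>\<^bsub>Z\<^esub>"
      using r(2) that by (simp add: lhom_closed[OF f] short_exactD(6)[OF se])
    also have "\<dots> = f x"
      using that by (simp add: lhom_zero[OF mods(3,2) s(1)] lhom_closed[OF f] Y.group_simps)
    finally show ?thesis
      using short_exactD(3)[OF se] that lhom_closed[OF r(1)] lhom_closed[OF f] by (simp add: inj_on_def)
  qed
  then show ?thesis
    using r by (intro bexI[of _ r]) auto
qed

text \<open>Subtracting \<open>f (r y)\<close> from y gives a map that kills the image of f, hence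
  factors through g.\<close>

lemma retraction_imp_section:
  assumes se: "short_exact R X f Y g Z" and mods: "left_module R X" "left_module R Y" "left_module R Z"
    and r: "r \<in> lhom R Y X" "\<And>x. x \<in> carrier X \<Longrightarrow> r (f x) = x"
  shows "\<exists>s\<in>lhom R Z Y. \<forall>z\<in>carrier Z. g (s z) = z"
proof -
  interpret Y: left_module R Y by fact
  interpret Z: left_module R Z by fact
  note g = short_exactD(2)[OF se] and f = short_exactD(1)[OF se]
  let ?h = "\<lambda>y. y \<ominus>\<^bsub>Y\<^esub> f (r y)"
  have h: "?h \<in> lhom R Y Y"
    by (rule lhom_diff[OF mods(2) lhom_id lhom_comp[OF r(1) f]])
  have hf: "?h (f x) = \<zero>\<^bsub>Y\<^esub>" if "x \<in> carrier X" for x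
    using that by (simp add: r lhom_closed[OF f] Y.group_simps)
  from short_exact_quotient_lhom[OF se mods(2,3,2) h hf]
  obtain s where s: "s \<in> lhom R Z Y" "\<forall>y\<in>carrier Y. s (g y) = ?h y"
    by (rule bexE)
  have "g (s z) = z" if z: "z \<in> carrier Z" for z
  proof -
    from short_exactD(4)[OF se z] obtain y where y: "y \<in> carrier Y" "g y = z"
      by (rule bexE)
    have "g (s z) = g y \<ominus>\<^bsub>Z\<^esub> g (f (r y))"
      using s(2) y by (simp add: lhom_minus[OF mods(2,3) g] lhom_closed[OF f] lhom_closed[OF r(1)] flip: y(2))
    then show ?thesis
      using y z by (simp add: short_exactD(6)[OF se] lhom_closed[OF r(1)] Z.group_simps)
  qed
  then show ?thesis
    using s(1) by (intro bexI[of _ s]) auto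
qed

subsection \<open>Vanishing of \<open>Ext\<^sup>1\<close> and cotorsion pairs\<close>

lemma short_exact_bsum:
  assumes "left_module R X" "left_module R Z"
  shows "short_exact R X (\<lambda>x. join x \<zero>\<^bsub>Z\<^esub>) (bsum X Z) rgt Z"
proof (rule short_exactI[OF bsum_lhom(1)[OF assms] bsum_lhom(4)[OF assms]])
  interpret X: left_module R X by fact
  interpret Z: left_module R Z by fact
  show "inj_on (\<lambda>x. join x \<zero>\<^bsub>Z\<^esub>) (carrier X)"
    by (rule inj_onI) simp
  show "\<exists>y\<in>carrier (bsum X Z). rgt y = z" if "z \<in> carrier Z" for z
    using that by (intro bexI[of _ "join \<zero>\<^bsub>X\<^esub> z"]) auto
  show "\<exists>x\<in>carrier X. join x \<zero>\<^bsub>Z\<^esub> = y" if "y \<in> carrier (bsum X Z)" "rgt y = \<zero>\<^bsub>Z\<^esub>" for y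
    using that join_lft_rgt[of y] by (intro bexI[of _ "lft y"]) auto
qed simp

text \<open>Vanishing of Ext^1 in the form in which it is proved and used;
  \<open>Ext1_vanishes_iff_splits\<close> links it to the quotient set of extensions.\<close>

definition splits :: "'r ring \<Rightarrow> ('r, 'm) module \<Rightarrow> ('r, 'm) module \<Rightarrow> bool" where
  "splits R Z X \<longleftrightarrow> (\<forall>E f g. E \<in> fg_mods R \<and> short_exact R X f E g Z \<longrightarrow>
     (\<exists>s\<in>lhom R Z E. \<forall>z\<in>carrier Z. g (s z) = z))"

lemma splitsD:
  "splits R Z X \<Longrightarrow> E \<in> fg_mods R \<Longrightarrow> short_exact R X f E g Z \<Longrightarrow> \<exists>s\<in>lhom R Z E. \<forall>z\<in>carrier Z. g (s z) = z"
  by (simp add: splits_def)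

lemma retractI:
  "i \<in> lhom R X Y \<Longrightarrow> p \<in> lhom R Y X \<Longrightarrow> (\<And>x. x \<in> carrier X \<Longrightarrow> p (i x) = x) \<Longrightarrow> retract R X Y"
  unfolding retract_def by (rule bexI[of _ i], rule bexI[of _ p]) simp_all

text \<open>If there is only one class, every extension is related to the split one, and the
  inclusion of Z into \<open>bsum X Z\<close> becomes a section. Conversely, a retraction of one
  extension and a section of another combine to a comparison map, so any two extensions are related.
  The sum \<open>bsum\<close> is why the carriers consist of sequences.\<close>

lemma Ext1_vanishes_iff_splits:
  fixes X Z :: "('r, nat \<Rightarrow> 'k) module"
  assumes X: "X \<in> fg_mods R" and Z: "Z \<in> fg_mods R"
  shows "Ext1_vanishes R Z X \<longleftrightarrow> splits R Z X"
proof -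
  note mX = fg_mods_module[OF X] and mZ = fg_mods_module[OF Z]
  interpret X: left_module R X by (rule mX)
  interpret Z: left_module R Z by (rule mZ)
  define x0 where "x0 = (\<lambda>x. join x \<zero>\<^bsub>Z\<^esub>, bsum X Z, rgt :: (nat \<Rightarrow> 'k) \<Rightarrow> nat \<Rightarrow> 'k)"
  have x0: "x0 \<in> extensions R Z X"
    using short_exact_bsum[OF mX mZ] bsum_fg[OF X Z] by (simp add: x0_def extensions_def)
  have refl: "(x, x) \<in> ext_equiv R Z X" if "x \<in> extensions R Z X" for x
  proof -
    obtain f E g where x: "x = (f, E, g)"
      by (cases x)
    show ?thesis
      using that unfolding x by (auto simp: ext_equiv_def intro!: bexI[OF _ lhom_id])
  qed
  show ?thesis
  proof
    assume "Ext1_vanishes R Z X"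
    then obtain Q where Q: "Ext1 R Z X = {Q}"
      by (auto simp: Ext1_vanishes_def is_singleton_def)
    have cls: "ext_equiv R Z X `` {x} = Q" if "x \<in> extensions R Z X" for x
    proof -
      have "ext_equiv R Z X `` {x} \<in> Ext1 R Z X"
        using that by (simp add: Ext1_def quotientI)
      then show ?thesis
        by (simp add: Q)
    qed
    show "splits R Z X"
      unfolding splits_def
    proof (intro allI impI, elim conjE)
      fix E f g assume E: "E \<in> fg_mods R" "short_exact R X f E g Z"
      then have x: "(f, E, g) \<in> extensions R Z X"
        by (simp add: extensions_def)
      \<comment> \<open>Reflexivity puts the extension into its own image, and this image equals
        that of the split extension \<open>x0\<close>.\<close>
      have "(f, E, g) \<in> ext_equiv R Z X `` {x0}"
        using refl[OF x] cls[OF x] cls[OF x0] by auto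
      then obtain h where h: "h \<in> lhom R (bsum X Z) E" "\<forall>e\<in>carrier (bsum X Z). g (h e) = rgt e"
        by (auto simp: ext_equiv_def x0_def)
      show "\<exists>s\<in>lhom R Z E. \<forall>z\<in>carrier Z. g (s z) = z"
        using h by (intro bexI[OF _ lhom_comp[OF bsum_lhom(2)[OF mX mZ] h(1)]]) auto
    qed
  next
    assume sp: "splits R Z X"
    have eq: "(x, y) \<in> ext_equiv R Z X" if xy: "x \<in> extensions R Z X" "y \<in> extensions R Z X" for x y
    proof -
      obtain f E g f' E' g' where fE: "x = (f, E, g)" "y = (f', E', g')"
        by (cases x, cases y)
      have E: "E \<in> fg_mods R" "short_exact R X f E g Z" and E': "E' \<in> fg_mods R" "short_exact R X f' E' g' Z"
        using xy by (auto simp: fE extensions_def)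
      note mE = fg_mods_module[OF E(1)] and mE' = fg_mods_module[OF E'(1)]
      interpret E': left_module R E' by (rule mE')
      from splitsD[OF sp E] obtain s where s: "s \<in> lhom R Z E" "\<forall>z\<in>carrier Z. g (s z) = z"
        by (rule bexE)
      from splitsD[OF sp E'] obtain s' where s': "s' \<in> lhom R Z E'" "\<forall>z\<in>carrier Z. g' (s' z) = z"
        by (rule bexE)
      have "\<exists>r\<in>lhom R E X. (\<forall>x\<in>carrier X. r (f x) = x) \<and> (\<forall>y\<in>carrier E. f (r y) = y \<ominus>\<^bsub>E\<^esub> s (g y))"
        by (rule section_imp_retraction[OF E(2) mX mE mZ s(1)]) (use s(2) in auto)
      then obtain r where r: "r \<in> lhom R E X" "\<forall>x\<in>carrier X. r (f x) = x"
        by auto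
      note f = short_exactD(1)[OF E(2)] short_exactD(1)[OF E'(2)]
      note g = short_exactD(2)[OF E(2)] short_exactD(2)[OF E'(2)]
      have h: "(\<lambda>e. f' (r e) \<oplus>\<^bsub>E'\<^esub> s' (g e)) \<in> lhom R E E'"
        by (rule lhom_plus[OF mE' lhom_comp[OF r(1) f(2)] lhom_comp[OF g(1) s'(1)]])
      have "f' (r (f x)) \<oplus>\<^bsub>E'\<^esub> s' (g (f x)) = f' x" if "x \<in> carrier X" for x
        using that r(2) by (simp add: short_exactD(6)[OF E(2)] lhom_zero[OF mZ mE' s'(1)] lhom_closed[OF f(2)])
      moreover have "g' (f' (r e) \<oplus>\<^bsub>E'\<^esub> s' (g e)) = g e" if "e \<in> carrier E" for e
        using that s'(2) by (simp add: lhom_add[OF g(2)] lhom_closed[OF f(2)] lhom_closed[OF s'(1)]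
            lhom_closed[OF r(1)] lhom_closed[OF g(1)] short_exactD(6)[OF E'(2)])
      ultimately show ?thesis
        using xy h unfolding fE ext_equiv_def by (auto intro!: bexI[OF _ h])
    qed
    have sub: "ext_equiv R Z X \<subseteq> extensions R Z X \<times> extensions R Z X"
      by (auto simp: ext_equiv_def)
    have "ext_equiv R Z X `` {x} = extensions R Z X" if "x \<in> extensions R Z X" for x
      using eq[OF that] sub by auto
    then have "Ext1 R Z X = {extensions R Z X}"
      using x0 unfolding Ext1_def quotient_def by auto
    then show "Ext1_vanishes R Z X"
      by (simp add: Ext1_vanishes_def)
  qed
qed

lemma splits_retract:
  assumes "splits R Z X" "X \<in> fg_mods R" "E \<in> fg_mods R" "Z \<in> fg_mods R" "short_exact R X f E g Z"
  shows "retract R Z E" "retract R X E"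
proof -
  note mods = fg_mods_module[OF assms(2)] fg_mods_module[OF assms(3)] fg_mods_module[OF assms(4)]
  from splitsD[OF assms(1,3,5)] obtain s where s: "s \<in> lhom R Z E" "\<forall>z\<in>carrier Z. g (s z) = z"
    by (rule bexE)
  show "retract R Z E"
    by (rule retractI[OF s(1) short_exactD(2)[OF assms(5)]]) (use s(2) in auto)
  have "\<exists>r\<in>lhom R E X. (\<forall>x\<in>carrier X. r (f x) = x) \<and> (\<forall>y\<in>carrier E. f (r y) = y \<ominus>\<^bsub>E\<^esub> s (g y))"
    by (rule section_imp_retraction[OF assms(5) mods s(1)]) (use s(2) in auto)
  then obtain r where r: "r \<in> lhom R E X" "\<forall>x\<in>carrier X. r (f x) = x"
    by auto
  show "retract R X E"
    by (rule retractI[OF short_exactD(1)[OF assms(5)] r(1)]) (use r(2) in auto)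
qed

text \<open>
  Given both kinds of approximations, a module orthogonal to one class is a retract of its
  approximation in the other class.
\<close>

lemma complete_cotorsion_pairI:
  fixes \<X> \<Y> :: "('r, nat \<Rightarrow> 'k) module set"
  assumes X: "\<X> \<subseteq> fg_mods R" "\<And>M X. M \<in> fg_mods R \<Longrightarrow> X \<in> \<X> \<Longrightarrow> retract R M X \<Longrightarrow> M \<in> \<X>"
    and Y: "\<Y> \<subseteq> fg_mods R" "\<And>M Y. M \<in> fg_mods R \<Longrightarrow> Y \<in> \<Y> \<Longrightarrow> retract R M Y \<Longrightarrow> M \<in> \<Y>"
    and ort: "\<And>X Y. X \<in> \<X> \<Longrightarrow> Y \<in> \<Y> \<Longrightarrow> splits R X Y"
    and r: "\<And>M. M \<in> fg_mods R \<Longrightarrow> \<exists>Y\<in>\<Y>. \<exists>X\<in>\<X>. \<exists>f g. short_exact R Y f X g M"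
    and l: "\<And>M. M \<in> fg_mods R \<Longrightarrow> \<exists>Y\<in>\<Y>. \<exists>X\<in>\<X>. \<exists>f g. short_exact R M f Y g X"
  shows "complete_cotorsion_pair R \<X> \<Y>"
proof -
  have "right_perp R \<X> = \<Y>"
  proof
    show "\<Y> \<subseteq> right_perp R \<X>"
      unfolding right_perp_def using X(1) Y(1) ort by (auto simp: Ext1_vanishes_iff_splits subset_iff)
    show "right_perp R \<X> \<subseteq> \<Y>"
    proof
      fix Z assume "Z \<in> right_perp R \<X>"
      then have Z: "Z \<in> fg_mods R" "\<And>L. L \<in> \<X> \<Longrightarrow> Ext1_vanishes R L Z"
        by (auto simp: right_perp_def)
      obtain Y' X' f g where YX: "Y' \<in> \<Y>" "X' \<in> \<X>" "short_exact R Z f Y' g X'"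
        using l[OF Z(1)] by auto
      have "splits R X' Z"
        using Z YX X(1) by (auto simp: Ext1_vanishes_iff_splits subset_iff)
      then have "retract R Z Y'"
        using splits_retract(2)[of R X' Z Y' f g] Z YX X(1) Y(1) by auto
      then show "Z \<in> \<Y>"
        by (rule Y(2)[OF Z(1) YX(1)])
    qed
  qed
  moreover have "left_perp R \<Y> = \<X>"
  proof
    show "\<X> \<subseteq> left_perp R \<Y>"
      unfolding left_perp_def using X(1) Y(1) ort by (auto simp: Ext1_vanishes_iff_splits subset_iff)
    show "left_perp R \<Y> \<subseteq> \<X>"
    proof
      fix Z assume "Z \<in> left_perp R \<Y>"
      then have Z: "Z \<in> fg_mods R" "\<And>L. L \<in> \<Y> \<Longrightarrow> Ext1_vanishes R Z L"
        by (auto simp: left_perp_def)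
      obtain Y' X' f g where YX: "Y' \<in> \<Y>" "X' \<in> \<X>" "short_exact R Y' f X' g Z"
        using r[OF Z(1)] by auto
      have "splits R Z Y'"
        using Z YX Y(1) by (auto simp: Ext1_vanishes_iff_splits subset_iff)
      then have "retract R Z X'"
        using splits_retract(1)[of R Z Y' X' f g] Z YX X(1) Y(1) by auto
      then show "Z \<in> \<X>"
        by (rule X(2)[OF Z(1) YX(2)])
    qed
  qed
  ultimately show ?thesis
    unfolding complete_cotorsion_pair_def cotorsion_pair_def using r l by simp
qed

definition ker_module :: "('r, 'm) module \<Rightarrow> ('r, 'n) module \<Rightarrow> ('m \<Rightarrow> 'n) \<Rightarrow> ('r, 'm) module" where
  "ker_module Y X p = Y\<lparr>carrier := {y \<in> carrier Y. p y = \<zero>\<^bsub>X\<^esub>}\<rparr>"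

lemma ker_module_module:
  assumes "left_module R Y" "left_module R X" "p \<in> lhom R Y X"
  shows "left_module R (ker_module Y X p)"
proof -
  interpret Y: left_module R Y by fact
  interpret X: left_module R X by fact
  show ?thesis
    using assms(3) by (intro left_module_pullback[OF assms(1), of _ "\<lambda>x. x"])
      (auto simp: ker_module_def lhom_add lhom_smult X.smult_r_null lhom_zero[OF assms] Y.smult_closed)
qed

text \<open>Subtracting \<open>i (p y)\<close> from y projects Y onto the kernel of p. The
  projection q is returned as well: it shows that the kernel is finitely generated, and its
  vanishing on the image of i drives the induction in \<open>nak_induct\<close>.\<close>

lemma ker_module_complement:
  assumes mods: "left_module R X" "left_module R Y"
    and i: "i \<in> lhom R X Y" and p: "p \<in> lhom R Y X" "\<And>x. x \<in> carrier X \<Longrightarrow> p (i x) = x"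
  shows "mod_iso R (X \<oplus>\<^sub>m ker_module Y X p) Y"
    "\<exists>q\<in>lhom R Y (ker_module Y X p). q ` carrier Y = carrier (ker_module Y X p) \<and> (\<forall>x\<in>carrier X. q (i x) = \<zero>\<^bsub>Y\<^esub>)"
proof -
  interpret X: left_module R X by fact
  interpret Y: left_module R Y by fact
  let ?K = "ker_module Y X p"
  define q where "q = (\<lambda>y. y \<ominus>\<^bsub>Y\<^esub> i (p y))"
  have K_simps: "x \<oplus>\<^bsub>?K\<^esub> y = x \<oplus>\<^bsub>Y\<^esub> y" "a \<odot>\<^bsub>?K\<^esub> x = a \<odot>\<^bsub>Y\<^esub> x" "\<zero>\<^bsub>?K\<^esub> = \<zero>\<^bsub>Y\<^esub>"
    "x \<in> carrier ?K \<longleftrightarrow> x \<in> carrier Y \<and> p x = \<zero>\<^bsub>X\<^esub>" for x y a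
    by (auto simp: ker_module_def)
  have q0: "q \<in> lhom R Y Y"
    unfolding q_def by (rule lhom_diff[OF mods(2) lhom_id lhom_comp[OF p(1) i]])
  have qK: "q y \<in> carrier ?K" if "y \<in> carrier Y" for y
    using that by (simp add: q_def K_simps lhom_closed[OF i] lhom_closed[OF p(1)] lhom_minus[OF mods(2,1) p(1)] p(2)
        X.group_simps)
  have q: "q \<in> lhom R Y ?K"
    by (rule lhomI[OF qK]) (simp_all add: K_simps lhom_add[OF q0] lhom_smult[OF q0])
  have qid: "q y = y" if "y \<in> carrier ?K" for y
    using that by (simp add: q_def K_simps lhom_zero[OF mods i] Y.group_simps)
  have qi: "q (i x) = \<zero>\<^bsub>Y\<^esub>" if "x \<in> carrier X" for x
    using that by (simp add: q_def p(2) lhom_closed[OF i] Y.group_simps)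
  have "q ` carrier Y = carrier ?K"
  proof
    show "q ` carrier Y \<subseteq> carrier ?K"
      using qK by auto
    show "carrier ?K \<subseteq> q ` carrier Y"
    proof
      fix y assume y: "y \<in> carrier ?K"
      then show "y \<in> q ` carrier Y"
        using qid[OF y] by (intro image_eqI[of _ _ y]) (auto simp: K_simps)
    qed
  qed
  with q qi show "\<exists>q\<in>lhom R Y ?K. q ` carrier Y = carrier ?K \<and> (\<forall>x\<in>carrier X. q (i x) = \<zero>\<^bsub>Y\<^esub>)"
    by (intro bexI[of _ q]) auto
  show "mod_iso R (X \<oplus>\<^sub>m ?K) Y"
  proof (rule mod_isoI)
    show "(\<lambda>(x, k). i x \<oplus>\<^bsub>Y\<^esub> k) \<in> lhom R (X \<oplus>\<^sub>m ?K) Y"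
      using i by (intro lhomI) (auto simp: direct_sum2_def K_simps lhom_closed lhom_add lhom_smult
          Y.smult_r_distr Y.smult_closed Y.M.a_ac)
    show "(\<lambda>y. (p y, q y)) \<in> lhom R Y (X \<oplus>\<^sub>m ?K)"
      using p(1) q by (intro lhomI) (simp_all add: direct_sum2_def lhom_closed[OF p(1)] lhom_add[OF p(1)] lhom_smult[OF p(1)]
          lhom_add[OF q] lhom_smult[OF q] lhom_closed[OF q])
    fix x assume "x \<in> carrier (X \<oplus>\<^sub>m ?K)"
    then obtain x1 k where x: "x = (x1, k)" "x1 \<in> carrier X" "k \<in> carrier ?K"
      by (auto simp: direct_sum2_def)
    have "p (i x1 \<oplus>\<^bsub>Y\<^esub> k) = x1"
      using x by (simp add: lhom_add[OF p(1)] lhom_closed[OF i] K_simps p(2))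
    moreover have "q (i x1 \<oplus>\<^bsub>Y\<^esub> k) = k"
      using x lhom_add[OF q, of "i x1" k] qi[OF x(2)] qid[OF x(3)] by (simp add: lhom_closed[OF i] K_simps)
    ultimately show "(\<lambda>y. (p y, q y)) ((\<lambda>(x, k). i x \<oplus>\<^bsub>Y\<^esub> k) x) = x"
      by (simp add: x)
  qed (simp add: q_def lhom_closed[OF i] lhom_closed[OF p(1)] Y.group_simps)
qed

lemma direct_summand_imp_retract:
  fixes X :: "('r, 'm) module"
  assumes "X \<in> fg_mods R" "direct_summand R X Y"
  shows "retract R X Y"
proof -
  obtain X' :: "('r, 'm) module" where X': "X' \<in> fg_mods R" "mod_iso R (X \<oplus>\<^sub>m X') Y"
    using assms(2) by (auto simp: direct_summand_def)
  note mods = fg_mods_module[OF assms(1)] fg_mods_module[OF X'(1)]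
  have "retract R X (X \<oplus>\<^sub>m X')"
    by (rule retractI[OF direct_sum2_lhom(1)[OF mods] direct_sum2_lhom(3)[OF mods]]) simp
  then show ?thesis
    by (rule retract_trans) (rule mod_iso_retract[OF direct_sum2_module[OF mods] X'(2)])
qed

section \<open>Modules over the truncated path algebra\<close>

locale nak_module = nakayama n t A + left_module A M
  for n t :: nat and A :: "'k::field nak ring" and M :: "('k nak, 'm) module" (structure)
begin

lemma act_closed [simp]:
  "x \<in> carrier M \<Longrightarrow> sc c \<odot> x \<in> carrier M"
  "x \<in> carrier M \<Longrightarrow> ee u \<odot> x \<in> carrier M"
  "x \<in> carrier M \<Longrightarrow> al r \<odot> x \<in> carrier M"
  by (simp_all add: smult_closed)

lemma act_laws:
  assumes x: "x \<in> carrier M"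
  shows "sc (a + b) \<odot> x = sc a \<odot> x \<oplus> sc b \<odot> x"
    "sc (a * b) \<odot> x = sc a \<odot> (sc b \<odot> x)"
    "sc 1 \<odot> x = x"
    "sc 0 \<odot> x = \<zero>"
    "ee u \<odot> (sc a \<odot> x) = sc a \<odot> (ee u \<odot> x)"
    "al r \<odot> (sc a \<odot> x) = sc a \<odot> (al r \<odot> x)"
    "ee u \<odot> (ee v \<odot> x) = (if u mod n = v mod n then ee u \<odot> x else \<zero>)"
    "al r \<odot> (ee u \<odot> x) = ee (u + r) \<odot> (al r \<odot> x)"
    "al r \<odot> (al s \<odot> x) = al (r + s) \<odot> x"
    "al 0 \<odot> x = x"
    "r \<ge> t \<Longrightarrow> al r \<odot> x = \<zero>"
proof -
  show "sc (a + b) \<odot> x = sc a \<odot> x \<oplus> sc b \<odot> x"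
    unfolding A_laws(1) by (rule smult_l_distr) (use x in auto)
  have "sc 0 = \<zero>\<^bsub>A\<^esub>"
    using A_laws(1)[of 0 0] A.add.r_cancel_one[of "sc 0" "sc 0"] by simp
  then show "sc 0 \<odot> x = \<zero>"
    using x by (simp add: smult_l_null)
  show "sc 1 \<odot> x = x" "al 0 \<odot> x = x"
    using x by (simp_all add: A_laws smult_one)
  show "r \<ge> t \<Longrightarrow> al r \<odot> x = \<zero>"
    using x by (simp add: al_zero smult_l_null)
  note assoc = smult_assoc[OF _ _ x, symmetric]
  show "sc (a * b) \<odot> x = sc a \<odot> (sc b \<odot> x)"
    by (simp add: assoc A_laws(2))
  show "ee u \<odot> (sc a \<odot> x) = sc a \<odot> (ee u \<odot> x)"
    by (simp add: assoc A_laws(4))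
  show "al r \<odot> (sc a \<odot> x) = sc a \<odot> (al r \<odot> x)"
    by (simp add: assoc A_laws(5))
  show "ee u \<odot> (ee v \<odot> x) = (if u mod n = v mod n then ee u \<odot> x else \<zero>)"
    using x by (simp add: assoc A_laws(6) smult_l_null)
  show "al r \<odot> (ee u \<odot> x) = ee (u + r) \<odot> (al r \<odot> x)"
    by (simp add: assoc A_laws(7))
  show "al r \<odot> (al s \<odot> x) = al (r + s) \<odot> x"
    by (simp add: assoc A_laws(8))
qed

lemma sc_zero [simp]: "sc c \<odot> \<zero> = \<zero>"
  and ee_zero [simp]: "ee u \<odot> \<zero> = \<zero>"
  and al_act_zero [simp]: "al r \<odot> \<zero> = \<zero>"
  by (simp_all add: smult_r_null)

lemma act_add:
  assumes "x \<in> carrier M" "y \<in> carrier M"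
  shows "sc c \<odot> (x \<oplus> y) = sc c \<odot> x \<oplus> sc c \<odot> y" "ee u \<odot> (x \<oplus> y) = ee u \<odot> x \<oplus> ee u \<odot> y"
    "al r \<odot> (x \<oplus> y) = al r \<odot> x \<oplus> al r \<odot> y"
    "sc c \<odot> (x \<ominus> y) = sc c \<odot> x \<ominus> sc c \<odot> y" "ee u \<odot> (x \<ominus> y) = ee u \<odot> x \<ominus> ee u \<odot> y"
    "al r \<odot> (x \<ominus> y) = al r \<odot> x \<ominus> al r \<odot> y"
  using assms by (simp_all add: smult_r_distr smult_minus)

text \<open>The idempotents at the vertices add up to 1; the partial sums \<open>eb m\<close> are
  followed up to \<open>eb n\<close>.\<close>

lemma eb_zero:
  assumes x: "x \<in> carrier M" and "\<And>u. u < n \<Longrightarrow> ee u \<odot> x = \<zero>"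
  shows "x = \<zero>"
proof -
  have "m \<le> n \<Longrightarrow> eb m \<odot> x = \<zero>" for m
  proof (induction m)
    case 0
    then show ?case
      using x by (simp add: A_laws(10) smult_l_null)
  next
    case (Suc m)
    then have "eb (Suc m) \<odot> x = eb m \<odot> x \<oplus> ee m \<odot> x"
      using smult_l_distr[OF A_closed(4,2) x] by (simp add: A_laws(11))
    then show ?case
      using Suc assms(2)[of m] by simp
  qed
  from this[of n] show ?thesis
    using x by (simp add: A_laws(12) smult_one)
qed

end

context nakayama
begin

lemma nak_moduleI: "left_module A M \<Longrightarrow> nak_module n t A M"
  by (simp add: nak_module_def nakayama_axioms)

text \<open>By \<open>A_induct\<close>, linearity over A need only be checked for scalars,
  idempotents and powers of \<alpha>.\<close>

lemma lhom_gensI: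
  assumes "left_module A M" "left_module A N"
    and f: "\<And>x. x \<in> carrier M \<Longrightarrow> f x \<in> carrier N"
    and add: "\<And>x y. x \<in> carrier M \<Longrightarrow> y \<in> carrier M \<Longrightarrow> f (x \<oplus>\<^bsub>M\<^esub> y) = f x \<oplus>\<^bsub>N\<^esub> f y"
    and gens: "\<And>c x. x \<in> carrier M \<Longrightarrow> f (sc c \<odot>\<^bsub>M\<^esub> x) = sc c \<odot>\<^bsub>N\<^esub> f x"
      "\<And>u x. x \<in> carrier M \<Longrightarrow> f (ee u \<odot>\<^bsub>M\<^esub> x) = ee u \<odot>\<^bsub>N\<^esub> f x"
      "\<And>r x. x \<in> carrier M \<Longrightarrow> f (al r \<odot>\<^bsub>M\<^esub> x) = al r \<odot>\<^bsub>N\<^esub> f x"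
  shows "f \<in> lhom A M N"
proof (rule lhomI[OF f add])
  interpret M: nak_module n t A M by (rule nak_moduleI) fact
  interpret N: nak_module n t A N by (rule nak_moduleI) fact
  fix a x assume a: "a \<in> carrier A" and x: "x \<in> carrier M"
  from a show "f (a \<odot>\<^bsub>M\<^esub> x) = a \<odot>\<^bsub>N\<^esub> f x"
  proof (induction rule: A_induct)
    case zero
    have "f (sc 0 \<odot>\<^bsub>M\<^esub> x) = sc 0 \<odot>\<^bsub>N\<^esub> f x"
      by (rule gens(1)[OF x])
    then show ?case
      using x f by (simp add: M.smult_l_null N.smult_l_null M.act_laws(4) N.act_laws(4))
  next
    case (add a b)
    then show ?case
      using x f by (simp add: M.smult_l_distr N.smult_l_distr assms(4) M.smult_closed)
  next
    case (gen c r u)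
    then show ?case
      using x f by (simp add: M.smult_assoc N.smult_assoc gens)
  qed
qed

section \<open>The uniserial modules\<close>

abbreviation U :: "nat \<Rightarrow> nat \<Rightarrow> 'k nak_mod" where
  "U i l \<equiv> uniserial n i l"

lemma U_simps [simp]:
  "v \<in> carrier (U i l) \<longleftrightarrow> (\<forall>j\<ge>l. v j = 0)"
  "\<zero>\<^bsub>U i l\<^esub> = (\<lambda>_. 0)"
  "v \<oplus>\<^bsub>U i l\<^esub> w = (\<lambda>j. v j + w j)"
  by (simp_all add: uniserial_def)

lemma action_eq: "uniserial_action n i l x v = (\<lambda>j. if j < l then \<Sum>s\<le>j. coef x (i + s) (j - s) * v s else 0)"
  by (simp add: uniserial_action_def coef_def cong: if_cong)

text \<open>The members of a residue class agree on paths shorter than t, and the action on a module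
  of length at most t reads only such paths.\<close>

lemma U_smult:
  assumes "x \<in> carrier PA" "l \<le> t"
  shows "cls x \<odot>\<^bsub>U i l\<^esub> v = uniserial_action n i l x v"
proof -
  let ?y = "SOME y. y \<in> cls x"
  have y: "?y \<in> cls x"
    by (rule someI[of "\<lambda>y. y \<in> cls x", OF cls_self[OF assms(1)]])
  have "uniserial_action n i l ?y v = uniserial_action n i l x v"
    using assms(2) by (auto simp: action_eq fun_eq_iff cls_mem(2)[OF assms(1) y] intro!: sum.cong)
  then show ?thesis
    by (simp add: uniserial_def)
qed

lemma action_mult:
  assumes "v \<in> carrier (U i l)"
  shows "uniserial_action n i l (x \<otimes>\<^bsub>PA\<^esub> y) v = uniserial_action n i l x (uniserial_action n i l y v)"
proof
  fix j
  show "uniserial_action n i l (x \<otimes>\<^bsub>PA\<^esub> y) v j = uniserial_action n i l x (uniserial_action n i l y v) j"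
  proof (cases "j < l")
    case True
    have "(\<Sum>s\<le>j. coef (x \<otimes>\<^bsub>PA\<^esub> y) (i + s) (j - s) * v s)
      = (\<Sum>s\<le>j. \<Sum>k\<le>j - s. coef x (i + (s + k)) (j - (s + k)) * coef y (i + s) k * v s)"
      by (simp add: coef_mult sum_distrib_right add.assoc)
    also have "\<dots> = (\<Sum>m\<le>j. \<Sum>s\<le>m. coef x (i + m) (j - m) * coef y (i + s) (m - s) * v s)"
      by (subst sum_triangle_swap) (intro sum.cong, auto)
    also have "\<dots> = (\<Sum>m\<le>j. coef x (i + m) (j - m) * (\<Sum>s\<le>m. coef y (i + s) (m - s) * v s))"
      by (simp add: sum_distrib_left mult.assoc)
    also have "\<dots> = (\<Sum>m\<le>j. coef x (i + m) (j - m) * uniserial_action n i l y v m)"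
      using True by (intro sum.cong) (auto simp: action_eq)
    finally show ?thesis
      using True by (simp add: action_eq)
  qed (simp add: action_eq)
qed

lemma action_one:
  assumes "v \<in> carrier (U i l)"
  shows "uniserial_action n i l \<one>\<^bsub>PA\<^esub> v = v"
proof
  fix j
  have "(\<Sum>s\<le>j. coef \<one>\<^bsub>PA\<^esub> (i + s) (j - s) * v s) = (\<Sum>s\<le>j. if s = j then v s else 0)"
    by (intro sum.cong) (auto simp: coef_one)
  then show "uniserial_action n i l \<one>\<^bsub>PA\<^esub> v j = v j"
    using assms by (simp add: action_eq)
qed

lemma U_module:
  assumes l: "l \<le> t"
  shows "left_module A (U i l)"
proof -
  have "abelian_group (U i l)"
  proof (rule abelian_groupI)
    fix x assume "x \<in> carrier (U i l)"
    then show "\<exists>y\<in>carrier (U i l). y \<oplus>\<^bsub>U i l\<^esub> x = \<zero>\<^bsub>U i l\<^esub>"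
      by (intro bexI[of _ "\<lambda>j. - x j"]) auto
  qed (auto simp: add_ac)
  moreover have "left_module_axioms A (U i l)"
  proof (rule left_module_axioms.intro)
    fix a v assume "a \<in> carrier A" "v \<in> carrier (U i l)"
    then obtain x where x: "x \<in> carrier PA" "a = cls x"
      using cls_surj by auto
    then show "a \<odot>\<^bsub>U i l\<^esub> v \<in> carrier (U i l)"
      by (simp add: U_smult[OF _ l] action_eq)
  next
    fix a b v assume "a \<in> carrier A" "b \<in> carrier A" "v \<in> carrier (U i l)"
    moreover then obtain x y where x: "x \<in> carrier PA" "a = cls x" and y: "y \<in> carrier PA" "b = cls y"
      using cls_surj by metis
    ultimately show "(a \<oplus>\<^bsub>A\<^esub> b) \<odot>\<^bsub>U i l\<^esub> v = a \<odot>\<^bsub>U i l\<^esub> v \<oplus>\<^bsub>U i l\<^esub> b \<odot>\<^bsub>U i l\<^esub> v"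
      "(a \<otimes>\<^bsub>A\<^esub> b) \<odot>\<^bsub>U i l\<^esub> v = a \<odot>\<^bsub>U i l\<^esub> (b \<odot>\<^bsub>U i l\<^esub> v)"
      using l by (simp_all add: U_smult action_mult PA_add_closed PA_mult_closed del: U_simps(1) flip: cls_simps(2,3))
        (simp add: action_eq coef_add distrib_right sum.distrib fun_eq_iff)
  next
    fix a v w assume "a \<in> carrier A" "v \<in> carrier (U i l)" "w \<in> carrier (U i l)"
    moreover then obtain x where x: "x \<in> carrier PA" "a = cls x"
      using cls_surj by metis
    ultimately show "a \<odot>\<^bsub>U i l\<^esub> (v \<oplus>\<^bsub>U i l\<^esub> w) = a \<odot>\<^bsub>U i l\<^esub> v \<oplus>\<^bsub>U i l\<^esub> a \<odot>\<^bsub>U i l\<^esub> w"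
      using l by (simp add: U_smult action_eq distrib_left sum.distrib fun_eq_iff)
  next
    fix v assume "v \<in> carrier (U i l)"
    then show "\<one>\<^bsub>A\<^esub> \<odot>\<^bsub>U i l\<^esub> v = v"
      using l by (simp add: U_smult action_one PA_one_closed del: U_simps(1) flip: cls_simps(4))
  qed
  ultimately show ?thesis
    by (simp add: left_module_def A.ring_axioms)
qed

text \<open>In coordinates \<alpha>^r is the shift by r, cut off at l, and \<open>ee u\<close> keeps
  the positions j whose vertex i + j is u. All computations inside U i l rest on these
  formulas.\<close>

lemma U_act:
  assumes l: "l \<le> t" and v: "v \<in> carrier (U i l)"
  shows "sc c \<odot>\<^bsub>U i l\<^esub> v = (\<lambda>j. c * v j)"
    "ee u \<odot>\<^bsub>U i l\<^esub> v = (\<lambda>j. if (i + j) mod n = u mod n then v j else 0)"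
    "al r \<odot>\<^bsub>U i l\<^esub> v = (\<lambda>j. if r \<le> j \<and> j < l then v (j - r) else 0)"
proof -
  have "(\<Sum>s\<le>j. coef (scal c) (i + s) (j - s) * v s) = (\<Sum>s\<le>j. if s = j then c * v s else 0)" for j
    by (intro sum.cong) (auto simp: coef_scal)
  then show "sc c \<odot>\<^bsub>U i l\<^esub> v = (\<lambda>j. c * v j)"
    using v by (simp add: sc_def U_smult[OF _ l] action_eq fun_eq_iff)
  have "(\<Sum>s\<le>j. coef (idem u) (i + s) (j - s) * v s)
      = (\<Sum>s\<le>j. if s = j then (if (i + j) mod n = u mod n then v j else 0) else 0)" for j
    by (intro sum.cong) (auto simp: coef_idem)
  then show "ee u \<odot>\<^bsub>U i l\<^esub> v = (\<lambda>j. if (i + j) mod n = u mod n then v j else 0)"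
    using v by (simp add: ee_def U_smult[OF _ l] action_eq fun_eq_iff)
  have "(\<Sum>s\<le>j. coef (pow_arr r) (i + s) (j - s) * v s) = (\<Sum>s\<le>j. if s = j - r then (if r \<le> j then v (j - r) else 0) else 0)" for j
    by (intro sum.cong) (auto simp: coef_pow_arr)
  then show "al r \<odot>\<^bsub>U i l\<^esub> v = (\<lambda>j. if r \<le> j \<and> j < l then v (j - r) else 0)"
    using v by (simp add: al_def U_smult[OF _ l] action_eq fun_eq_iff)
qed

text \<open>Congruent starts give the same record and not only isomorphic modules, so start vertices
  can be arbitrary natural numbers and be rewritten modulo n.\<close>

lemma U_cong:
  assumes "i mod n = i' mod n"
  shows "U i l = U i' l"
proof -
  have "cyc_path n (i + s) r = cyc_path n (i' + s) r" for s r
    by (rule cyc_path_cong) (rule mod_add_cong[OF assms refl])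
  then have "uniserial_action n i l x v = uniserial_action n i' l x v" for x :: "nat \<times> nat list \<Rightarrow> 'k" and v
    by (simp add: uniserial_action_def cong: if_cong)
  then show ?thesis
    by (simp add: uniserial_def fun_eq_iff)
qed

definition basis :: "nat \<Rightarrow> nat \<Rightarrow> 'k" where
  "basis j = (\<lambda>k. if k = j then 1 else 0)"

lemma U_fg:
  assumes l: "l \<le> t"
  shows "U i l \<in> fg_mods A"
proof -
  note m = U_module[OF l, of i]
  have "N = carrier (U i l)" if N: "submodule N A (U i l)" "basis ` {..<l} \<subseteq> N" for N
  proof
    show "N \<subseteq> carrier (U i l)"
      using N(1) unfolding submodule_iff[OF m] by simp
    show "carrier (U i l) \<subseteq> N"
    proof
      fix v assume v: "v \<in> carrier (U i l)"
      have "(\<lambda>j. if j < m then v j else 0) \<in> N" if "m \<le> l" for m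
        using that
      proof (induction m)
        case 0
        have "\<zero>\<^bsub>U i l\<^esub> \<in> N"
          using N(1) unfolding submodule_iff[OF m] by simp
        then show ?case
          by simp
      next
        case (Suc m)
        have "basis m \<in> N"
          using Suc.prems N(2) by auto
        then have "sc (v m) \<odot>\<^bsub>U i l\<^esub> basis m \<in> N"
          using N(1) A_closed(1)[of "v m"] unfolding submodule_iff[OF m] by simp
        moreover have "(\<lambda>j. if j < m then v j else 0) \<in> N"
          using Suc by simp
        ultimately have "(\<lambda>j. if j < m then v j else 0) \<oplus>\<^bsub>U i l\<^esub> (sc (v m) \<odot>\<^bsub>U i l\<^esub> basis m) \<in> N"
          using N(1) unfolding submodule_iff[OF m] by simp
        moreover have "(\<lambda>j. if j < m then v j else 0) \<oplus>\<^bsub>U i l\<^esub> (sc (v m) \<odot>\<^bsub>U i l\<^esub> basis m)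
            = (\<lambda>j. if j < Suc m then v j else 0)"
          using Suc.prems by (subst U_act[OF l]) (auto simp: basis_def fun_eq_iff less_Suc_eq)
        ultimately show ?case
          by simp
      qed
      moreover have "(\<lambda>j. if j < l then v j else 0) = v"
        using v by (auto simp: fun_eq_iff)
      ultimately show "v \<in> N"
        by (metis order_refl)
    qed
  qed
  moreover have "basis ` {..<l} \<subseteq> carrier (U i l)"
    by (auto simp: basis_def)
  ultimately show ?thesis
    using m unfolding fg_mods_def finitely_generated_def by (auto intro!: exI[of _ "basis ` {..<l}"])
qed

end

subsection \<open>Maps out of uniserial modules\<close>

context nak_module
begin

text \<open>The sum of \<open>v j\<close> times \<alpha>^j x over j < m, that is, the image of v
  under the map from a uniserial module that sends its top basis vector to x.\<close>

primrec comb :: "'m \<Rightarrow> nat \<Rightarrow> (nat \<Rightarrow> 'k) \<Rightarrow> 'm" where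
  "comb x 0 v = \<zero>"
| "comb x (Suc m) v = comb x m v \<oplus> sc (v m) \<odot> (al m \<odot> x)"

lemma comb_closed [simp]: "x \<in> carrier M \<Longrightarrow> comb x m v \<in> carrier M"
  by (induction m) simp_all

lemma comb_cong: "(\<And>j. j < m \<Longrightarrow> v j = w j) \<Longrightarrow> comb x m v = comb x m w"
  by (induction m) simp_all

lemma comb_zero:
  assumes x: "x \<in> carrier M" and v: "\<And>j. j < m \<Longrightarrow> v j = 0"
  shows "comb x m v = \<zero>"
  using v by (induction m) (simp_all add: x act_laws(4))

lemma comb_add: "x \<in> carrier M \<Longrightarrow> comb x m (\<lambda>j. v j + w j) = comb x m v \<oplus> comb x m w"
  by (induction m) (simp_all add: act_laws(1) M.a_ac)

lemma comb_sc: "x \<in> carrier M \<Longrightarrow> comb x m (\<lambda>j. c * v j) = sc c \<odot> comb x m v"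
  by (induction m) (simp_all add: act_laws(2) act_add)

lemma comb_ee:
  assumes x: "x \<in> carrier M" "ee i \<odot> x = x"
  shows "comb x m (\<lambda>j. if (i + j) mod n = u mod n then v j else 0) = ee u \<odot> comb x m v"
proof (induction m)
  case (Suc m)
  have "ee (i + m) \<odot> (al m \<odot> x) = al m \<odot> x"
    using act_laws(8)[OF x(1), of m i] x(2) by simp
  then have "ee u \<odot> (al m \<odot> x) = (if (i + m) mod n = u mod n then al m \<odot> x else \<zero>)"
    using act_laws(7)[OF act_closed(3)[OF x(1)], of u "i + m" m] ee_cong[of "i + m" u] by auto
  with Suc x(1) show ?case
    by (simp add: act_add act_laws(5) act_laws(4))
qed simp

text \<open>Applying \<alpha>^r shifts the coefficients by r. The number of terms grows to m + r;
  \<open>comb_extend\<close> cuts it back when \<alpha>^l kills x.\<close>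

lemma comb_al:
  assumes x: "x \<in> carrier M"
  shows "al r \<odot> comb x m v = comb x (m + r) (\<lambda>j. if r \<le> j then v (j - r) else 0)"
proof (induction m)
  case 0
  have "comb x r (\<lambda>j. if r \<le> j then v (j - r) else 0) = \<zero>"
    by (rule comb_zero[OF x]) simp
  then show ?case
    by simp
next
  case (Suc m)
  then show ?case
    using x by (simp add: act_add act_laws(6,9) add.commute)
qed

lemma al_eq_zero_mono:
  assumes "x \<in> carrier M" "al l \<odot> x = \<zero>" "l \<le> m"
  shows "al m \<odot> x = \<zero>"
  using assms act_laws(9)[of x "m - l" l] by simp

lemma comb_extend:
  assumes x: "x \<in> carrier M" "al l \<odot> x = \<zero>"
  shows "comb x (l + r) v = comb x l v"
  by (induction r) (simp_all add: x al_eq_zero_mono[OF x])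

end

text \<open>A uniserial module is cyclic, with the relations that its generator lies at the vertex i
  and is killed by \<alpha>^l. Thus each element of M with these two properties gives a map out of U
  i l.\<close>

lemma (in nakayama) comb_lhom:
  assumes M: "left_module A M" and l: "l \<le> t"
    and x: "x \<in> carrier M" "ee i \<odot>\<^bsub>M\<^esub> x = x" "al l \<odot>\<^bsub>M\<^esub> x = \<zero>\<^bsub>M\<^esub>"
  shows "nak_module.comb n t M x l \<in> lhom A (U i l) M"
proof -
  interpret M: nak_module n t A M by (rule nak_moduleI) fact
  show ?thesis
  proof (rule lhom_gensI[OF U_module[OF l] M])
    fix c v assume "v \<in> carrier (U i l)"
    then show "M.comb x l (sc c \<odot>\<^bsub>U i l\<^esub> v) = sc c \<odot>\<^bsub>M\<^esub> M.comb x l v"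
      by (simp add: U_act[OF l] M.comb_sc x)
  next
    fix u v assume "v \<in> carrier (U i l)"
    then show "M.comb x l (ee u \<odot>\<^bsub>U i l\<^esub> v) = ee u \<odot>\<^bsub>M\<^esub> M.comb x l v"
      by (simp add: U_act[OF l] M.comb_ee x)
  next
    fix r v assume v: "v \<in> carrier (U i l)"
    have "M.comb x l (al r \<odot>\<^bsub>U i l\<^esub> v) = M.comb x l (\<lambda>j. if r \<le> j then v (j - r) else 0)"
      using v by (intro M.comb_cong) (simp add: U_act[OF l])
    also have "\<dots> = M.comb x (l + r) (\<lambda>j. if r \<le> j then v (j - r) else 0)"
      by (simp add: M.comb_extend x)
    also have "\<dots> = al r \<odot>\<^bsub>M\<^esub> M.comb x l v"
      by (simp add: M.comb_al x)
    finally show "M.comb x l (al r \<odot>\<^bsub>U i l\<^esub> v) = al r \<odot>\<^bsub>M\<^esub> M.comb x l v" .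
  qed (simp_all add: x M.comb_add)
qed

lemma (in nakayama) comb_basis:
  assumes M: "left_module A M" and x: "x \<in> carrier M" and l: "1 \<le> l"
  shows "nak_module.comb n t M x l (basis 0) = x"
proof -
  interpret M: nak_module n t A M by (rule nak_moduleI) fact
  obtain m where m: "l = Suc m"
    using l by (cases l) auto
  have "M.comb x (Suc m) (basis 0) = x"
    by (induction m) (simp_all add: x basis_def M.act_laws)
  then show ?thesis
    by (simp add: m)
qed

lemma (in nakayama) lhom_comb:
  assumes M: "left_module A M" and N: "left_module A N" and f: "f \<in> lhom A M N" and x: "x \<in> carrier M"
  shows "f (nak_module.comb n t M x m v) = nak_module.comb n t N (f x) m v"
proof -
  interpret M: nak_module n t A M by (rule nak_moduleI) fact
  interpret N: nak_module n t A N by (rule nak_moduleI) fact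
  show ?thesis
    by (induction m) (simp_all add: lhom_zero[OF M N f] lhom_add[OF f] lhom_smult[OF f] x)
qed

lemma (in nakayama) U_comb:
  assumes l: "l \<le> t" and v: "v \<in> carrier (U i l)"
  shows "nak_module.comb n t (U i l) (basis 0) l v = v"
proof (cases l)
  case 0
  interpret nak_module n t A "U i 0" by (rule nak_moduleI) (rule U_module, simp)
  show ?thesis
    using v by (simp add: 0 fun_eq_iff)
next
  case (Suc l')
  interpret nak_module n t A "U i l" by (rule nak_moduleI) (rule U_module[OF l])
  have b: "basis 0 \<in> carrier (U i l)"
    using Suc by (simp add: basis_def)
  have "comb (basis 0) m v = (\<lambda>j. if j < m then v j else 0)" if "m \<le> l" for m
    using that
  proof (induction m)
    case (Suc m)
    have "al m \<odot>\<^bsub>U i l\<^esub> basis 0 = basis m"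
      using Suc.prems by (subst U_act(3)[OF l b]) (auto simp: basis_def fun_eq_iff)
    moreover have "basis m \<in> carrier (U i l)"
      using Suc.prems by (simp add: basis_def)
    then have "sc (v m) \<odot>\<^bsub>U i l\<^esub> basis m = (\<lambda>j. v m * basis m j)"
      by (rule U_act(1)[OF l])
    ultimately have "comb (basis 0) (Suc m) v = (\<lambda>j. (if j < m then v j else 0) + v m * basis m j)"
      using Suc by simp
    also have "\<dots> = (\<lambda>j. if j < Suc m then v j else 0)"
      by (auto simp: basis_def fun_eq_iff less_Suc_eq)
    finally show ?case .
  qed simp
  from this[of l] show ?thesis
    using v by (auto simp: fun_eq_iff)
qed

text \<open>U i l is generated by \<open>basis 0\<close>, so f is determined by its value
  there.\<close>

lemma (in nakayama) U_lhom_eq: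
  assumes M: "left_module A M" and l: "1 \<le> l" "l \<le> t" and f: "f \<in> lhom A (U i l) M" and v: "v \<in> carrier (U i l)"
  shows "f v = nak_module.comb n t M (f (basis 0)) l v"
proof -
  have b: "basis 0 \<in> carrier (U i l)"
    using l by (simp add: basis_def)
  have "f v = f (nak_module.comb n t (U i l) (basis 0) l v)"
    by (simp only: U_comb[OF l(2) v])
  then show ?thesis
    by (simp only: lhom_comb[OF U_module[OF l(2)] M f b])
qed

subsection \<open>Lifting maps out of, and extending maps into, uniserial modules\<close>

text \<open>
  All classes of modules below are cut out by conditions \<open>van j p q\<close>: at the vertex \<open>j\<close>, what is
  killed by paths of length \<open>p\<close> lies in the image of the paths of length \<open>q\<close>.
\<close>

definition (in nakayama) van :: "nat \<Rightarrow> nat \<Rightarrow> nat \<Rightarrow> ('k nak, 'm) module \<Rightarrow> bool" where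
  "van j p q M \<longleftrightarrow> (\<forall>x\<in>carrier M. ee j \<odot>\<^bsub>M\<^esub> x = x \<and> al p \<odot>\<^bsub>M\<^esub> x = \<zero>\<^bsub>M\<^esub> \<longrightarrow>
     (\<exists>y\<in>carrier M. x = al q \<odot>\<^bsub>M\<^esub> y))"

text \<open>Multiplying a preimage by the idempotent of a vertex q steps before j keeps it a
  preimage, so it can be taken at that vertex.\<close>

lemma (in nakayama) vanD:
  assumes "left_module A M" "van j p q M" "x \<in> carrier M" "ee j \<odot>\<^bsub>M\<^esub> x = x" "al p \<odot>\<^bsub>M\<^esub> x = \<zero>\<^bsub>M\<^esub>"
    and i: "(i + q) mod n = j mod n"
  shows "\<exists>y\<in>carrier M. ee i \<odot>\<^bsub>M\<^esub> y = y \<and> al q \<odot>\<^bsub>M\<^esub> y = x"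
proof -
  interpret M: nak_module n t A M by (rule nak_moduleI) fact
  obtain y where y: "y \<in> carrier M" "x = al q \<odot>\<^bsub>M\<^esub> y"
    using assms unfolding van_def by auto
  have "al q \<odot>\<^bsub>M\<^esub> (ee i \<odot>\<^bsub>M\<^esub> y) = ee (i + q) \<odot>\<^bsub>M\<^esub> x"
    using y by (simp add: M.act_laws(8))
  also have "\<dots> = x"
    using assms(4) ee_cong[OF i] by simp
  finally show ?thesis
    using y by (intro bexI[of _ "ee i \<odot>\<^bsub>M\<^esub> y"]) (simp_all add: M.act_laws(7))
qed

text \<open>An arbitrary preimage is multiplied by \<open>ee i\<close>.\<close>

lemma (in nakayama) short_exact_lift_vertex:
  assumes mods: "left_module A Y" "left_module A Z" and se: "short_exact A X f Y g Z"
    and z: "z \<in> carrier Z" "ee i \<odot>\<^bsub>Z\<^esub> z = z"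
  shows "\<exists>y\<in>carrier Y. ee i \<odot>\<^bsub>Y\<^esub> y = y \<and> g y = z"
proof -
  interpret Y: nak_module n t A Y by (rule nak_moduleI) fact
  from short_exactD(4)[OF se z(1)] obtain y where y: "y \<in> carrier Y" "g y = z"
    by (rule bexE)
  then show ?thesis
    using z by (intro bexI[of _ "ee i \<odot>\<^bsub>Y\<^esub> y"]) (simp_all add: Y.act_laws(7) lhom_smult[OF short_exactD(2)[OF se]])
qed

lemma (in nakayama) short_exact_kernel_vertex:
  assumes mods: "left_module A X" "left_module A Y" and se: "short_exact A X f Y g Z"
    and y: "y \<in> carrier Y" "ee i \<odot>\<^bsub>Y\<^esub> y = y" "g y = \<zero>\<^bsub>Z\<^esub>"
  shows "\<exists>x\<in>carrier X. ee i \<odot>\<^bsub>X\<^esub> x = x \<and> f x = y"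
proof -
  interpret X: nak_module n t A X by (rule nak_moduleI) fact
  from short_exactD(5)[OF se y(1,3)] obtain x where x: "x \<in> carrier X" "f x = y"
    by (rule bexE)
  then show ?thesis
    using y by (intro bexI[of _ "ee i \<odot>\<^bsub>X\<^esub> x"]) (simp_all add: X.act_laws(7) lhom_smult[OF short_exactD(1)[OF se]])
qed

text \<open>Lift the image of the generator to y at the vertex i. Then \<alpha>^l y comes from an
  element x of X at i + l that is killed by \<alpha>^(t-l). The condition gives x = \<alpha>^l x',
  so y minus f x' is a lift killed by \<alpha>^l and defines the map.\<close>

lemma (in nakayama) U_lift:
  assumes mods: "left_module A X" "left_module A Y" "left_module A Z" and se: "short_exact A X f Y g Z"
    and l: "1 \<le> l" "l \<le> t" and van: "van (i + l) (t - l) l X" and h: "h \<in> lhom A (U i l) Z"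
  shows "\<exists>h'\<in>lhom A (U i l) Y. \<forall>v\<in>carrier (U i l). g (h' v) = h v"
proof -
  interpret X: nak_module n t A X by (rule nak_moduleI) fact
  interpret Y: nak_module n t A Y by (rule nak_moduleI) fact
  interpret Z: nak_module n t A Z by (rule nak_moduleI) fact
  note f = short_exactD(1)[OF se] and g = short_exactD(2)[OF se]
  have f_inj: "x = x'" if "x \<in> carrier X" "x' \<in> carrier X" "f x = f x'" for x x'
    using that short_exactD(3)[OF se] by (simp add: inj_on_def)
  have b: "basis 0 \<in> carrier (U i l)"
    using l by (simp add: basis_def)
  define z where "z = h (basis 0)"
  have "ee i \<odot>\<^bsub>U i l\<^esub> basis 0 = basis 0" "al l \<odot>\<^bsub>U i l\<^esub> basis 0 = \<zero>\<^bsub>U i l\<^esub>"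
    using b by (auto simp: U_act[OF l(2)] basis_def fun_eq_iff)
  then have z: "z \<in> carrier Z" "ee i \<odot>\<^bsub>Z\<^esub> z = z" "al l \<odot>\<^bsub>Z\<^esub> z = \<zero>\<^bsub>Z\<^esub>"
    unfolding z_def using b h lhom_smult[OF h, of "ee i" "basis 0"] lhom_smult[OF h, of "al l" "basis 0"]
      lhom_zero[OF U_module[OF l(2)] mods(3) h] by (simp_all add: lhom_closed del: U_simps)
  from short_exact_lift_vertex[OF mods(2,3) se z(1,2)]
  obtain y where y: "y \<in> carrier Y" "ee i \<odot>\<^bsub>Y\<^esub> y = y" "g y = z"
    by auto
  have "ee (i + l) \<odot>\<^bsub>Y\<^esub> (al l \<odot>\<^bsub>Y\<^esub> y) = al l \<odot>\<^bsub>Y\<^esub> y"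
    using y by (simp flip: Y.act_laws(8))
  moreover have "g (al l \<odot>\<^bsub>Y\<^esub> y) = \<zero>\<^bsub>Z\<^esub>"
    using y z by (simp add: lhom_smult[OF g])
  ultimately obtain x where x: "x \<in> carrier X" "ee (i + l) \<odot>\<^bsub>X\<^esub> x = x" "f x = al l \<odot>\<^bsub>Y\<^esub> y"
    using short_exact_kernel_vertex[OF mods(1,2) se, of "al l \<odot>\<^bsub>Y\<^esub> y" "i + l"] y by auto
  \<comment> \<open>Its image under f is \<alpha>^t y = 0.\<close>
  have "al (t - l) \<odot>\<^bsub>X\<^esub> x = \<zero>\<^bsub>X\<^esub>"
    by (rule f_inj) (use x y l in \<open>simp_all add: lhom_smult[OF f] lhom_zero[OF mods(1,2) f] Y.act_laws(9,11)\<close>)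
  from vanD[OF mods(1) van x(1,2) this refl]
  obtain x' where x': "x' \<in> carrier X" "ee i \<odot>\<^bsub>X\<^esub> x' = x'" "al l \<odot>\<^bsub>X\<^esub> x' = x"
    by auto
  define y' where "y' = y \<ominus>\<^bsub>Y\<^esub> f x'"
  have fx': "ee i \<odot>\<^bsub>Y\<^esub> f x' = f x'" "al l \<odot>\<^bsub>Y\<^esub> f x' = f x"
    using x' by (simp_all flip: lhom_smult[OF f])
  have y': "y' \<in> carrier Y" "ee i \<odot>\<^bsub>Y\<^esub> y' = y'" "al l \<odot>\<^bsub>Y\<^esub> y' = \<zero>\<^bsub>Y\<^esub>" "g y' = z"
    using x x' y z unfolding y'_def
    by (simp_all add: Y.act_add fx' lhom_closed[OF f] Y.group_simps lhom_minus[OF mods(2,3) g]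
        short_exactD(6)[OF se] Z.group_simps)
  have "g (Y.comb y' l v) = h v" if "v \<in> carrier (U i l)" for v
    using U_lhom_eq[OF mods(3) l h that] by (simp add: lhom_comb[OF mods(2,3) g y'(1)] y'(4) z_def)
  then show ?thesis
    using comb_lhom[OF mods(2) l(2) y'(1-3)] by (intro bexI[of _ "Y.comb y' l"]) auto
qed

text \<open>A maximal subspace T that contains S and avoids v has codimension one: by maximality
  every vector is in T plus a multiple of v, and the coefficient of v is the functional.\<close>

lemma (in nak_module) functional_exists:
  assumes S: "S \<subseteq> carrier M" "\<zero> \<in> S" "\<And>x y. x \<in> S \<Longrightarrow> y \<in> S \<Longrightarrow> x \<oplus> y \<in> S" "\<And>c x. x \<in> S \<Longrightarrow> sc c \<odot> x \<in> S"
    and v: "v \<in> carrier M" "v \<notin> S"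
  shows "\<exists>\<phi>. (\<forall>x\<in>carrier M. \<forall>y\<in>carrier M. \<phi> (x \<oplus> y) = \<phi> x + \<phi> y) \<and> (\<forall>c. \<forall>x\<in>carrier M. \<phi> (sc c \<odot> x) = c * \<phi> x)
    \<and> (\<forall>x\<in>S. \<phi> x = 0) \<and> \<phi> v = (1 :: 'k)"
proof -
  define subsp where "subsp T \<longleftrightarrow> T \<subseteq> carrier M \<and> \<zero> \<in> T \<and> (\<forall>x\<in>T. \<forall>y\<in>T. x \<oplus> y \<in> T) \<and> (\<forall>c. \<forall>x\<in>T. sc c \<odot> x \<in> T)" for T
  define \<T> where "\<T> = {T. subsp T \<and> S \<subseteq> T \<and> v \<notin> T}"
  have "\<exists>T\<in>\<T>. \<forall>X\<in>\<T>. T \<subseteq> X \<longrightarrow> X = T"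
  proof (rule subset_Zorn_nonempty)
    have "S \<in> \<T>"
      using S v by (auto simp: \<T>_def subsp_def)
    then show "\<T> \<noteq> {}"
      by auto
  next
    fix \<C> assume \<C>: "\<C> \<noteq> {}" "subset.chain \<T> \<C>"
    have sub: "C \<in> \<C> \<Longrightarrow> subsp C \<and> S \<subseteq> C \<and> v \<notin> C" for C
      using \<C>(2) by (auto simp: subset.chain_def \<T>_def)
    have lin: "C \<subseteq> D \<or> D \<subseteq> C" if "C \<in> \<C>" "D \<in> \<C>" for C D
      using \<C>(2) that by (auto simp: subset.chain_def)
    have "x \<oplus> y \<in> \<Union>\<C>" if xy: "x \<in> \<Union>\<C>" "y \<in> \<Union>\<C>" for x y
    proof -
      obtain C D where C: "C \<in> \<C>" "x \<in> C" and D: "D \<in> \<C>" "y \<in> D"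
        using xy by auto
      from lin[OF C(1) D(1)] show ?thesis
      proof
        assume "C \<subseteq> D"
        then have "x \<in> D"
          using C(2) by auto
        then have "x \<oplus> y \<in> D"
          using sub[OF D(1)] D(2) by (simp add: subsp_def)
        then show ?thesis
          using D(1) by auto
      next
        assume "D \<subseteq> C"
        then have "y \<in> C"
          using D(2) by auto
        then have "x \<oplus> y \<in> C"
          using sub[OF C(1)] C(2) by (simp add: subsp_def)
        then show ?thesis
          using C(1) by auto
      qed
    qed
    moreover obtain C0 where C0: "C0 \<in> \<C>"
      using \<C>(1) by auto
    moreover have "C \<subseteq> carrier M" "v \<notin> C" "\<And>c x. x \<in> C \<Longrightarrow> sc c \<odot> x \<in> C" if "C \<in> \<C>" for C
      using sub[OF that] by (simp_all add: subsp_def)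
    moreover have "\<zero> \<in> C0" "S \<subseteq> C0"
      using sub[OF C0] by (simp_all add: subsp_def)
    ultimately have "\<Union>\<C> \<subseteq> carrier M" "\<zero> \<in> \<Union>\<C>" "\<forall>x\<in>\<Union>\<C>. \<forall>y\<in>\<Union>\<C>. x \<oplus> y \<in> \<Union>\<C>"
        "\<forall>c. \<forall>x\<in>\<Union>\<C>. sc c \<odot> x \<in> \<Union>\<C>" "S \<subseteq> \<Union>\<C>" "v \<notin> \<Union>\<C>"
      by (meson Sup_least, meson UnionI, meson, meson UnionE UnionI, meson Sup_upper order_trans, meson UnionE)
    then show "\<Union>\<C> \<in> \<T>"
      by (simp add: \<T>_def subsp_def)
  qed
  then obtain T where T: "subsp T" "S \<subseteq> T" "v \<notin> T" and max: "\<And>X. subsp X \<Longrightarrow> S \<subseteq> X \<Longrightarrow> v \<notin> X \<Longrightarrow> T \<subseteq> X \<Longrightarrow> X = T"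
    by (auto simp: \<T>_def)
  have Tc: "x \<in> T \<Longrightarrow> x \<in> carrier M" and T0: "\<zero> \<in> T" and Tadd: "x \<in> T \<Longrightarrow> y \<in> T \<Longrightarrow> x \<oplus> y \<in> T"
    and Tsc: "x \<in> T \<Longrightarrow> sc c \<odot> x \<in> T" for x y c
    using T(1) by (auto simp: subsp_def)
  \<comment> \<open>\<open>D w c\<close> means that w has the coefficient c at v modulo T.\<close>
  define D where "D w c \<longleftrightarrow> (\<exists>\<tau>\<in>T. w = \<tau> \<oplus> sc c \<odot> v)" for w c
  have ex: "\<exists>c. D w c" if w: "w \<in> carrier M" for w
  proof (cases "w \<in> T")
    case True
    then have "D w 0"
      unfolding D_def using Tc v by (intro bexI[of _ w]) (simp_all add: act_laws(4))
    then show ?thesis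
      by auto
  next
    case False
    \<comment> \<open>The span of T and w is larger than T, so it contains v. The coefficient of w
      in v is nonzero because v is not in T, and solving for w gives its coefficient at v.\<close>
    define X where "X = {\<tau> \<oplus> sc c \<odot> w | \<tau> c. \<tau> \<in> T}"
    have XI: "\<tau> \<in> T \<Longrightarrow> \<tau> \<oplus> sc c \<odot> w \<in> X" for \<tau> c
      by (auto simp: X_def)
    have TX: "T \<subseteq> X"
    proof
      fix \<tau> assume "\<tau> \<in> T"
      then show "\<tau> \<in> X"
        using XI[of \<tau> 0] Tc w by (simp add: act_laws(4))
    qed
    have wX: "w \<in> X"
      using XI[OF T0, of 1] w by (simp add: act_laws(3))
    have "subsp X"
      unfolding subsp_def
    proof (intro conjI ballI allI)
      show "X \<subseteq> carrier M"
        using Tc w by (auto simp: X_def)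
      show "\<zero> \<in> X"
        using TX T0 by auto
    next
      fix x y assume "x \<in> X" "y \<in> X"
      then obtain \<tau> c \<tau>' c' where xy: "x = \<tau> \<oplus> sc c \<odot> w" "y = \<tau>' \<oplus> sc c' \<odot> w" "\<tau> \<in> T" "\<tau>' \<in> T"
        by (auto simp: X_def)
      have "x \<oplus> y = (\<tau> \<oplus> \<tau>') \<oplus> sc (c + c') \<odot> w"
        using xy Tc w by (simp add: act_laws(1) M.a_ac)
      then show "x \<oplus> y \<in> X"
        using XI[OF Tadd[OF xy(3,4)]] by simp
    next
      fix a x assume "x \<in> X"
      then obtain \<tau> c where x: "x = \<tau> \<oplus> sc c \<odot> w" "\<tau> \<in> T"
        by (auto simp: X_def)
      have "sc a \<odot> x = sc a \<odot> \<tau> \<oplus> sc (a * c) \<odot> w"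
        using x Tc w by (simp add: act_laws(2) act_add)
      then show "sc a \<odot> x \<in> X"
        using XI[OF Tsc[OF x(2)]] by simp
    qed
    then have "v \<in> X"
      using max[of X] T(2) TX wX False by auto
    then obtain \<tau> c where \<tau>: "v = \<tau> \<oplus> sc c \<odot> w" "\<tau> \<in> T"
      by (auto simp: X_def)
    have c: "c \<noteq> 0"
      using \<tau> T(3) Tc w by (auto simp: act_laws(4))
    have "sc (- inverse c) \<odot> \<tau> \<oplus> sc (inverse c) \<odot> v
      = (sc (- inverse c) \<odot> \<tau> \<oplus> sc (inverse c) \<odot> \<tau>) \<oplus> sc (inverse c * c) \<odot> w"
      unfolding \<tau>(1) using Tc[OF \<tau>(2)] w by (simp add: act_add act_laws(2) M.a_assoc)
    also have "\<dots> = w"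
      using Tc[OF \<tau>(2)] w c by (simp add: act_laws(3,4) flip: act_laws(1))
    finally have "D w (inverse c)"
      unfolding D_def by (intro bexI[OF _ Tsc[OF \<tau>(2), of "- inverse c"]]) simp
    then show ?thesis
      by auto
  qed
  \<comment> \<open>Two different coefficients would put a nonzero multiple of v, hence v itself,
    into T.\<close>
  have unique: "c = c'" if cc: "D w c" "D w c'" for w c c'
  proof (rule ccontr)
    assume ne: "c \<noteq> c'"
    obtain \<tau> \<tau>' where \<tau>: "\<tau> \<in> T" "\<tau>' \<in> T" "\<tau> \<oplus> sc c \<odot> v = \<tau>' \<oplus> sc c' \<odot> v"
      using cc by (auto simp: D_def)
    have "sc (- c') \<odot> v \<oplus> (\<tau> \<oplus> sc c \<odot> v) = sc (- c') \<odot> v \<oplus> (\<tau>' \<oplus> sc c' \<odot> v)"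
      by (simp only: \<tau>(3))
    then have "\<tau> \<oplus> sc (c - c') \<odot> v = \<tau>'"
      using v Tc[OF \<tau>(1)] Tc[OF \<tau>(2)] act_laws(1)[OF v(1), of "- c'" c] act_laws(1)[OF v(1), of "- c'" c']
      by (simp add: M.a_ac act_laws(4))
    then have "sc (- 1) \<odot> \<tau> \<oplus> (\<tau> \<oplus> sc (c - c') \<odot> v) = sc (- 1) \<odot> \<tau> \<oplus> \<tau>'"
      by simp
    moreover have "sc (- 1) \<odot> \<tau> \<oplus> \<tau> = \<zero>"
      using act_laws(1)[OF Tc[OF \<tau>(1)], of "- 1" 1] Tc[OF \<tau>(1)] by (simp add: act_laws(3,4))
    ultimately have "sc (c - c') \<odot> v = sc (- 1) \<odot> \<tau> \<oplus> \<tau>'"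
      using v Tc[OF \<tau>(1)] by (simp flip: M.a_assoc)
    then have "sc (c - c') \<odot> v \<in> T"
      using Tadd[OF Tsc[OF \<tau>(1), of "- 1"] \<tau>(2)] by simp
    then have "sc (inverse (c - c')) \<odot> (sc (c - c') \<odot> v) \<in> T"
      by (rule Tsc)
    then show False
      using T(3) v ne by (simp add: act_laws(3) flip: act_laws(2))
  qed
  define \<phi> where "\<phi> w = (SOME c. D w c)" for w
  have \<phi>: "D w (\<phi> w)" if "w \<in> carrier M" for w
    unfolding \<phi>_def by (rule someI_ex[OF ex[OF that]])
  have \<phi>_eq: "\<phi> w = c" if "w \<in> carrier M" "D w c" for w c
    by (rule unique[OF \<phi>[OF that(1)] that(2)])
  have "\<phi> (x \<oplus> y) = \<phi> x + \<phi> y" if xy: "x \<in> carrier M" "y \<in> carrier M" for x y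
  proof (rule \<phi>_eq)
    obtain \<tau> \<tau>' where \<tau>: "\<tau> \<in> T" "x = \<tau> \<oplus> sc (\<phi> x) \<odot> v" and \<tau>': "\<tau>' \<in> T" "y = \<tau>' \<oplus> sc (\<phi> y) \<odot> v"
      using \<phi>[OF xy(1)] \<phi>[OF xy(2)] unfolding D_def by auto
    have "x \<oplus> y = (\<tau> \<oplus> sc (\<phi> x) \<odot> v) \<oplus> (\<tau>' \<oplus> sc (\<phi> y) \<odot> v)"
      by (simp only: \<tau>(2)[symmetric] \<tau>'(2)[symmetric])
    also have "\<dots> = (\<tau> \<oplus> \<tau>') \<oplus> sc (\<phi> x + \<phi> y) \<odot> v"
      using Tc[OF \<tau>(1)] Tc[OF \<tau>'(1)] v by (simp add: act_laws(1) M.a_ac)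
    finally show "D (x \<oplus> y) (\<phi> x + \<phi> y)"
      unfolding D_def by (intro bexI[OF _ Tadd[OF \<tau>(1) \<tau>'(1)]])
  qed (use xy in simp)
  moreover have "\<phi> (sc c \<odot> x) = c * \<phi> x" if x: "x \<in> carrier M" for x c
  proof (rule \<phi>_eq)
    obtain \<tau> where \<tau>: "\<tau> \<in> T" "x = \<tau> \<oplus> sc (\<phi> x) \<odot> v"
      using \<phi>[OF x] unfolding D_def by auto
    have "sc c \<odot> x = sc c \<odot> (\<tau> \<oplus> sc (\<phi> x) \<odot> v)"
      by (simp only: \<tau>(2)[symmetric])
    also have "\<dots> = sc c \<odot> \<tau> \<oplus> sc (c * \<phi> x) \<odot> v"
      using Tc[OF \<tau>(1)] v by (simp add: act_add act_laws(2))
    finally show "D (sc c \<odot> x) (c * \<phi> x)"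
      unfolding D_def by (intro bexI[OF _ Tsc[OF \<tau>(1)]])
  qed (use x in simp)
  moreover have "\<phi> x = 0" if "x \<in> S" for x
  proof (rule \<phi>_eq)
    have x: "x \<in> T"
      using T(2) that by auto
    then show "x \<in> carrier M"
      by (rule Tc)
    show "D x 0"
      unfolding D_def using x Tc v by (intro bexI[of _ x]) (simp_all add: act_laws(4))
  qed
  moreover have "\<phi> v = 1"
    by (rule \<phi>_eq) (use v T0 in \<open>auto simp: D_def act_laws(3) intro!: bexI[of _ \<zero>]\<close>)
  ultimately show ?thesis
    by (intro exI[of _ \<phi>] conjI ballI allI)
qed

text \<open>
  A map into \<open>U i l\<close> is determined by its last coordinate, a functional on the space at the vertex
  \<open>i + l - 1\<close> that vanishes on the image of the paths of length \<open>l\<close>.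
\<close>

lemma (in nakayama) U_extend_injection:
  assumes mods: "left_module A X" "left_module A Y" and f: "f \<in> lhom A X Y" "inj_on f (carrier X)"
    and l: "1 \<le> l" "l \<le> t" and h: "h \<in> lhom A X (U i l)"
    and pure: "\<And>x y. x \<in> carrier X \<Longrightarrow> y \<in> carrier Y \<Longrightarrow> ee (i + l - 1) \<odot>\<^bsub>X\<^esub> x = x \<Longrightarrow> f x = al l \<odot>\<^bsub>Y\<^esub> y \<Longrightarrow>
      \<exists>x'\<in>carrier X. x = al l \<odot>\<^bsub>X\<^esub> x'"
  shows "\<exists>h'\<in>lhom A Y (U i l). \<forall>x\<in>carrier X. h' (f x) = h x"
proof -
  interpret X: nak_module n t A X by (rule nak_moduleI) fact
  interpret Y: nak_module n t A Y by (rule nak_moduleI) fact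
  define e where "e = i + l - 1"
  \<comment> \<open>The vertex l steps before e; the multiple \<open>n * l\<close> of n keeps the
    number from dropping below 0.\<close>
  define e' where "e' = e + (n * l - l)"
  have nl: "l \<le> n * l"
    using n_pos by simp
  have e': "(e' + l) mod n = e mod n"
  proof -
    have "e' + l = e + n * l"
      by (simp only: e'_def add.assoc le_add_diff_inverse2[OF nl])
    then show ?thesis
      by simp
  qed
  have hX: "h x \<in> carrier (U i l)" if "x \<in> carrier X" for x
    using lhom_closed[OF h that] .
  define \<phi> where "\<phi> x = h x (l - 1)" for x
  have \<phi>_add: "\<phi> (x \<oplus>\<^bsub>X\<^esub> y) = \<phi> x + \<phi> y" if "x \<in> carrier X" "y \<in> carrier X" for x y
    using that by (simp add: \<phi>_def lhom_add[OF h])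
  have \<phi>_sc: "\<phi> (sc c \<odot>\<^bsub>X\<^esub> x) = c * \<phi> x" if "x \<in> carrier X" for c x
    using that by (simp add: \<phi>_def lhom_smult[OF h] U_act[OF l(2) hX] del: U_simps)
  have \<phi>_ee: "\<phi> (ee e \<odot>\<^bsub>X\<^esub> x) = \<phi> x" if "x \<in> carrier X" for x
    using that l by (simp add: \<phi>_def e_def lhom_smult[OF h] U_act[OF l(2) hX] del: U_simps)
  have h_coord: "h x j = \<phi> (al (l - 1 - j) \<odot>\<^bsub>X\<^esub> x)" if "x \<in> carrier X" "j < l" for x j
    using that l by (simp add: \<phi>_def lhom_smult[OF h] U_act[OF l(2) hX] del: U_simps)
  have \<phi>_al: "\<phi> (al l \<odot>\<^bsub>X\<^esub> x) = 0" if "x \<in> carrier X" for x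
    using that l by (simp add: \<phi>_def lhom_smult[OF h] U_act[OF l(2) hX] del: U_simps)
  have \<phi>_zero: "\<phi> \<zero>\<^bsub>X\<^esub> = 0"
    by (simp add: \<phi>_def lhom_zero[OF mods(1) U_module[OF l(2)] h])
  have f_inj: "x = x'" if "x \<in> carrier X" "x' \<in> carrier X" "f x = f x'" for x x'
    using that f(2) by (simp add: inj_on_def)
  have "\<exists>\<psi>. (\<forall>x\<in>carrier Y. \<forall>y\<in>carrier Y. \<psi> (x \<oplus>\<^bsub>Y\<^esub> y) = \<psi> x + \<psi> y) \<and> (\<forall>c. \<forall>x\<in>carrier Y. \<psi> (sc c \<odot>\<^bsub>Y\<^esub> x) = c * \<psi> x)
    \<and> (\<forall>x\<in>carrier Y. \<psi> (al l \<odot>\<^bsub>Y\<^esub> x) = 0) \<and> (\<forall>x\<in>carrier Y. \<psi> (ee e \<odot>\<^bsub>Y\<^esub> x) = \<psi> x)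
    \<and> (\<forall>x\<in>carrier X. \<psi> (f x) = \<phi> x)"
  proof (cases "\<forall>x\<in>carrier X. \<phi> x = 0")
    case True
    then show ?thesis
      by (intro exI[of _ "\<lambda>_. 0"]) simp
  next
    case False
    then obtain x1 where x1: "x1 \<in> carrier X" "\<phi> x1 \<noteq> 0"
      by auto
    define x0 where "x0 = sc (inverse (\<phi> x1)) \<odot>\<^bsub>X\<^esub> x1"
    have x0: "x0 \<in> carrier X" "\<phi> x0 = 1"
      using x1 by (simp_all add: x0_def \<phi>_sc)
    \<comment> \<open>The functional must vanish on S and be 1 at \<open>f x0\<close>. The
      assumption \<open>pure\<close> is what keeps \<open>f x0\<close> out of S: otherwise a vector
      of X on which \<phi> is 1 would lie in the image of \<alpha>^l, where \<phi> is 0.\<close>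
    define S where "S = {f x \<oplus>\<^bsub>Y\<^esub> al l \<odot>\<^bsub>Y\<^esub> y | x y. x \<in> carrier X \<and> y \<in> carrier Y \<and> \<phi> x = 0}"
    have SI: "f x \<oplus>\<^bsub>Y\<^esub> al l \<odot>\<^bsub>Y\<^esub> y \<in> S" if "x \<in> carrier X" "y \<in> carrier Y" "\<phi> x = 0" for x y
      using that by (auto simp: S_def)
    have fz: "f \<zero>\<^bsub>X\<^esub> = \<zero>\<^bsub>Y\<^esub>"
      by (rule lhom_zero[OF mods f(1)])
    have f_S: "f x \<in> S" if "x \<in> carrier X" "\<phi> x = 0" for x
      using SI[OF that(1) Y.M.zero_closed that(2)] that by (simp add: lhom_closed[OF f(1)])
    have al_S: "al l \<odot>\<^bsub>Y\<^esub> y \<in> S" if "y \<in> carrier Y" for y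
      using SI[OF X.M.zero_closed that \<phi>_zero] that by (simp add: fz)
    have "f x0 \<notin> S"
    proof
      assume "f x0 \<in> S"
      then obtain x y where xy: "x \<in> carrier X" "y \<in> carrier Y" "\<phi> x = 0" "f x0 = f x \<oplus>\<^bsub>Y\<^esub> al l \<odot>\<^bsub>Y\<^esub> y"
        by (auto simp: S_def)
      define x2 where "x2 = ee e \<odot>\<^bsub>X\<^esub> (x0 \<ominus>\<^bsub>X\<^esub> x)"
      have "f (x0 \<ominus>\<^bsub>X\<^esub> x) = al l \<odot>\<^bsub>Y\<^esub> y"
        using xy x0 by (simp add: lhom_minus[OF mods f(1)] lhom_closed[OF f(1)] Y.group_simps)
      then have "f x2 = ee (e' + l) \<odot>\<^bsub>Y\<^esub> (al l \<odot>\<^bsub>Y\<^esub> y)"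
        using xy x0 by (simp add: x2_def lhom_smult[OF f(1)] ee_cong[OF e'])
      also have "\<dots> = al l \<odot>\<^bsub>Y\<^esub> (ee e' \<odot>\<^bsub>Y\<^esub> y)"
        using xy by (simp add: Y.act_laws(8))
      finally have "f x2 = al l \<odot>\<^bsub>Y\<^esub> (ee e' \<odot>\<^bsub>Y\<^esub> y)" .
      moreover have x2: "x2 \<in> carrier X" "ee e \<odot>\<^bsub>X\<^esub> x2 = x2"
        using xy x0 by (simp_all add: x2_def X.act_laws(7))
      ultimately obtain x' where "x' \<in> carrier X" "x2 = al l \<odot>\<^bsub>X\<^esub> x'"
        using pure[of x2 "ee e' \<odot>\<^bsub>Y\<^esub> y"] xy by (auto simp: e_def)
      then have "\<phi> x2 = 0"
        by (simp add: \<phi>_al)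
      moreover have "\<phi> x2 = \<phi> (x0 \<ominus>\<^bsub>X\<^esub> x)"
        using xy x0 by (simp add: x2_def \<phi>_ee)
      moreover have "\<phi> x0 = \<phi> (x \<oplus>\<^bsub>X\<^esub> (x0 \<ominus>\<^bsub>X\<^esub> x))"
        using xy x0 by (simp add: X.group_simps)
      then have "\<phi> x0 = \<phi> x + \<phi> (x0 \<ominus>\<^bsub>X\<^esub> x)"
        using xy x0 by (simp only: \<phi>_add X.M.minus_closed)
      ultimately show False
        using xy x0 by simp
    qed
    have "\<exists>\<psi>. (\<forall>x\<in>carrier Y. \<forall>y\<in>carrier Y. \<psi> (x \<oplus>\<^bsub>Y\<^esub> y) = \<psi> x + \<psi> y) \<and> (\<forall>c. \<forall>x\<in>carrier Y. \<psi> (sc c \<odot>\<^bsub>Y\<^esub> x) = c * \<psi> x)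
      \<and> (\<forall>x\<in>S. \<psi> x = 0) \<and> \<psi> (f x0) = (1 :: 'k)"
    proof (rule Y.functional_exists)
      show "S \<subseteq> carrier Y"
        using lhom_closed[OF f(1)] by (auto simp: S_def)
      show "\<zero>\<^bsub>Y\<^esub> \<in> S"
        using f_S[OF X.M.zero_closed \<phi>_zero] by (simp add: fz)
      show "f x0 \<in> carrier Y"
        using x0 by (simp add: lhom_closed[OF f(1)])
    next
      fix a b assume "a \<in> S" "b \<in> S"
      then obtain x y x' y' where *: "a = f x \<oplus>\<^bsub>Y\<^esub> al l \<odot>\<^bsub>Y\<^esub> y" "x \<in> carrier X" "y \<in> carrier Y" "\<phi> x = 0"
          "b = f x' \<oplus>\<^bsub>Y\<^esub> al l \<odot>\<^bsub>Y\<^esub> y'" "x' \<in> carrier X" "y' \<in> carrier Y" "\<phi> x' = 0"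
        unfolding S_def by auto
      then have "a \<oplus>\<^bsub>Y\<^esub> b = f (x \<oplus>\<^bsub>X\<^esub> x') \<oplus>\<^bsub>Y\<^esub> al l \<odot>\<^bsub>Y\<^esub> (y \<oplus>\<^bsub>Y\<^esub> y')"
        by (simp add: lhom_add[OF f(1)] lhom_closed[OF f(1)] Y.act_add Y.M.a_ac)
      then show "a \<oplus>\<^bsub>Y\<^esub> b \<in> S"
        using SI[of "x \<oplus>\<^bsub>X\<^esub> x'" "y \<oplus>\<^bsub>Y\<^esub> y'"] * by (simp add: \<phi>_add)
    next
      fix c a assume "a \<in> S"
      then obtain x y where *: "a = f x \<oplus>\<^bsub>Y\<^esub> al l \<odot>\<^bsub>Y\<^esub> y" "x \<in> carrier X" "y \<in> carrier Y" "\<phi> x = 0"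
        unfolding S_def by auto
      then have "sc c \<odot>\<^bsub>Y\<^esub> a = f (sc c \<odot>\<^bsub>X\<^esub> x) \<oplus>\<^bsub>Y\<^esub> al l \<odot>\<^bsub>Y\<^esub> (sc c \<odot>\<^bsub>Y\<^esub> y)"
        by (simp add: lhom_smult[OF f(1)] lhom_closed[OF f(1)] Y.act_add Y.act_laws(6))
      then show "sc c \<odot>\<^bsub>Y\<^esub> a \<in> S"
        using SI[of "sc c \<odot>\<^bsub>X\<^esub> x" "sc c \<odot>\<^bsub>Y\<^esub> y"] * by (simp add: \<phi>_sc)
    qed fact
    then obtain \<psi> where \<psi>': "\<forall>x\<in>carrier Y. \<forall>y\<in>carrier Y. \<psi> (x \<oplus>\<^bsub>Y\<^esub> y) = \<psi> x + \<psi> y"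
        "\<forall>c. \<forall>x\<in>carrier Y. \<psi> (sc c \<odot>\<^bsub>Y\<^esub> x) = c * \<psi> x" "\<forall>x\<in>S. \<psi> x = 0" "\<psi> (f x0) = (1 :: 'k)"
      by (elim exE conjE) (rule that)
    note \<psi>_add = \<psi>'(1)[rule_format] and \<psi>_sc = \<psi>'(2)[rule_format] and \<psi>_S = \<psi>'(3)[rule_format] and \<psi>_1 = \<psi>'(4)
    have "\<psi> (f x) = \<phi> x" if x: "x \<in> carrier X" for x
    proof -
      have "\<phi> (x \<oplus>\<^bsub>X\<^esub> sc (- \<phi> x) \<odot>\<^bsub>X\<^esub> x0) = 0"
        using x x0 by (simp add: \<phi>_add \<phi>_sc)
      then have "\<psi> (f (x \<oplus>\<^bsub>X\<^esub> sc (- \<phi> x) \<odot>\<^bsub>X\<^esub> x0)) = 0"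
        using x x0 by (intro \<psi>_S f_S) simp_all
      then show ?thesis
        using x x0 by (simp add: lhom_add[OF f(1)] lhom_smult[OF f(1)] lhom_closed[OF f(1)] \<psi>_add \<psi>_sc \<psi>_1)
    qed
    note \<psi>_f = this
    have "\<psi> (ee e \<odot>\<^bsub>Y\<^esub> (al l \<odot>\<^bsub>Y\<^esub> y)) = 0" if "y \<in> carrier Y" for y
    proof -
      have "ee e \<odot>\<^bsub>Y\<^esub> (al l \<odot>\<^bsub>Y\<^esub> y) = al l \<odot>\<^bsub>Y\<^esub> (ee e' \<odot>\<^bsub>Y\<^esub> y)"
        using that ee_cong[OF e'] by (simp add: Y.act_laws(8))
      then show ?thesis
        using that by (simp add: \<psi>_S al_S)
    qed
    \<comment> \<open>Composing \<psi> with \<open>ee e\<close> concentrates it at the vertex e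
      without changing it on the image of f, and it still kills the image of \<alpha>^l.\<close>
    then show ?thesis
      by (intro exI[of _ "\<lambda>y. \<psi> (ee e \<odot>\<^bsub>Y\<^esub> y)"])
        (simp add: Y.act_add \<psi>_add Y.act_laws(5,7) \<psi>_sc \<psi>_f \<phi>_ee flip: lhom_smult[OF f(1)])
  qed
  then obtain \<psi> where \<psi>': "\<forall>x\<in>carrier Y. \<forall>y\<in>carrier Y. \<psi> (x \<oplus>\<^bsub>Y\<^esub> y) = \<psi> x + \<psi> y"
      "\<forall>c. \<forall>x\<in>carrier Y. \<psi> (sc c \<odot>\<^bsub>Y\<^esub> x) = c * \<psi> x"
      "\<forall>x\<in>carrier Y. \<psi> (al l \<odot>\<^bsub>Y\<^esub> x) = 0" "\<forall>x\<in>carrier Y. \<psi> (ee e \<odot>\<^bsub>Y\<^esub> x) = \<psi> x"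
      "\<forall>x\<in>carrier X. \<psi> (f x) = \<phi> x"
    by (elim exE conjE) (rule that)
  note \<psi>_add = \<psi>'(1)[rule_format] and \<psi>_sc = \<psi>'(2)[rule_format] and \<psi>_al = \<psi>'(3)[rule_format]
    and \<psi>_ee = \<psi>'(4)[rule_format] and \<psi>_f = \<psi>'(5)[rule_format]
  \<comment> \<open>The coordinate j of a vector of U i l is the last coordinate of its image under
    \<alpha>^(l-1-j), as in \<open>h_coord\<close>; this dictates \<open>h'\<close>.\<close>
  define h' where "h' y = (\<lambda>j. if j < l then \<psi> (al (l - 1 - j) \<odot>\<^bsub>Y\<^esub> y) else 0)" for y
  have h'_closed: "h' y \<in> carrier (U i l)" for y
    by (simp add: h'_def)
  have \<psi>_zero: "\<psi> \<zero>\<^bsub>Y\<^esub> = 0"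
    using \<psi>_sc[OF Y.M.zero_closed, of 0] by simp
  have "h' \<in> lhom A Y (U i l)"
  proof (rule lhom_gensI[OF mods(2) U_module[OF l(2)] h'_closed])
    fix x y assume "x \<in> carrier Y" "y \<in> carrier Y"
    then show "h' (x \<oplus>\<^bsub>Y\<^esub> y) = h' x \<oplus>\<^bsub>U i l\<^esub> h' y"
      by (auto simp: h'_def Y.act_add \<psi>_add fun_eq_iff)
  next
    fix c x assume "x \<in> carrier Y"
    then show "h' (sc c \<odot>\<^bsub>Y\<^esub> x) = sc c \<odot>\<^bsub>U i l\<^esub> h' x"
      unfolding U_act[OF l(2) h'_closed] by (auto simp: h'_def Y.act_laws(6) \<psi>_sc fun_eq_iff)
  next
    fix u x assume x: "x \<in> carrier Y"
    have "\<psi> (al (l - 1 - j) \<odot>\<^bsub>Y\<^esub> (ee u \<odot>\<^bsub>Y\<^esub> x)) = (if (i + j) mod n = u mod n then \<psi> (al (l - 1 - j) \<odot>\<^bsub>Y\<^esub> x) else 0)"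
      if j: "j < l" for j
    proof -
      let ?y = "al (l - 1 - j) \<odot>\<^bsub>Y\<^esub> x"
      have "\<psi> (al (l - 1 - j) \<odot>\<^bsub>Y\<^esub> (ee u \<odot>\<^bsub>Y\<^esub> x)) = \<psi> (ee e \<odot>\<^bsub>Y\<^esub> (ee (u + (l - 1 - j)) \<odot>\<^bsub>Y\<^esub> ?y))"
        using x by (simp add: Y.act_laws(8) \<psi>_ee)
      also have "\<dots> = (if e mod n = (u + (l - 1 - j)) mod n then \<psi> ?y else 0)"
        using x by (simp add: Y.act_laws(7) \<psi>_ee \<psi>_zero)
      also have "e = i + j + (l - 1 - j)"
        using j by (simp add: e_def)
      also have "(i + j + (l - 1 - j)) mod n = (u + (l - 1 - j)) mod n \<longleftrightarrow> (i + j) mod n = u mod n"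
        using cong_add_rcancel_nat[of "i + j" "l - 1 - j" u n] by (simp add: cong_def)
      finally show ?thesis .
    qed
    then show "h' (ee u \<odot>\<^bsub>Y\<^esub> x) = ee u \<odot>\<^bsub>U i l\<^esub> h' x"
      unfolding U_act[OF l(2) h'_closed] by (auto simp: h'_def fun_eq_iff)
  next
    fix r x assume x: "x \<in> carrier Y"
    have "\<psi> (al (l - 1 - j) \<odot>\<^bsub>Y\<^esub> (al r \<odot>\<^bsub>Y\<^esub> x)) = (if r \<le> j then \<psi> (al (l - 1 - (j - r)) \<odot>\<^bsub>Y\<^esub> x) else 0)"
      if j: "j < l" for j
    proof (cases "r \<le> j")
      case True
      have "l - 1 - j + r = l - 1 - (j - r)"
        using True j by simp
      then show ?thesis
        using x True by (simp add: Y.act_laws(9))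
    next
      case False
      have "l - 1 - j + r = l + (r - 1 - j)"
        using False j by simp
      then have "al (l - 1 - j) \<odot>\<^bsub>Y\<^esub> (al r \<odot>\<^bsub>Y\<^esub> x) = al l \<odot>\<^bsub>Y\<^esub> (al (r - 1 - j) \<odot>\<^bsub>Y\<^esub> x)"
        using x by (simp add: Y.act_laws(9))
      then show ?thesis
        using x False by (simp add: \<psi>_al)
    qed
    then show "h' (al r \<odot>\<^bsub>Y\<^esub> x) = al r \<odot>\<^bsub>U i l\<^esub> h' x"
      unfolding U_act[OF l(2) h'_closed] by (auto simp: h'_def fun_eq_iff)
  qed
  moreover have "h' (f x) = h x" if x: "x \<in> carrier X" for x
  proof
    fix j
    show "h' (f x) j = h x j"
    proof (cases "j < l")
      case True
      then show ?thesis
        using x by (simp add: h'_def h_coord \<psi>_f flip: lhom_smult[OF f(1)])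
    next
      case False
      then show ?thesis
        using hX[OF x] by (simp add: h'_def)
    qed
  qed
  ultimately show ?thesis
    by (intro bexI[of _ h']) auto
qed

text \<open>Let f x = \<alpha>^l y. Then g y is killed by \<alpha>^l, so the condition writes it as
  g of some \<alpha>^(t-l) y', and y minus \<alpha>^(t-l) y' comes from X. Since \<alpha>^t = 0,
  applying \<alpha>^l to this difference still gives f x; this is the purity required by
  \<open>U_extend_injection\<close>.\<close>

lemma (in nakayama) U_extend:
  assumes mods: "left_module A X" "left_module A Y" "left_module A Z" and se: "short_exact A X f Y g Z"
    and l: "1 \<le> l" "l \<le> t" and j: "(j + 1) mod n = i mod n" and van: "van j l (t - l) Z"
    and h: "h \<in> lhom A X (U i l)"
  shows "\<exists>h'\<in>lhom A Y (U i l). \<forall>x\<in>carrier X. h' (f x) = h x"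
proof (rule U_extend_injection[OF mods(1,2) short_exactD(1)[OF se] short_exactD(3)[OF se] l h])
  interpret X: nak_module n t A X by (rule nak_moduleI) fact
  interpret Y: nak_module n t A Y by (rule nak_moduleI) fact
  interpret Z: nak_module n t A Z by (rule nak_moduleI) fact
  note f = short_exactD(1)[OF se] and g = short_exactD(2)[OF se]
  have f_inj: "x = x'" if "x \<in> carrier X" "x' \<in> carrier X" "f x = f x'" for x x'
    using that short_exactD(3)[OF se] by (simp add: inj_on_def)
  fix x y0 assume x: "x \<in> carrier X" "ee (i + l - 1) \<odot>\<^bsub>X\<^esub> x = x" and y0: "y0 \<in> carrier Y" "f x = al l \<odot>\<^bsub>Y\<^esub> y0"
  \<comment> \<open>The socle of U i l is at i + l - 1, which lies l steps after j.\<close>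
  have "(j + 1 + (l - 1)) mod n = (i + (l - 1)) mod n"
    using mod_add_cong[OF j refl] .
  then have jl: "(j + l) mod n = (i + l - 1) mod n"
    using l by simp
  define y where "y = ee j \<odot>\<^bsub>Y\<^esub> y0"
  have y: "y \<in> carrier Y" "ee j \<odot>\<^bsub>Y\<^esub> y = y"
    using y0 by (simp_all add: y_def Y.act_laws(7))
  have "al l \<odot>\<^bsub>Y\<^esub> y = ee (i + l - 1) \<odot>\<^bsub>Y\<^esub> f x"
    using y0 by (simp add: y_def Y.act_laws(8) ee_cong[OF jl])
  also have "\<dots> = f x"
    using x by (simp flip: lhom_smult[OF f])
  finally have fx: "al l \<odot>\<^bsub>Y\<^esub> y = f x" .
  have gy: "g y \<in> carrier Z" "ee j \<odot>\<^bsub>Z\<^esub> g y = g y"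
    using y by (simp_all add: lhom_closed[OF g] flip: lhom_smult[OF g])
  have "al l \<odot>\<^bsub>Z\<^esub> g y = g (f x)"
    using y by (simp add: fx flip: lhom_smult[OF g])
  then have "al l \<odot>\<^bsub>Z\<^esub> g y = \<zero>\<^bsub>Z\<^esub>"
    using short_exactD(6)[OF se x(1)] by simp
  from van[unfolded van_def, rule_format, OF gy(1) conjI[OF gy(2) this]]
  obtain z' where z': "z' \<in> carrier Z" "g y = al (t - l) \<odot>\<^bsub>Z\<^esub> z'"
    by (rule bexE)
  from short_exactD(4)[OF se z'(1)] obtain y' where y': "y' \<in> carrier Y" "g y' = z'"
    by (rule bexE)
  have "y \<ominus>\<^bsub>Y\<^esub> al (t - l) \<odot>\<^bsub>Y\<^esub> y' \<in> carrier Y" "g (y \<ominus>\<^bsub>Y\<^esub> al (t - l) \<odot>\<^bsub>Y\<^esub> y') = \<zero>\<^bsub>Z\<^esub>"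
    using y y' z' by (simp_all add: lhom_minus[OF mods(2,3) g] lhom_smult[OF g] Z.group_simps)
  from short_exactD(5)[OF se this] obtain x' where x': "x' \<in> carrier X" "f x' = y \<ominus>\<^bsub>Y\<^esub> al (t - l) \<odot>\<^bsub>Y\<^esub> y'"
    by (rule bexE)
  have "f (al l \<odot>\<^bsub>X\<^esub> x') = al l \<odot>\<^bsub>Y\<^esub> y \<ominus>\<^bsub>Y\<^esub> al t \<odot>\<^bsub>Y\<^esub> y'"
    using x' y y' l by (simp add: lhom_smult[OF f] Y.act_add Y.act_laws(9))
  also have "\<dots> = f x"
    using x y' by (simp add: fx Y.act_laws(11) Y.group_simps lhom_closed[OF f])
  finally have "x = al l \<odot>\<^bsub>X\<^esub> x'"
    using x x' by - (rule f_inj, simp_all)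
  then show "\<exists>x'\<in>carrier X. x = al l \<odot>\<^bsub>X\<^esub> x'"
    using x' by auto
qed

subsection \<open>Finite dimension\<close>

context nak_module
begin

text \<open>Spans are taken over lists, whose length replaces the dimension as the measure of the
  induction in \<open>nak_induct\<close>.\<close>

primrec kspan :: "'m list \<Rightarrow> 'm set" where
  "kspan [] = {\<zero>}"
| "kspan (b # bs) = {sc c \<odot> b \<oplus> v | c v. v \<in> kspan bs}"

lemma kspan_carrier: "set bs \<subseteq> carrier M \<Longrightarrow> kspan bs \<subseteq> carrier M"
  by (induction bs) auto

lemma kspan_zero:
  assumes "set bs \<subseteq> carrier M"
  shows "\<zero> \<in> kspan bs"
  using assms
proof (induction bs)
  case (Cons b bs)
  then have "\<zero> = sc 0 \<odot> b \<oplus> \<zero>" "\<zero> \<in> kspan bs"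
    by (simp_all add: act_laws(4))
  then show ?case
    unfolding kspan.simps mem_Collect_eq by (intro exI[of _ 0] exI[of _ \<zero>] conjI)
qed simp

lemma kspan_add:
  assumes "set bs \<subseteq> carrier M" "x \<in> kspan bs" "y \<in> kspan bs"
  shows "x \<oplus> y \<in> kspan bs"
  using assms
proof (induction bs arbitrary: x y)
  case (Cons b bs)
  from Cons.prems(2) obtain c v where x: "x = sc c \<odot> b \<oplus> v" "v \<in> kspan bs"
    by auto
  from Cons.prems(3) obtain d w where y: "y = sc d \<odot> b \<oplus> w" "w \<in> kspan bs"
    by auto
  have vw: "v \<in> carrier M" "w \<in> carrier M"
    using x y kspan_carrier[of bs] Cons.prems(1) by auto
  have "x \<oplus> y = sc (c + d) \<odot> b \<oplus> (v \<oplus> w)"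
    using vw Cons.prems(1) by (simp add: x y act_laws(1) M.a_ac)
  moreover have "v \<oplus> w \<in> kspan bs"
    using Cons.IH[OF _ x(2) y(2)] Cons.prems(1) by simp
  ultimately show ?case
    unfolding kspan.simps mem_Collect_eq by (intro exI[of _ "c + d"] exI[of _ "v \<oplus> w"] conjI)
qed simp

lemma kspan_sc:
  assumes "set bs \<subseteq> carrier M" "x \<in> kspan bs"
  shows "sc a \<odot> x \<in> kspan bs"
  using assms
proof (induction bs arbitrary: x)
  case (Cons b bs)
  from Cons.prems(2) obtain c v where x: "x = sc c \<odot> b \<oplus> v" "v \<in> kspan bs"
    by auto
  have v: "v \<in> carrier M"
    using x kspan_carrier[of bs] Cons.prems(1) by auto
  have "sc a \<odot> x = sc (a * c) \<odot> b \<oplus> sc a \<odot> v"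
    using v Cons.prems(1) by (simp add: x act_add act_laws(2))
  moreover have "sc a \<odot> v \<in> kspan bs"
    using Cons.IH[OF _ x(2)] Cons.prems(1) by simp
  ultimately show ?case
    unfolding kspan.simps mem_Collect_eq by (intro exI[of _ "a * c"] exI[of _ "sc a \<odot> v"] conjI)
qed simp

lemma kspan_Cons_mono:
  assumes "set (b # bs) \<subseteq> carrier M" "v \<in> kspan bs"
  shows "v \<in> kspan (b # bs)"
proof -
  have "v \<in> carrier M"
    using assms kspan_carrier[of bs] by auto
  then have "v = sc 0 \<odot> b \<oplus> v"
    using assms(1) by (simp add: act_laws(4))
  then show ?thesis
    unfolding kspan.simps mem_Collect_eq using assms(2) by (intro exI[of _ 0] exI[of _ v] conjI)
qed

lemma kspan_mem:
  assumes "set bs \<subseteq> carrier M" "b \<in> set bs"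
  shows "b \<in> kspan bs"
  using assms
proof (induction bs)
  case (Cons a bs)
  show ?case
  proof (cases "b = a")
    case True
    then have "b = sc 1 \<odot> a \<oplus> \<zero>"
      using Cons.prems by (simp add: act_laws(3))
    then show ?thesis
      unfolding kspan.simps mem_Collect_eq using kspan_zero[of bs] Cons.prems(1)
      by (intro exI[of _ 1] exI[of _ \<zero>] conjI) auto
  next
    case False
    then show ?thesis
      using Cons kspan_Cons_mono[of a bs b] by simp
  qed
qed simp

lemma kspan_maps:
  assumes bs: "set bs \<subseteq> carrier M" and cs: "set cs \<subseteq> carrier M"
    and f: "\<And>x y. x \<in> carrier M \<Longrightarrow> y \<in> carrier M \<Longrightarrow> f (x \<oplus> y) = f x \<oplus> f y"
      "\<And>c x. x \<in> carrier M \<Longrightarrow> f (sc c \<odot> x) = sc c \<odot> f x" "f \<zero> = \<zero>"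
    and b: "\<And>b. b \<in> set bs \<Longrightarrow> f b \<in> kspan cs"
    and x: "x \<in> kspan bs"
  shows "f x \<in> kspan cs"
  using bs b x
proof (induction bs arbitrary: x)
  case Nil
  then show ?case
    using f(3) kspan_zero[OF cs] by simp
next
  case (Cons b bs)
  from Cons.prems(3) obtain c v where x: "x = sc c \<odot> b \<oplus> v" "v \<in> kspan bs"
    by auto
  have v: "v \<in> carrier M"
    using x kspan_carrier[of bs] Cons.prems(1) by auto
  have "f x = sc c \<odot> f b \<oplus> f v"
    using v Cons.prems(1) by (simp add: x f)
  moreover have "f v \<in> kspan cs"
    by (rule Cons.IH[OF _ _ x(2)]) (use Cons.prems in simp_all)
  moreover have "f b \<in> kspan cs"
    using Cons.prems by simp
  ultimately show ?case
    using kspan_add[OF cs] kspan_sc[OF cs] by simp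
qed

text \<open>A vector of the span is coded by a coefficient at b, put in front of the code of a
  remainder in the span of bs. Only injectivity matters, so coefficient and remainder may be chosen
  arbitrarily.\<close>

lemma kspan_inj:
  assumes "set bs \<subseteq> carrier M"
  shows "\<exists>g :: 'm \<Rightarrow> nat \<Rightarrow> 'k. inj_on g (kspan bs)"
  using assms
proof (induction bs)
  case Nil
  show ?case
    by (rule exI[of _ "\<lambda>_ _. 0"]) simp
next
  case (Cons b bs)
  have "set bs \<subseteq> carrier M"
    using Cons.prems by simp
  from Cons.IH[OF this] obtain g :: "'m \<Rightarrow> nat \<Rightarrow> 'k" where g: "inj_on g (kspan bs)"
    by (rule exE)
  have "\<forall>x\<in>kspan (b # bs). \<exists>cv. x = sc (fst cv) \<odot> b \<oplus> snd cv \<and> snd cv \<in> kspan bs"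
  proof
    fix x assume "x \<in> kspan (b # bs)"
    then obtain c v where "x = sc c \<odot> b \<oplus> v" "v \<in> kspan bs"
      by auto
    then show "\<exists>cv. x = sc (fst cv) \<odot> b \<oplus> snd cv \<and> snd cv \<in> kspan bs"
      by (intro exI[of _ "(c, v)"]) simp
  qed
  then have "\<exists>cv. \<forall>x\<in>kspan (b # bs). x = sc (fst (cv x)) \<odot> b \<oplus> snd (cv x) \<and> snd (cv x) \<in> kspan bs"
    by (rule bchoice)
  then obtain cv where cv: "\<forall>x\<in>kspan (b # bs). x = sc (fst (cv x)) \<odot> b \<oplus> snd (cv x) \<and> snd (cv x) \<in> kspan bs"
    by (rule exE)
  have "inj_on (\<lambda>x. case_nat (fst (cv x)) (g (snd (cv x)))) (kspan (b # bs))"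
  proof (rule inj_onI)
    fix x y assume xy: "x \<in> kspan (b # bs)" "y \<in> kspan (b # bs)"
      and eq: "case_nat (fst (cv x)) (g (snd (cv x))) = case_nat (fst (cv y)) (g (snd (cv y)))"
    have e1: "fst (cv x) = fst (cv y)"
      using fun_cong[OF eq, of 0] by simp
    have "g (snd (cv x)) = g (snd (cv y))"
    proof
      fix k show "g (snd (cv x)) k = g (snd (cv y)) k"
        using fun_cong[OF eq, of "Suc k"] by simp
    qed
    then have e2: "snd (cv x) = snd (cv y)"
      by (rule inj_onD[OF g _ conjunct2[OF bspec[OF cv xy(1)]] conjunct2[OF bspec[OF cv xy(2)]]])
    have "x = sc (fst (cv x)) \<odot> b \<oplus> snd (cv x)"
      by (rule conjunct1[OF bspec[OF cv xy(1)]])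
    also have "\<dots> = sc (fst (cv y)) \<odot> b \<oplus> snd (cv y)"
      by (simp only: e1 e2)
    also have "\<dots> = y"
      by (rule conjunct1[OF bspec[OF cv xy(2)], symmetric])
    finally show "x = y" .
  qed
  then show ?case
    by (rule exI[where x = "\<lambda>x. case_nat (fst (cv x)) (g (snd (cv x)))"])
qed

text \<open>The vectors \<open>al r \<odot> (ee u \<odot> s)\<close> with s among the generators, r
  < t and u < n span: powers of \<alpha> and idempotents send each of them to 0 or to another
  one.\<close>

lemma finitely_generated_kspan:
  assumes "finitely_generated A M"
  shows "\<exists>bs. set bs \<subseteq> carrier M \<and> kspan bs = carrier M"
proof -
  obtain S where S: "finite S" "S \<subseteq> carrier M" "\<And>N. submodule N A M \<Longrightarrow> S \<subseteq> N \<Longrightarrow> N = carrier M"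
    using assms by (auto simp: finitely_generated_def)
  have "finite ((\<lambda>(s, r, u). al r \<odot> (ee u \<odot> s)) ` (S \<times> {..<t} \<times> {..<n}))"
    using S(1) by auto
  then obtain bs where bs: "set bs = (\<lambda>(s, r, u). al r \<odot> (ee u \<odot> s)) ` (S \<times> {..<t} \<times> {..<n})"
    using finite_list by metis
  have bsI: "al r \<odot> (ee u \<odot> s) \<in> set bs" if "s \<in> S" "r < t" "u < n" for s r u
    unfolding bs using that by (intro image_eqI[of _ _ "(s, r, u)"]) auto
  have bs_c: "set bs \<subseteq> carrier M"
    unfolding bs using S(2) by auto
  have gen: "sc c \<odot> (al r \<odot> (ee u \<odot> x)) \<in> kspan bs" if "x \<in> kspan bs" for c r u x
  proof (rule kspan_sc[OF bs_c], rule kspan_maps[OF bs_c bs_c, of "\<lambda>x. al r \<odot> (ee u \<odot> x)"])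
    fix b assume "b \<in> set bs"
    then obtain s r' u' where b: "b = al r' \<odot> (ee u' \<odot> s)" "s \<in> S" "r' < t" "u' < n"
      unfolding bs by auto
    then have s: "s \<in> carrier M"
      using S(2) by auto
    have "ee u \<odot> b = (if u mod n = (u' + r') mod n then b else \<zero>)"
      using s ee_cong[of u "u' + r'"] by (simp add: b act_laws(7,8))
    then have "al r \<odot> (ee u \<odot> b) = (if u mod n = (u' + r') mod n then al (r + r') \<odot> (ee u' \<odot> s) else \<zero>)"
      using s by (simp add: b act_laws(9))
    moreover have "al (r + r') \<odot> (ee u' \<odot> s) \<in> kspan bs"
    proof (cases "r + r' < t")
      case True
      then show ?thesis
        using bsI[OF b(2) True b(4)] by (intro kspan_mem[OF bs_c])
    next
      case False
      then show ?thesis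
        using s kspan_zero[OF bs_c] by (simp add: act_laws(11))
    qed
    ultimately show "al r \<odot> (ee u \<odot> b) \<in> kspan bs"
      using kspan_zero[OF bs_c] by simp
  qed (use that in \<open>simp_all add: act_add act_laws(5,6)\<close>)
  have sm: "a \<odot> x \<in> kspan bs" if "a \<in> carrier A" "x \<in> kspan bs" for a x
    using that(1)
  proof (induction rule: A_induct)
    case zero
    then show ?case
      using that(2) kspan_zero[OF bs_c] kspan_carrier[OF bs_c] by (auto simp: smult_l_null)
  next
    case (add a b)
    then show ?case
      using that(2) kspan_add[OF bs_c] kspan_carrier[OF bs_c] by (auto simp: smult_l_distr)
  next
    case (gen c r u)
    have "x \<in> carrier M"
      using that(2) kspan_carrier[OF bs_c] by auto
    then have "(sc c \<otimes>\<^bsub>A\<^esub> (al r \<otimes>\<^bsub>A\<^esub> ee u)) \<odot> x = sc c \<odot> (al r \<odot> (ee u \<odot> x))"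
      by (simp add: smult_assoc)
    then show ?case
      using \<open>\<And>c r u x. x \<in> kspan bs \<Longrightarrow> sc c \<odot> (al r \<odot> (ee u \<odot> x)) \<in> kspan bs\<close>[OF that(2)] by simp
  qed
  have sub: "submodule (kspan bs) A M"
    unfolding submodule_iff[OF left_module_axioms]
    using kspan_carrier[OF bs_c] kspan_zero[OF bs_c] kspan_add[OF bs_c] sm by simp
  moreover have "S \<subseteq> kspan bs"
  proof
    fix s assume s: "s \<in> S"
    then have sM: "s \<in> carrier M"
      using S(2) by auto
    have "m \<le> n \<Longrightarrow> eb m \<odot> s \<in> kspan bs" for m
    proof (induction m)
      case 0
      then show ?case
        using sM kspan_zero[OF bs_c] by (simp add: A_laws(10) smult_l_null)
    next
      case (Suc m)
      have "eb (Suc m) \<odot> s = eb m \<odot> s \<oplus> ee m \<odot> s"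
        using smult_l_distr[OF A_closed(4,2) sM] Suc.prems by (simp add: A_laws(11))
      moreover have "ee m \<odot> s \<in> kspan bs"
        using bsI[OF s, of 0 m] Suc.prems t_ge_2 sM by (intro kspan_mem[OF bs_c]) (simp add: act_laws(10))
      ultimately show ?case
        using Suc kspan_add[OF bs_c] by simp
    qed
    from this[of n] show "s \<in> kspan bs"
      using sM by (simp add: A_laws(12) smult_one)
  qed
  ultimately show ?thesis
    using S(3)[of "kspan bs"] bs_c by auto
qed

end

lemma (in nakayama) kspan_image:
  assumes "left_module A M" "left_module A N" and f: "f \<in> lhom A M N" and bs: "set bs \<subseteq> carrier M"
  shows "f ` nak_module.kspan n t M bs = nak_module.kspan n t N (map f bs)"
proof -
  interpret M: nak_module n t A M by (rule nak_moduleI) fact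
  interpret N: nak_module n t A N by (rule nak_moduleI) fact
  from bs show ?thesis
  proof (induction bs)
    case Nil
    then show ?case
      by (simp add: lhom_zero[OF assms(1-3)])
  next
    case (Cons b bs)
    have sub: "M.kspan bs \<subseteq> carrier M"
      using M.kspan_carrier Cons.prems by simp
    have f_eq: "f (sc c \<odot>\<^bsub>M\<^esub> b \<oplus>\<^bsub>M\<^esub> v) = sc c \<odot>\<^bsub>N\<^esub> f b \<oplus>\<^bsub>N\<^esub> f v" if "v \<in> M.kspan bs" for c v
      using that sub Cons.prems by (simp add: lhom_add[OF f] lhom_smult[OF f] subset_iff)
    have IH: "f ` M.kspan bs = N.kspan (map f bs)"
      using Cons by simp
    show ?case
    proof (intro equalityI subsetI)
      fix y assume "y \<in> f ` M.kspan (b # bs)"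
      then obtain c v where y: "y = f (sc c \<odot>\<^bsub>M\<^esub> b \<oplus>\<^bsub>M\<^esub> v)" "v \<in> M.kspan bs"
        unfolding M.kspan.simps by auto
      have "y = sc c \<odot>\<^bsub>N\<^esub> f b \<oplus>\<^bsub>N\<^esub> f v" "f v \<in> N.kspan (map f bs)"
        unfolding IH[symmetric] using y f_eq[OF y(2)] by simp_all
      then show "y \<in> N.kspan (map f (b # bs))"
        unfolding list.map N.kspan.simps mem_Collect_eq by (intro exI[of _ c] exI[of _ "f v"] conjI)
    next
      fix y assume "y \<in> N.kspan (map f (b # bs))"
      then obtain c w where y: "y = sc c \<odot>\<^bsub>N\<^esub> f b \<oplus>\<^bsub>N\<^esub> w" "w \<in> f ` M.kspan bs"
        unfolding list.map N.kspan.simps IH by auto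
      from y(2) obtain v where v: "w = f v" "v \<in> M.kspan bs"
        by (rule imageE)
      have "y = f (sc c \<odot>\<^bsub>M\<^esub> b \<oplus>\<^bsub>M\<^esub> v)"
        unfolding y(1) v(1) f_eq[OF v(2)] ..
      moreover have "sc c \<odot>\<^bsub>M\<^esub> b \<oplus>\<^bsub>M\<^esub> v \<in> M.kspan (b # bs)"
        unfolding M.kspan.simps mem_Collect_eq using v(2) by (intro exI[of _ c] exI[of _ v] conjI refl)
      ultimately show "y \<in> f ` M.kspan (b # bs)"
        by (intro image_eqI[of _ _ "sc c \<odot>\<^bsub>M\<^esub> b \<oplus>\<^bsub>M\<^esub> v"])
    qed
  qed
qed

lemma (in nakayama) kspan_exchange:
  assumes "left_module A M" "left_module A N" and f: "f \<in> lhom A M N" and bs: "set bs \<subseteq> carrier M"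
    and u: "u \<in> nak_module.kspan n t M bs" "u \<noteq> \<zero>\<^bsub>M\<^esub>" "f u = \<zero>\<^bsub>N\<^esub>"
  shows "\<exists>cs. length cs < length bs \<and> set cs \<subseteq> carrier N \<and> f ` nak_module.kspan n t M bs = nak_module.kspan n t N cs"
proof -
  interpret M: nak_module n t A M by (rule nak_moduleI) fact
  interpret N: nak_module n t A N by (rule nak_moduleI) fact
  note img = kspan_image[OF assms(1-3)]
  from bs u show ?thesis
  proof (induction bs)
    case (Cons b bs)
    have b: "b \<in> carrier M" and bs: "set bs \<subseteq> carrier M"
      using Cons.prems by auto
    obtain c v where cv: "u = sc c \<odot>\<^bsub>M\<^esub> b \<oplus>\<^bsub>M\<^esub> v" "v \<in> M.kspan bs"
      using Cons.prems(2) by auto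
    have v: "v \<in> carrier M"
      using cv(2) M.kspan_carrier[OF bs] by auto
    have fbs: "set (map f bs) \<subseteq> carrier N"
      using bs lhom_closed[OF f] by auto
    show ?case
    proof (cases "c = 0")
      case True
      then have "u = v"
        using cv v b by (simp add: M.act_laws(4))
      then obtain cs where cs: "length cs < length bs" "set cs \<subseteq> carrier N" "f ` M.kspan bs = N.kspan cs"
        using Cons.IH[OF bs] cv(2) Cons.prems(3,4) by auto
      have "f ` M.kspan (b # bs) = N.kspan (f b # cs)"
        using img[of "b # bs"] img[OF bs] cs(3) Cons.prems(1) by simp
      then show ?thesis
        using cs b by (intro exI[of _ "f b # cs"]) (auto simp: lhom_closed[OF f])
    next
      case False
      have "sc c \<odot>\<^bsub>N\<^esub> f b \<oplus>\<^bsub>N\<^esub> f v = \<zero>\<^bsub>N\<^esub>"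
        using Cons.prems(4) b v by (simp add: cv(1) lhom_add[OF f] lhom_smult[OF f])
      then have "sc (inverse c) \<odot>\<^bsub>N\<^esub> (sc c \<odot>\<^bsub>N\<^esub> f b \<oplus>\<^bsub>N\<^esub> f v) = \<zero>\<^bsub>N\<^esub>"
        by simp
      then have "f b \<oplus>\<^bsub>N\<^esub> sc (inverse c) \<odot>\<^bsub>N\<^esub> f v = \<zero>\<^bsub>N\<^esub>"
        using False b v by (simp add: N.act_add N.act_laws(3) lhom_closed[OF f] flip: N.act_laws(2))
      then have fbv: "f b \<oplus>\<^bsub>N\<^esub> sc (inverse c) \<odot>\<^bsub>N\<^esub> f v = \<zero>\<^bsub>N\<^esub>" .
      have fc: "f b \<in> carrier N" "f v \<in> carrier N"
        using b v by (simp_all add: lhom_closed[OF f])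
      have z: "sc (inverse c) \<odot>\<^bsub>N\<^esub> f v \<oplus>\<^bsub>N\<^esub> sc (- inverse c) \<odot>\<^bsub>N\<^esub> f v = \<zero>\<^bsub>N\<^esub>"
        using N.act_laws(1)[OF fc(2), of "inverse c" "- inverse c"] fc by (simp add: N.act_laws(4))
      have "f b = f b \<oplus>\<^bsub>N\<^esub> (sc (inverse c) \<odot>\<^bsub>N\<^esub> f v \<oplus>\<^bsub>N\<^esub> sc (- inverse c) \<odot>\<^bsub>N\<^esub> f v)"
        unfolding z using fc by simp
      also have "\<dots> = (f b \<oplus>\<^bsub>N\<^esub> sc (inverse c) \<odot>\<^bsub>N\<^esub> f v) \<oplus>\<^bsub>N\<^esub> sc (- inverse c) \<odot>\<^bsub>N\<^esub> f v"
        using fc by (simp add: N.M.a_assoc)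
      finally have fb: "f b = sc (- inverse c) \<odot>\<^bsub>N\<^esub> f v"
        unfolding fbv using fc by simp
      have fv: "f v \<in> N.kspan (map f bs)"
        using cv(2) img[OF bs] by auto
      have "N.kspan (f b # map f bs) = N.kspan (map f bs)"
      proof
        show "N.kspan (map f bs) \<subseteq> N.kspan (f b # map f bs)"
          using N.kspan_Cons_mono[of "f b" "map f bs"] fbs b by (auto simp: lhom_closed[OF f] simp del: N.kspan.simps)
        show "N.kspan (f b # map f bs) \<subseteq> N.kspan (map f bs)"
        proof
          fix y assume "y \<in> N.kspan (f b # map f bs)"
          then obtain d w where "y = sc d \<odot>\<^bsub>N\<^esub> f b \<oplus>\<^bsub>N\<^esub> w" "w \<in> N.kspan (map f bs)"
            unfolding N.kspan.simps by auto
          moreover have "f b \<in> N.kspan (map f bs)"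
            unfolding fb by (rule N.kspan_sc[OF fbs fv])
          ultimately show "y \<in> N.kspan (map f bs)"
            using N.kspan_add[OF fbs N.kspan_sc[OF fbs]] by simp
        qed
      qed
      then show ?thesis
        using img[of "b # bs"] Cons.prems(1) fbs by (intro exI[of _ "map f bs"]) (simp del: N.kspan.simps M.kspan.simps)
    qed
  qed simp
qed

section \<open>Decomposition into uniserial modules\<close>

text \<open>The structure is transported along an injection of the finite-dimensional carrier into
  sequences.\<close>

lemma (in nakayama) fg_copy:
  fixes M :: "('k nak, 'm) module"
  assumes "M \<in> fg_mods A"
  shows "\<exists>M' :: 'k nak_mod. M' \<in> fg_mods A \<and> mod_iso A M M'"
proof -
  interpret M: nak_module n t A M by (rule nak_moduleI) (rule fg_mods_module[OF assms])
  have "finitely_generated A M"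
    using assms by (simp add: fg_mods_def)
  from M.finitely_generated_kspan[OF this] obtain bs where bs: "set bs \<subseteq> carrier M" "M.kspan bs = carrier M"
    by (elim exE conjE) (rule that)
  from M.kspan_inj[OF bs(1)] obtain g :: "'m \<Rightarrow> nat \<Rightarrow> 'k" where "inj_on g (M.kspan bs)"
    by (rule exE)
  then have g: "inj_on g (carrier M)"
    unfolding bs(2) .
  define k where "k = inv_into (carrier M) g"
  have kg: "k (g x) = x" if "x \<in> carrier M" for x
    using that g by (simp add: k_def)
  define M' :: "'k nak_mod" where "M' = \<lparr>carrier = g ` carrier M, monoid.mult = undefined, one = undefined,
    zero = g \<zero>\<^bsub>M\<^esub>, add = (\<lambda>x y. g (k x \<oplus>\<^bsub>M\<^esub> k y)), smult = (\<lambda>a x. g (a \<odot>\<^bsub>M\<^esub> k x))\<rparr>"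
  have M'_simps: "carrier M' = g ` carrier M" "\<zero>\<^bsub>M'\<^esub> = g \<zero>\<^bsub>M\<^esub>" "x \<oplus>\<^bsub>M'\<^esub> y = g (k x \<oplus>\<^bsub>M\<^esub> k y)"
    "a \<odot>\<^bsub>M'\<^esub> x = g (a \<odot>\<^bsub>M\<^esub> k x)" for x y a
    by (simp_all add: M'_def)
  have M': "left_module A M'"
  proof (rule left_module_pullback[OF M.left_module_axioms, of _ k])
    show "inj_on k (carrier M')"
      by (rule inj_onI) (auto simp: M'_simps kg)
  qed (auto simp: M'_simps kg M.smult_closed)
  have "g \<in> lhom A M M'"
    by (rule lhomI) (auto simp: M'_simps kg)
  then have "mod_iso A M M'"
    unfolding mod_iso_def by (rule bexI[rotated]) (simp add: M'_simps g bij_betw_def)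
  then show ?thesis
    using mod_iso_fg[OF assms M'] by (intro exI[of _ M'] conjI)
qed

text \<open>\<open>direct_summand\<close> demands a complement in the type of X, while the kernel of
  p lives in the type of Y; hence the copy \<open>K'\<close>.\<close>

lemma (in nakayama) retract_imp_direct_summand:
  fixes X :: "'k nak_mod"
  assumes X: "X \<in> fg_mods A" and Y: "Y \<in> fg_mods A" and r: "retract A X Y"
  shows "direct_summand A X Y"
proof -
  note mods = fg_mods_module[OF X] fg_mods_module[OF Y]
  from r[unfolded retract_def]
  obtain i p where i: "i \<in> lhom A X Y" and p: "p \<in> lhom A Y X" "\<forall>x\<in>carrier X. p (i x) = x"
    by (elim bexE) (rule that)
  let ?K = "ker_module Y X p"
  note K = ker_module_module[OF mods(2,1) p(1)]
  have comp: "mod_iso A (X \<oplus>\<^sub>m ?K) Y"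
    "\<exists>q\<in>lhom A Y ?K. q ` carrier Y = carrier ?K \<and> (\<forall>x\<in>carrier X. q (i x) = \<zero>\<^bsub>Y\<^esub>)"
    by (rule ker_module_complement[OF mods i p(1)]; use p(2) in simp)+
  from comp(2) obtain q where q: "q \<in> lhom A Y ?K" "q ` carrier Y = carrier ?K"
    by (elim bexE conjE) (rule that)
  have "?K \<in> fg_mods A"
    by (rule fg_mods_onto[OF Y K q])
  from fg_copy[OF this] obtain K' :: "'k nak_mod" where K': "K' \<in> fg_mods A" "mod_iso A ?K K'"
    by (elim exE conjE) (rule that)
  from mod_iso_sym[OF K K'(2)] obtain f where f: "f \<in> lhom A K' ?K" "bij_betw f (carrier K') (carrier ?K)"
    by (auto simp: mod_iso_def)
  have "(\<lambda>(x, y). (x, f y)) \<in> lhom A (X \<oplus>\<^sub>m K') (X \<oplus>\<^sub>m ?K)"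
    by (rule lhomI) (auto simp: direct_sum2_def lhom_closed[OF f(1)] lhom_add[OF f(1)] lhom_smult[OF f(1)])
  moreover have "bij_betw (\<lambda>(x, y). (x, f y)) (carrier (X \<oplus>\<^sub>m K')) (carrier (X \<oplus>\<^sub>m ?K))"
    using bij_betw_map_prod[OF bij_betw_id f(2), of "carrier X"]
    by (simp add: direct_sum2_def map_prod_def case_prod_unfold)
  ultimately have "mod_iso A (X \<oplus>\<^sub>m K') (X \<oplus>\<^sub>m ?K)"
    unfolding mod_iso_def by (intro bexI[of _ "\<lambda>(x, y). (x, f y)"])
  then have "mod_iso A (X \<oplus>\<^sub>m K') Y"
    by (rule mod_iso_trans[OF _ comp(1)])
  then show ?thesis
    unfolding direct_summand_def using K'(1) by (intro bexI[of _ K'])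
qed

lemma lhom_inj_on:
  assumes "left_module R M" "left_module R N" "f \<in> lhom R M N"
    and "\<And>x. x \<in> carrier M \<Longrightarrow> f x = \<zero>\<^bsub>N\<^esub> \<Longrightarrow> x = \<zero>\<^bsub>M\<^esub>"
  shows "inj_on f (carrier M)"
proof (rule inj_onI)
  interpret M: left_module R M by fact
  interpret N: left_module R N by fact
  fix x y assume xy: "x \<in> carrier M" "y \<in> carrier M" "f x = f y"
  then have "f (x \<ominus>\<^bsub>M\<^esub> y) = \<zero>\<^bsub>N\<^esub>"
    by (simp add: lhom_minus[OF assms(1-3)] lhom_closed[OF assms(3)] N.group_simps)
  then have "x \<ominus>\<^bsub>M\<^esub> y = \<zero>\<^bsub>M\<^esub>"
    using xy by (intro assms(4)) simp_all
  then show "x = y"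
    using xy by (simp add: M.group_simps)
qed

text \<open>
  An element that survives paths of maximal length generates a uniserial submodule \<open>U i l\<close>, which
  is a retract since all paths of length \<open>l\<close> act as zero.
\<close>

lemma (in nakayama) uniserial_retract_exists:
  assumes M: "left_module A M" and nz: "carrier M \<noteq> {\<zero>\<^bsub>M\<^esub>}"
  shows "\<exists>i l. i < n \<and> 1 \<le> l \<and> l \<le> t \<and> retract A (U i l) M"
proof -
  interpret M: nak_module n t A M by (rule nak_moduleI) fact
  define P where "P l \<longleftrightarrow> (\<exists>x\<in>carrier M. al l \<odot>\<^bsub>M\<^esub> x \<noteq> \<zero>\<^bsub>M\<^esub>)" for l
  \<comment> \<open>The least l for which \<alpha>^l is zero on M.\<close>
  define l where "l = (LEAST l. \<not> P l)"
  have nPt: "\<not> P t"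
    by (auto simp: P_def M.act_laws(11))
  have nP: "\<not> P l"
    unfolding l_def by (rule LeastI[of "\<lambda>l. \<not> P l", OF nPt])
  have lt: "l \<le> t"
    unfolding l_def by (rule Least_le[of "\<lambda>l. \<not> P l", OF nPt])
  obtain x0 where "x0 \<in> carrier M" "x0 \<noteq> \<zero>\<^bsub>M\<^esub>"
    using nz M.M.zero_closed by auto
  then have "P 0"
    by (auto simp: P_def M.act_laws(10))
  then have l1: "1 \<le> l"
    using nP by (cases l) auto
  have "P (l - 1)"
    using not_less_Least[of "l - 1" "\<lambda>l. \<not> P l"] l1 unfolding l_def[symmetric] by simp
  then obtain x where x: "x \<in> carrier M" "al (l - 1) \<odot>\<^bsub>M\<^esub> x \<noteq> \<zero>\<^bsub>M\<^esub>"
    by (auto simp: P_def)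
  have "\<exists>u. u < n \<and> ee u \<odot>\<^bsub>M\<^esub> (al (l - 1) \<odot>\<^bsub>M\<^esub> x) \<noteq> \<zero>\<^bsub>M\<^esub>"
  proof (rule ccontr)
    assume none: "\<nexists>u. u < n \<and> ee u \<odot>\<^bsub>M\<^esub> (al (l - 1) \<odot>\<^bsub>M\<^esub> x) \<noteq> \<zero>\<^bsub>M\<^esub>"
    have "al (l - 1) \<odot>\<^bsub>M\<^esub> x = \<zero>\<^bsub>M\<^esub>"
    proof (rule M.eb_zero)
      show "ee u \<odot>\<^bsub>M\<^esub> (al (l - 1) \<odot>\<^bsub>M\<^esub> x) = \<zero>\<^bsub>M\<^esub>" if "u < n" for u
        using none that by simp
    qed (use x(1) in simp)
    then show False
      using x(2) by simp
  qed
  then obtain u where u: "u < n" "ee u \<odot>\<^bsub>M\<^esub> (al (l - 1) \<odot>\<^bsub>M\<^esub> x) \<noteq> \<zero>\<^bsub>M\<^esub>"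
    by (elim exE conjE) (rule that)
  \<comment> \<open>The vertex l - 1 steps before u, so that the surviving path starts at i and ends
    at u.\<close>
  define i where "i = (u + (n * (l - 1) - (l - 1))) mod n"
  have "l - 1 \<le> n * (l - 1)"
    using n_pos by simp
  then have shift: "u + (n * (l - 1) - (l - 1)) + (l - 1) = u + n * (l - 1)"
    by (simp only: add.assoc le_add_diff_inverse2)
  have iu: "(i + (l - 1)) mod n = u mod n"
    by (simp only: i_def mod_add_left_eq shift mod_mult_self2)
  define y where "y = ee i \<odot>\<^bsub>M\<^esub> x"
  have y: "y \<in> carrier M" "ee i \<odot>\<^bsub>M\<^esub> y = y" "al l \<odot>\<^bsub>M\<^esub> y = \<zero>\<^bsub>M\<^esub>"
    using x nP by (simp_all add: y_def M.act_laws(7) P_def)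
  have top: "al (l - 1) \<odot>\<^bsub>M\<^esub> y \<noteq> \<zero>\<^bsub>M\<^esub>"
    using u x ee_cong[OF iu] by (simp add: y_def M.act_laws(8))
  define \<iota> where "\<iota> = M.comb y l"
  note mU = U_module[OF lt, of i]
  have \<iota>: "\<iota> \<in> lhom A (U i l) M"
    unfolding \<iota>_def by (rule comb_lhom[OF M lt y])
  have b: "basis j \<in> carrier (U i l)" if "j < l" for j
    using that by (simp add: basis_def)
  have \<iota>_last: "\<iota> (basis (l - 1)) = al (l - 1) \<odot>\<^bsub>M\<^esub> y"
  proof -
    have "basis (l - 1) = al (l - 1) \<odot>\<^bsub>U i l\<^esub> basis 0"
      using l1 by (subst U_act(3)[OF lt b]) (auto simp: basis_def fun_eq_iff)
    then have "\<iota> (basis (l - 1)) = al (l - 1) \<odot>\<^bsub>M\<^esub> \<iota> (basis 0)"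
      using lhom_smult[OF \<iota> A_closed(3) b[of 0]] l1 by simp
    then show ?thesis
      by (simp add: \<iota>_def comb_basis[OF M y(1) l1])
  qed
  have inj: "inj_on \<iota> (carrier (U i l))"
  proof (rule lhom_inj_on[OF mU M \<iota>])
    fix v assume v: "v \<in> carrier (U i l)" "\<iota> v = \<zero>\<^bsub>M\<^esub>"
    show "v = \<zero>\<^bsub>U i l\<^esub>"
    proof (rule ccontr)
      assume "v \<noteq> \<zero>\<^bsub>U i l\<^esub>"
      then obtain j0 where "v j0 \<noteq> 0"
        by (auto simp: fun_eq_iff)
      \<comment> \<open>At the first nonzero coordinate j of v, \<alpha>^(l-1-j) moves this
        coordinate to the last place and kills the rest. As \<iota> does not kill the last basis
        vector, v cannot be in its kernel.\<close>
      define j where "j = (LEAST j. v j \<noteq> 0)"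
      have j1: "v j \<noteq> 0"
        unfolding j_def by (rule LeastI[of "\<lambda>j. v j \<noteq> 0", OF \<open>v j0 \<noteq> 0\<close>])
      have "\<not> v s \<noteq> 0" if "s < j" for s
        using that unfolding j_def by (rule not_less_Least)
      then have j2: "v s = 0" if "s < j" for s
        using that by blast
      note j = j1 j2
      have jl: "j < l"
        by (rule ccontr) (use j(1) v(1) in simp)
      have "al (l - 1 - j) \<odot>\<^bsub>U i l\<^esub> v = sc (v j) \<odot>\<^bsub>U i l\<^esub> basis (l - 1)"
      proof -
        have eq: "(if l - 1 - j \<le> s \<and> s < l then v (s - (l - 1 - j)) else 0) = v j * basis (l - 1) s" for s
        proof (cases "s = l - 1")
          case True
          then show ?thesis
            using jl by (simp add: basis_def)
        next
          case False
          have "v (s - (l - 1 - j)) = 0" if "l - 1 - j \<le> s" "s < l"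
          proof (rule j(2))
            show "s - (l - 1 - j) < j"
              using that False jl by arith
          qed
          then show ?thesis
            using False by (auto simp: basis_def)
        qed
        have bl: "basis (l - 1) \<in> carrier (U i l)"
          by (rule b) (use l1 in simp)
        show ?thesis
          unfolding U_act(3)[OF lt v(1)] U_act(1)[OF lt bl] by (rule ext) (rule eq)
      qed
      then have "sc (v j) \<odot>\<^bsub>M\<^esub> (al (l - 1) \<odot>\<^bsub>M\<^esub> y) = al (l - 1 - j) \<odot>\<^bsub>M\<^esub> \<iota> v"
        using lhom_smult[OF \<iota> A_closed(3) v(1), of "l - 1 - j"] lhom_smult[OF \<iota> A_closed(1) b, of "l - 1" "v j"] l1
        by (simp add: \<iota>_last[simplified])
      then have "sc (inverse (v j)) \<odot>\<^bsub>M\<^esub> (sc (v j) \<odot>\<^bsub>M\<^esub> (al (l - 1) \<odot>\<^bsub>M\<^esub> y)) = \<zero>\<^bsub>M\<^esub>"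
        by (simp add: v(2))
      then show False
        using top y j(1) by (simp add: M.act_laws(3) flip: M.act_laws(2))
    qed
  qed
  \<comment> \<open>\<alpha>^l is zero on M and \<iota> is injective, so v = 0.\<close>
  have pure: "\<exists>x'\<in>carrier (U i l). v = al l \<odot>\<^bsub>U i l\<^esub> x'"
    if "v \<in> carrier (U i l)" "z \<in> carrier M" "\<iota> v = al l \<odot>\<^bsub>M\<^esub> z" for v z
  proof -
    interpret Ui: nak_module n t A "U i l" by (rule nak_moduleI) (rule mU)
    have "\<iota> v = \<iota> \<zero>\<^bsub>U i l\<^esub>"
      using that nP by (simp add: P_def lhom_zero[OF mU M \<iota>] del: U_simps)
    then have "v = \<zero>\<^bsub>U i l\<^esub>"
      by (rule inj_onD[OF inj _ that(1) Ui.M.zero_closed])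
    then show ?thesis
      by (intro bexI[OF _ Ui.M.zero_closed]) (simp del: U_simps)
  qed
  have "\<exists>p\<in>lhom A M (U i l). \<forall>v\<in>carrier (U i l). p (\<iota> v) = v"
    by (rule U_extend_injection[OF mU M \<iota> inj l1 lt lhom_id]) (rule pure)
  then obtain p where "p \<in> lhom A M (U i l)" "\<forall>v\<in>carrier (U i l). p (\<iota> v) = v"
    by (rule bexE)
  then have "retract A (U i l) M"
    by (intro retractI[OF \<iota>]) auto
  moreover have "i < n"
    unfolding i_def using n_pos by simp
  ultimately show ?thesis
    using l1 lt by (intro exI[of _ i] exI[of _ l]) simp
qed

text \<open>The decomposition into uniserial modules as an induction rule. The complement K of a
  uniserial retract is the image of M under a map that kills the nonzero vector
  \<open>\<iota> (basis 0)\<close>, so by \<open>kspan_exchange\<close> it is spanned by fewer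
  vectors.\<close>

theorem (in nakayama) nak_induct [consumes 1, case_names zero step]:
  fixes M :: "'k nak_mod"
  assumes "M \<in> fg_mods A"
    and zero: "\<And>M. M \<in> fg_mods A \<Longrightarrow> carrier M = {\<zero>\<^bsub>M\<^esub>} \<Longrightarrow> Q M"
    and step: "\<And>M K i l. \<lbrakk>M \<in> fg_mods A; K \<in> fg_mods A; i < n; 1 \<le> l; l \<le> t; mod_iso A (bsum (U i l) K) M; Q K\<rbrakk> \<Longrightarrow> Q M"
  shows "Q M"
proof -
  have "left_module A M" "finitely_generated A M"
    using assms(1) by (simp_all add: fg_mods_def)
  from nak_module.finitely_generated_kspan[OF nak_moduleI[OF this(1)] this(2)]
  obtain bs where "set bs \<subseteq> carrier M" "nak_module.kspan n t M bs = carrier M"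
    by (elim exE conjE) (rule that)
  with assms(1) show ?thesis
  proof (induction "length bs" arbitrary: M bs rule: less_induct)
    case less
    note M = fg_mods_module[OF less.prems(1)]
    show ?case
    proof (cases "carrier M = {\<zero>\<^bsub>M\<^esub>}")
      case True
      then show ?thesis
        using zero less.prems(1) by simp
    next
      case False
      then obtain i l where il: "i < n" "1 \<le> l" "l \<le> t" "retract A (U i l) M"
        using uniserial_retract_exists[OF M] by auto
      note mU = U_module[OF il(3), of i]
      interpret Ui: nak_module n t A "U i l" by (rule nak_moduleI) (rule mU)
      from il(4)[unfolded retract_def]
      obtain \<iota> p where \<iota>: "\<iota> \<in> lhom A (U i l) M" and p: "p \<in> lhom A M (U i l)" "\<forall>v\<in>carrier (U i l). p (\<iota> v) = v"
        by (elim bexE) (rule that)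
      define K where "K = ker_module M (U i l) p"
      have K: "left_module A K"
        unfolding K_def by (rule ker_module_module[OF M mU p(1)])
      have comp: "mod_iso A (U i l \<oplus>\<^sub>m K) M"
        "\<exists>q\<in>lhom A M K. q ` carrier M = carrier K \<and> (\<forall>x\<in>carrier (U i l). q (\<iota> x) = \<zero>\<^bsub>M\<^esub>)"
        unfolding K_def by (rule ker_module_complement[OF mU M \<iota> p(1)]; use p(2) in simp)+
      from comp(2) obtain q where q: "q \<in> lhom A M K" "q ` carrier M = carrier K" "\<forall>x\<in>carrier (U i l). q (\<iota> x) = \<zero>\<^bsub>M\<^esub>"
        by (elim bexE conjE) (rule that)
      have K_fg: "K \<in> fg_mods A"
        by (rule fg_mods_onto[OF less.prems(1) K q(1,2)])
      have b: "basis 0 \<in> carrier (U i l)"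
        using il(2) by (simp add: basis_def)
      have "p (\<iota> (basis 0)) \<noteq> \<zero>\<^bsub>U i l\<^esub>"
        using p(2) b by (simp add: basis_def fun_eq_iff)
      then have "\<iota> (basis 0) \<noteq> \<zero>\<^bsub>M\<^esub>"
        using lhom_zero[OF M mU p(1)] by auto
      moreover have q0: "q (\<iota> (basis 0)) = \<zero>\<^bsub>K\<^esub>"
        using q(3) b by (simp add: K_def ker_module_def)
      moreover have "\<iota> (basis 0) \<in> nak_module.kspan n t M bs"
        using less.prems(3) lhom_closed[OF \<iota> b] by simp
      ultimately have "\<exists>cs. length cs < length bs \<and> set cs \<subseteq> carrier K \<and>
          q ` nak_module.kspan n t M bs = nak_module.kspan n t K cs"
        by (intro kspan_exchange[OF M K q(1) less.prems(2)])
      then obtain cs where "length cs < length bs" "set cs \<subseteq> carrier K"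
          "q ` nak_module.kspan n t M bs = nak_module.kspan n t K cs"
        by (elim exE conjE) (rule that)
      then have cs: "length cs < length bs" "set cs \<subseteq> carrier K" "nak_module.kspan n t K cs = carrier K"
        using less.prems(3) q(2) by simp_all
      have "Q K"
        by (rule less.hyps[OF cs(1) K_fg cs(2,3)])
      moreover have "mod_iso A (bsum (U i l) K) M"
        by (rule mod_iso_trans[OF mod_iso_sym[OF direct_sum2_module[OF mU K] bsum_iso[OF mU K]] comp(1)])
      ultimately show ?thesis
        using step[OF less.prems(1) K_fg il(1-3)] by simp
    qed
  qed
qed

section \<open>Classes of modules defined by vanishing conditions\<close>

subsection \<open>Finite direct sums\<close>

lemma direct_sum_simps:
  assumes "finite I"
  shows "f \<in> carrier (direct_sum I X) \<longleftrightarrow> f \<in> (\<Pi>\<^sub>E i\<in>I. carrier (X i))"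
    "\<zero>\<^bsub>direct_sum I X\<^esub> = (\<lambda>i\<in>I. \<zero>\<^bsub>X i\<^esub>)"
    "f \<oplus>\<^bsub>direct_sum I X\<^esub> g = (\<lambda>i\<in>I. f i \<oplus>\<^bsub>X i\<^esub> g i)"
    "a \<odot>\<^bsub>direct_sum I X\<^esub> f = (\<lambda>i\<in>I. a \<odot>\<^bsub>X i\<^esub> f i)"
  using assms by (simp_all add: direct_sum_def)

lemma direct_sum_module:
  assumes "finite I" "ring R" "\<And>i. i \<in> I \<Longrightarrow> left_module R (X i)"
  shows "left_module R (direct_sum I X)"
proof -
  note s = direct_sum_simps[OF assms(1)]
  have ag: "abelian_group (X i)" if "i \<in> I" for i
    using assms(3)[OF that] by (rule left_module_group)
  have am: "abelian_monoid (X i)" if "i \<in> I" for i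
    using ag[OF that] by (rule abelian_group.axioms)
  have "abelian_group (direct_sum I X)"
  proof (rule abelian_groupI)
    fix f g assume "f \<in> carrier (direct_sum I X)" "g \<in> carrier (direct_sum I X)"
    then have fi: "f i \<in> carrier (X i)" "g i \<in> carrier (X i)" if "i \<in> I" for i
      using that by (auto simp: s)
    show "f \<oplus>\<^bsub>direct_sum I X\<^esub> g \<in> carrier (direct_sum I X)"
      unfolding s by (intro restrict_PiE_iff[THEN iffD2] ballI abelian_monoid.a_closed[OF am] fi)
  next
    show "\<zero>\<^bsub>direct_sum I X\<^esub> \<in> carrier (direct_sum I X)"
      by (auto simp: s abelian_monoid.zero_closed[OF am])
  next
    fix f g h assume "f \<in> carrier (direct_sum I X)" "g \<in> carrier (direct_sum I X)" "h \<in> carrier (direct_sum I X)"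
    then have fi: "f i \<in> carrier (X i)" "g i \<in> carrier (X i)" "h i \<in> carrier (X i)" if "i \<in> I" for i
      using that by (auto simp: s)
    show "f \<oplus>\<^bsub>direct_sum I X\<^esub> g \<oplus>\<^bsub>direct_sum I X\<^esub> h = f \<oplus>\<^bsub>direct_sum I X\<^esub> (g \<oplus>\<^bsub>direct_sum I X\<^esub> h)"
      unfolding s using fi by (intro restrict_ext) (simp add: abelian_monoid.a_assoc[OF am])
  next
    fix f g assume "f \<in> carrier (direct_sum I X)" "g \<in> carrier (direct_sum I X)"
    then have fi: "f i \<in> carrier (X i)" "g i \<in> carrier (X i)" if "i \<in> I" for i
      using that by (auto simp: s)
    show "f \<oplus>\<^bsub>direct_sum I X\<^esub> g = g \<oplus>\<^bsub>direct_sum I X\<^esub> f"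
      unfolding s by (intro restrict_ext abelian_monoid.a_comm[OF am] fi)
  next
    fix f assume f: "f \<in> carrier (direct_sum I X)"
    then have fi: "f i \<in> carrier (X i)" if "i \<in> I" for i
      using that by (auto simp: s)
    have "(\<lambda>i\<in>I. \<zero>\<^bsub>X i\<^esub> \<oplus>\<^bsub>X i\<^esub> f i) = f"
      using f fi by (intro extensionalityI[of _ I]) (auto simp: s abelian_monoid.l_zero[OF am] PiE_def)
    then show "\<zero>\<^bsub>direct_sum I X\<^esub> \<oplus>\<^bsub>direct_sum I X\<^esub> f = f"
      by (simp add: s cong: restrict_cong)
    have "(\<lambda>i\<in>I. \<ominus>\<^bsub>X i\<^esub> f i) \<in> carrier (direct_sum I X)"
      using fi by (auto simp: s abelian_group.a_inv_closed[OF ag])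
    moreover have "(\<lambda>i\<in>I. \<ominus>\<^bsub>X i\<^esub> f i) \<oplus>\<^bsub>direct_sum I X\<^esub> f = \<zero>\<^bsub>direct_sum I X\<^esub>"
      unfolding s using fi by (intro restrict_ext) (simp add: abelian_group.l_neg[OF ag])
    ultimately show "\<exists>g\<in>carrier (direct_sum I X). g \<oplus>\<^bsub>direct_sum I X\<^esub> f = \<zero>\<^bsub>direct_sum I X\<^esub>"
      by (intro bexI[of _ "\<lambda>i\<in>I. \<ominus>\<^bsub>X i\<^esub> f i"])
  qed
  moreover have "left_module_axioms R (direct_sum I X)"
  proof (rule left_module_axioms.intro)
    fix a f assume a: "a \<in> carrier R" and "f \<in> carrier (direct_sum I X)"
    then have fi: "f i \<in> carrier (X i)" if "i \<in> I" for i
      using that by (auto simp: s)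
    show "a \<odot>\<^bsub>direct_sum I X\<^esub> f \<in> carrier (direct_sum I X)"
      unfolding s by (intro restrict_PiE_iff[THEN iffD2] ballI left_module.smult_closed[OF assms(3) a] fi)
  next
    fix a b f assume ab: "a \<in> carrier R" "b \<in> carrier R" and f: "f \<in> carrier (direct_sum I X)"
    then have fi: "f i \<in> carrier (X i)" if "i \<in> I" for i
      using that by (auto simp: s)
    show "(a \<oplus>\<^bsub>R\<^esub> b) \<odot>\<^bsub>direct_sum I X\<^esub> f = a \<odot>\<^bsub>direct_sum I X\<^esub> f \<oplus>\<^bsub>direct_sum I X\<^esub> b \<odot>\<^bsub>direct_sum I X\<^esub> f"
      unfolding s using fi ab by (intro restrict_ext) (simp add: left_module.smult_l_distr[OF assms(3)])
    show "(a \<otimes>\<^bsub>R\<^esub> b) \<odot>\<^bsub>direct_sum I X\<^esub> f = a \<odot>\<^bsub>direct_sum I X\<^esub> (b \<odot>\<^bsub>direct_sum I X\<^esub> f)"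
      unfolding s using fi ab by (intro restrict_ext) (simp add: left_module.smult_assoc[OF assms(3)])
  next
    fix a f g assume a: "a \<in> carrier R" and "f \<in> carrier (direct_sum I X)" "g \<in> carrier (direct_sum I X)"
    then have fi: "f i \<in> carrier (X i)" "g i \<in> carrier (X i)" if "i \<in> I" for i
      using that by (auto simp: s)
    show "a \<odot>\<^bsub>direct_sum I X\<^esub> (f \<oplus>\<^bsub>direct_sum I X\<^esub> g) = a \<odot>\<^bsub>direct_sum I X\<^esub> f \<oplus>\<^bsub>direct_sum I X\<^esub> a \<odot>\<^bsub>direct_sum I X\<^esub> g"
      unfolding s using fi a by (intro restrict_ext) (simp add: left_module.smult_r_distr[OF assms(3)])
  next
    fix f assume f: "f \<in> carrier (direct_sum I X)"
    then have fi: "f i \<in> carrier (X i)" if "i \<in> I" for i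
      using that by (auto simp: s)
    show "\<one>\<^bsub>R\<^esub> \<odot>\<^bsub>direct_sum I X\<^esub> f = f"
      unfolding s using f fi by (intro extensionalityI[of _ I]) (auto simp: s left_module.smult_one[OF assms(3)] PiE_def)
  qed
  ultimately show ?thesis
    using assms(2) by (simp add: left_module_def)
qed

lemma direct_sum_fg:
  assumes "finite I" "ring R" "\<And>i. i \<in> I \<Longrightarrow> X i \<in> fg_mods R"
  shows "direct_sum I X \<in> fg_mods R"
  using assms(1,3)
proof (induction I)
  case empty
  have "left_module R (direct_sum {} X)"
    by (rule direct_sum_module) (use assms(2) in auto)
  then show ?case
    by (rule fg_mods_trivial) (auto simp: direct_sum_def)
next
  case (insert i I)
  have mX: "left_module R (X j)" if "j \<in> insert i I" for j
    using insert.prems[OF that] by (rule fg_mods_module)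
  have fin: "finite (insert i I)"
    using insert.hyps by simp
  note s = direct_sum_simps[OF fin] direct_sum_simps[OF insert.hyps(1)]
  have fg: "direct_sum I X \<in> fg_mods R" "X i \<in> fg_mods R"
    using insert by simp_all
  have m: "left_module R (direct_sum (insert i I) X)"
    by (rule direct_sum_module[OF fin assms(2) mX])
  have z: "\<zero>\<^bsub>X j\<^esub> \<in> carrier (X j)" "a \<in> carrier R \<Longrightarrow> a \<odot>\<^bsub>X j\<^esub> \<zero>\<^bsub>X j\<^esub> = \<zero>\<^bsub>X j\<^esub>"
    "x \<in> carrier (X j) \<Longrightarrow> x \<oplus>\<^bsub>X j\<^esub> \<zero>\<^bsub>X j\<^esub> = x" "x \<in> carrier (X j) \<Longrightarrow> \<zero>\<^bsub>X j\<^esub> \<oplus>\<^bsub>X j\<^esub> x = x"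
    if "j \<in> insert i I" for j a x
  proof -
    interpret Xj: left_module R "X j" by (rule mX[OF that])
    show "\<zero>\<^bsub>X j\<^esub> \<in> carrier (X j)" "a \<in> carrier R \<Longrightarrow> a \<odot>\<^bsub>X j\<^esub> \<zero>\<^bsub>X j\<^esub> = \<zero>\<^bsub>X j\<^esub>"
      "x \<in> carrier (X j) \<Longrightarrow> x \<oplus>\<^bsub>X j\<^esub> \<zero>\<^bsub>X j\<^esub> = x" "x \<in> carrier (X j) \<Longrightarrow> \<zero>\<^bsub>X j\<^esub> \<oplus>\<^bsub>X j\<^esub> x = x"
      by (simp_all add: Xj.smult_r_null)
  qed
  let ?f1 = "\<lambda>x. \<lambda>k\<in>insert i I. if k = i then x else \<zero>\<^bsub>X k\<^esub>"
  let ?f2 = "\<lambda>f. \<lambda>k\<in>insert i I. if k = i then \<zero>\<^bsub>X k\<^esub> else f k"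
  have "finitely_generated R (direct_sum (insert i I) X)"
  proof (rule finitely_generated_onto2[OF fg_mods_module[OF fg(2)] _ fg_mods_module[OF fg(1)] _ m])
    show "?f1 \<in> lhom R (X i) (direct_sum (insert i I) X)"
      by (rule lhomI) (auto simp: s z intro!: restrict_ext)
    show "?f2 \<in> lhom R (direct_sum I X) (direct_sum (insert i I) X)"
      by (rule lhomI) (auto simp: s z intro!: restrict_ext)
  next
    fix f assume f: "f \<in> carrier (direct_sum (insert i I) X)"
    then have fk: "f k \<in> carrier (X k)" if "k \<in> insert i I" for k
      using that by (auto simp: s)
    have "restrict f I \<in> carrier (direct_sum I X)"
      using fk by (auto simp: s)
    moreover have "f = ?f1 (f i) \<oplus>\<^bsub>direct_sum (insert i I) X\<^esub> ?f2 (restrict f I)"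
    proof
      fix k
      show "f k = (?f1 (f i) \<oplus>\<^bsub>direct_sum (insert i I) X\<^esub> ?f2 (restrict f I)) k"
      proof (cases "k \<in> insert i I")
        case True
        then show ?thesis
          using fk[OF True] insert.hyps(2) by (auto simp: s z)
      next
        case False
        then show ?thesis
          using f by (auto simp: s)
      qed
    qed
    ultimately show "\<exists>x\<in>carrier (X i). \<exists>y\<in>carrier (direct_sum I X). f = ?f1 x \<oplus>\<^bsub>direct_sum (insert i I) X\<^esub> ?f2 y"
      using fk[of i] by (intro bexI[of _ "f i"] bexI[of _ "restrict f I"]) auto
  qed (use fg in \<open>auto simp: fg_mods_def\<close>)
  then show ?case
    using m by (simp add: fg_mods_def)
qed

lemma direct_sum_retract:
  assumes "finite I" "\<And>i. i \<in> I \<Longrightarrow> left_module R (X i)" "i0 \<in> I"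
  shows "retract R (X i0) (direct_sum I X)"
proof -
  note s = direct_sum_simps[OF assms(1)]
  have z: "\<zero>\<^bsub>X j\<^esub> \<in> carrier (X j)" "a \<in> carrier R \<Longrightarrow> a \<odot>\<^bsub>X j\<^esub> \<zero>\<^bsub>X j\<^esub> = \<zero>\<^bsub>X j\<^esub>"
    "\<zero>\<^bsub>X j\<^esub> \<oplus>\<^bsub>X j\<^esub> \<zero>\<^bsub>X j\<^esub> = \<zero>\<^bsub>X j\<^esub>"
    if "j \<in> I" for j a
  proof -
    interpret Xj: left_module R "X j" by (rule assms(2)[OF that])
    show "\<zero>\<^bsub>X j\<^esub> \<in> carrier (X j)" "a \<in> carrier R \<Longrightarrow> a \<odot>\<^bsub>X j\<^esub> \<zero>\<^bsub>X j\<^esub> = \<zero>\<^bsub>X j\<^esub>"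
      "\<zero>\<^bsub>X j\<^esub> \<oplus>\<^bsub>X j\<^esub> \<zero>\<^bsub>X j\<^esub> = \<zero>\<^bsub>X j\<^esub>"
      by (simp_all add: Xj.smult_r_null)
  qed
  show ?thesis
  proof (rule retractI)
    show "(\<lambda>x. \<lambda>k\<in>I. if k = i0 then x else \<zero>\<^bsub>X k\<^esub>) \<in> lhom R (X i0) (direct_sum I X)"
      by (rule lhomI) (auto simp: s z intro!: restrict_ext)
    show "(\<lambda>f. f i0) \<in> lhom R (direct_sum I X) (X i0)"
      using assms(3) by (intro lhomI) (auto simp: s)
  qed (use assms(3) in simp)
qed

context nakayama
begin

subsection \<open>Stability of the vanishing conditions\<close>

lemma van_retract:
  assumes mods: "left_module A M" "left_module A N" and r: "retract A M N" and van: "van j p q N"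
  shows "van j p q M"
  unfolding van_def
proof (intro ballI impI, elim conjE)
  obtain i \<pi> where i: "i \<in> lhom A M N" and \<pi>: "\<pi> \<in> lhom A N M" "\<forall>x\<in>carrier M. \<pi> (i x) = x"
    using r unfolding retract_def by auto
  fix x assume x: "x \<in> carrier M" "ee j \<odot>\<^bsub>M\<^esub> x = x" "al p \<odot>\<^bsub>M\<^esub> x = \<zero>\<^bsub>M\<^esub>"
  have ix: "ee j \<odot>\<^bsub>N\<^esub> i x = i x \<and> al p \<odot>\<^bsub>N\<^esub> i x = \<zero>\<^bsub>N\<^esub>"
    using lhom_smult[OF i, of "ee j" x] lhom_smult[OF i, of "al p" x] x lhom_zero[OF mods i] by simp
  from van[unfolded van_def, rule_format, OF lhom_closed[OF i x(1)] ix]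
  obtain y where y: "y \<in> carrier N" "i x = al q \<odot>\<^bsub>N\<^esub> y"
    by (rule bexE)
  have "x = \<pi> (i x)"
    using \<pi>(2) x(1) by simp
  also have "\<dots> = al q \<odot>\<^bsub>M\<^esub> \<pi> y"
    using y by (simp add: lhom_smult[OF \<pi>(1)])
  finally show "\<exists>y\<in>carrier M. x = al q \<odot>\<^bsub>M\<^esub> y"
    by (intro bexI[of _ "\<pi> y"] lhom_closed[OF \<pi>(1) y(1)])
qed

lemma van_trivial:
  assumes "left_module A M" "carrier M = {\<zero>\<^bsub>M\<^esub>}"
  shows "van j p q M"
proof -
  interpret nak_module n t A M by (rule nak_moduleI) fact
  show ?thesis
    by (auto simp: van_def assms(2))
qed

lemma van_direct_sum:
  assumes I: "finite I" and mods: "\<And>i. i \<in> I \<Longrightarrow> left_module A (X i)" and van: "\<And>i. i \<in> I \<Longrightarrow> van j p q (X i)"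
  shows "van j p q (direct_sum I X)"
  unfolding van_def
proof (intro ballI impI, elim conjE)
  note s = direct_sum_simps[OF I]
  fix f assume f: "f \<in> carrier (direct_sum I X)"
    and e: "ee j \<odot>\<^bsub>direct_sum I X\<^esub> f = f" and a: "al p \<odot>\<^bsub>direct_sum I X\<^esub> f = \<zero>\<^bsub>direct_sum I X\<^esub>"
  have "\<forall>i\<in>I. \<exists>y. y \<in> carrier (X i) \<and> f i = al q \<odot>\<^bsub>X i\<^esub> y"
  proof
    fix i assume i: "i \<in> I"
    have "f i \<in> carrier (X i)"
      using f i by (auto simp: s)
    moreover have "ee j \<odot>\<^bsub>X i\<^esub> f i = f i"
      using fun_cong[OF e, of i] i by (simp add: s)
    moreover have "al p \<odot>\<^bsub>X i\<^esub> f i = \<zero>\<^bsub>X i\<^esub>"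
      using fun_cong[OF a, of i] i by (simp add: s)
    ultimately have "\<exists>y\<in>carrier (X i). f i = al q \<odot>\<^bsub>X i\<^esub> y"
      using van[OF i] unfolding van_def by simp
    then show "\<exists>y. y \<in> carrier (X i) \<and> f i = al q \<odot>\<^bsub>X i\<^esub> y"
      by (elim bexE) (intro exI conjI)
  qed
  then have "\<exists>y. \<forall>i\<in>I. y i \<in> carrier (X i) \<and> f i = al q \<odot>\<^bsub>X i\<^esub> y i"
    by (rule bchoice)
  then obtain y where y: "\<forall>i\<in>I. y i \<in> carrier (X i) \<and> f i = al q \<odot>\<^bsub>X i\<^esub> y i"
    by (rule exE)
  have "f = al q \<odot>\<^bsub>direct_sum I X\<^esub> restrict y I"
  proof
    fix i show "f i = (al q \<odot>\<^bsub>direct_sum I X\<^esub> restrict y I) i"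
      using f y by (cases "i \<in> I") (auto simp: s)
  qed
  then show "\<exists>y\<in>carrier (direct_sum I X). f = al q \<odot>\<^bsub>direct_sum I X\<^esub> y"
    using y by (intro bexI[of _ "restrict y I"]) (auto simp: s)
qed

lemma van_direct_sum2:
  assumes mods: "left_module A M" "left_module A N" and van: "van j p q M" "van j p q N"
  shows "van j p q (M \<oplus>\<^sub>m N)"
  unfolding van_def
proof (intro ballI impI, elim conjE)
  fix z assume z: "z \<in> carrier (M \<oplus>\<^sub>m N)" "ee j \<odot>\<^bsub>M \<oplus>\<^sub>m N\<^esub> z = z" "al p \<odot>\<^bsub>M \<oplus>\<^sub>m N\<^esub> z = \<zero>\<^bsub>M \<oplus>\<^sub>m N\<^esub>"
  obtain x y where xy: "z = (x, y)"
    by (cases z)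
  have "x \<in> carrier M" "ee j \<odot>\<^bsub>M\<^esub> x = x \<and> al p \<odot>\<^bsub>M\<^esub> x = \<zero>\<^bsub>M\<^esub>"
      and "y \<in> carrier N" "ee j \<odot>\<^bsub>N\<^esub> y = y \<and> al p \<odot>\<^bsub>N\<^esub> y = \<zero>\<^bsub>N\<^esub>"
    using z by (auto simp: xy direct_sum2_def)
  note x = this(1,2) and y = this(3,4)
  from van(1)[unfolded van_def, rule_format, OF x]
  obtain x' where x': "x' \<in> carrier M" "x = al q \<odot>\<^bsub>M\<^esub> x'"
    by (rule bexE)
  from van(2)[unfolded van_def, rule_format, OF y]
  obtain y' where y': "y' \<in> carrier N" "y = al q \<odot>\<^bsub>N\<^esub> y'"
    by (rule bexE)
  show "\<exists>w\<in>carrier (M \<oplus>\<^sub>m N). z = al q \<odot>\<^bsub>M \<oplus>\<^sub>m N\<^esub> w"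
    using x'(1) y'(1) by (intro bexI[of _ "(x', y')"]) (simp_all add: xy direct_sum2_def flip: x'(2) y'(2))
qed

lemma van_bsum:
  assumes mods: "left_module A M" "left_module A N" and van: "van j p q M" "van j p q N"
  shows "van j p q (bsum M N)"
  by (rule van_retract[OF bsum_module[OF mods] direct_sum2_module[OF mods] _ van_direct_sum2[OF assms]])
    (rule mod_iso_retract[OF bsum_module[OF mods] mod_iso_sym[OF direct_sum2_module[OF mods] bsum_iso[OF mods]]])

text \<open>Basis vectors suffice as tests: \<open>basis s\<close> lies at a + s, is killed by
  \<alpha>^p if l \<le> s + p, and is in the image of \<alpha>^q only if q \<le> s. Membership of U
  a l in a class thus becomes arithmetic.\<close>

lemma van_U:
  assumes l: "l \<le> t"
  shows "van j p q (U a l) \<longleftrightarrow> (\<forall>s<l. (a + s) mod n = j mod n \<and> l \<le> s + p \<longrightarrow> q \<le> s)"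
proof
  assume van: "van j p q (U a l)"
  show "\<forall>s<l. (a + s) mod n = j mod n \<and> l \<le> s + p \<longrightarrow> q \<le> s"
  proof (intro allI impI, elim conjE)
    fix s assume s: "s < l" "(a + s) mod n = j mod n" "l \<le> s + p"
    have b: "basis s \<in> carrier (U a l)"
      using s(1) by (simp add: basis_def)
    have "ee j \<odot>\<^bsub>U a l\<^esub> basis s = basis s"
      unfolding U_act(2)[OF l b] using s(2) by (intro ext) (simp add: basis_def)
    moreover have "al p \<odot>\<^bsub>U a l\<^esub> basis s = \<zero>\<^bsub>U a l\<^esub>"
      unfolding U_act(3)[OF l b] using s(3) by (intro ext) (auto simp: basis_def)
    ultimately have "ee j \<odot>\<^bsub>U a l\<^esub> basis s = basis s \<and> al p \<odot>\<^bsub>U a l\<^esub> basis s = \<zero>\<^bsub>U a l\<^esub>" ..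
    from van[unfolded van_def, rule_format, OF b this]
    obtain y where y: "y \<in> carrier (U a l)" "basis s = al q \<odot>\<^bsub>U a l\<^esub> y"
      by (rule bexE)
    have "basis s s = (if q \<le> s \<and> s < l then y (s - q) else 0)"
      using fun_cong[OF y(2), of s] unfolding U_act(3)[OF l y(1)] .
    then show "q \<le> s"
      by (auto simp: basis_def split: if_splits)
  qed
next
  assume *: "\<forall>s<l. (a + s) mod n = j mod n \<and> l \<le> s + p \<longrightarrow> q \<le> s"
  show "van j p q (U a l)"
    unfolding van_def
  proof (intro ballI impI, elim conjE)
    fix v assume v: "v \<in> carrier (U a l)" "ee j \<odot>\<^bsub>U a l\<^esub> v = v" "al p \<odot>\<^bsub>U a l\<^esub> v = \<zero>\<^bsub>U a l\<^esub>"
    have supp: "q \<le> s \<and> s < l" if "v s \<noteq> 0" for s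
    proof -
      have sl: "s < l"
        by (rule ccontr) (use v(1) that in simp)
      have "(a + s) mod n = j mod n"
        using fun_cong[OF v(2)[unfolded U_act(2)[OF l v(1)]], of s] that by (auto split: if_splits)
      moreover have "l \<le> s + p"
        using fun_cong[OF v(3)[unfolded U_act(3)[OF l v(1)]], of "s + p"] that by (auto split: if_splits)
      ultimately show ?thesis
        using * sl by auto
    qed
    have y: "(\<lambda>k. v (k + q)) \<in> carrier (U a l)"
      using v(1) by simp
    have "v = al q \<odot>\<^bsub>U a l\<^esub> (\<lambda>k. v (k + q))"
      unfolding U_act(3)[OF l y] using supp by (auto simp: fun_eq_iff)
    then show "\<exists>y\<in>carrier (U a l). v = al q \<odot>\<^bsub>U a l\<^esub> y"
      by (rule bexI[OF _ y])
  qed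
qed

text \<open>Each such class is closed under sums and retracts and is therefore determined by the
  uniserial modules in it; union of condition sets corresponds to intersection of classes.\<close>

definition modcls :: "(nat \<times> nat \<times> nat) set \<Rightarrow> 'k nak_mod set" where
  "modcls T = {M \<in> fg_mods A. \<forall>(j, p, q)\<in>T. van j p q M}"

lemma modcls_fg: "M \<in> modcls T \<Longrightarrow> M \<in> fg_mods A"
  by (simp add: modcls_def)

lemma modcls_van: "M \<in> modcls T \<Longrightarrow> (j, p, q) \<in> T \<Longrightarrow> van j p q M"
  by (auto simp: modcls_def)

lemma modcls_retract:
  assumes "N \<in> modcls T" "M \<in> fg_mods A" "retract A M N"
  shows "M \<in> modcls T"
  using assms van_retract[OF fg_mods_module fg_mods_module assms(3)] by (auto simp: modcls_def)

lemma modcls_bsum: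
  assumes M: "M \<in> modcls T" and N: "N \<in> modcls T"
  shows "bsum M N \<in> modcls T"
proof -
  note mods = fg_mods_module[OF modcls_fg[OF M]] fg_mods_module[OF modcls_fg[OF N]]
  have "van j p q (bsum M N)" if "(j, p, q) \<in> T" for j p q
    by (rule van_bsum[OF mods modcls_van[OF M that] modcls_van[OF N that]])
  then show ?thesis
    using bsum_fg[OF modcls_fg[OF M] modcls_fg[OF N]] by (auto simp: modcls_def)
qed

lemma modcls_trivial: "M \<in> fg_mods A \<Longrightarrow> carrier M = {\<zero>\<^bsub>M\<^esub>} \<Longrightarrow> M \<in> modcls T"
  using van_trivial[OF fg_mods_module, of M] by (auto simp: modcls_def)

text \<open>The uniserial summands of a module in the class are retracts of it, hence belong to the
  class.\<close>

lemma modcls_induct [consumes 1, case_names zero uni sum iso]: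
  assumes "M \<in> modcls T"
    and zero: "\<And>M. M \<in> fg_mods A \<Longrightarrow> carrier M = {\<zero>\<^bsub>M\<^esub>} \<Longrightarrow> Q M"
    and uni: "\<And>i l. i < n \<Longrightarrow> 1 \<le> l \<Longrightarrow> l \<le> t \<Longrightarrow> U i l \<in> modcls T \<Longrightarrow> Q (U i l)"
    and sum: "\<And>M N. M \<in> fg_mods A \<Longrightarrow> N \<in> fg_mods A \<Longrightarrow> Q M \<Longrightarrow> Q N \<Longrightarrow> Q (bsum M N)"
    and iso: "\<And>M N. M \<in> fg_mods A \<Longrightarrow> N \<in> fg_mods A \<Longrightarrow> mod_iso A M N \<Longrightarrow> Q M \<Longrightarrow> Q N"
  shows "Q M"
proof -
  from modcls_fg[OF assms(1)] have "M \<in> modcls T \<longrightarrow> Q M"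
  proof (induction rule: nak_induct)
    case (zero M)
    then show ?case
      using assms(2) by simp
  next
    case (step M K i l)
    note mods = U_module[OF step(5), of i] fg_mods_module[OF step(2)]
    note bs = bsum_module[OF mods]
    have bM: "retract A (bsum (U i l) K) M"
      by (rule mod_iso_retract[OF bs step(6)])
    show ?case
    proof
      assume M: "M \<in> modcls T"
      have K: "K \<in> modcls T"
        by (rule modcls_retract[OF M step(2) retract_trans[OF bsum_retract(2)[OF mods] bM]])
      have Uil: "U i l \<in> modcls T"
        by (rule modcls_retract[OF M U_fg[OF step(5)] retract_trans[OF bsum_retract(1)[OF mods] bM]])
      have "Q (bsum (U i l) K)"
        using sum[OF U_fg[OF step(5)] step(2) uni[OF step(3-5) Uil]] step(7) K by simp
      then show "Q M"
        by (rule iso[OF bsum_fg[OF U_fg[OF step(5)] step(2)] step(1,6)])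
    qed
  qed
  then show ?thesis
    using assms(1) by simp
qed

text \<open>The coordinate m of the power receives X, those below m receive K.\<close>

lemma retract_direct_sum_Suc:
  assumes N: "left_module A N" and K: "left_module A K" "retract A K (direct_sum {..<m} (\<lambda>_. N))"
    and X: "left_module A X" "retract A X N"
  shows "retract A (bsum X K) (direct_sum {..<Suc m} (\<lambda>_. N))"
proof -
  interpret K: left_module A K by fact
  interpret N: left_module A N by fact
  note s = direct_sum_simps[OF finite_lessThan]
  obtain i p where i: "i \<in> lhom A X N" and p: "p \<in> lhom A N X" "\<forall>x\<in>carrier X. p (i x) = x"
    using X(2) unfolding retract_def by auto
  obtain j q where j: "j \<in> lhom A K (direct_sum {..<m} (\<lambda>_. N))" and q: "q \<in> lhom A (direct_sum {..<m} (\<lambda>_. N)) K"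
      and qj: "\<forall>x\<in>carrier K. q (j x) = x"
    using K(2) unfolding retract_def by auto
  have jE: "j x \<in> (\<Pi>\<^sub>E i\<in>{..<m}. carrier N)" if "x \<in> carrier K" for x
    using lhom_closed[OF j that] by (simp add: s)
  let ?I = "\<lambda>z. \<lambda>k\<in>{..<Suc m}. if k = m then i (lft z) else j (rgt z) k"
  let ?P = "\<lambda>f. join (p (f m)) (q (restrict f {..<m}))"
  show ?thesis
  proof (rule retractI)
    show "?I \<in> lhom A (bsum X K) (direct_sum {..<Suc m} (\<lambda>_. N))"
    proof (rule lhomI)
      fix z assume "z \<in> carrier (bsum X K)"
      then show "?I z \<in> carrier (direct_sum {..<Suc m} (\<lambda>_. N))"
        using PiE_mem[OF jE[of "rgt z"]] unfolding s
        by (intro restrict_PiE_iff[THEN iffD2] ballI) (auto simp: lhom_closed[OF i] less_Suc_eq)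
    next
      fix z w assume "z \<in> carrier (bsum X K)" "w \<in> carrier (bsum X K)"
      then show "?I (z \<oplus>\<^bsub>bsum X K\<^esub> w) = ?I z \<oplus>\<^bsub>direct_sum {..<Suc m} (\<lambda>_. N)\<^esub> ?I w"
        by (auto simp: s lhom_add[OF i] lhom_add[OF j] less_Suc_eq intro!: restrict_ext)
    next
      fix a z assume "a \<in> carrier A" "z \<in> carrier (bsum X K)"
      then show "?I (a \<odot>\<^bsub>bsum X K\<^esub> z) = a \<odot>\<^bsub>direct_sum {..<Suc m} (\<lambda>_. N)\<^esub> ?I z"
        by (auto simp: s lhom_smult[OF i] lhom_smult[OF j] less_Suc_eq intro!: restrict_ext)
    qed
    have r: "restrict f {..<m} \<in> carrier (direct_sum {..<m} (\<lambda>_. N))" "f m \<in> carrier N"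
      if f: "f \<in> carrier (direct_sum {..<Suc m} (\<lambda>_. N))" for f
    proof -
      have "f k \<in> carrier N" if "k < Suc m" for k
        using PiE_mem[OF f[unfolded s(1)], of k] that by simp
      then show "restrict f {..<m} \<in> carrier (direct_sum {..<m} (\<lambda>_. N))" "f m \<in> carrier N"
        unfolding s(1) by (simp_all add: restrict_PiE_iff)
    qed
    show "?P \<in> lhom A (direct_sum {..<Suc m} (\<lambda>_. N)) (bsum X K)"
    proof (rule lhomI)
      fix f assume f: "f \<in> carrier (direct_sum {..<Suc m} (\<lambda>_. N))"
      show "?P f \<in> carrier (bsum X K)"
        using lhom_closed[OF p(1) r(2)[OF f]] lhom_closed[OF q r(1)[OF f]] by simp
    next
      fix f g assume fg: "f \<in> carrier (direct_sum {..<Suc m} (\<lambda>_. N))" "g \<in> carrier (direct_sum {..<Suc m} (\<lambda>_. N))"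
      have "restrict (f \<oplus>\<^bsub>direct_sum {..<Suc m} (\<lambda>_. N)\<^esub> g) {..<m}
          = restrict f {..<m} \<oplus>\<^bsub>direct_sum {..<m} (\<lambda>_. N)\<^esub> restrict g {..<m}"
        unfolding s by (rule restrict_ext) simp
      then show "?P (f \<oplus>\<^bsub>direct_sum {..<Suc m} (\<lambda>_. N)\<^esub> g) = ?P f \<oplus>\<^bsub>bsum X K\<^esub> ?P g"
        using lhom_add[OF q r(1)[OF fg(1)] r(1)[OF fg(2)]] lhom_add[OF p(1) r(2)[OF fg(1)] r(2)[OF fg(2)]]
        by (simp add: s(3)[of "Suc m"])
    next
      fix a f assume af: "a \<in> carrier A" "f \<in> carrier (direct_sum {..<Suc m} (\<lambda>_. N))"
      have "restrict (a \<odot>\<^bsub>direct_sum {..<Suc m} (\<lambda>_. N)\<^esub> f) {..<m}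
          = a \<odot>\<^bsub>direct_sum {..<m} (\<lambda>_. N)\<^esub> restrict f {..<m}"
        unfolding s by (rule restrict_ext) simp
      then show "?P (a \<odot>\<^bsub>direct_sum {..<Suc m} (\<lambda>_. N)\<^esub> f) = a \<odot>\<^bsub>bsum X K\<^esub> ?P f"
        using lhom_smult[OF q af(1) r(1)[OF af(2)]] lhom_smult[OF p(1) af(1) r(2)[OF af(2)]]
        by (simp add: s(4)[of "Suc m"])
    qed
    fix z assume z: "z \<in> carrier (bsum X K)"
    then have "restrict (?I z) {..<m} = j (rgt z)"
      using jE[of "rgt z"] by (intro extensionalityI[of _ "{..<m}"]) (auto simp: PiE_def)
    then show "?P (?I z) = z"
      using z p(2) qj by simp
  qed
qed

text \<open>The conditions pass from N to sums and retracts. Conversely, a module of the class is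
  assembled from uniserial modules of the class, each a retract of N, so one copy of N per summand
  suffices.\<close>

lemma add_class_eq_modcls:
  assumes N: "N \<in> fg_mods A" and van: "\<And>j p q. (j, p, q) \<in> T \<Longrightarrow> van j p q N"
    and r: "\<And>i l. i < n \<Longrightarrow> 1 \<le> l \<Longrightarrow> l \<le> t \<Longrightarrow> U i l \<in> modcls T \<Longrightarrow> retract A (U i l) N"
  shows "add_class A N = (modcls T :: 'k nak_mod set)"
proof
  note mN = fg_mods_module[OF N]
  have ds: "direct_sum {..<m} (\<lambda>_. N) \<in> fg_mods A" for m :: nat
    by (rule direct_sum_fg) (use N A.ring_axioms in auto)
  show "add_class A N \<subseteq> modcls T"
  proof
    fix X :: "'k nak_mod" assume "X \<in> add_class A N"
    then obtain m :: nat where X: "X \<in> fg_mods A" "direct_summand A X (direct_sum {..<m} (\<lambda>_. N))"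
      by (auto simp: add_class_def)
    have "van j p q X" if "(j, p, q) \<in> T" for j p q
      by (rule van_retract[OF fg_mods_module[OF X(1)] fg_mods_module[OF ds] direct_summand_imp_retract[OF X]])
        (rule van_direct_sum; simp add: mN van[OF that])
    then show "X \<in> modcls T"
      using X(1) by (auto simp: modcls_def)
  qed
  show "modcls T \<subseteq> add_class A N"
  proof
    fix X :: "'k nak_mod" assume X: "X \<in> modcls T"
    have "\<exists>m::nat. retract A X (direct_sum {..<m} (\<lambda>_. N))"
      using modcls_fg[OF X] X
    proof (induction rule: nak_induct)
      case (zero M)
      have m: "left_module A (direct_sum {..<0::nat} (\<lambda>_. N))"
        using ds[of 0] by (rule fg_mods_module)
      have "retract A M (direct_sum {..<0::nat} (\<lambda>_. N))"
        by (rule retractI[OF lhom_const_zero[OF m] lhom_const_zero[OF fg_mods_module[OF zero(1)]]]) (use zero in simp)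
      then show ?case
        by (rule exI)
    next
      case (step M K i l)
      note mods = U_module[OF step(5), of i] fg_mods_module[OF step(2)]
      have Mb: "retract A M (bsum (U i l) K)"
        by (rule mod_iso_retract[OF fg_mods_module[OF step(1)] mod_iso_sym[OF bsum_module[OF mods] step(6)]])
      have bM: "retract A (bsum (U i l) K) M"
        by (rule mod_iso_retract[OF bsum_module[OF mods] step(6)])
      have K: "K \<in> modcls T"
        by (rule modcls_retract[OF step(8) step(2) retract_trans[OF bsum_retract(2)[OF mods] bM]])
      have Uil: "U i l \<in> modcls T"
        by (rule modcls_retract[OF step(8) U_fg[OF step(5)] retract_trans[OF bsum_retract(1)[OF mods] bM]])
      obtain m :: nat where "retract A K (direct_sum {..<m} (\<lambda>_. N))"
        using step(7)[OF K] by auto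
      then have "retract A (bsum (U i l) K) (direct_sum {..<Suc m} (\<lambda>_. N))"
        by (rule retract_direct_sum_Suc[OF mN mods(2) _ mods(1) r[OF step(3-5) Uil]])
      then have "retract A M (direct_sum {..<Suc m} (\<lambda>_. N))"
        by (rule retract_trans[OF Mb])
      then show ?case
        by (rule exI)
    qed
    then obtain m :: nat where "retract A X (direct_sum {..<m} (\<lambda>_. N))"
      by auto
    then have "direct_summand A X (direct_sum {..<m} (\<lambda>_. N))"
      by (rule retract_imp_direct_summand[OF modcls_fg[OF X] ds])
    then show "X \<in> add_class A N"
      using modcls_fg[OF X] by (auto simp: add_class_def)
  qed
qed

end

subsection \<open>Relative projectivity and injectivity\<close>

context nakayama
begin

text \<open>Only the kernel of the surjection is restricted to \<open>\<K>\<close>. If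
  \<open>\<K>\<close> is one class of a cotorsion pair, this gives orthogonality
  (\<open>lproj_splits\<close>); if it is an exact category, it gives projective objects
  (\<open>lproj_projectives\<close>). Both thus come from the same computation.\<close>

definition lproj :: "'k nak_mod set \<Rightarrow> 'k nak_mod \<Rightarrow> bool" where
  "lproj \<K> Q \<longleftrightarrow> (\<forall>X Y Z f g h. X \<in> \<K> \<and> X \<in> fg_mods A \<and> Y \<in> fg_mods A \<and> Z \<in> fg_mods A \<and> short_exact A X f Y g Z \<and>
     h \<in> lhom A Q Z \<longrightarrow> (\<exists>h'\<in>lhom A Q Y. \<forall>x\<in>carrier Q. g (h' x) = h x))"

definition linj :: "'k nak_mod set \<Rightarrow> 'k nak_mod \<Rightarrow> bool" where
  "linj \<K> Q \<longleftrightarrow> (\<forall>X Y Z f g h. Z \<in> \<K> \<and> X \<in> fg_mods A \<and> Y \<in> fg_mods A \<and> Z \<in> fg_mods A \<and> short_exact A X f Y g Z \<and>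
     h \<in> lhom A X Q \<longrightarrow> (\<exists>h'\<in>lhom A Y Q. \<forall>x\<in>carrier X. h' (f x) = h x))"

lemma lprojD:
  assumes "lproj \<K> Q" "X \<in> \<K>" "X \<in> fg_mods A" "Y \<in> fg_mods A" "Z \<in> fg_mods A" "short_exact A X f Y g Z" "h \<in> lhom A Q Z"
  shows "\<exists>h'\<in>lhom A Q Y. \<forall>x\<in>carrier Q. g (h' x) = h x"
  using assms(1)[unfolded lproj_def, rule_format, OF conjI[OF assms(2) conjI[OF assms(3) conjI[OF assms(4)
    conjI[OF assms(5) conjI[OF assms(6,7)]]]]]] .

lemma linjD:
  assumes "linj \<K> Q" "Z \<in> \<K>" "X \<in> fg_mods A" "Y \<in> fg_mods A" "Z \<in> fg_mods A" "short_exact A X f Y g Z" "h \<in> lhom A X Q"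
  shows "\<exists>h'\<in>lhom A Y Q. \<forall>x\<in>carrier X. h' (f x) = h x"
  using assms(1)[unfolded linj_def, rule_format, OF conjI[OF assms(2) conjI[OF assms(3) conjI[OF assms(4)
    conjI[OF assms(5) conjI[OF assms(6,7)]]]]]] .

lemma lprojI:
  assumes "\<And>X Y Z f g h. X \<in> \<K> \<Longrightarrow> X \<in> fg_mods A \<Longrightarrow> Y \<in> fg_mods A \<Longrightarrow> Z \<in> fg_mods A \<Longrightarrow> short_exact A X f Y g Z \<Longrightarrow>
    h \<in> lhom A Q Z \<Longrightarrow> \<exists>h'\<in>lhom A Q Y. \<forall>x\<in>carrier Q. g (h' x) = h x"
  shows "lproj \<K> Q"
  unfolding lproj_def by (intro allI impI, elim conjE) (rule assms)

lemma linjI: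
  assumes "\<And>X Y Z f g h. Z \<in> \<K> \<Longrightarrow> X \<in> fg_mods A \<Longrightarrow> Y \<in> fg_mods A \<Longrightarrow> Z \<in> fg_mods A \<Longrightarrow> short_exact A X f Y g Z \<Longrightarrow>
    h \<in> lhom A X Q \<Longrightarrow> \<exists>h'\<in>lhom A Y Q. \<forall>x\<in>carrier X. h' (f x) = h x"
  shows "linj \<K> Q"
  unfolding linj_def by (intro allI impI, elim conjE) (rule assms)

lemma lproj_retract:
  assumes "lproj \<K> Q" "retract A P Q"
  shows "lproj \<K> P"
proof (rule lprojI)
  fix X Y Z f g h
  assume *: "X \<in> \<K>" "X \<in> fg_mods A" "Y \<in> fg_mods A" "Z \<in> fg_mods A" "short_exact A X f Y g Z" and h: "h \<in> lhom A P Z"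
  from assms(2)[unfolded retract_def]
  obtain i p where ip: "i \<in> lhom A P Q" "p \<in> lhom A Q P" "\<forall>x\<in>carrier P. p (i x) = x"
    by (elim bexE) (rule that)
  from lprojD[OF assms(1) * lhom_comp[OF ip(2) h]]
  obtain h' where h': "h' \<in> lhom A Q Y" "\<forall>x\<in>carrier Q. g (h' x) = h (p x)"
    by (elim bexE) (rule that)
  show "\<exists>h'\<in>lhom A P Y. \<forall>x\<in>carrier P. g (h' x) = h x"
    by (rule bexI[OF _ lhom_comp[OF ip(1) h'(1)]]) (use h'(2) ip in \<open>simp add: lhom_closed\<close>)
qed

lemma linj_retract:
  assumes "linj \<K> Q" "retract A P Q"
  shows "linj \<K> P"
proof (rule linjI)
  fix X Y Z f g h
  assume *: "Z \<in> \<K>" "X \<in> fg_mods A" "Y \<in> fg_mods A" "Z \<in> fg_mods A" "short_exact A X f Y g Z" and h: "h \<in> lhom A X P"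
  from assms(2)[unfolded retract_def]
  obtain i p where ip: "i \<in> lhom A P Q" "p \<in> lhom A Q P" "\<forall>x\<in>carrier P. p (i x) = x"
    by (elim bexE) (rule that)
  from linjD[OF assms(1) * lhom_comp[OF h ip(1)]]
  obtain h' where h': "h' \<in> lhom A Y Q" "\<forall>x\<in>carrier X. h' (f x) = i (h x)"
    by (elim bexE) (rule that)
  show "\<exists>h'\<in>lhom A Y P. \<forall>x\<in>carrier X. h' (f x) = h x"
    by (rule bexI[OF _ lhom_comp[OF h'(1) ip(2)]]) (use h'(2) ip h in \<open>simp add: lhom_closed\<close>)
qed

lemma lproj_bsum:
  assumes mods: "left_module A P" "left_module A Q" and lp: "lproj \<K> P" "lproj \<K> Q"
  shows "lproj \<K> (bsum P Q)"
proof (rule lprojI)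
  fix X Y Z f g h
  assume *: "X \<in> \<K>" "X \<in> fg_mods A" "Y \<in> fg_mods A" "Z \<in> fg_mods A" "short_exact A X f Y g Z"
    and h: "h \<in> lhom A (bsum P Q) Z"
  note mY = fg_mods_module[OF *(3)] and mZ = fg_mods_module[OF *(4)]
  interpret P: left_module A P by fact
  interpret Q: left_module A Q by fact
  from lprojD[OF lp(1) * lhom_comp[OF bsum_lhom(1)[OF mods] h]]
  obtain h1 where h1: "h1 \<in> lhom A P Y" "\<forall>x\<in>carrier P. g (h1 x) = h (join x \<zero>\<^bsub>Q\<^esub>)"
    by (elim bexE) (rule that)
  from lprojD[OF lp(2) * lhom_comp[OF bsum_lhom(2)[OF mods] h]]
  obtain h2 where h2: "h2 \<in> lhom A Q Y" "\<forall>x\<in>carrier Q. g (h2 x) = h (join \<zero>\<^bsub>P\<^esub> x)"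
    by (elim bexE) (rule that)
  show "\<exists>h'\<in>lhom A (bsum P Q) Y. \<forall>x\<in>carrier (bsum P Q). g (h' x) = h x"
  proof (rule bexI[OF _ bsum_lhom_sum[OF mY h1(1) h2(1)]], rule ballI)
    fix z assume z: "z \<in> carrier (bsum P Q)"
    then have "g (h1 (lft z) \<oplus>\<^bsub>Y\<^esub> h2 (rgt z)) = h (join (lft z) \<zero>\<^bsub>Q\<^esub>) \<oplus>\<^bsub>Z\<^esub> h (join \<zero>\<^bsub>P\<^esub> (rgt z))"
      using h1 h2 by (simp add: lhom_add[OF short_exactD(2)[OF *(5)]] lhom_closed)
    also have "\<dots> = h (join (lft z) \<zero>\<^bsub>Q\<^esub> \<oplus>\<^bsub>bsum P Q\<^esub> join \<zero>\<^bsub>P\<^esub> (rgt z))"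
      by (rule lhom_add[OF h, symmetric]) (use z in simp_all)
    also have "join (lft z) \<zero>\<^bsub>Q\<^esub> \<oplus>\<^bsub>bsum P Q\<^esub> join \<zero>\<^bsub>P\<^esub> (rgt z) = z"
      using z by simp
    finally show "g (h1 (lft z) \<oplus>\<^bsub>Y\<^esub> h2 (rgt z)) = h z" .
  qed
qed

lemma linj_bsum:
  assumes mods: "left_module A P" "left_module A Q" and li: "linj \<K> P" "linj \<K> Q"
  shows "linj \<K> (bsum P Q)"
proof (rule linjI)
  fix X Y Z f g h
  assume *: "Z \<in> \<K>" "X \<in> fg_mods A" "Y \<in> fg_mods A" "Z \<in> fg_mods A" "short_exact A X f Y g Z"
    and h: "h \<in> lhom A X (bsum P Q)"
  from linjD[OF li(1) * lhom_comp[OF h bsum_lhom(3)[OF mods]]]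
  obtain h1 where h1: "h1 \<in> lhom A Y P" "\<forall>x\<in>carrier X. h1 (f x) = lft (h x)"
    by (elim bexE) (rule that)
  from linjD[OF li(2) * lhom_comp[OF h bsum_lhom(4)[OF mods]]]
  obtain h2 where h2: "h2 \<in> lhom A Y Q" "\<forall>x\<in>carrier X. h2 (f x) = rgt (h x)"
    by (elim bexE) (rule that)
  show "\<exists>h'\<in>lhom A Y (bsum P Q). \<forall>x\<in>carrier X. h' (f x) = h x"
    by (rule bexI[OF _ bsum_lhom_pair[OF h1(1) h2(1)]]) (use h1(2) h2(2) in simp)
qed

lemma lproj_trivial:
  assumes "left_module A P" "carrier P = {\<zero>\<^bsub>P\<^esub>}"
  shows "lproj \<K> P"
proof (rule lprojI)
  fix X Y Z f g h
  assume *: "Y \<in> fg_mods A" "Z \<in> fg_mods A" "short_exact A X f Y g Z" and h: "h \<in> lhom A P Z"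
  note mY = fg_mods_module[OF *(1)] and mZ = fg_mods_module[OF *(2)]
  show "\<exists>h'\<in>lhom A P Y. \<forall>x\<in>carrier P. g (h' x) = h x"
    by (rule bexI[OF _ lhom_const_zero[OF mY]])
      (simp add: assms(2) lhom_zero[OF assms(1) mZ h] lhom_zero[OF mY mZ short_exactD(2)[OF *(3)]])
qed

lemma linj_trivial:
  assumes "left_module A P" "carrier P = {\<zero>\<^bsub>P\<^esub>}"
  shows "linj \<K> P"
proof (rule linjI)
  fix X Y Z f g h
  assume h: "h \<in> lhom A X P"
  show "\<exists>h'\<in>lhom A Y P. \<forall>x\<in>carrier X. h' (f x) = h x"
    by (rule bexI[OF _ lhom_const_zero[OF assms(1)]]) (use lhom_closed[OF h] assms(2) in auto)
qed

lemma lproj_U: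
  assumes "1 \<le> l" "l \<le> t" "\<And>X. X \<in> \<K> \<Longrightarrow> van (i + l) (t - l) l X"
  shows "lproj \<K> (U i l)"
proof (rule lprojI)
  fix X Y Z f g h
  assume *: "X \<in> \<K>" "X \<in> fg_mods A" "Y \<in> fg_mods A" "Z \<in> fg_mods A" "short_exact A X f Y g Z" and h: "h \<in> lhom A (U i l) Z"
  show "\<exists>h'\<in>lhom A (U i l) Y. \<forall>x\<in>carrier (U i l). g (h' x) = h x"
    by (rule U_lift[OF fg_mods_module[OF *(2)] fg_mods_module[OF *(3)] fg_mods_module[OF *(4)] *(5) assms(1,2) assms(3)[OF *(1)] h])
qed

lemma linj_U:
  assumes "1 \<le> l" "l \<le> t" "(j + 1) mod n = i mod n" "\<And>Z. Z \<in> \<K> \<Longrightarrow> van j l (t - l) Z"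
  shows "linj \<K> (U i l)"
proof (rule linjI)
  fix X Y Z f g h
  assume *: "Z \<in> \<K>" "X \<in> fg_mods A" "Y \<in> fg_mods A" "Z \<in> fg_mods A" "short_exact A X f Y g Z" and h: "h \<in> lhom A X (U i l)"
  show "\<exists>h'\<in>lhom A Y (U i l). \<forall>x\<in>carrier X. h' (f x) = h x"
    by (rule U_extend[OF fg_mods_module[OF *(2)] fg_mods_module[OF *(3)] fg_mods_module[OF *(4)] *(5) assms(1-3) assms(4)[OF *(1)] h])
qed

lemma lproj_modcls:
  assumes "M \<in> modcls T" "\<And>i l. i < n \<Longrightarrow> 1 \<le> l \<Longrightarrow> l \<le> t \<Longrightarrow> U i l \<in> modcls T \<Longrightarrow> lproj \<K> (U i l)"
  shows "lproj \<K> M"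
  using assms(1)
proof (induction rule: modcls_induct)
  case (zero M)
  then show ?case
    by (intro lproj_trivial fg_mods_module)
next
  case (uni i l)
  then show ?case
    by (rule assms(2))
next
  case (sum M N)
  then show ?case
    by (intro lproj_bsum fg_mods_module)
next
  case (iso M N)
  show ?case
    by (rule lproj_retract[OF iso(4) mod_iso_retract[OF fg_mods_module[OF iso(2)] mod_iso_sym[OF fg_mods_module[OF iso(1)] iso(3)]]])
qed

lemma linj_modcls:
  assumes "M \<in> modcls T" "\<And>i l. i < n \<Longrightarrow> 1 \<le> l \<Longrightarrow> l \<le> t \<Longrightarrow> U i l \<in> modcls T \<Longrightarrow> linj \<K> (U i l)"
  shows "linj \<K> M"
  using assms(1)
proof (induction rule: modcls_induct)
  case (zero M)
  then show ?case
    by (intro linj_trivial fg_mods_module)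
next
  case (uni i l)
  then show ?case
    by (rule assms(2))
next
  case (sum M N)
  then show ?case
    by (intro linj_bsum fg_mods_module)
next
  case (iso M N)
  show ?case
    by (rule linj_retract[OF iso(4) mod_iso_retract[OF fg_mods_module[OF iso(2)] mod_iso_sym[OF fg_mods_module[OF iso(1)] iso(3)]]])
qed

lemma lproj_splits:
  assumes "lproj \<K> Z" "X \<in> \<K>" "X \<in> fg_mods A" "Z \<in> fg_mods A"
  shows "splits A Z X"
  unfolding splits_def
  by (intro allI impI, elim conjE) (rule lprojD[OF assms(1-3) _ assms(4) _ lhom_id])

lemma linj_splits:
  assumes "linj \<K> X" "Z \<in> \<K>" "X \<in> fg_mods A" "Z \<in> fg_mods A"
  shows "splits A Z X"
  unfolding splits_def
proof (intro allI impI, elim conjE)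
  fix E f g assume E: "E \<in> fg_mods A" "short_exact A X f E g Z"
  from linjD[OF assms(1-3) E(1) assms(4) E(2) lhom_id]
  obtain r where r: "r \<in> lhom A E X" "\<forall>x\<in>carrier X. r (f x) = x"
    by (elim bexE) (rule that)
  show "\<exists>s\<in>lhom A Z E. \<forall>z\<in>carrier Z. g (s z) = z"
    by (rule retraction_imp_section[OF E(2) fg_mods_module[OF assms(3)] fg_mods_module[OF E(1)] fg_mods_module[OF assms(4)] r(1)])
      (use r(2) in simp)
qed

lemma lproj_projectives:
  assumes "lproj \<B> Q" "Q \<in> \<B>" "\<B> \<subseteq> fg_mods A"
  shows "Q \<in> projectives A \<B>"
  unfolding projectives_def conflation_def
proof (intro CollectI conjI assms(2) allI impI ballI, elim conjE)
  fix X f Y g Z h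
  assume h: "h \<in> lhom A Q Z" and *: "X \<in> \<B>" "Y \<in> \<B>" "Z \<in> \<B>" "short_exact A X f Y g Z"
  show "\<exists>h'\<in>lhom A Q Y. \<forall>x\<in>carrier Q. g (h' x) = h x"
    by (rule lprojD[OF assms(1) *(1) subsetD[OF assms(3) *(1)] subsetD[OF assms(3) *(2)] subsetD[OF assms(3) *(3)] *(4) h])
qed

lemma linj_injectives:
  assumes "linj \<B> Q" "Q \<in> \<B>" "\<B> \<subseteq> fg_mods A"
  shows "Q \<in> injectives A \<B>"
  unfolding injectives_def conflation_def
proof (intro CollectI conjI assms(2) allI impI ballI, elim conjE)
  fix X f Y g Z h
  assume h: "h \<in> lhom A X Q" and *: "X \<in> \<B>" "Y \<in> \<B>" "Z \<in> \<B>" "short_exact A X f Y g Z"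
  show "\<exists>h'\<in>lhom A Y Q. \<forall>x\<in>carrier X. h' (f x) = h x"
    by (rule linjD[OF assms(1) *(3) subsetD[OF assms(3) *(1)] subsetD[OF assms(3) *(2)] subsetD[OF assms(3) *(3)] *(4) h])
qed

subsection \<open>Thick classes\<close>

text \<open>
  The chase for the vertex \<open>j\<close> and length \<open>r\<close> also uses the condition at the end of the paths of length
  \<open>r\<close> that leave \<open>j\<close>, or at the start of the paths of length \<open>t - r\<close> that enter \<open>j\<close>.
\<close>

lemma thick_modcls:
  fixes D :: "nat \<Rightarrow> nat \<Rightarrow> bool"
  assumes T: "T = {(j, r, t - r) | j r. r \<le> t \<and> D j r}"
    and fwd: "\<And>j r. D j r \<Longrightarrow> r \<le> t \<Longrightarrow> D (j + r) (t - r)"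
    and bwd: "\<And>i j r. D j r \<Longrightarrow> r \<le> t \<Longrightarrow> (i + (t - r)) mod n = j mod n \<Longrightarrow> D i (t - r)"
  shows "thick A (modcls T)"
proof -
  have main: "(\<forall>j r. r \<le> t \<and> D j r \<longrightarrow> van j r (t - r) X) \<and> (\<forall>j r. r \<le> t \<and> D j r \<longrightarrow> van j r (t - r) Y) \<longrightarrow> (\<forall>j r. r \<le> t \<and> D j r \<longrightarrow> van j r (t - r) Z)"
      "(\<forall>j r. r \<le> t \<and> D j r \<longrightarrow> van j r (t - r) X) \<and> (\<forall>j r. r \<le> t \<and> D j r \<longrightarrow> van j r (t - r) Z) \<longrightarrow> (\<forall>j r. r \<le> t \<and> D j r \<longrightarrow> van j r (t - r) Y)"
      "(\<forall>j r. r \<le> t \<and> D j r \<longrightarrow> van j r (t - r) Y) \<and> (\<forall>j r. r \<le> t \<and> D j r \<longrightarrow> van j r (t - r) Z) \<longrightarrow> (\<forall>j r. r \<le> t \<and> D j r \<longrightarrow> van j r (t - r) X)"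
    if fg: "X \<in> fg_mods A" "Y \<in> fg_mods A" "Z \<in> fg_mods A" and se: "short_exact A X f Y g Z" for X Y Z :: "'k nak_mod" and f g
  proof -
    note mods = fg_mods_module[OF fg(1)] fg_mods_module[OF fg(2)] fg_mods_module[OF fg(3)]
    interpret X: nak_module n t A X by (rule nak_moduleI) fact
    interpret Y: nak_module n t A Y by (rule nak_moduleI) fact
    interpret Z: nak_module n t A Z by (rule nak_moduleI) fact
    note f = short_exactD(1)[OF se] and g = short_exactD(2)[OF se]
    have f_inj: "x = x'" if "x \<in> carrier X" "x' \<in> carrier X" "f x = f x'" for x x'
      using that short_exactD(3)[OF se] by (simp add: inj_on_def)
    \<comment> \<open>For the quotient: a lift y of z has \<alpha>^r y in X, at the vertex j + r and
      killed by \<alpha>^(t-r). The condition for X there, provided by \<open>fwd\<close>, allows y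
      to be corrected.\<close>
    show "(\<forall>j r. r \<le> t \<and> D j r \<longrightarrow> van j r (t - r) X) \<and> (\<forall>j r. r \<le> t \<and> D j r \<longrightarrow> van j r (t - r) Y) \<longrightarrow> (\<forall>j r. r \<le> t \<and> D j r \<longrightarrow> van j r (t - r) Z)"
    proof (intro impI allI, elim conjE)
      fix j r assume vX: "\<forall>j r. r \<le> t \<and> D j r \<longrightarrow> van j r (t - r) X" and vY: "\<forall>j r. r \<le> t \<and> D j r \<longrightarrow> van j r (t - r) Y"
        and r: "r \<le> t" "D j r"
      show "van j r (t - r) Z"
        unfolding van_def
      proof (intro ballI impI, elim conjE)
        fix z assume z: "z \<in> carrier Z" "ee j \<odot>\<^bsub>Z\<^esub> z = z" "al r \<odot>\<^bsub>Z\<^esub> z = \<zero>\<^bsub>Z\<^esub>"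
        from short_exact_lift_vertex[OF mods(2,3) se z(1,2)]
        obtain y where y: "y \<in> carrier Y" "ee j \<odot>\<^bsub>Y\<^esub> y = y" "g y = z"
          by (elim bexE conjE) (rule that)
        have ay: "al r \<odot>\<^bsub>Y\<^esub> y \<in> carrier Y" "ee (j + r) \<odot>\<^bsub>Y\<^esub> (al r \<odot>\<^bsub>Y\<^esub> y) = al r \<odot>\<^bsub>Y\<^esub> y" "g (al r \<odot>\<^bsub>Y\<^esub> y) = \<zero>\<^bsub>Z\<^esub>"
          using y z Y.act_laws(8)[OF y(1), of r j] by (simp_all add: lhom_smult[OF g])
        from short_exact_kernel_vertex[OF mods(1,2) se ay]
        obtain x where x: "x \<in> carrier X" "ee (j + r) \<odot>\<^bsub>X\<^esub> x = x" "f x = al r \<odot>\<^bsub>Y\<^esub> y"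
          by (elim bexE conjE) (rule that)
        have "al (t - r) \<odot>\<^bsub>X\<^esub> x = \<zero>\<^bsub>X\<^esub>"
          by (rule f_inj) (use x y r in \<open>simp_all add: lhom_smult[OF f] lhom_zero[OF mods(1,2) f] Y.act_laws(9,11)\<close>)
        moreover have "van (j + r) (t - r) r X"
          using vX[rule_format, of "t - r" "j + r"] fwd[OF r(2,1)] r(1) by simp
        ultimately have "\<exists>x'\<in>carrier X. ee j \<odot>\<^bsub>X\<^esub> x' = x' \<and> al r \<odot>\<^bsub>X\<^esub> x' = x"
          by (intro vanD[OF mods(1) _ x(1,2) _ refl])
        then obtain x' where x': "x' \<in> carrier X" "ee j \<odot>\<^bsub>X\<^esub> x' = x'" "al r \<odot>\<^bsub>X\<^esub> x' = x"
          by (elim bexE conjE) (rule that)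
        have fx': "ee j \<odot>\<^bsub>Y\<^esub> f x' = f x'" "al r \<odot>\<^bsub>Y\<^esub> f x' = f x"
          using x' lhom_smult[OF f A_closed(2) x'(1), of j] lhom_smult[OF f A_closed(3) x'(1), of r] by simp_all
        have "ee j \<odot>\<^bsub>Y\<^esub> (y \<ominus>\<^bsub>Y\<^esub> f x') = y \<ominus>\<^bsub>Y\<^esub> f x' \<and> al r \<odot>\<^bsub>Y\<^esub> (y \<ominus>\<^bsub>Y\<^esub> f x') = \<zero>\<^bsub>Y\<^esub>"
          using x x' y by (simp add: Y.act_add fx' lhom_closed[OF f] Y.group_simps)
        moreover have c: "y \<ominus>\<^bsub>Y\<^esub> f x' \<in> carrier Y"
          using x' y by (simp add: lhom_closed[OF f])
        moreover have "van j r (t - r) Y"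
          using vY r by simp
        ultimately have "\<exists>y'\<in>carrier Y. y \<ominus>\<^bsub>Y\<^esub> f x' = al (t - r) \<odot>\<^bsub>Y\<^esub> y'"
          unfolding van_def by simp
        then obtain y' where y': "y' \<in> carrier Y" "y \<ominus>\<^bsub>Y\<^esub> f x' = al (t - r) \<odot>\<^bsub>Y\<^esub> y'"
          by (rule bexE)
        have "g (y \<ominus>\<^bsub>Y\<^esub> f x') = z"
          using x' y z by (simp add: lhom_minus[OF mods(2,3) g] lhom_closed[OF f] short_exactD(6)[OF se] Z.group_simps)
        then have "z = al (t - r) \<odot>\<^bsub>Z\<^esub> g y'"
          using y' by (simp add: lhom_smult[OF g])
        then show "\<exists>y\<in>carrier Z. z = al (t - r) \<odot>\<^bsub>Z\<^esub> y"
          by (rule bexI[OF _ lhom_closed[OF g y'(1)]])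
      qed
    qed
    \<comment> \<open>For the extension: g y is \<alpha>^(t-r) z' by the condition for Z. After
      subtracting \<alpha>^(t-r) times a lift of z', the element comes from X, where the condition
      for X applies.\<close>
    show "(\<forall>j r. r \<le> t \<and> D j r \<longrightarrow> van j r (t - r) X) \<and> (\<forall>j r. r \<le> t \<and> D j r \<longrightarrow> van j r (t - r) Z) \<longrightarrow> (\<forall>j r. r \<le> t \<and> D j r \<longrightarrow> van j r (t - r) Y)"
    proof (intro impI allI, elim conjE)
      fix j r assume vX: "\<forall>j r. r \<le> t \<and> D j r \<longrightarrow> van j r (t - r) X" and vZ: "\<forall>j r. r \<le> t \<and> D j r \<longrightarrow> van j r (t - r) Z"
        and r: "r \<le> t" "D j r"
      \<comment> \<open>The vertex t - r steps before j, written as j + r - t plus a multiple of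
        n.\<close>
      define j' where "j' = j + r + (t * n - t)"
      have "t \<le> t * n"
        using n_pos by simp
      then have "j' + (t - r) = j + t * n"
        using r(1) unfolding j'_def by linarith
      then have j': "(j' + (t - r)) mod n = j mod n"
        by simp
      show "van j r (t - r) Y"
        unfolding van_def
      proof (intro ballI impI, elim conjE)
        fix y assume y: "y \<in> carrier Y" "ee j \<odot>\<^bsub>Y\<^esub> y = y" "al r \<odot>\<^bsub>Y\<^esub> y = \<zero>\<^bsub>Y\<^esub>"
        have gy: "g y \<in> carrier Z" "ee j \<odot>\<^bsub>Z\<^esub> g y = g y" "al r \<odot>\<^bsub>Z\<^esub> g y = \<zero>\<^bsub>Z\<^esub>"
          using y lhom_smult[OF g A_closed(2) y(1), of j] lhom_smult[OF g A_closed(3) y(1), of r]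
          by (simp_all add: lhom_closed[OF g] lhom_zero[OF mods(2,3) g])
        have "van j r (t - r) Z"
          using vZ r by simp
        from vanD[OF mods(3) this gy j']
        obtain z' where z': "z' \<in> carrier Z" "ee j' \<odot>\<^bsub>Z\<^esub> z' = z'" "al (t - r) \<odot>\<^bsub>Z\<^esub> z' = g y"
          by (elim bexE conjE) (rule that)
        from short_exact_lift_vertex[OF mods(2,3) se z'(1,2)]
        obtain y' where y': "y' \<in> carrier Y" "ee j' \<odot>\<^bsub>Y\<^esub> y' = y'" "g y' = z'"
          by (elim bexE conjE) (rule that)
        let ?y = "y \<ominus>\<^bsub>Y\<^esub> al (t - r) \<odot>\<^bsub>Y\<^esub> y'"
        have e: "ee j \<odot>\<^bsub>Y\<^esub> (al (t - r) \<odot>\<^bsub>Y\<^esub> y') = al (t - r) \<odot>\<^bsub>Y\<^esub> y'"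
          using y'(2) Y.act_laws(8)[OF y'(1), of "t - r" j'] ee_cong[OF j'] by simp
        have "?y \<in> carrier Y" "ee j \<odot>\<^bsub>Y\<^esub> ?y = ?y" "g ?y = \<zero>\<^bsub>Z\<^esub>"
          using y y' z' by (simp_all add: Y.act_add e lhom_minus[OF mods(2,3) g] lhom_smult[OF g] lhom_closed[OF g] Z.group_simps)
        from short_exact_kernel_vertex[OF mods(1,2) se this]
        obtain x where x: "x \<in> carrier X" "ee j \<odot>\<^bsub>X\<^esub> x = x" "f x = ?y"
          by (elim bexE conjE) (rule that)
        have "al r \<odot>\<^bsub>Y\<^esub> ?y = \<zero>\<^bsub>Y\<^esub>"
          using y y' r(1) by (simp add: Y.act_add Y.act_laws(9,11) Y.group_simps)
        then have "al r \<odot>\<^bsub>X\<^esub> x = \<zero>\<^bsub>X\<^esub>"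
          by - (rule f_inj, use x in \<open>simp_all add: lhom_smult[OF f] lhom_zero[OF mods(1,2) f]\<close>)
        then have "\<exists>x'\<in>carrier X. x = al (t - r) \<odot>\<^bsub>X\<^esub> x'"
          using vX[rule_format, OF conjI[OF r]] x unfolding van_def by simp
        then obtain x' where x': "x' \<in> carrier X" "x = al (t - r) \<odot>\<^bsub>X\<^esub> x'"
          by (rule bexE)
        have "y = al (t - r) \<odot>\<^bsub>Y\<^esub> y' \<oplus>\<^bsub>Y\<^esub> ?y"
          using y y' by (simp add: Y.group_simps)
        also have "?y = al (t - r) \<odot>\<^bsub>Y\<^esub> f x'"
          using x' by (simp add: lhom_smult[OF f] flip: x(3))
        finally have "y = al (t - r) \<odot>\<^bsub>Y\<^esub> (y' \<oplus>\<^bsub>Y\<^esub> f x')"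
          using y' x' by (simp add: Y.act_add lhom_closed[OF f])
        then show "\<exists>w\<in>carrier Y. y = al (t - r) \<odot>\<^bsub>Y\<^esub> w"
          using y' x' by (intro bexI[of _ "y' \<oplus>\<^bsub>Y\<^esub> f x'"]) (simp_all add: lhom_closed[OF f])
      qed
    qed
    \<comment> \<open>For the kernel: f x is \<alpha>^(t-r) y by the condition for Y. The condition
      for Z at j', provided by \<open>bwd\<close>, makes g y a multiple of \<alpha>^r; subtracting
      \<alpha>^r times a lift moves y into X and leaves \<alpha>^(t-r) y unchanged, because
      \<alpha>^t = 0.\<close>
    show "(\<forall>j r. r \<le> t \<and> D j r \<longrightarrow> van j r (t - r) Y) \<and> (\<forall>j r. r \<le> t \<and> D j r \<longrightarrow> van j r (t - r) Z) \<longrightarrow> (\<forall>j r. r \<le> t \<and> D j r \<longrightarrow> van j r (t - r) X)"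
    proof (intro impI allI, elim conjE)
      fix j r assume vY: "\<forall>j r. r \<le> t \<and> D j r \<longrightarrow> van j r (t - r) Y" and vZ: "\<forall>j r. r \<le> t \<and> D j r \<longrightarrow> van j r (t - r) Z"
        and r: "r \<le> t" "D j r"
      define j' where "j' = j + r + (t * n - t)"
      have "t \<le> t * n"
        using n_pos by simp
      then have "j' + (t - r) = j + t * n"
        using r(1) unfolding j'_def by linarith
      then have j': "(j' + (t - r)) mod n = j mod n"
        by simp
      show "van j r (t - r) X"
        unfolding van_def
      proof (intro ballI impI, elim conjE)
        fix x assume x: "x \<in> carrier X" "ee j \<odot>\<^bsub>X\<^esub> x = x" "al r \<odot>\<^bsub>X\<^esub> x = \<zero>\<^bsub>X\<^esub>"
        have fx: "f x \<in> carrier Y" "ee j \<odot>\<^bsub>Y\<^esub> f x = f x" "al r \<odot>\<^bsub>Y\<^esub> f x = \<zero>\<^bsub>Y\<^esub>"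
          using x lhom_smult[OF f A_closed(2) x(1), of j] lhom_smult[OF f A_closed(3) x(1), of r]
          by (simp_all add: lhom_closed[OF f] lhom_zero[OF mods(1,2) f])
        have "van j r (t - r) Y"
          using vY r by simp
        from vanD[OF mods(2) this fx j']
        obtain y where y: "y \<in> carrier Y" "ee j' \<odot>\<^bsub>Y\<^esub> y = y" "al (t - r) \<odot>\<^bsub>Y\<^esub> y = f x"
          by (elim bexE conjE) (rule that)
        have gy: "g y \<in> carrier Z" "ee j' \<odot>\<^bsub>Z\<^esub> g y = g y" "al (t - r) \<odot>\<^bsub>Z\<^esub> g y = \<zero>\<^bsub>Z\<^esub>"
          using y lhom_smult[OF g A_closed(2) y(1), of j'] lhom_smult[OF g A_closed(3) y(1), of "t - r"] x(1)
          by (simp_all add: lhom_closed[OF g] short_exactD(6)[OF se])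
        have "van j' (t - r) r Z"
          using vZ[rule_format, of "t - r" j'] bwd[OF r(2,1) j'] r(1) by simp
        then have "\<exists>z'\<in>carrier Z. g y = al r \<odot>\<^bsub>Z\<^esub> z'"
          using gy unfolding van_def by simp
        then obtain z' where z': "z' \<in> carrier Z" "g y = al r \<odot>\<^bsub>Z\<^esub> z'"
          by (rule bexE)
        from short_exactD(4)[OF se z'(1)] obtain y' where y': "y' \<in> carrier Y" "g y' = z'"
          by (rule bexE)
        let ?y = "y \<ominus>\<^bsub>Y\<^esub> al r \<odot>\<^bsub>Y\<^esub> y'"
        have "?y \<in> carrier Y" "g ?y = \<zero>\<^bsub>Z\<^esub>"
          using y y' z' by (simp_all add: lhom_minus[OF mods(2,3) g] lhom_smult[OF g] Z.group_simps)
        from short_exactD(5)[OF se this] obtain x' where x': "x' \<in> carrier X" "f x' = ?y"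
          by (rule bexE)
        have "f x = f (al (t - r) \<odot>\<^bsub>X\<^esub> x')"
          using x' y y' r(1) fx(1) by (simp add: lhom_smult[OF f] Y.act_add Y.act_laws(9,11) Y.group_simps)
        then have "x = al (t - r) \<odot>\<^bsub>X\<^esub> x'"
          by - (rule f_inj, use x x' in simp_all)
        then show "\<exists>x'\<in>carrier X. x = al (t - r) \<odot>\<^bsub>X\<^esub> x'"
          by (rule bexI[OF _ x'(1)])
      qed
    qed
  qed
  have mem: "M \<in> modcls T \<longleftrightarrow> M \<in> fg_mods A \<and> (\<forall>j r. r \<le> t \<and> D j r \<longrightarrow> van j r (t - r) M)" for M
    by (auto simp: modcls_def T)
  show ?thesis
    unfolding thick_def
  proof (intro conjI ballI allI impI)
    show "modcls T \<subseteq> fg_mods A"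
      by (auto dest: modcls_fg)
  next
    fix X Y :: "'k nak_mod" assume *: "X \<in> fg_mods A" "Y \<in> modcls T" "direct_summand A X Y"
    show "X \<in> modcls T"
      by (rule modcls_retract[OF *(2,1) direct_summand_imp_retract[OF *(1,3)]])
  next
    fix X Y Z :: "'k nak_mod" and f g
    assume fg: "X \<in> fg_mods A" "Y \<in> fg_mods A" "Z \<in> fg_mods A" and se: "short_exact A X f Y g Z"
    note m = main[OF fg se]
    show "Z \<in> modcls T" if "X \<in> modcls T \<and> Y \<in> modcls T"
      using m(1) that fg unfolding mem by simp
    show "Y \<in> modcls T" if "X \<in> modcls T \<and> Z \<in> modcls T"
      using m(2) that fg unfolding mem by simp
    show "X \<in> modcls T" if "Y \<in> modcls T \<and> Z \<in> modcls T"
      using m(3) that fg unfolding mem by simp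
  qed
qed

end

subsection \<open>Approximations\<close>

lemma short_exact_zero_left:
  assumes "left_module R M" "left_module R N" "carrier N = {\<zero>\<^bsub>N\<^esub>}"
  shows "short_exact R N (\<lambda>_. \<zero>\<^bsub>M\<^esub>) M (\<lambda>x. x) M"
  by (rule short_exactI[OF lhom_const_zero[OF assms(1)] lhom_id]) (simp_all add: assms(3))

lemma short_exact_zero_right:
  assumes "left_module R M" "left_module R N" "carrier N = {\<zero>\<^bsub>N\<^esub>}"
  shows "short_exact R M (\<lambda>x. x) M (\<lambda>_. \<zero>\<^bsub>N\<^esub>) N"
proof (rule short_exactI[OF lhom_id lhom_const_zero[OF assms(2)]])
  interpret M: left_module R M by fact
  show "\<exists>y\<in>carrier M. \<zero>\<^bsub>N\<^esub> = z" if "z \<in> carrier N" for z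
    using that by (intro bexI[OF _ M.M.zero_closed]) (simp add: assms(3))
  show "\<exists>x\<in>carrier M. x = y" if "y \<in> carrier M" for y
    using that by simp
qed simp_all

lemma short_exact_bsum2:
  assumes mods: "left_module R X1" "left_module R Y1" "left_module R Z1" "left_module R X2" "left_module R Y2" "left_module R Z2"
    and se1: "short_exact R X1 f1 Y1 g1 Z1" and se2: "short_exact R X2 f2 Y2 g2 Z2"
  shows "short_exact R (bsum X1 X2) (\<lambda>z. join (f1 (lft z)) (f2 (rgt z))) (bsum Y1 Y2)
    (\<lambda>z. join (g1 (lft z)) (g2 (rgt z))) (bsum Z1 Z2)"
proof (rule short_exactI)
  note b = bsum_lhom[OF mods(1,4)] and b' = bsum_lhom[OF mods(2,5)]
  show "(\<lambda>z. join (f1 (lft z)) (f2 (rgt z))) \<in> lhom R (bsum X1 X2) (bsum Y1 Y2)"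
    by (rule bsum_lhom_pair[OF lhom_comp[OF b(3) short_exactD(1)[OF se1]] lhom_comp[OF b(4) short_exactD(1)[OF se2]]])
  show "(\<lambda>z. join (g1 (lft z)) (g2 (rgt z))) \<in> lhom R (bsum Y1 Y2) (bsum Z1 Z2)"
    by (rule bsum_lhom_pair[OF lhom_comp[OF b'(3) short_exactD(2)[OF se1]] lhom_comp[OF b'(4) short_exactD(2)[OF se2]]])
  show "inj_on (\<lambda>z. join (f1 (lft z)) (f2 (rgt z))) (carrier (bsum X1 X2))"
  proof (rule inj_onI)
    fix z w assume zw: "z \<in> carrier (bsum X1 X2)" "w \<in> carrier (bsum X1 X2)"
      "join (f1 (lft z)) (f2 (rgt z)) = join (f1 (lft w)) (f2 (rgt w))"
    have "lft z = lft w"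
      by (rule inj_onD[OF short_exactD(3)[OF se1]]) (use zw in simp_all)
    moreover have "rgt z = rgt w"
      by (rule inj_onD[OF short_exactD(3)[OF se2]]) (use zw in simp_all)
    ultimately have "join (lft z) (rgt z) = join (lft w) (rgt w)"
      by (simp only:)
    then show "z = w"
      by simp
  qed
next
  fix z assume z: "z \<in> carrier (bsum Z1 Z2)"
  from z have "lft z \<in> carrier Z1" "rgt z \<in> carrier Z2"
    by simp_all
  from short_exactD(4)[OF se1 this(1)] short_exactD(4)[OF se2 this(2)]
  obtain y1 y2 where y: "y1 \<in> carrier Y1" "g1 y1 = lft z" "y2 \<in> carrier Y2" "g2 y2 = rgt z"
    by (elim bexE) (rule that)
  show "\<exists>y\<in>carrier (bsum Y1 Y2). join (g1 (lft y)) (g2 (rgt y)) = z"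
    by (rule bexI[of _ "join y1 y2"]) (simp_all add: y)
next
  fix y assume y: "y \<in> carrier (bsum Y1 Y2)" "join (g1 (lft y)) (g2 (rgt y)) = \<zero>\<^bsub>bsum Z1 Z2\<^esub>"
  then have y': "lft y \<in> carrier Y1" "g1 (lft y) = \<zero>\<^bsub>Z1\<^esub>" "rgt y \<in> carrier Y2" "g2 (rgt y) = \<zero>\<^bsub>Z2\<^esub>"
    by simp_all
  from short_exactD(5)[OF se1 y'(1,2)] short_exactD(5)[OF se2 y'(3,4)]
  obtain x1 x2 where x: "x1 \<in> carrier X1" "f1 x1 = lft y" "x2 \<in> carrier X2" "f2 x2 = rgt y"
    by (elim bexE) (rule that)
  show "\<exists>x\<in>carrier (bsum X1 X2). join (f1 (lft x)) (f2 (rgt x)) = y"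
    by (rule bexI[of _ "join x1 x2"]) (simp_all add: x)
next
  fix x assume "x \<in> carrier (bsum X1 X2)"
  then show "join (g1 (lft (join (f1 (lft x)) (f2 (rgt x))))) (g2 (rgt (join (f1 (lft x)) (f2 (rgt x))))) = \<zero>\<^bsub>bsum Z1 Z2\<^esub>"
    by (simp add: short_exactD(6)[OF se1] short_exactD(6)[OF se2])
qed

lemma short_exact_iso_right:
  assumes mods: "left_module R M" "left_module R N" and se: "short_exact R X f Y g M" and iso: "mod_iso R M N"
  shows "\<exists>g'. short_exact R X f Y g' N"
proof -
  from mod_iso_inverse[OF mods(1) iso]
  obtain h k where h: "h \<in> lhom R M N" "k \<in> lhom R N M" "\<forall>x\<in>carrier M. k (h x) = x" "\<forall>y\<in>carrier N. h (k y) = y"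
    by (elim bexE conjE) (rule that)
  note g = short_exactD(2)[OF se]
  have "short_exact R X f Y (\<lambda>y. h (g y)) N"
  proof (rule short_exactI[OF short_exactD(1)[OF se] lhom_comp[OF g h(1)] short_exactD(3)[OF se]])
    fix z assume z: "z \<in> carrier N"
    from short_exactD(4)[OF se lhom_closed[OF h(2) z]] obtain y where "y \<in> carrier Y" "g y = k z"
      by (rule bexE)
    then show "\<exists>y\<in>carrier Y. h (g y) = z"
      using h(4) z by (intro bexI[of _ y]) simp_all
  next
    fix y assume y: "y \<in> carrier Y" "h (g y) = \<zero>\<^bsub>N\<^esub>"
    have "g y = k (h (g y))"
      using h(3) lhom_closed[OF g y(1)] by simp
    also have "\<dots> = \<zero>\<^bsub>M\<^esub>"
      unfolding y(2) by (rule lhom_zero[OF mods(2,1) h(2)])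
    finally show "\<exists>x\<in>carrier X. f x = y"
      by (rule short_exactD(5)[OF se y(1)])
  next
    fix x assume "x \<in> carrier X"
    then show "h (g (f x)) = \<zero>\<^bsub>N\<^esub>"
      by (simp add: short_exactD(6)[OF se] lhom_zero[OF mods h(1)])
  qed
  then show ?thesis
    by (intro exI[of _ "\<lambda>y. h (g y)"])
qed

lemma short_exact_iso_left:
  assumes mods: "left_module R M" "left_module R N" and se: "short_exact R M f Y g Z" and iso: "mod_iso R M N"
  shows "\<exists>f'. short_exact R N f' Y g Z"
proof -
  from mod_iso_inverse[OF mods(1) iso]
  obtain h k where h: "h \<in> lhom R M N" "k \<in> lhom R N M" "\<forall>x\<in>carrier M. k (h x) = x" "\<forall>y\<in>carrier N. h (k y) = y"
    by (elim bexE conjE) (rule that)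
  note f = short_exactD(1)[OF se]
  have "short_exact R N (\<lambda>y. f (k y)) Y g Z"
  proof (rule short_exactI[OF lhom_comp[OF h(2) f] short_exactD(2)[OF se] _ short_exactD(4)[OF se]])
    show "inj_on (\<lambda>y. f (k y)) (carrier N)"
    proof (rule inj_onI)
      fix x y assume xy: "x \<in> carrier N" "y \<in> carrier N" "f (k x) = f (k y)"
      have "k x = k y"
        by (rule inj_onD[OF short_exactD(3)[OF se] xy(3)]) (use xy lhom_closed[OF h(2)] in simp_all)
      then have "h (k x) = h (k y)"
        by (simp only:)
      then show "x = y"
        using h(4) xy by simp
    qed
  next
    fix y assume "y \<in> carrier Y" "g y = \<zero>\<^bsub>Z\<^esub>"
    from short_exactD(5)[OF se this] obtain x where x: "x \<in> carrier M" "f x = y"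
      by (rule bexE)
    show "\<exists>x\<in>carrier N. f (k x) = y"
      by (rule bexI[of _ "h x"]) (use x h in \<open>simp_all add: lhom_closed\<close>)
  next
    fix x assume "x \<in> carrier N"
    then show "g (f (k x)) = \<zero>\<^bsub>Z\<^esub>"
      by (intro short_exactD(6)[OF se] lhom_closed[OF h(2)])
  qed
  then show ?thesis
    by (intro exI[of _ "\<lambda>y. f (k y)"])
qed

context nakayama
begin

text \<open>The approximation property of a complete cotorsion pair for a single module, named so
  that it can be transported along sums and isomorphisms. Having enough projective objects is
  expressed by the same notion.\<close>

definition app_r :: "'k nak_mod set \<Rightarrow> 'k nak_mod set \<Rightarrow> 'k nak_mod \<Rightarrow> bool" where
  "app_r \<Y> \<X> M \<longleftrightarrow> (\<exists>Y\<in>\<Y>. \<exists>X\<in>\<X>. \<exists>f g. short_exact A Y f X g M)"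

definition app_l :: "'k nak_mod set \<Rightarrow> 'k nak_mod set \<Rightarrow> 'k nak_mod \<Rightarrow> bool" where
  "app_l \<Y> \<X> M \<longleftrightarrow> (\<exists>Y\<in>\<Y>. \<exists>X\<in>\<X>. \<exists>f g. short_exact A M f Y g X)"

lemma app_rI: "short_exact A Y f X g M \<Longrightarrow> Y \<in> \<Y> \<Longrightarrow> X \<in> \<X> \<Longrightarrow> app_r \<Y> \<X> M"
  unfolding app_r_def by (intro bexI exI)

lemma app_lI: "short_exact A M f Y g X \<Longrightarrow> Y \<in> \<Y> \<Longrightarrow> X \<in> \<X> \<Longrightarrow> app_l \<Y> \<X> M"
  unfolding app_l_def by (intro bexI exI)

definition sum_closed :: "'k nak_mod set \<Rightarrow> bool" where
  "sum_closed \<X> \<longleftrightarrow> \<X> \<subseteq> fg_mods A \<and> (\<forall>M\<in>fg_mods A. carrier M = {\<zero>\<^bsub>M\<^esub>} \<longrightarrow> M \<in> \<X>) \<and> (\<forall>M\<in>\<X>. \<forall>N\<in>\<X>. bsum M N \<in> \<X>)"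

lemma sum_closed_modcls: "sum_closed (modcls T)"
  by (auto simp: sum_closed_def modcls_bsum modcls_trivial dest: modcls_fg)

lemma sum_closed_Int: "sum_closed \<X> \<Longrightarrow> sum_closed \<Y> \<Longrightarrow> sum_closed (\<X> \<inter> \<Y>)"
  by (auto simp: sum_closed_def)

lemma sum_closed_rel: "sum_closed {M \<in> fg_mods A. lproj \<K> M \<and> linj \<L> M}"
  unfolding sum_closed_def
  by (auto intro: lproj_bsum linj_bsum lproj_trivial linj_trivial fg_mods_module bsum_fg)

lemma trivial_module_ex: "U 0 0 \<in> fg_mods A" "carrier (U 0 0) = {\<zero>\<^bsub>U 0 0\<^esub>}"
  by (simp_all add: U_fg) (auto simp: fun_eq_iff)

lemma sum_closed_trivial:
  assumes "sum_closed \<X>"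
  shows "U 0 0 \<in> \<X>"
proof -
  have "\<forall>M\<in>fg_mods A. carrier M = {\<zero>\<^bsub>M\<^esub>} \<longrightarrow> M \<in> \<X>"
    using assms unfolding sum_closed_def by (elim conjE)
  from this[rule_format, OF trivial_module_ex] show ?thesis .
qed

lemma app_r_self:
  assumes "U 0 0 \<in> \<Y>" "M \<in> \<X>" "M \<in> fg_mods A"
  shows "app_r \<Y> \<X> M"
  by (rule app_rI[OF short_exact_zero_left[OF fg_mods_module[OF assms(3)] fg_mods_module[OF trivial_module_ex(1)]
    trivial_module_ex(2)] assms(1,2)])

lemma app_l_self:
  assumes "U 0 0 \<in> \<X>" "M \<in> \<Y>" "M \<in> fg_mods A"
  shows "app_l \<Y> \<X> M"
  by (rule app_lI[OF short_exact_zero_right[OF fg_mods_module[OF assms(3)] fg_mods_module[OF trivial_module_ex(1)]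
    trivial_module_ex(2)] assms(2,1)])

lemma app_r_bsum:
  assumes sc: "sum_closed \<Y>" "sum_closed \<X>" and fg: "M \<in> fg_mods A" "N \<in> fg_mods A" and app: "app_r \<Y> \<X> M" "app_r \<Y> \<X> N"
  shows "app_r \<Y> \<X> (bsum M N)"
proof -
  from app(1)[unfolded app_r_def] obtain Y1 X1 f1 g1 where 1: "Y1 \<in> \<Y>" "X1 \<in> \<X>" "short_exact A Y1 f1 X1 g1 M"
    by (elim bexE exE) (rule that)
  from app(2)[unfolded app_r_def] obtain Y2 X2 f2 g2 where 2: "Y2 \<in> \<Y>" "X2 \<in> \<X>" "short_exact A Y2 f2 X2 g2 N"
    by (elim bexE exE) (rule that)
  have m: "left_module A Y1" "left_module A X1" "left_module A Y2" "left_module A X2"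
    using sc 1 2 by (auto simp: sum_closed_def intro: fg_mods_module)
  show ?thesis
    by (rule app_rI[OF short_exact_bsum2[OF m(1,2) fg_mods_module[OF fg(1)] m(3,4) fg_mods_module[OF fg(2)] 1(3) 2(3)]])
      (use sc 1 2 in \<open>simp_all add: sum_closed_def\<close>)
qed

lemma app_l_bsum:
  assumes sc: "sum_closed \<Y>" "sum_closed \<X>" and fg: "M \<in> fg_mods A" "N \<in> fg_mods A" and app: "app_l \<Y> \<X> M" "app_l \<Y> \<X> N"
  shows "app_l \<Y> \<X> (bsum M N)"
proof -
  from app(1)[unfolded app_l_def] obtain Y1 X1 f1 g1 where 1: "Y1 \<in> \<Y>" "X1 \<in> \<X>" "short_exact A M f1 Y1 g1 X1"
    by (elim bexE exE) (rule that)
  from app(2)[unfolded app_l_def] obtain Y2 X2 f2 g2 where 2: "Y2 \<in> \<Y>" "X2 \<in> \<X>" "short_exact A N f2 Y2 g2 X2"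
    by (elim bexE exE) (rule that)
  have m: "left_module A Y1" "left_module A X1" "left_module A Y2" "left_module A X2"
    using sc 1 2 by (auto simp: sum_closed_def intro: fg_mods_module)
  show ?thesis
    by (rule app_lI[OF short_exact_bsum2[OF fg_mods_module[OF fg(1)] m(1,2) fg_mods_module[OF fg(2)] m(3,4) 1(3) 2(3)]])
      (use sc 1 2 in \<open>simp_all add: sum_closed_def\<close>)
qed

lemma app_r_modcls:
  assumes sc: "sum_closed \<Y>" "sum_closed \<X>"
    and U: "\<And>i l. i < n \<Longrightarrow> 1 \<le> l \<Longrightarrow> l \<le> t \<Longrightarrow> U i l \<in> modcls T \<Longrightarrow> app_r \<Y> \<X> (U i l)" and M: "M \<in> modcls T"
  shows "app_r \<Y> \<X> M"
  using M
proof (induction rule: modcls_induct)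
  case (zero M)
  then show ?case
    using sc by (intro app_r_self sum_closed_trivial) (auto simp: sum_closed_def)
next
  case (uni i l)
  then show ?case
    by (rule U)
next
  case (sum M N)
  then show ?case
    by (rule app_r_bsum[OF sc])
next
  case (iso M N)
  from iso(4)[unfolded app_r_def] obtain Y X f g where 1: "Y \<in> \<Y>" "X \<in> \<X>" "short_exact A Y f X g M"
    by (elim bexE exE) (rule that)
  from short_exact_iso_right[OF fg_mods_module[OF iso(1)] fg_mods_module[OF iso(2)] 1(3) iso(3)]
  obtain g' where "short_exact A Y f X g' N"
    by (rule exE)
  then show ?case
    by (rule app_rI[OF _ 1(1,2)])
qed

lemma app_l_modcls:
  assumes sc: "sum_closed \<Y>" "sum_closed \<X>"
    and U: "\<And>i l. i < n \<Longrightarrow> 1 \<le> l \<Longrightarrow> l \<le> t \<Longrightarrow> U i l \<in> modcls T \<Longrightarrow> app_l \<Y> \<X> (U i l)" and M: "M \<in> modcls T"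
  shows "app_l \<Y> \<X> M"
  using M
proof (induction rule: modcls_induct)
  case (zero M)
  then show ?case
    using sc by (intro app_l_self sum_closed_trivial) (auto simp: sum_closed_def)
next
  case (uni i l)
  then show ?case
    by (rule U)
next
  case (sum M N)
  then show ?case
    by (rule app_l_bsum[OF sc])
next
  case (iso M N)
  from iso(4)[unfolded app_l_def] obtain Y X f g where 1: "Y \<in> \<Y>" "X \<in> \<X>" "short_exact A M f Y g X"
    by (elim bexE exE) (rule that)
  from short_exact_iso_left[OF fg_mods_module[OF iso(1)] fg_mods_module[OF iso(2)] 1(3) iso(3)]
  obtain f' where "short_exact A N f' Y g X"
    by (rule exE)
  then show ?case
    by (rule app_lI[OF _ 1(1,2)])
qed

lemma modcls_empty: "modcls {} = fg_mods A"
  by (simp add: modcls_def)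

text \<open>Both classes are closed under sums and retracts, so the inclusion can be tested on
  uniserial modules.\<close>

lemma modcls_subset:
  assumes "\<And>i l. i < n \<Longrightarrow> 1 \<le> l \<Longrightarrow> l \<le> t \<Longrightarrow> U i l \<in> modcls T \<Longrightarrow> U i l \<in> modcls T'"
  shows "modcls T \<subseteq> modcls T'"
proof
  fix M assume "M \<in> modcls T"
  then show "M \<in> modcls T'"
  proof (induction rule: modcls_induct)
    case (iso M N)
    show ?case
      by (rule modcls_retract[OF iso(4,2) mod_iso_retract[OF fg_mods_module[OF iso(2)] mod_iso_sym[OF fg_mods_module[OF iso(1)] iso(3)]]])
  qed (use assms modcls_bsum modcls_trivial in auto)
qed

text \<open>
  Writing \<open>U i l\<close> as the interval from \<open>i\<close> to \<open>i + l\<close>: for \<open>a \<le> c \<le> b \<le> e\<close> the intervals form an exact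
  sequence \<open>0 \<rightarrow> [c, e) \<rightarrow> [a, e) \<oplus> [c, b) \<rightarrow> [a, b) \<rightarrow> 0\<close>.
\<close>

definition shift :: "'k \<Rightarrow> nat \<Rightarrow> (nat \<Rightarrow> 'k) \<Rightarrow> nat \<Rightarrow> 'k" where
  "shift c w x = (\<lambda>j. if j < w then 0 else c * x (j - w))"

definition trunc :: "nat \<Rightarrow> (nat \<Rightarrow> 'k) \<Rightarrow> nat \<Rightarrow> 'k" where
  "trunc u x = (\<lambda>j. if j < u then x j else 0)"

lemma shift_lhom:
  assumes l: "l + w \<le> t"
  shows "shift c w \<in> lhom A (U (a + w) l) (U a (l + w))"
proof -
  have l': "l \<le> t"
    using l by simp
  have cl: "shift c w x \<in> carrier (U a (l + w))" if "x \<in> carrier (U (a + w) l)" for x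
    using that by (simp add: shift_def)
  show ?thesis
  proof (rule lhom_gensI[OF U_module[OF l'] U_module[OF l] cl])
    fix d x assume x: "x \<in> carrier (U (a + w) l)"
    show "shift c w (sc d \<odot>\<^bsub>U (a + w) l\<^esub> x) = sc d \<odot>\<^bsub>U a (l + w)\<^esub> shift c w x"
      unfolding U_act[OF l' x] U_act[OF l cl[OF x]] by (auto simp: shift_def fun_eq_iff)
  next
    fix u x assume x: "x \<in> carrier (U (a + w) l)"
    show "shift c w (ee u \<odot>\<^bsub>U (a + w) l\<^esub> x) = ee u \<odot>\<^bsub>U a (l + w)\<^esub> shift c w x"
      unfolding U_act[OF l' x] U_act[OF l cl[OF x]] by (auto simp: shift_def fun_eq_iff)
  next
    fix r x assume x: "x \<in> carrier (U (a + w) l)"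
    show "shift c w (al r \<odot>\<^bsub>U (a + w) l\<^esub> x) = al r \<odot>\<^bsub>U a (l + w)\<^esub> shift c w x"
    proof
      fix j
      show "shift c w (al r \<odot>\<^bsub>U (a + w) l\<^esub> x) j = (al r \<odot>\<^bsub>U a (l + w)\<^esub> shift c w x) j"
        unfolding U_act[OF l' x] U_act[OF l cl[OF x]]
        by (cases "j < w"; cases "j < l + w"; cases "r + w \<le> j") (auto simp: shift_def add.commute)
    qed
  qed (auto simp: shift_def fun_eq_iff distrib_left)
qed

lemma trunc_lhom:
  assumes "u \<le> v" and v: "v \<le> t"
  shows "trunc u \<in> lhom A (U a v) (U a u)"
proof -
  have u: "u \<le> t"
    using assms by simp
  have cl: "trunc u x \<in> carrier (U a u)" for x
    by (simp add: trunc_def)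
  show ?thesis
  proof (rule lhom_gensI[OF U_module[OF v] U_module[OF u] cl])
    fix d x assume x: "x \<in> carrier (U a v)"
    show "trunc u (sc d \<odot>\<^bsub>U a v\<^esub> x) = sc d \<odot>\<^bsub>U a u\<^esub> trunc u x"
      unfolding U_act[OF v x] U_act[OF u cl] by (auto simp: trunc_def fun_eq_iff)
  next
    fix e x assume x: "x \<in> carrier (U a v)"
    show "trunc u (ee e \<odot>\<^bsub>U a v\<^esub> x) = ee e \<odot>\<^bsub>U a u\<^esub> trunc u x"
      unfolding U_act[OF v x] U_act[OF u cl] by (auto simp: trunc_def fun_eq_iff)
  next
    fix r x assume x: "x \<in> carrier (U a v)"
    show "trunc u (al r \<odot>\<^bsub>U a v\<^esub> x) = al r \<odot>\<^bsub>U a u\<^esub> trunc u x"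
      unfolding U_act[OF v x] U_act[OF u cl] using assms by (auto simp: trunc_def fun_eq_iff)
  qed (auto simp: trunc_def fun_eq_iff)
qed

text \<open>Here c = a + w, b = a + u and e = a + v; the scalar -1 makes the composite vanish. For w
  = u the second summand is 0 and [b, e) is the kernel of [a, e) over [a, b), a syzygy if v = t. For
  w = 1 and v = u + 1 the sequence is the almost split one ending in U a u.\<close>

lemma U_ses:
  assumes w: "w \<le> u" and u: "u \<le> v" and v: "v \<le> t"
  shows "\<exists>f g. short_exact A (U (a + w) (v - w)) f (bsum (U a v) (U (a + w) (u - w))) g (U a u)"
proof -
  have ut: "u \<le> t" and vw: "v - w \<le> t" and uw: "u - w \<le> t"
    using assms by auto
  have s1: "shift 1 w \<in> lhom A (U (a + w) (v - w)) (U a v)"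
    using shift_lhom[of "v - w" w 1 a] w u v by simp
  have s2: "shift (- 1) w \<in> lhom A (U (a + w) (u - w)) (U a u)"
    using shift_lhom[of "u - w" w "- 1" a] w u v by simp
  have t1: "trunc (u - w) \<in> lhom A (U (a + w) (v - w)) (U (a + w) (u - w))"
    by (rule trunc_lhom) (use assms in auto)
  have t2: "trunc u \<in> lhom A (U a v) (U a u)"
    by (rule trunc_lhom[OF u v])
  let ?f = "\<lambda>x. join (shift 1 w x) (trunc (u - w) x)"
  let ?g = "\<lambda>z. trunc u (lft z) \<oplus>\<^bsub>U a u\<^esub> shift (- 1) w (rgt z)"
  have "short_exact A (U (a + w) (v - w)) ?f (bsum (U a v) (U (a + w) (u - w))) ?g (U a u)"
  proof (rule short_exactI[OF bsum_lhom_pair[OF s1 t1] bsum_lhom_sum[OF U_module[OF ut] t2 s2]])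
    show "inj_on ?f (carrier (U (a + w) (v - w)))"
    proof (rule inj_onI)
      fix x y assume "?f x = ?f y"
      then have eq: "shift 1 w x = shift 1 w y"
        by simp
      show "x = y"
      proof
        fix j show "x j = y j"
          using fun_cong[OF eq, of "j + w"] by (simp add: shift_def)
      qed
    qed
  next
    fix z assume z: "z \<in> carrier (U a u)"
    have "?g (join z (\<lambda>_. 0)) = z"
      using z by (auto simp: trunc_def shift_def fun_eq_iff)
    moreover have "join z (\<lambda>_. 0) \<in> carrier (bsum (U a v) (U (a + w) (u - w)))"
      using z u by simp
    ultimately show "\<exists>y\<in>carrier (bsum (U a v) (U (a + w) (u - w))). ?g y = z"
      by (rule bexI)
  next
    fix y assume y: "y \<in> carrier (bsum (U a v) (U (a + w) (u - w)))" "?g y = \<zero>\<^bsub>U a u\<^esub>"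
    let ?x = "\<lambda>j. lft y (j + w)"
    have gy: "trunc u (lft y) j + shift (- 1) w (rgt y) j = 0" for j
      using fun_cong[OF y(2), of j] by simp
    have "shift 1 w ?x = lft y"
    proof
      fix j show "shift 1 w ?x j = lft y j"
        using gy[of j] w by (cases "j < w") (auto simp: shift_def trunc_def)
    qed
    moreover have "trunc (u - w) ?x = rgt y"
    proof
      fix j show "trunc (u - w) ?x j = rgt y j"
      proof (cases "j < u - w")
        case True
        then have "j + w < u"
          by simp
        then show ?thesis
          using gy[of "j + w"] True by (simp add: shift_def trunc_def)
      next
        case False
        then show ?thesis
          using y(1) by (simp add: trunc_def)
      qed
    qed
    ultimately have "?f ?x = y"
      by simp
    moreover have "?x \<in> carrier (U (a + w) (v - w))"
      using y(1) by simp
    ultimately show "\<exists>x\<in>carrier (U (a + w) (v - w)). ?f x = y"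
      by (rule bexI)
  next
    fix x assume x: "x \<in> carrier (U (a + w) (v - w))"
    show "?g (?f x) = \<zero>\<^bsub>U a u\<^esub>"
    proof -
      have "trunc u (shift 1 w x) j + shift (- 1) w (trunc (u - w) x) j = 0" for j
        using w by (cases "j < w"; cases "j < u") (auto simp: shift_def trunc_def)
      then show ?thesis
        by (simp add: fun_eq_iff)
    qed
  qed
  then show ?thesis
    by (intro exI)
qed

subsection \<open>Frobenius classes\<close>

lemma projectivesD:
  assumes "Q \<in> projectives R \<B>" "conflation R \<B> X f Y g Z" "h \<in> lhom R Q Z"
  shows "\<exists>h'\<in>lhom R Q Y. \<forall>x\<in>carrier Q. g (h' x) = h x"
  using assms(1) unfolding projectives_def mem_Collect_eq
  by (elim conjE) (erule allE[of _ X], erule allE[of _ f], erule allE[of _ Y], erule allE[of _ g], erule allE[of _ Z],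
    erule impE[OF _ assms(2)], erule bspec[OF _ assms(3)])

lemma injectivesD:
  assumes "Q \<in> injectives R \<B>" "conflation R \<B> X f Y g Z" "h \<in> lhom R X Q"
  shows "\<exists>h'\<in>lhom R Y Q. \<forall>x\<in>carrier X. h' (f x) = h x"
  using assms(1) unfolding injectives_def mem_Collect_eq
  by (elim conjE) (erule allE[of _ X], erule allE[of _ f], erule allE[of _ Y], erule allE[of _ g], erule allE[of _ Z],
    erule impE[OF _ assms(2)], erule bspec[OF _ assms(3)])

lemma projectives_retract:
  assumes "Q \<in> projectives A \<B>" "P \<in> \<B>" "retract A P Q"
  shows "P \<in> projectives A \<B>"
  unfolding projectives_def mem_Collect_eq
proof (intro conjI assms(2) allI impI ballI)
  fix X f Y g Z h assume c: "conflation A \<B> X f Y g Z" and h: "h \<in> lhom A P Z"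
  from assms(3)[unfolded retract_def]
  obtain i p where ip: "i \<in> lhom A P Q" "p \<in> lhom A Q P" "\<forall>x\<in>carrier P. p (i x) = x"
    by (elim bexE) (rule that)
  from projectivesD[OF assms(1) c lhom_comp[OF ip(2) h]]
  obtain h' where h': "h' \<in> lhom A Q Y" "\<forall>x\<in>carrier Q. g (h' x) = h (p x)"
    by (rule bexE)
  show "\<exists>h'\<in>lhom A P Y. \<forall>x\<in>carrier P. g (h' x) = h x"
    by (rule bexI[OF _ lhom_comp[OF ip(1) h'(1)]]) (use h'(2) ip in \<open>simp add: lhom_closed\<close>)
qed

lemma injectives_retract:
  assumes "Q \<in> injectives A \<B>" "P \<in> \<B>" "retract A P Q"
  shows "P \<in> injectives A \<B>"
  unfolding injectives_def mem_Collect_eq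
proof (intro conjI assms(2) allI impI ballI)
  fix X f Y g Z h assume c: "conflation A \<B> X f Y g Z" and h: "h \<in> lhom A X P"
  from assms(3)[unfolded retract_def]
  obtain i p where ip: "i \<in> lhom A P Q" "p \<in> lhom A Q P" "\<forall>x\<in>carrier P. p (i x) = x"
    by (elim bexE) (rule that)
  from injectivesD[OF assms(1) c lhom_comp[OF h ip(1)]]
  obtain h' where h': "h' \<in> lhom A Y Q" "\<forall>x\<in>carrier X. h' (f x) = i (h x)"
    by (rule bexE)
  show "\<exists>h'\<in>lhom A Y P. \<forall>x\<in>carrier X. h' (f x) = h x"
    by (rule bexI[OF _ lhom_comp[OF h'(1) ip(2)]]) (use h'(2) ip h in \<open>simp add: lhom_closed\<close>)
qed

text \<open>
  If enough objects are both projective and injective, then every projective, and every injective,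
  object is a retract of one of these.
\<close>

lemma frobeniusI:
  assumes B: "\<B> \<subseteq> fg_mods A" and G: "\<G> \<subseteq> projectives A \<B>" "\<G> \<subseteq> injectives A \<B>"
    and r: "\<And>Z. Z \<in> \<B> \<Longrightarrow> app_r \<B> \<G> Z" and l: "\<And>Z. Z \<in> \<B> \<Longrightarrow> app_l \<G> \<B> Z"
  shows "frobenius A \<B>" and "Q \<in> projectives A \<B> \<Longrightarrow> \<exists>Y\<in>\<G>. retract A Q Y"
proof -
  have GB: "\<G> \<subseteq> \<B>"
    using G(1) by (auto simp: projectives_def)
  have pr: "\<exists>Y\<in>\<G>. retract A Q Y" if Q: "Q \<in> projectives A \<B>" for Q
  proof -
    have QB: "Q \<in> \<B>"
      using Q by (simp add: projectives_def)
    from r[OF QB, unfolded app_r_def] obtain X Y f g where XY: "X \<in> \<B>" "Y \<in> \<G>" "short_exact A X f Y g Q"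
      by (elim bexE exE) (rule that)
    have "conflation A \<B> X f Y g Q"
      using XY QB GB by (auto simp: conflation_def)
    from projectivesD[OF Q this lhom_id] obtain s where s: "s \<in> lhom A Q Y" "\<forall>x\<in>carrier Q. g (s x) = x"
      by (rule bexE)
    have "retract A Q Y"
      by (rule retractI[OF s(1) short_exactD(2)[OF XY(3)]]) (use s(2) in simp)
    then show ?thesis
      by (rule bexI[OF _ XY(2)])
  qed
  then show "Q \<in> projectives A \<B> \<Longrightarrow> \<exists>Y\<in>\<G>. retract A Q Y"
    by simp
  have inj: "\<exists>Y\<in>\<G>. retract A Q Y" if Q: "Q \<in> injectives A \<B>" for Q
  proof -
    have QB: "Q \<in> \<B>"
      using Q by (simp add: injectives_def)
    from l[OF QB, unfolded app_l_def] obtain Y X f g where XY: "Y \<in> \<G>" "X \<in> \<B>" "short_exact A Q f Y g X"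
      by (elim bexE exE) (rule that)
    have "conflation A \<B> Q f Y g X"
      using XY QB GB by (auto simp: conflation_def)
    from injectivesD[OF Q this lhom_id] obtain s where s: "s \<in> lhom A Y Q" "\<forall>x\<in>carrier Q. s (f x) = x"
      by (rule bexE)
    have "retract A Q Y"
      by (rule retractI[OF short_exactD(1)[OF XY(3)] s(1)]) (use s(2) in simp)
    then show ?thesis
      by (rule bexI[OF _ XY(1)])
  qed
  have "projectives A \<B> = injectives A \<B>"
  proof (intro equalityI subsetI)
    fix Q assume Q: "Q \<in> projectives A \<B>"
    from pr[OF Q] obtain Y where "Y \<in> \<G>" "retract A Q Y"
      by (rule bexE)
    then show "Q \<in> injectives A \<B>"
      using injectives_retract[of Y \<B> Q] G(2) Q by (auto simp: projectives_def)
  next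
    fix Q assume Q: "Q \<in> injectives A \<B>"
    from inj[OF Q] obtain Y where "Y \<in> \<G>" "retract A Q Y"
      by (rule bexE)
    then show "Q \<in> projectives A \<B>"
      using projectives_retract[of Y \<B> Q] G(1) Q by (auto simp: injectives_def)
  qed
  moreover have "\<exists>X f Y g. conflation A \<B> X f Y g Z \<and> Y \<in> projectives A \<B>" if Z: "Z \<in> \<B>" for Z
  proof -
    from r[OF Z, unfolded app_r_def] obtain X Y f g where XY: "X \<in> \<B>" "Y \<in> \<G>" "short_exact A X f Y g Z"
      by (elim bexE exE) (rule that)
    have "conflation A \<B> X f Y g Z \<and> Y \<in> projectives A \<B>"
      using XY Z GB G(1) by (auto simp: conflation_def)
    then show ?thesis
      by (intro exI)
  qed
  moreover have "\<exists>f Y g X. conflation A \<B> Z f Y g X \<and> Y \<in> injectives A \<B>" if Z: "Z \<in> \<B>" for Z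
  proof -
    from l[OF Z, unfolded app_l_def] obtain Y X f g where XY: "Y \<in> \<G>" "X \<in> \<B>" "short_exact A Z f Y g X"
      by (elim bexE exE) (rule that)
    have "conflation A \<B> Z f Y g X \<and> Y \<in> injectives A \<B>"
      using XY Z GB G(2) by (auto simp: conflation_def)
    then show ?thesis
      by (intro exI)
  qed
  ultimately show "frobenius A \<B>"
    unfolding frobenius_def by simp
qed

text \<open>By \<open>frobeniusI\<close> every projective object is a retract of one in
  \<open>\<G>\<close>, hence lies in \<open>\<G>\<close> as soon as this class is closed under
  retracts.\<close>

lemma frobenius_pairI:
  assumes B: "\<B> \<subseteq> fg_mods A" and G: "\<G> \<subseteq> projectives A \<B>" "\<G> \<subseteq> injectives A \<B>"
    and r: "\<And>Z. Z \<in> \<B> \<Longrightarrow> app_r \<B> \<G> Z" and l: "\<And>Z. Z \<in> \<B> \<Longrightarrow> app_l \<G> \<B> Z"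
    and retr: "\<And>Q Y. Q \<in> \<B> \<Longrightarrow> Y \<in> \<G> \<Longrightarrow> retract A Q Y \<Longrightarrow> Q \<in> \<G>"
  shows "frobenius_pair A \<B> \<G>"
proof -
  have "projectives A \<B> \<subseteq> \<G>"
  proof
    fix Q assume Q: "Q \<in> projectives A \<B>"
    from frobeniusI(2)[OF B G r l Q] obtain Y where "Y \<in> \<G>" "retract A Q Y"
      by (rule bexE)
    then show "Q \<in> \<G>"
      using retr[of Q Y] Q by (simp add: projectives_def)
  qed
  then show ?thesis
    using frobeniusI(1)[OF B G r l] G(1) by (auto simp: frobenius_pair_def)
qed

end

section \<open>Coprime parameters, or Loewy length two\<close>

lemma cotorsion_pair_splits:
  fixes X Y :: "('r, nat \<Rightarrow> 'k) module"
  assumes "cotorsion_pair R \<X> \<Y>" "X \<in> \<X>" "Y \<in> \<Y>"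
  shows "splits R X Y"
proof -
  have X: "X \<in> left_perp R \<Y>" and Y: "Y \<in> right_perp R \<X>"
    using assms by (auto simp: cotorsion_pair_def)
  have "Ext1_vanishes R X Y"
    using X assms(3) by (simp add: left_perp_def)
  then show ?thesis
    using X Y Ext1_vanishes_iff_splits[of Y R X] by (simp add: left_perp_def right_perp_def)
qed

lemma cotorsion_pair_left:
  fixes X :: "('r, nat \<Rightarrow> 'k) module"
  assumes "cotorsion_pair R \<X> \<Y>" "X \<in> fg_mods R" "\<And>Y. Y \<in> \<Y> \<Longrightarrow> splits R X Y"
  shows "X \<in> \<X>"
proof -
  have eq: "left_perp R \<Y> = \<X>" "right_perp R \<X> = \<Y>"
    using assms(1) by (simp_all add: cotorsion_pair_def)
  have "Ext1_vanishes R X Y" if "Y \<in> \<Y>" for Y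
  proof -
    have "Y \<in> fg_mods R"
      using that unfolding eq(2)[symmetric] right_perp_def by simp
    then show ?thesis
      using assms(3)[OF that] Ext1_vanishes_iff_splits[OF _ assms(2)] by simp
  qed
  then show ?thesis
    using assms(2) unfolding eq(1)[symmetric] left_perp_def by simp
qed

lemma cotorsion_pair_right:
  fixes Y :: "('r, nat \<Rightarrow> 'k) module"
  assumes "cotorsion_pair R \<X> \<Y>" "Y \<in> fg_mods R" "\<And>X. X \<in> \<X> \<Longrightarrow> splits R X Y"
  shows "Y \<in> \<Y>"
proof -
  have eq: "left_perp R \<Y> = \<X>" "right_perp R \<X> = \<Y>"
    using assms(1) by (simp_all add: cotorsion_pair_def)
  have "Ext1_vanishes R X Y" if "X \<in> \<X>" for X
  proof -
    have "X \<in> fg_mods R"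
      using that unfolding eq(1)[symmetric] left_perp_def by simp
    then show ?thesis
      using assms(3)[OF that] Ext1_vanishes_iff_splits[OF assms(2)] by simp
  qed
  then show ?thesis
    using assms(2) unfolding eq(2)[symmetric] right_perp_def by simp
qed

lemma cotorsion_pair_fg:
  assumes "cotorsion_pair R \<X> \<Y>"
  shows "\<X> \<subseteq> fg_mods R" "\<Y> \<subseteq> fg_mods R"
  using assms by (auto simp: cotorsion_pair_def left_perp_def right_perp_def)

context nakayama
begin

text \<open>At every vertex the socle lies in the image of \<alpha>^(t-1). Among the nonzero
  uniserial modules only those of length t qualify, so this is the class of projective
  modules.\<close>

abbreviation (input) proj_conds :: "(nat \<times> nat \<times> nat) set" where
  "proj_conds \<equiv> {(j, 1, t - 1) | j. True}"

lemma U_proj_conds: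
  assumes "1 \<le> l" "l \<le> t"
  shows "U a l \<in> modcls proj_conds \<longleftrightarrow> l = t"
proof
  assume "U a l \<in> modcls proj_conds"
  then have "van (a + (l - 1)) 1 (t - 1) (U a l)"
    by (rule modcls_van) auto
  from this[unfolded van_U[OF assms(2)], rule_format, of "l - 1"] show "l = t"
    using assms by simp
next
  assume "l = t"
  then show "U a l \<in> modcls proj_conds"
    using U_fg[OF assms(2), of a] by (auto simp: modcls_def van_U)
qed

text \<open>For l = t the condition of \<open>lproj_U\<close> concerns only x = 0, as \<alpha>^0 is
  the identity.\<close>

lemma proj_conds_lproj:
  assumes "M \<in> modcls proj_conds"
  shows "lproj (fg_mods A) M"
  using assms
proof (rule lproj_modcls)
  fix i l assume l: "1 \<le> l" "l \<le> t" and U: "U i l \<in> modcls proj_conds"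
  show "lproj (fg_mods A) (U i l)"
  proof (rule lproj_U[OF l])
    fix X assume X: "X \<in> fg_mods A"
    interpret X: nak_module n t A X by (rule nak_moduleI[OF fg_mods_module[OF X]])
    have "l = t"
      using U unfolding U_proj_conds[OF l] .
    then show "van (i + l) (t - l) l X"
      by (auto simp: van_def X.act_laws intro!: bexI[of _ "\<zero>\<^bsub>X\<^esub>"])
  qed
qed

text \<open>For l = t the condition of \<open>linj_U\<close> asks for preimages under \<alpha>^0,
  which always exist. So projective modules are injective as well.\<close>

lemma proj_conds_linj:
  assumes "M \<in> modcls proj_conds"
  shows "linj (fg_mods A) M"
  using assms
proof (rule linj_modcls)
  fix i l assume l: "1 \<le> l" "l \<le> t" and U: "U i l \<in> modcls proj_conds"
  have i: "(i + n - 1 + 1) mod n = i mod n"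
    using n_pos by simp
  show "linj (fg_mods A) (U i l)"
  proof (rule linj_U[OF l i])
    fix X assume X: "X \<in> fg_mods A"
    interpret X: nak_module n t A X by (rule nak_moduleI[OF fg_mods_module[OF X]])
    have "l = t"
      using U unfolding U_proj_conds[OF l] .
    then show "van (i + n - 1) l (t - l) X"
      by (auto simp: van_def X.act_laws)
  qed
qed

lemma thick_retract:
  fixes M :: "'k nak_mod"
  assumes "thick A \<W>" "M \<in> fg_mods A" "N \<in> \<W>" "retract A M N"
  shows "M \<in> \<W>"
proof -
  have N: "N \<in> fg_mods A"
    using assms(1,3) by (auto simp: thick_def)
  have "\<forall>X\<in>fg_mods A. \<forall>Y\<in>\<W>. direct_summand A X Y \<longrightarrow> X \<in> \<W>"
    using assms(1) unfolding thick_def by (elim conjE)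
  from this[rule_format, OF assms(2,3) retract_imp_direct_summand[OF assms(2) N assms(4)]] show ?thesis .
qed

lemma thick_two_of_three:
  assumes "thick A \<W>" "short_exact A X f Y g Z" and fg: "X \<in> fg_mods A" "Y \<in> fg_mods A" "Z \<in> fg_mods A"
  shows "X \<in> \<W> \<Longrightarrow> Z \<in> \<W> \<Longrightarrow> Y \<in> \<W>" "Y \<in> \<W> \<Longrightarrow> Z \<in> \<W> \<Longrightarrow> X \<in> \<W>"
proof -
  have "\<forall>X\<in>fg_mods A. \<forall>Y\<in>fg_mods A. \<forall>Z\<in>fg_mods A. \<forall>f g. short_exact A X f Y g Z \<longrightarrow>
        (X \<in> \<W> \<and> Y \<in> \<W> \<longrightarrow> Z \<in> \<W>) \<and> (X \<in> \<W> \<and> Z \<in> \<W> \<longrightarrow> Y \<in> \<W>) \<and> (Y \<in> \<W> \<and> Z \<in> \<W> \<longrightarrow> X \<in> \<W>)"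
    using assms(1) unfolding thick_def by (elim conjE)
  from this[rule_format, OF fg assms(2)]
  show "X \<in> \<W> \<Longrightarrow> Z \<in> \<W> \<Longrightarrow> Y \<in> \<W>" "Y \<in> \<W> \<Longrightarrow> Z \<in> \<W> \<Longrightarrow> X \<in> \<W>"
    by simp_all
qed

lemma thick_bsum:
  assumes "thick A \<W>" "M \<in> \<W>" "N \<in> \<W>"
  shows "bsum M N \<in> \<W>"
proof -
  have fg: "M \<in> fg_mods A" "N \<in> fg_mods A"
    using assms by (auto simp: thick_def)
  show ?thesis
    by (rule thick_two_of_three(1)[OF assms(1) short_exact_bsum[OF fg_mods_module[OF fg(1)] fg_mods_module[OF fg(2)]]
      fg(1) bsum_fg[OF fg] fg(2) assms(2,3)])
qed

text \<open>Otherwise all uniserial summands of M, which lie in \<open>\<W>\<close> by thickness,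
  would have length t.\<close>

lemma thick_uniserial:
  assumes W: "thick A \<W>" and P: "modcls proj_conds \<subseteq> \<W>" and M: "M \<in> \<W>" "M \<notin> modcls proj_conds"
  shows "\<exists>a l. 1 \<le> l \<and> l < t \<and> U a l \<in> \<W>"
proof (rule ccontr)
  assume no: "\<nexists>a l. 1 \<le> l \<and> l < t \<and> U a l \<in> \<W>"
  have "M \<in> fg_mods A"
    using W M(1) by (auto simp: thick_def)
  then have "M \<in> \<W> \<longrightarrow> M \<in> modcls proj_conds"
  proof (induction rule: nak_induct)
    case (zero M)
    then show ?case
      using modcls_trivial by simp
  next
    case (step M K i l)
    note mods = U_module[OF step(5), of i] fg_mods_module[OF step(2)]
    have Mb: "retract A M (bsum (U i l) K)"
      by (rule mod_iso_retract[OF fg_mods_module[OF step(1)] mod_iso_sym[OF bsum_module[OF mods] step(6)]])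
    have bM: "retract A (bsum (U i l) K) M"
      by (rule mod_iso_retract[OF bsum_module[OF mods] step(6)])
    show ?case
    proof
      assume MW: "M \<in> \<W>"
      have K: "K \<in> \<W>"
        by (rule thick_retract[OF W step(2) MW retract_trans[OF bsum_retract(2)[OF mods] bM]])
      have Uil: "U i l \<in> \<W>"
        by (rule thick_retract[OF W U_fg[OF step(5)] MW retract_trans[OF bsum_retract(1)[OF mods] bM]])
      have "\<not> l < t"
        using no step(4) Uil by auto
      then have "U i l \<in> modcls proj_conds"
        unfolding U_proj_conds[OF step(4,5)] using step(5) by simp
      moreover have "K \<in> modcls proj_conds"
        using step(7) K by simp
      ultimately have "bsum (U i l) K \<in> modcls proj_conds"
        by (rule modcls_bsum)
      then show "M \<in> modcls proj_conds"
        by (rule modcls_retract[OF _ step(1) Mb])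
    qed
  qed
  then show False
    using M by simp
qed

lemma thick_all:
  assumes W: "thick A \<W>" and P: "modcls proj_conds \<subseteq> \<W>" and M: "M \<in> \<W>" "M \<notin> modcls proj_conds"
    and nt: "coprime n t \<or> t = 2"
  shows "fg_mods A \<subseteq> \<W>"
proof -
  have zero: "U b 0 \<in> \<W>" for b
    by (rule subsetD[OF P modcls_trivial[OF U_fg]]) (auto simp: fun_eq_iff)
  have top: "U b t \<in> \<W>" for b
    using P U_proj_conds[of t b] t_ge_2 by auto
  note tt = thick_two_of_three[OF W]
  \<comment> \<open>The projective cover of U a l is U a t, with kernel U (a + l) (t - l).\<close>
  have \<Omega>: "U (a + l) (t - l) \<in> \<W>" if l: "l \<le> t" and U: "U a l \<in> \<W>" for a l
  proof -
    from U_ses[OF order_refl l order_refl, of a]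
    obtain f g where se: "short_exact A (U (a + l) (t - l)) f (bsum (U a t) (U (a + l) (l - l))) g (U a l)"
      by (elim exE) (rule that)
    show ?thesis
      by (rule tt(2)[OF se U_fg bsum_fg[OF U_fg U_fg] U_fg[OF l] thick_bsum[OF W top] U])
        (use zero in simp_all)
  qed
  have \<Omega>2: "U (a + t) l \<in> \<W>" if l: "l \<le> t" and U: "U a l \<in> \<W>" for a l
    using \<Omega>[OF _ \<Omega>[OF l U]] l by simp
  obtain a l where l: "1 \<le> l" "l < t" and U: "U a l \<in> \<W>"
    using thick_uniserial[OF W P M] by auto
  have all: "U b l \<in> \<W>" for b
    using nt
  proof
    assume cop: "coprime n t"
    have iter: "U (a + k * t) l \<in> \<W>" for k
    proof (induction k)
      case (Suc k)
      show ?case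
        using \<Omega>2[OF less_imp_le[OF l(2)] Suc] by (simp add: algebra_simps)
    qed (use U in simp)
    \<comment> \<open>With x inverse to t modulo n, x times b - a double syzygies lead from a to b;
      \<open>b + a * n - a\<close> represents b - a.\<close>
    obtain x where x: "[t * x = 1] (mod n)"
      using cong_solve_coprime_nat[of t n] cop by (auto simp: coprime_commute)
    have "[t * x * (b + a * n - a) = 1 * (b + a * n - a)] (mod n)"
      by (rule cong_scalar_right[OF x])
    then have "[a + (x * (b + a * n - a)) * t = a + (b + a * n - a)] (mod n)"
      by (intro cong_add_lcancel_nat[THEN iffD2]) (simp add: algebra_simps)
    moreover have "a \<le> a * n"
      using n_pos by simp
    ultimately have "(a + (x * (b + a * n - a)) * t) mod n = b mod n"
      by (simp add: cong_def)
    then show ?thesis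
      using iter[of "x * (b + a * n - a)"] U_cong by metis
  next
    \<comment> \<open>The only length below t is 1, and a single syzygy moves the simple module to
      the next vertex.\<close>
    assume t: "t = 2"
    then have l1: "l = 1"
      using l by simp
    have iter: "U (a + k) l \<in> \<W>" for k
    proof (induction k)
      case (Suc k)
      show ?case
        using \<Omega>[OF less_imp_le[OF l(2)] Suc] by (simp add: l1 t)
    qed (use U in simp)
    have "a \<le> a * n"
      using n_pos by simp
    then have "a + (b + a * n - a) = b + a * n"
      by linarith
    then have "(a + (b + a * n - a)) mod n = b mod n"
      by simp
    then show ?thesis
      using iter[of "b + a * n - a"] U_cong by metis
  qed
  \<comment> \<open>In the almost split sequence ending in U b (Suc l) both ends have the same
    length, so both lie in \<open>\<W>\<close>; hence so does the middle, which has U (b + 1) l as a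
    summand.\<close>
  have down: "(\<forall>b. U b l \<in> \<W>) \<longrightarrow> (\<forall>b. U b 1 \<in> \<W>)" if "1 \<le> l" "l < t" for l
    using that
  proof (induction l rule: dec_induct)
    case (step l)
    show ?case
    proof
      assume h: "\<forall>b. U b (Suc l) \<in> \<W>"
      have lt: "Suc l \<le> Suc (Suc l)" "Suc (Suc l) \<le> t" "1 \<le> Suc l"
        using step by simp_all
      have "U (b + 1) l \<in> \<W>" for b
      proof -
        from U_ses[OF lt(3,1,2), of b]
        obtain f g where se: "short_exact A (U (b + 1) (Suc (Suc l) - 1)) f
            (bsum (U b (Suc (Suc l))) (U (b + 1) (Suc l - 1))) g (U b (Suc l))"
          by (elim exE) (rule that)
        have lt': "l \<le> t" "Suc l \<le> t"
          using lt by simp_all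
        have B: "bsum (U b (Suc (Suc l))) (U (b + 1) (Suc l - 1)) \<in> \<W>"
          by (rule tt(1)[OF se U_fg bsum_fg[OF U_fg U_fg] U_fg]) (use lt h in simp_all)
        have "retract A (U (b + 1) (Suc l - 1)) (bsum (U b (Suc (Suc l))) (U (b + 1) (Suc l - 1)))"
          by (rule bsum_retract(2)[OF U_module U_module]) (use lt in simp_all)
        then have "U (b + 1) (Suc l - 1) \<in> \<W>"
          by (rule thick_retract[OF W U_fg B, rotated]) (use lt in simp)
        then show ?thesis
          by simp
      qed
      \<comment> \<open>Every vertex is a successor: b is \<open>b + n - 1 + 1\<close> modulo
        n.\<close>
      then have "U b l \<in> \<W>" for b
        using U_cong[of "b + n - 1 + 1" b l] n_pos by (metis add.commute le_add_diff_inverse2 mod_add_self2 trans_le_add2)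
      then show "\<forall>b. U b 1 \<in> \<W>"
        using step by simp
    qed
  qed simp
  have simp1: "U b 1 \<in> \<W>" for b
    using down[OF l] all by simp
  \<comment> \<open>U b (Suc l) is an extension of the simple module at b by U (b + 1) l.\<close>
  have every: "\<forall>b. l \<le> t \<longrightarrow> U b l \<in> \<W>" for l
  proof (induction l)
    case 0
    then show ?case
      using zero by simp
  next
    case (Suc l)
    show ?case
    proof (intro allI impI)
      fix b assume lt: "Suc l \<le> t"
      have "1 \<le> Suc l"
        by simp
      from U_ses[OF order_refl this lt, of b]
      obtain f g where se: "short_exact A (U (b + 1) (Suc l - 1)) f (bsum (U b (Suc l)) (U (b + 1) (1 - 1))) g (U b 1)"
        by (elim exE) (rule that)
      have B: "bsum (U b (Suc l)) (U (b + 1) (1 - 1)) \<in> \<W>"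
        by (rule tt(1)[OF se U_fg bsum_fg[OF U_fg U_fg] U_fg]) (use lt Suc simp1 in simp_all)
      show "U b (Suc l) \<in> \<W>"
        by (rule thick_retract[OF W U_fg[OF lt] B bsum_retract(1)[OF U_module U_module]]) (use lt in simp_all)
    qed
  qed
  show ?thesis
  proof
    fix M :: "'k nak_mod" assume "M \<in> fg_mods A"
    then show "M \<in> \<W>"
    proof (induction rule: nak_induct)
      case (zero M)
      then show ?case
        by (rule subsetD[OF P modcls_trivial])
    next
      case (step M K i l)
      have "bsum (U i l) K \<in> \<W>"
        by (rule thick_bsum[OF W _ step(7)]) (use every step(5) in simp)
      then show ?case
        by (rule thick_retract[OF W step(1)])
          (rule mod_iso_retract[OF fg_mods_module[OF step(1)]
            mod_iso_sym[OF bsum_module[OF U_module[OF step(5)] fg_mods_module[OF step(2)]] step(6)]])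
    qed
  qed
qed

lemma hovey_frobenius_pair:
  fixes \<C> :: "'k nak_mod set"
  assumes H: "hovey_triple A \<C> \<F> \<W>" and nt: "coprime n t \<or> t = 2"
  shows "frobenius_pair A (\<C> \<inter> \<F>) (\<C> \<inter> \<F> \<inter> \<W>)"
proof -
  have cc: "complete_cotorsion_pair A (\<C> \<inter> \<W>) \<F>" "complete_cotorsion_pair A \<C> (\<F> \<inter> \<W>)" and W: "thick A \<W>"
    using H by (simp_all add: hovey_triple_def)
  then have c: "cotorsion_pair A (\<C> \<inter> \<W>) \<F>" "cotorsion_pair A \<C> (\<F> \<inter> \<W>)"
    by (simp_all add: complete_cotorsion_pair_def)
  note fg = cotorsion_pair_fg(2)[OF c(1)] cotorsion_pair_fg(1)[OF c(2)]
  have Wfg: "\<W> \<subseteq> fg_mods A"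
    using W by (simp add: thick_def)
  \<comment> \<open>Projective modules are orthogonal to everything, so they lie in the left class
    of every cotorsion pair; in particular \<open>\<W>\<close> contains them, as
    \<open>thick_all\<close> requires.\<close>
  have PCW: "M \<in> \<C> \<inter> \<W>" if M: "M \<in> modcls proj_conds" for M
    by (rule cotorsion_pair_left[OF c(1) modcls_fg[OF M]], rule lproj_splits[OF proj_conds_lproj[OF M]])
      (use fg M modcls_fg in auto)
  have PFW: "M \<in> \<F> \<inter> \<W>" if M: "M \<in> modcls proj_conds" for M
    by (rule cotorsion_pair_right[OF c(2) modcls_fg[OF M]], rule linj_splits[OF proj_conds_linj[OF M]])
      (use fg M modcls_fg in auto)
  show ?thesis
  proof (cases "\<W> \<subseteq> modcls proj_conds")
    case True
    have F: "\<F> = fg_mods A"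
    proof (rule equalityI[OF fg(1)], rule subsetI)
      fix M :: "'k nak_mod" assume M: "M \<in> fg_mods A"
      show "M \<in> \<F>"
        by (rule cotorsion_pair_right[OF c(1) M], rule lproj_splits[OF proj_conds_lproj M M])
          (use True Wfg in auto)
    qed
    have C: "\<C> = fg_mods A"
    proof (rule equalityI[OF fg(2)], rule subsetI)
      fix M :: "'k nak_mod" assume M: "M \<in> fg_mods A"
      show "M \<in> \<C>"
        by (rule cotorsion_pair_left[OF c(2) M], rule linj_splits[OF proj_conds_linj M _ M])
          (use True Wfg in auto)
    qed
    have eq: "\<C> \<inter> \<F> = fg_mods A" "fg_mods A \<inter> \<W> = \<W>"
      using C F Wfg by auto
    \<comment> \<open>With \<open>\<C>\<close> and \<open>\<F>\<close> equal to the whole category,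
      the approximations of the two cotorsion pairs provide enough projective and enough injective
      objects in \<open>\<W>\<close>.\<close>
    have r: "app_r (fg_mods A) \<W> Z" if "Z \<in> fg_mods A" for Z
      using cc(1) that Wfg unfolding complete_cotorsion_pair_def app_r_def C F by (simp add: Int_absorb1)
    have l: "app_l \<W> (fg_mods A) Z" if "Z \<in> fg_mods A" for Z
      using cc(2) that Wfg unfolding complete_cotorsion_pair_def app_l_def C F by (simp add: Int_absorb1)
    show ?thesis
      unfolding eq
    proof (rule frobenius_pairI[OF order_refl _ _ r l])
      show "\<W> \<subseteq> projectives A (fg_mods A)" "\<W> \<subseteq> injectives A (fg_mods A)"
        using True Wfg by (auto intro!: lproj_projectives linj_injectives proj_conds_lproj proj_conds_linj)
      show "\<And>Q Y. Q \<in> fg_mods A \<Longrightarrow> Y \<in> \<W> \<Longrightarrow> retract A Q Y \<Longrightarrow> Q \<in> \<W>"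
        by (rule thick_retract[OF W])
    qed
  next
    case False
    then obtain M where M: "M \<in> \<W>" "M \<notin> modcls proj_conds"
      by auto
    have "fg_mods A \<subseteq> \<W>"
      by (rule thick_all[OF W _ M nt]) (use PCW in auto)
    then have eq: "\<C> \<inter> \<F> \<inter> \<W> = \<C> \<inter> \<F>" "\<C> \<inter> \<W> = \<C>"
      using fg by auto
    \<comment> \<open>Now \<open>\<C>\<close> and \<open>\<F>\<close> themselves form a cotorsion
      pair, so Ext^1 vanishes between the end terms of each conflation.\<close>
    note c1 = c(1)[unfolded eq]
    have U0: "U 0 0 \<in> \<C> \<inter> \<F>"
      using PCW PFW modcls_trivial[OF trivial_module_ex] by auto
    have B: "\<C> \<inter> \<F> \<subseteq> fg_mods A"
      using fg by auto
    have pr: "\<C> \<inter> \<F> \<subseteq> projectives A (\<C> \<inter> \<F>)"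
    proof
      fix Q assume Q: "Q \<in> \<C> \<inter> \<F>"
      show "Q \<in> projectives A (\<C> \<inter> \<F>)"
        unfolding projectives_def mem_Collect_eq
      proof (intro conjI Q allI impI ballI)
        fix X f Y g Z h assume *: "conflation A (\<C> \<inter> \<F>) X f Y g Z" and h: "h \<in> lhom A Q Z"
        then have XYZ: "X \<in> \<F>" "Y \<in> fg_mods A" "Z \<in> \<C>" "short_exact A X f Y g Z"
          using B by (auto simp: conflation_def)
        from splitsD[OF cotorsion_pair_splits[OF c1 XYZ(3,1)] XYZ(2,4)]
        obtain s where s: "s \<in> lhom A Z Y" "\<forall>z\<in>carrier Z. g (s z) = z"
          by (rule bexE)
        show "\<exists>h'\<in>lhom A Q Y. \<forall>x\<in>carrier Q. g (h' x) = h x"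
          by (rule bexI[OF _ lhom_comp[OF h s(1)]]) (use s(2) lhom_closed[OF h] in simp)
      qed
    qed
    have inj: "\<C> \<inter> \<F> \<subseteq> injectives A (\<C> \<inter> \<F>)"
    proof
      fix Q assume Q: "Q \<in> \<C> \<inter> \<F>"
      show "Q \<in> injectives A (\<C> \<inter> \<F>)"
        unfolding injectives_def mem_Collect_eq
      proof (intro conjI Q allI impI ballI)
        fix X f Y g Z h assume *: "conflation A (\<C> \<inter> \<F>) X f Y g Z" and h: "h \<in> lhom A X Q"
        then have XYZ: "X \<in> \<F>" "Y \<in> fg_mods A" "Z \<in> \<C>" "short_exact A X f Y g Z" and fgs: "X \<in> fg_mods A" "Z \<in> fg_mods A"
          using B by (auto simp: conflation_def)
        from splitsD[OF cotorsion_pair_splits[OF c1 XYZ(3,1)] XYZ(2,4)]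
        obtain s where s: "s \<in> lhom A Z Y" "\<forall>z\<in>carrier Z. g (s z) = z"
          by (rule bexE)
        have "\<exists>r\<in>lhom A Y X. (\<forall>x\<in>carrier X. r (f x) = x) \<and> (\<forall>y\<in>carrier Y. f (r y) = y \<ominus>\<^bsub>Y\<^esub> s (g y))"
          by (rule section_imp_retraction[OF XYZ(4) fg_mods_module[OF fgs(1)] fg_mods_module[OF XYZ(2)]
            fg_mods_module[OF fgs(2)] s(1)]) (use s(2) in simp)
        then obtain r where r: "r \<in> lhom A Y X" "\<forall>x\<in>carrier X. r (f x) = x"
          by (elim bexE conjE) (rule that)
        show "\<exists>h'\<in>lhom A Y Q. \<forall>x\<in>carrier X. h' (f x) = h x"
          by (rule bexI[OF _ lhom_comp[OF r(1) h]]) (use r(2) in simp)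
      qed
    qed
    show ?thesis
      unfolding eq
    proof (rule frobenius_pairI[OF B pr inj])
      \<comment> \<open>Every object is its own approximation, with the zero module as the remaining
        term.\<close>
      fix Z assume Z: "Z \<in> \<C> \<inter> \<F>"
      then have "Z \<in> fg_mods A"
        using B by auto
      with Z U0 show "app_r (\<C> \<inter> \<F>) (\<C> \<inter> \<F>) Z" "app_l (\<C> \<inter> \<F>) (\<C> \<inter> \<F>) Z"
        by (simp_all only: app_r_self app_l_self)
    qed
  qed
qed

end

section \<open>The exceptional Hovey triple\<close>

context nakayama
begin

lemma lproj_mono: "lproj \<K>' Q \<Longrightarrow> \<K> \<subseteq> \<K>' \<Longrightarrow> lproj \<K> Q"
  by (rule lprojI, erule lprojD) auto

lemma linj_mono: "linj \<K>' Q \<Longrightarrow> \<K> \<subseteq> \<K>' \<Longrightarrow> linj \<K> Q"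
  by (rule linjI, erule linjD) auto

lemma U_t_proj_conds: "U a t \<in> modcls proj_conds"
  using U_proj_conds[of t a] t_ge_2 by simp

lemma U_t_lproj: "\<K> \<subseteq> fg_mods A \<Longrightarrow> lproj \<K> (U a t)"
  by (rule lproj_mono[OF proj_conds_lproj[OF U_t_proj_conds]])

lemma U_t_linj: "\<K> \<subseteq> fg_mods A \<Longrightarrow> linj \<K> (U a t)"
  by (rule linj_mono[OF proj_conds_linj[OF U_t_proj_conds]])

lemma modcls_Un: "modcls (S \<union> T) = modcls S \<inter> modcls T"
  by (auto simp: modcls_def ball_Un)

lemma U_0_modcls: "U a 0 \<in> modcls T"
  by (rule modcls_trivial[OF U_fg]) (auto simp: fun_eq_iff)

text \<open>The sequence of \<open>U_ses\<close> read as a covering of [a, b) by [a, e) and [c,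
  b).\<close>

lemma app_r_ses:
  assumes "sum_closed \<X>" "w \<le> u" "u \<le> v" "v \<le> t"
    and "U (a + w) (v - w) \<in> \<Y>" "U a v \<in> \<X>" "U (a + w) (u - w) \<in> \<X>"
  shows "app_r \<Y> \<X> (U a u)"
proof -
  from U_ses[OF assms(2-4), of a]
  obtain f g where "short_exact A (U (a + w) (v - w)) f (bsum (U a v) (U (a + w) (u - w))) g (U a u)"
    by (elim exE) (rule that)
  then show ?thesis
    by (rule app_rI[OF _ assms(5)]) (use assms in \<open>simp add: sum_closed_def\<close>)
qed

text \<open>The same sequence read as an embedding of [c, e) into [a, e) and [c, b).\<close>

lemma app_l_ses:
  assumes "sum_closed \<Y>" "w \<le> u" "u \<le> v" "v \<le> t"
    and "U a v \<in> \<Y>" "U (a + w) (u - w) \<in> \<Y>" "U a u \<in> \<X>"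
  shows "app_l \<Y> \<X> (U (a + w) (v - w))"
proof -
  from U_ses[OF assms(2-4), of a]
  obtain f g where "short_exact A (U (a + w) (v - w)) f (bsum (U a v) (U (a + w) (u - w))) g (U a u)"
    by (elim exE) (rule that)
  then show ?thesis
    by (rule app_lI[OF _ _ assms(7)]) (use assms in \<open>simp add: sum_closed_def\<close>)
qed

text \<open>Approximations pass to sums, so they need only be given for uniserial modules; the empty
  set of conditions stands for all modules.\<close>

lemma complete_cotorsion_pair_modcls:
  assumes ort: "\<And>X Y. X \<in> modcls S \<Longrightarrow> Y \<in> modcls T \<Longrightarrow> splits A X Y"
    and r: "\<And>a l. 1 \<le> l \<Longrightarrow> l \<le> t \<Longrightarrow> app_r (modcls T) (modcls S) (U a l)"
    and l: "\<And>a l. 1 \<le> l \<Longrightarrow> l \<le> t \<Longrightarrow> app_l (modcls T) (modcls S) (U a l)"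
  shows "complete_cotorsion_pair A (modcls S) (modcls T)"
proof (rule complete_cotorsion_pairI[OF _ _ _ _ ort])
  show "modcls S \<subseteq> fg_mods A" "modcls T \<subseteq> fg_mods A"
    by (auto dest: modcls_fg)
  show "M \<in> modcls S" if "M \<in> fg_mods A" "X \<in> modcls S" "retract A M X" for M X
    by (rule modcls_retract[OF that(2,1,3)])
  show "M \<in> modcls T" if "M \<in> fg_mods A" "X \<in> modcls T" "retract A M X" for M X
    by (rule modcls_retract[OF that(2,1,3)])
  fix M :: "'k nak_mod" assume "M \<in> fg_mods A"
  then have M: "M \<in> modcls {}"
    by (simp add: modcls_empty)
  show "\<exists>Y\<in>modcls T. \<exists>X\<in>modcls S. \<exists>f g. short_exact A Y f X g M"
    unfolding app_r_def[symmetric] by (rule app_r_modcls[OF sum_closed_modcls sum_closed_modcls r M])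
  show "\<exists>Y\<in>modcls T. \<exists>X\<in>modcls S. \<exists>f g. short_exact A M f Y g X"
    unfolding app_l_def[symmetric] by (rule app_l_modcls[OF sum_closed_modcls sum_closed_modcls l M])
qed

text \<open>The two sums may have different index and carrier types: the second one runs over pairs
  or over R, and for \<open>\<W>\<close> its summands are themselves sums of two modules.\<close>

lemma add_class_direct_sum:
  fixes X :: "'i \<Rightarrow> ('k nak, 'x) module" and Y :: "'j \<Rightarrow> ('k nak, 'y) module"
  assumes I: "finite I" "\<And>i. i \<in> I \<Longrightarrow> X i \<in> fg_mods A" "\<And>i j p q. i \<in> I \<Longrightarrow> (j, p, q) \<in> T \<Longrightarrow> van j p q (X i)"
    and K: "finite K" "\<And>i. i \<in> K \<Longrightarrow> Y i \<in> fg_mods A" "\<And>i j p q. i \<in> K \<Longrightarrow> (j, p, q) \<in> T \<Longrightarrow> van j p q (Y i)"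
    and cover: "\<And>a l. a < n \<Longrightarrow> 1 \<le> l \<Longrightarrow> l \<le> t \<Longrightarrow> U a l \<in> modcls T \<Longrightarrow>
      (\<exists>i\<in>I. retract A (U a l) (X i)) \<or> (\<exists>i\<in>K. retract A (U a l) (Y i))"
  shows "add_class A (direct_sum I X \<oplus>\<^sub>m direct_sum K Y) = (modcls T :: 'k nak_mod set)"
proof (rule add_class_eq_modcls)
  note mX = fg_mods_module[OF I(2)] and mY = fg_mods_module[OF K(2)]
  have R: "ring A"
    by (rule A.ring_axioms)
  note m = direct_sum_module[OF I(1) R mX] direct_sum_module[OF K(1) R mY]
  show "direct_sum I X \<oplus>\<^sub>m direct_sum K Y \<in> fg_mods A"
    by (rule direct_sum2_fg[OF direct_sum_fg[OF I(1) R I(2)] direct_sum_fg[OF K(1) R K(2)]])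
  show "van j p q (direct_sum I X \<oplus>\<^sub>m direct_sum K Y)" if "(j, p, q) \<in> T" for j p q
    by (rule van_direct_sum2[OF m van_direct_sum[OF I(1) mX I(3)[OF _ that]] van_direct_sum[OF K(1) mY K(3)[OF _ that]]])
  fix a l assume *: "a < n" "1 \<le> l" "l \<le> t" "U a l \<in> modcls T"
  have r1: "retract A (direct_sum I X) (direct_sum I X \<oplus>\<^sub>m direct_sum K Y)"
    by (rule retractI[OF direct_sum2_lhom(1)[OF m] direct_sum2_lhom(3)[OF m]]) simp_all
  have r2: "retract A (direct_sum K Y) (direct_sum I X \<oplus>\<^sub>m direct_sum K Y)"
    by (rule retractI[OF direct_sum2_lhom(2)[OF m] direct_sum2_lhom(4)[OF m]]) simp_all
  from cover[OF *] show "retract A (U a l) (direct_sum I X \<oplus>\<^sub>m direct_sum K Y)"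
  proof (elim disjE bexE)
    fix i assume i: "i \<in> I" "retract A (U a l) (X i)"
    have "retract A (X i) (direct_sum I X)"
      by (rule direct_sum_retract[OF I(1) mX i(1)])
    then show ?thesis
      by (rule retract_trans[OF retract_trans[OF i(2)] r1])
  next
    fix i assume i: "i \<in> K" "retract A (U a l) (Y i)"
    have "retract A (Y i) (direct_sum K Y)"
      by (rule direct_sum_retract[OF K(1) mY i(1)])
    then show ?thesis
      by (rule retract_trans[OF retract_trans[OF i(2)] r2])
  qed
qed

end

locale exceptional_nakayama = nakayama n t A for n t :: nat and A :: "'k::field nak ring" +
  fixes d :: nat
  assumes d_gcd: "d = gcd n t" and d_ge_2: "d \<ge> 2" and t_ge_3: "t \<ge> 3"
begin

section \<open>Arithmetic modulo d\<close>

lemma d_dvd: "d dvd n" "d dvd t"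
  by (simp_all add: d_gcd)

lemma dvd_cong: "x mod n = y mod n \<Longrightarrow> d dvd x \<longleftrightarrow> d dvd y"
  using dvd_mod_iff[OF d_dvd(1), of x] dvd_mod_iff[OF d_dvd(1), of y] by simp

text \<open>Membership in R is unaffected by a double syzygy.\<close>

lemma dvd_add_t: "d dvd x + t \<longleftrightarrow> d dvd x"
  by (rule dvd_add_left_iff[OF d_dvd(2)])

text \<open>Here d \<ge> 2 enters: R contains no two neighbouring vertices.\<close>

lemma not_dvd_Suc: "d dvd x \<Longrightarrow> \<not> d dvd Suc x"
  using d_ge_2 dvd_add_right_iff[of d x 1] by auto

text \<open>
  On the modules \<open>U a l\<close> these conditions are those by which the theorem selects the summands of
  \<open>\<C>\<close>, \<open>\<F>\<close> and \<open>\<W>\<close>.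
\<close>

definition "cC = {(j, t - 1, 1 :: nat) | j. d dvd j}"
definition "cF = {(j, 1 :: nat, t - 1) | j. d dvd j}"
text \<open>With i + l = j and l = t - r these conditions express Ext^1(U i l, M) = 0 for i and i +
  l outside R; the start i is congruent to j + r modulo d since d divides t.\<close>

definition "cW = {(j, r, t - r) | j r. r \<le> t \<and> (\<not> d dvd j \<and> \<not> d dvd (j + r))}"

text \<open>Only the top position s = 0 can violate q = 1, and it is killed by \<alpha>^(t-1)
  exactly if l < t.\<close>

lemma U_cC:
  assumes "1 \<le> l" "l \<le> t"
  shows "U a l \<in> modcls cC \<longleftrightarrow> l = t \<or> \<not> d dvd a"
proof
  assume U: "U a l \<in> modcls cC"
  show "l = t \<or> \<not> d dvd a"
  proof (rule ccontr)
    assume "\<not> ?thesis"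
    then have c: "l < t" "d dvd a"
      using assms by auto
    then have "van a (t - 1) 1 (U a l)"
      by (intro modcls_van[OF U]) (auto simp: cC_def)
    from this[unfolded van_U[OF assms(2)], rule_format, of 0] have "\<not> l \<le> t - 1"
      using assms by auto
    then show False
      using c by linarith
  qed
next
  assume c: "l = t \<or> \<not> d dvd a"
  have "1 \<le> s" if "d dvd j" "(a + s) mod n = j mod n" "l \<le> s + (t - 1)" for j s
  proof (rule ccontr)
    assume "\<not> 1 \<le> s"
    then have "s = 0" "l \<le> t - 1"
      using that(3) by simp_all
    then show False
      using c that(1) dvd_cong[OF that(2)] assms by auto
  qed
  then show "U a l \<in> modcls cC"
    unfolding modcls_def cC_def using U_fg[OF assms(2), of a] van_U[OF assms(2)] by auto
qed

text \<open>Only the socle position s = l - 1 is killed by \<alpha>, and it lies in the image of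
  \<alpha>^(t-1) exactly if l = t.\<close>

lemma U_cF:
  assumes "1 \<le> l" "l \<le> t"
  shows "U a l \<in> modcls cF \<longleftrightarrow> l = t \<or> \<not> d dvd a + (l - 1)"
proof
  assume U: "U a l \<in> modcls cF"
  show "l = t \<or> \<not> d dvd a + (l - 1)"
  proof (rule ccontr)
    assume "\<not> ?thesis"
    then have c: "l < t" "d dvd a + (l - 1)"
      using assms by auto
    then have "van (a + (l - 1)) 1 (t - 1) (U a l)"
      by (intro modcls_van[OF U]) (auto simp: cF_def)
    from this[unfolded van_U[OF assms(2)], rule_format, of "l - 1"] show False
      using c assms by simp
  qed
next
  assume c: "l = t \<or> \<not> d dvd a + (l - 1)"
  have "t - 1 \<le> s" if "d dvd j" "s < l" "(a + s) mod n = j mod n" "l \<le> s + 1" for j s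
  proof -
    have "s = l - 1"
      using that by simp
    then show ?thesis
      using c that(1) dvd_cong[OF that(3)] by auto
  qed
  then show "U a l \<in> modcls cF"
    unfolding modcls_def cF_def using U_fg[OF assms(2), of a] van_U[OF assms(2)] by auto
qed

text \<open>A condition fails exactly for vertices a + s and a + e outside R with s < l \<le> e < t,
  taking r = e - s. As neighbours are not both in R, such an s is missing only for l = 1 with a in
  R, and such an e only for l = t, or for l = t - 1 with a + l in R.\<close>

lemma U_cW:
  assumes "1 \<le> l" "l \<le> t"
  shows "U a l \<in> modcls cW \<longleftrightarrow> l = t \<or> (l = 1 \<and> d dvd a) \<or> (l = t - 1 \<and> d dvd a + l)"
proof
  assume U: "U a l \<in> modcls cW"
  show "l = t \<or> (l = 1 \<and> d dvd a) \<or> (l = t - 1 \<and> d dvd a + l)"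
  proof (rule ccontr)
    assume c: "\<not> ?thesis"
    have "\<exists>s<l. \<not> d dvd a + s"
    proof (cases "d dvd a")
      case True
      then have "1 < l"
        using c assms by auto
      then show ?thesis
        using not_dvd_Suc[OF True] by (intro exI[of _ 1]) simp
    next
      case False
      then show ?thesis
        using assms by (intro exI[of _ 0]) simp
    qed
    then obtain s where s: "s < l" "\<not> d dvd a + s"
      by auto
    have "\<exists>e. l \<le> e \<and> e < t \<and> \<not> d dvd a + e"
    proof (cases "d dvd a + l")
      case True
      then have "l + 1 < t"
        using c assms by auto
      then show ?thesis
        using not_dvd_Suc[OF True] by (intro exI[of _ "l + 1"]) simp
    next
      case False
      then show ?thesis
        using assms c by (intro exI[of _ l]) simp
    qed
    then obtain e where e: "l \<le> e" "e < t" "\<not> d dvd a + e"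
      by auto
    have "van (a + s) (e - s) (t - (e - s)) (U a l)"
      by (rule modcls_van[OF U]) (use s e in \<open>auto simp: cW_def\<close>)
    from this[unfolded van_U[OF assms(2)], rule_format, of s] show False
      using s e by simp
  qed
next
  assume c: "l = t \<or> (l = 1 \<and> d dvd a) \<or> (l = t - 1 \<and> d dvd a + l)"
  have "t - r \<le> s"
    if r: "r \<le> t" "\<not> d dvd j" "\<not> d dvd (j + r)" and s: "s < l" "(a + s) mod n = j mod n" "l \<le> s + r" for j r s
  proof -
    have as: "\<not> d dvd a + s"
      using r(2) dvd_cong[OF s(2)] by simp
    have "(a + s + r) mod n = (j + r) mod n"
      using s(2) by (metis mod_add_left_eq)
    then have asr: "\<not> d dvd a + (s + r)"
      using r(3) dvd_cong[of "a + s + r" "j + r"] by (simp add: add.assoc)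
    show ?thesis
      using c
    proof (elim disjE conjE)
      assume "l = t"
      then show ?thesis
        using s(3) by simp
    next
      assume "l = 1" "d dvd a"
      then show ?thesis
        using s(1) as by simp
    next
      assume l: "l = t - 1" "d dvd a + l"
      then have "s + r \<noteq> l"
        using asr by auto
      then show ?thesis
        using s(3) l(1) by simp
    qed
  qed
  then show "U a l \<in> modcls cW"
    unfolding modcls_def cW_def using U_fg[OF assms(2), of a] van_U[OF assms(2)] by auto
qed

section \<open>The two cotorsion pairs and the thick class\<close>

abbreviation (input) "\<C> \<equiv> modcls cC :: 'k nak_mod set"
abbreviation (input) "\<F> \<equiv> modcls cF :: 'k nak_mod set"
abbreviation (input) "\<W> \<equiv> modcls cW :: 'k nak_mod set"

text \<open>If l = t - 1 and d divides a + l, then d does not divide the next number a + t, hence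
  not a. A simple module at a vertex in R is excluded by \<open>cC\<close>.\<close>

lemma U_CW:
  assumes "1 \<le> l" "l \<le> t"
  shows "U a l \<in> modcls (cC \<union> cW) \<longleftrightarrow> l = t \<or> (l = t - 1 \<and> d dvd a + l)"
proof -
  have "\<not> d dvd a" if "l = t - 1" "d dvd a + l"
  proof
    assume a: "d dvd a"
    have "Suc (a + l) = a + t"
      using that t_ge_2 by simp
    then have "\<not> d dvd a + t"
      using not_dvd_Suc[OF that(2)] by metis
    then show False
      using dvd_add_t[of a] a by blast
  qed
  then show ?thesis
    unfolding modcls_Un using U_cC[OF assms, of a] U_cW[OF assms, of a] by auto
qed

text \<open>The last vertex a + l - 1 is a neighbour of a + l and so outside R if a + l is inside. A
  simple module at a vertex in R has its socle there and is excluded by \<open>cF\<close>.\<close>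

lemma U_FW:
  assumes "1 \<le> l" "l \<le> t"
  shows "U a l \<in> modcls (cF \<union> cW) \<longleftrightarrow> l = t \<or> (l = t - 1 \<and> d dvd a + l)"
proof -
  have "\<not> d dvd a + (l - 1)" if "d dvd a + l"
    using not_dvd_Suc[of "a + (l - 1)"] that assms(1) by auto
  then show ?thesis
    unfolding modcls_Un using U_cF[OF assms, of a] U_cW[OF assms, of a] t_ge_3 by auto
qed

lemma FW_eq: "modcls (cF \<union> cW) = modcls (cC \<union> cW)"
  by (intro equalityI modcls_subset) (simp_all only: U_CW U_FW)

text \<open>For the nonprojective summands, l = t - 1 turns the condition of \<open>lproj_U\<close>
  into \<open>van (a + l) 1 (t - 1)\<close>, which belongs to \<open>cF\<close> since d divides a +
  l.\<close>

lemma CW_lproj: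
  assumes "M \<in> modcls (cC \<union> cW)"
  shows "lproj (modcls cF) M"
  using assms
proof (rule lproj_modcls)
  fix a l assume l: "1 \<le> l" "l \<le> t" and U: "U a l \<in> modcls (cC \<union> cW)"
  show "lproj \<F> (U a l)"
  proof (cases "l = t")
    case True
    show ?thesis
      unfolding True by (rule U_t_lproj) (auto dest: modcls_fg)
  next
    case False
    then have lt: "l = t - 1" "d dvd a + l"
      using U False unfolding U_CW[OF l] by blast+
    show ?thesis
    proof (rule lproj_U[OF l])
      fix X assume "X \<in> \<F>"
      then show "van (a + l) (t - l) l X"
        by (rule modcls_van) (use lt t_ge_2 in \<open>auto simp: cF_def\<close>)
    qed
  qed
qed

text \<open>For the nonprojective summands, \<open>linj_U\<close> asks for the condition with
  exponents t - 1 and 1 at the vertex before a, which belongs to \<open>cC\<close>.\<close>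

lemma CW_linj:
  assumes "M \<in> modcls (cC \<union> cW)"
  shows "linj (modcls cC) M"
  using assms
proof (rule linj_modcls)
  fix a l assume l: "1 \<le> l" "l \<le> t" and U: "U a l \<in> modcls (cC \<union> cW)"
  show "linj \<C> (U a l)"
  proof (cases "l = t")
    case True
    show ?thesis
      unfolding True by (rule U_t_linj) (auto dest: modcls_fg)
  next
    case False
    then have lt: "l = t - 1" "d dvd a + l"
      using U False unfolding U_CW[OF l] by blast+
    have a: "(a + n - 1 + 1) mod n = a mod n"
      using n_pos by simp
    \<comment> \<open>Modulo n the vertex before a differs from a + l by t, so it is divisible by d
      as well.\<close>
    have "a + n - 1 + t = a + l + n"
      using lt(1) t_ge_2 n_pos by simp
    then have j: "d dvd a + n - 1"
      using dvd_add_t[of "a + n - 1"] dvd_add_left_iff[OF d_dvd(1), of "a + l"] lt(2) by simp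
    show ?thesis
    proof (rule linj_U[OF l a])
      fix X assume "X \<in> \<C>"
      then show "van (a + n - 1) l (t - l) X"
        by (rule modcls_van) (use lt(1) t_ge_2 j in \<open>auto simp: cC_def\<close>)
    qed
  qed
qed

text \<open>The number k is -t modulo n: it moves a start vertex back by t without truncated
  subtraction.\<close>

lemma pred_shift:
  obtains k where "d dvd k" "k + t = t * n"
proof -
  have "t \<le> t * n"
    using n_pos by simp
  then have "t * n - t + t = t * n"
    by simp
  moreover have "d dvd t * n - t"
    by (intro dvd_diff_nat dvd_mult2 d_dvd)
  ultimately show ?thesis
    by (rule that[rotated])
qed

text \<open>For the covering, [a, a+l) is a quotient of [a, a+t), or of [a, a+t-1) if a + t - 1 is
  in R; either way a nonzero kernel has its last vertex outside R. For the embedding, only modules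
  whose last vertex lies in R need work; the cokernel has length t - 1 and stops just before that
  vertex.\<close>

lemma complete_CW_F: "complete_cotorsion_pair A (modcls (cC \<union> cW)) (modcls cF)"
proof (rule complete_cotorsion_pair_modcls)
  show "splits A X Y" if "X \<in> modcls (cC \<union> cW)" "Y \<in> modcls cF" for X Y
    by (rule lproj_splits[OF CW_lproj[OF that(1)] that(2) modcls_fg[OF that(2)] modcls_fg[OF that(1)]])
next
  fix a l assume l: "1 \<le> l" "l \<le> t"
  show "app_r \<F> (modcls (cC \<union> cW)) (U a l)"
  proof (cases "l = t")
    case True
    then show ?thesis
      using l U_CW[OF l, of a] by (intro app_r_self U_0_modcls U_fg) auto
  next
    case False
    then have lt: "l < t"
      using l by simp
    show ?thesis
    proof (cases "d dvd a + (t - 1)")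
      case True
      have "U (a + l) (t - 1 - l) \<in> \<F>"
      proof (cases "l = t - 1")
        case True
        then show ?thesis
          by (simp add: U_0_modcls)
      next
        case False
        then have l': "1 \<le> t - 1 - l" "t - 1 - l \<le> t"
          using lt by auto
        have "a + (t - 1) = Suc (a + l + (t - 1 - l - 1))"
          using l' by simp
        then have "\<not> d dvd a + l + (t - 1 - l - 1)"
          using not_dvd_Suc[of "a + l + (t - 1 - l - 1)"] True by auto
        then show ?thesis
          using U_cF[OF l', of "a + l"] by blast
      qed
      moreover have "U a (t - 1) \<in> modcls (cC \<union> cW)"
        using U_CW[of "t - 1" a] t_ge_2 True by simp
      ultimately show ?thesis
        using lt U_0_modcls by (intro app_r_ses[OF sum_closed_modcls, of l l "t - 1"]) simp_all
    next
      case False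
      have l': "1 \<le> t - l" "t - l \<le> t"
        using lt by auto
      have eq: "a + l + (t - l - 1) = a + (t - 1)"
        using lt by simp
      have "U (a + l) (t - l) \<in> \<F>"
        using False U_cF[OF l', of "a + l", unfolded eq] by blast
      moreover have "U a t \<in> modcls (cC \<union> cW)"
        using U_CW[of t a] t_ge_2 by simp
      ultimately show ?thesis
        using lt U_0_modcls by (intro app_r_ses[OF sum_closed_modcls, of l l t]) simp_all
    qed
  qed
  show "app_l \<F> (modcls (cC \<union> cW)) (U a l)"
  proof (cases "U a l \<in> \<F>")
    case True
    then show ?thesis
      using U_fg[OF l(2)] by (intro app_l_self U_0_modcls)
  next
    case False
    then have lt: "l < t" and al: "d dvd a + (l - 1)"
      using l U_cF[OF l, of a] by auto
    obtain k where k: "d dvd k" "k + t = t * n"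
      by (rule pred_shift)
    \<comment> \<open>Modulo n this is a + l - t, so U a' t has the same socle as U a l. Its
      quotient U a' (t - 1) omits the vertex a + l - 1 in R, and the other middle term is U a (l -
      1), which ends outside R or is 0.\<close>
    define a' where "a' = a + l + k"
    have sh: "a' + (t - l) = a + t * n"
      using lt k(2) by (simp add: a'_def)
    have "U (a' + (t - l)) (t - 1 - (t - l)) \<in> \<F>"
    proof (cases "l = 1")
      case True
      then show ?thesis
        by (simp add: U_0_modcls)
    next
      case False
      then have l': "1 \<le> l - 1" "l - 1 \<le> t"
        using l by auto
      have eq: "a + (l - 1) = Suc (a + (l - 1 - 1))" "a + t * n + (l - 1 - 1) = a + (l - 1 - 1) + t * n"
        using l' by simp_all
      have "\<not> d dvd a + (l - 1 - 1)"
      proof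
        assume "d dvd a + (l - 1 - 1)"
        from not_dvd_Suc[OF this, folded eq(1)] al show False
          by (rule notE)
      qed
      moreover have "d dvd t * n"
        using d_dvd by simp
      ultimately have "\<not> d dvd a + t * n + (l - 1 - 1)"
        unfolding eq(2) using dvd_add_left_iff by blast
      moreover have "t - 1 - (t - l) = l - 1"
        using lt by simp
      ultimately show ?thesis
        using U_cF[OF l', of "a + t * n"] sh by simp
    qed
    moreover have "U a' t \<in> \<F>"
      using U_cF[of t a'] t_ge_2 by simp
    moreover have "U a' (t - 1) \<in> modcls (cC \<union> cW)"
    proof -
      have "a' + (t - 1) = a + (l - 1) + k + t"
        using t_ge_2 l by (simp add: a'_def)
      then have "d dvd a' + (t - 1)"
        using al k(1) d_dvd by simp
      then show ?thesis
        using U_CW[of "t - 1" a'] t_ge_2 by simp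
    qed
    ultimately have "app_l \<F> (modcls (cC \<union> cW)) (U (a' + (t - l)) (t - (t - l)))"
      using l by (intro app_l_ses[OF sum_closed_modcls, of "t - l" "t - 1" t]) simp_all
    moreover have "U (a' + (t - l)) (t - (t - l)) = U a l"
      using U_cong[of "a + t * n" a l] l unfolding sh by simp
    ultimately show ?thesis
      by simp
  qed
qed

text \<open>For the covering, a module [a, a+l) outside \<open>\<C>\<close> has a in R; the kernel
  is [a+1, a+t), and the middle term [a+1, a+l) starts outside R. For the embedding, [a, a+l) is put
  into the module with the same socle and length t, or t - 1 if a + l is in R, so that a nonzero
  cokernel starts outside R.\<close>

lemma complete_C_CW: "complete_cotorsion_pair A (modcls cC) (modcls (cC \<union> cW))"
proof (rule complete_cotorsion_pair_modcls)
  show "splits A X Y" if "X \<in> modcls cC" "Y \<in> modcls (cC \<union> cW)" for X Y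
    by (rule linj_splits[OF CW_linj[OF that(2)] that(1) modcls_fg[OF that(2)] modcls_fg[OF that(1)]])
next
  fix a l assume l: "1 \<le> l" "l \<le> t"
  show "app_r (modcls (cC \<union> cW)) \<C> (U a l)"
  proof (cases "U a l \<in> \<C>")
    case True
    then show ?thesis
      using U_fg[OF l(2)] by (intro app_r_self U_0_modcls)
  next
    case False
    then have lt: "l < t" and a: "d dvd a"
      using l U_cC[OF l, of a] by auto
    have "U (a + 1) (t - 1) \<in> modcls (cC \<union> cW)"
      using U_CW[of "t - 1" "a + 1"] t_ge_2 dvd_add_t[of a] a by simp
    moreover have "U (a + 1) (l - 1) \<in> \<C>"
    proof (cases "l = 1")
      case True
      then show ?thesis
        by (simp add: U_0_modcls)
    next
      case False
      then show ?thesis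
        using U_cC[of "l - 1" "a + 1"] not_dvd_Suc[OF a] l by simp
    qed
    moreover have "U a t \<in> \<C>"
      using U_cC[of t a] t_ge_2 by simp
    ultimately show ?thesis
      using l by (intro app_r_ses[OF sum_closed_modcls, of 1 l t]) simp_all
  qed
  obtain k where k: "d dvd k" "k + t = t * n"
    by (rule pred_shift)
  show "app_l (modcls (cC \<union> cW)) \<C> (U a l)"
  proof (cases "l = t")
    case True
    then show ?thesis
      using l U_CW[OF l, of a] by (intro app_l_self U_0_modcls U_fg) auto
  next
    case False
    then have lt: "l < t"
      using l by simp
    show ?thesis
    proof (cases "d dvd a + l")
      case True
      \<comment> \<open>Modulo n this is a + l - (t - 1), the start of the module of length t - 1
        that ends where U a l ends.\<close>
      define a' where "a' = Suc (a + l + k)"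
      have sh: "a' + (t - 1 - l) = a + t * n"
        using lt k(2) by (simp add: a'_def)
      have "a' + (t - 1) = a + l + k + t"
        using t_ge_2 by (simp add: a'_def)
      then have "d dvd a' + (t - 1)"
        using True k(1) d_dvd by simp
      then have "U a' (t - 1) \<in> modcls (cC \<union> cW)"
        using U_CW[of "t - 1" a'] t_ge_2 by simp
      moreover have "U a' (t - 1 - l) \<in> \<C>"
      proof (cases "l = t - 1")
        case True
        then show ?thesis
          by (simp add: U_0_modcls)
      next
        case False
        have "\<not> d dvd a'"
          using not_dvd_Suc[of "a + l + k"] True k(1) by (simp add: a'_def)
        then show ?thesis
          using U_cC[of "t - 1 - l" a'] False lt by simp
      qed
      ultimately have "app_l (modcls (cC \<union> cW)) \<C> (U (a' + (t - 1 - l)) (t - 1 - (t - 1 - l)))"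
        using lt U_0_modcls by (intro app_l_ses[OF sum_closed_modcls, of "t - 1 - l" "t - 1 - l" "t - 1"]) simp_all
      moreover have "U (a' + (t - 1 - l)) (t - 1 - (t - 1 - l)) = U a l"
        using U_cong[of "a + t * n" a l] lt unfolding sh by simp
      ultimately show ?thesis
        by simp
    next
      case False
      define a' where "a' = a + l + k"
      have sh: "a' + (t - l) = a + t * n"
        using lt k(2) by (simp add: a'_def)
      have "\<not> d dvd a'"
        using False dvd_add_left_iff[OF k(1), of "a + l"] by (simp add: a'_def)
      then have "U a' (t - l) \<in> \<C>"
        using U_cC[of "t - l" a'] lt by simp
      moreover have "U a' t \<in> modcls (cC \<union> cW)"
        using U_CW[of t a'] t_ge_2 by simp
      ultimately have "app_l (modcls (cC \<union> cW)) \<C> (U (a' + (t - l)) (t - (t - l)))"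
        using lt U_0_modcls by (intro app_l_ses[OF sum_closed_modcls, of "t - l" "t - l" t]) simp_all
      moreover have "U (a' + (t - l)) (t - (t - l)) = U a l"
        using U_cong[of "a + t * n" a l] l unfolding sh by simp
      ultimately show ?thesis
        by simp
    qed
  qed
qed

text \<open>Passing from (j, r) to (j + r, t - r) replaces the vertices j, j + r by j + r, j + t,
  and a shift by t does not affect divisibility by d.\<close>

lemma thick_W: "thick A \<W>"
proof (rule thick_modcls[OF cW_def])
  fix j r assume r: "\<not> d dvd j \<and> \<not> d dvd (j + r)" "r \<le> t"
  then have "j + r + (t - r) = j + t"
    by simp
  then show "\<not> d dvd j + r \<and> \<not> d dvd (j + r + (t - r))"
    using r(1) dvd_add_t[of j] by simp
next
  fix i j r assume r: "\<not> d dvd j \<and> \<not> d dvd (j + r)" "r \<le> t" and i: "(i + (t - r)) mod n = j mod n"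
  have "(i + (t - r) + r) mod n = (j + r) mod n"
    using i by (metis mod_add_left_eq)
  then have "d dvd i + (t - r) + r \<longleftrightarrow> d dvd j + r"
    by (rule dvd_cong)
  moreover have "i + (t - r) + r = i + t"
    using r(2) by simp
  ultimately show "\<not> d dvd i \<and> \<not> d dvd i + (t - r)"
    using r(1) dvd_add_t[of i] dvd_cong[OF i] by simp
qed

lemma hovey: "hovey_triple A \<C> \<F> \<W>"
  using complete_CW_F complete_C_CW thick_W FW_eq by (simp add: hovey_triple_def flip: modcls_Un)

section \<open>Exceptionality and the type of the triple\<close>

lemma n_ge_d: "d \<le> n"
  using d_dvd(1) n_pos by (intro dvd_imp_le) simp_all

lemma not_dvd_pred_n: "\<not> d dvd n - 1"
  using not_dvd_Suc[of "n - 1"] n_pos d_dvd(1) by auto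

lemma S_CF: "U (n - 1) 1 \<in> \<C> \<inter> \<F>"
  using U_cC[of 1 "n - 1"] U_cF[of 1 "n - 1"] t_ge_2 not_dvd_pred_n by simp

text \<open>Ext^1 from this simple module is governed by the condition at the vertex n, that is 0,
  which is one of those defining \<open>\<C>\<close>.\<close>

lemma S_projective: "U (n - 1) 1 \<in> projectives A (\<C> \<inter> \<F>)"
proof (rule lproj_projectives[OF _ S_CF])
  show "\<C> \<inter> \<F> \<subseteq> fg_mods A"
    by (auto dest: modcls_fg)
  show "lproj (\<C> \<inter> \<F>) (U (n - 1) 1)"
  proof (rule lproj_U)
    fix X assume "X \<in> \<C> \<inter> \<F>"
    then have "X \<in> \<C>" ..
    then show "van (n - 1 + 1) (t - 1) 1 X"
      by (rule modcls_van) (use n_pos d_dvd(1) in \<open>simp add: cC_def\<close>)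
  qed (use t_ge_2 in simp_all)
qed

lemma exceptional_triple: "exceptional A \<C> \<F> \<W>"
proof -
  \<comment> \<open>Here t \<ge> 3 is essential: for t = 2 the simple module would have length t -
    1, and as the next vertex is in R it would lie in \<open>\<W>\<close>.\<close>
  have "U (n - 1) 1 \<notin> \<W>"
    using U_cW[of 1 "n - 1"] t_ge_3 not_dvd_pred_n by auto
  then have "\<C> \<inter> \<F> \<inter> \<W> \<noteq> projectives A (\<C> \<inter> \<F>)"
    using S_projective by auto
  then show ?thesis
    using hovey by (simp add: exceptional_def frobenius_pair_def)
qed

text \<open>The module of length 2 starting at n - 2 gives a nonsplit conflation that begins with
  the simple module at n - 1. Its terms lie in \<open>\<C> \<inter> \<F>\<close> because for d \<ge>
  3 both vertices are outside R.\<close>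

lemma not_frobenius:
  assumes "3 \<le> d"
  shows "\<not> frobenius A (\<C> \<inter> \<F>)"
proof
  assume "frobenius A (\<C> \<inter> \<F>)"
  then have inj: "U (n - 1) 1 \<in> injectives A (\<C> \<inter> \<F>)"
    using S_projective by (simp add: frobenius_def)
  have n3: "3 \<le> n"
    using assms n_ge_d by simp
  have n2: "\<not> d dvd n - 2"
  proof
    assume "d dvd n - 2"
    from dvd_diff_nat[OF d_dvd(1) this] have "d dvd 2"
      using n3 by simp
    then show False
      using assms dvd_imp_le[of d 2] by simp
  qed
  have eq: "n - 2 + 1 = n - 1"
    using n3 by simp
  have "1 \<le> (1::nat)" "1 \<le> (2::nat)" "2 \<le> t"
    using t_ge_2 by simp_all
  from U_ses[OF this, of "n - 2", unfolded eq]
  obtain f g where se: "short_exact A (U (n - 1) (2 - 1)) f (bsum (U (n - 2) 2) (U (n - 1) (1 - 1))) g (U (n - 2) 1)"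
    by (elim exE) (rule that)
  have B2: "U (n - 2) 2 \<in> \<C>" "U (n - 2) 2 \<in> \<F>" and B1: "U (n - 2) 1 \<in> \<C>" "U (n - 2) 1 \<in> \<F>"
    using n2 eq not_dvd_pred_n t_ge_2
    by (simp_all add: U_cC U_cF)
  \<comment> \<open>The second summand is the zero module that \<open>U_ses\<close> produces for w =
    u.\<close>
  define Y where "Y = bsum (U (n - 2) 2) (U (n - 1) 0)"
  have "Y \<in> \<C> \<inter> \<F>"
    unfolding Y_def using B2 by (simp add: modcls_bsum U_0_modcls)
  then have cf: "conflation A (\<C> \<inter> \<F>) (U (n - 1) 1) f Y g (U (n - 2) 1)"
    using se B1 S_CF by (simp add: conflation_def Y_def)
  from injectivesD[OF inj cf lhom_id]
  obtain r where r: "r \<in> lhom A Y (U (n - 1) 1)" "\<forall>x\<in>carrier (U (n - 1) 1). r (f x) = x"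
    by (rule bexE)
  have f: "f \<in> lhom A (U (n - 1) 1) Y"
    using short_exactD(1)[OF se] by (simp add: Y_def)
  have re: "retract A (U (n - 1) 1) Y"
    by (rule retractI[OF f r(1)]) (use r(2) in simp)
  \<comment> \<open>A condition that excludes the retraction: at n - 1 the elements killed by
    \<alpha> are multiples of \<alpha> in U (n - 2) 2, but not in the simple module.\<close>
  have v: "van (n - 1) 1 1 Y"
    unfolding Y_def by (rule van_bsum[OF U_module U_module]) (use t_ge_2 in \<open>simp_all add: van_U\<close>)
  have "van (n - 1) 1 1 (U (n - 1) 1)"
    by (rule van_retract[OF U_module _ re v]) (use t_ge_2 in \<open>simp_all add: Y_def bsum_module U_module\<close>)
  from this[unfolded van_U[OF order_trans[OF one_le_numeral t_ge_2]], rule_format, of 0] show False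
    by simp
qed

text \<open>For d = 2 the nonprojective uniserial modules in \<open>\<C> \<inter> \<F>\<close> are
  those with odd start and odd length. Both kinds of conditions hold at all even vertices, which for
  odd a makes U a 1 and U a (t - 1) relatively projective and injective at the same time.\<close>

lemma frobenius_2:
  assumes "d = 2"
  shows "frobenius A (\<C> \<inter> \<F>)"
proof -
  have nt: "even n" "even t"
    using d_dvd assms by simp_all
  have CF: "\<C> \<inter> \<F> = modcls (cC \<union> cF)"
    by (simp add: modcls_Un)
  have UB: "U a l \<in> modcls (cC \<union> cF) \<longleftrightarrow> l = t \<or> odd a \<and> odd l" if "1 \<le> l" "l \<le> t" for a l
    unfolding modcls_Un using U_cC[OF that, of a] U_cF[OF that, of a] that by (auto simp: assms)
  have fg: "modcls (cC \<union> cF) \<subseteq> fg_mods A"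
    by (auto dest: modcls_fg)
  \<comment> \<open>Taking all objects that are relatively projective and injective makes closure
    under sums immediate.\<close>
  define G where "G = modcls (cC \<union> cF) \<inter> {M \<in> fg_mods A. lproj (modcls (cC \<union> cF)) M \<and> linj (modcls (cC \<union> cF)) M}"
  have scG: "sum_closed G"
    unfolding G_def by (intro sum_closed_Int sum_closed_modcls sum_closed_rel)
  have conds: "van j (t - 1) 1 X" "van j 1 (t - 1) X" if "X \<in> modcls (cC \<union> cF)" "even j" for X j
  proof -
    have "(j, t - 1, 1) \<in> cC \<union> cF" "(j, 1, t - 1) \<in> cC \<union> cF"
      unfolding cC_def cF_def using that(2) assms by simp_all
    then show "van j (t - 1) 1 X" "van j 1 (t - 1) X"
      by (simp_all only: modcls_van[OF that(1)])
  qed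
  have G_t: "U a t \<in> G" for a
    using UB[of t a] t_ge_2 U_t_lproj[OF fg] U_t_linj[OF fg] U_fg by (simp add: G_def)
  have G_pred: "U a (t - 1) \<in> G" and G_1: "U a 1 \<in> G" if a: "odd a" for a
  proof -
    have j: "(a + n - 1 + 1) mod n = a mod n" "even (a + n - 1)" "even (a + (t - 1))" "even (a + 1)"
      using n_pos a nt t_ge_2 by simp_all
    have e: "t - (t - 1) = 1"
      using t_ge_2 by simp
    have "lproj (modcls (cC \<union> cF)) (U a (t - 1))"
      by (rule lproj_U) (use t_ge_2 j(3) conds in \<open>simp_all add: e\<close>)
    moreover have "linj (modcls (cC \<union> cF)) (U a (t - 1))"
      by (rule linj_U[OF _ _ j(1)]) (use t_ge_2 j(2) conds in \<open>simp_all add: e\<close>)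
    ultimately show "U a (t - 1) \<in> G"
      using UB[of "t - 1" a] t_ge_2 U_fg[of "t - 1" a] nt a by (simp add: G_def)
    have "lproj (modcls (cC \<union> cF)) (U a 1)"
      by (rule lproj_U) (use t_ge_2 j(4) conds in simp_all)
    moreover have "linj (modcls (cC \<union> cF)) (U a 1)"
      by (rule linj_U[OF _ _ j(1)]) (use t_ge_2 j(2) conds in simp_all)
    ultimately show "U a 1 \<in> G"
      using UB[of 1 a] t_ge_2 U_fg[of 1 a] a by (simp add: G_def)
  qed
  show ?thesis
    unfolding CF
  proof (rule frobeniusI(1)[OF fg, of G])
    show "G \<subseteq> projectives A (modcls (cC \<union> cF))" "G \<subseteq> injectives A (modcls (cC \<union> cF))"
      using fg by (auto simp: G_def intro!: lproj_projectives linj_injectives)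
  next
    fix M assume M: "M \<in> modcls (cC \<union> cF)"
    show "app_r (modcls (cC \<union> cF)) G M"
    proof (rule app_r_modcls[OF sum_closed_modcls scG _ M])
      fix a l assume l: "1 \<le> l" "l \<le> t" and U: "U a l \<in> modcls (cC \<union> cF)"
      show "app_r (modcls (cC \<union> cF)) G (U a l)"
      proof (cases "l = t")
        case True
        then show ?thesis
          using G_t U_fg[OF l(2)] by (intro app_r_self U_0_modcls) auto
      next
        case False
        then have lt: "l < t" and odd: "odd a" "odd l"
          using U l UB[OF l, of a] by auto
        \<comment> \<open>The covering is by [a, a+t-1) and the simple module at the socle vertex a
          + l - 1; the kernel [a+l-1, a+t-1) again has odd start and odd length t - l.\<close>
        have o: "odd (a + (l - 1))" "odd (t - l)"
          using odd l nt lt by auto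
        have "U (a + (l - 1)) (t - 1 - (l - 1)) \<in> modcls (cC \<union> cF)"
          using UB[of "t - l" "a + (l - 1)"] o lt l by simp
        moreover have "U (a + (l - 1)) (l - (l - 1)) \<in> G"
          using G_1[OF o(1)] l by simp
        ultimately show ?thesis
          using lt G_pred[OF odd(1)] by (intro app_r_ses[OF scG, of "l - 1" l "t - 1"]) simp_all
      qed
    qed
    show "app_l G (modcls (cC \<union> cF)) M"
    proof (rule app_l_modcls[OF scG sum_closed_modcls _ M])
      fix a l assume l: "1 \<le> l" "l \<le> t" and U: "U a l \<in> modcls (cC \<union> cF)"
      show "app_l G (modcls (cC \<union> cF)) (U a l)"
      proof (cases "l = t")
        case True
        then show ?thesis
          using G_t U_fg[OF l(2)] by (intro app_l_self U_0_modcls) auto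
      next
        case False
        then have lt: "l < t" and odd: "odd a" "odd l"
          using U l UB[OF l, of a] by auto
        obtain k where k: "d dvd k" "k + t = t * n"
          by (rule pred_shift)
        \<comment> \<open>Modulo n this is a + l - (t - 1). U a l embeds into the sum of U a' (t -
          1), which has the same socle, and the simple module at its top a; the cokernel is U a' (t
          - l).\<close>
        define a' where "a' = a + l + 1 + k"
        have sh: "a' + (t - l - 1) = a + t * n"
          using lt k(2) by (simp add: a'_def)
        have o: "odd a'" "odd (t - l)" "odd (a + t * n)"
          using odd l nt lt k(1) by (auto simp: a'_def assms)
        have "U (a' + (t - l - 1)) (t - l - (t - l - 1)) \<in> G"
          using G_1[OF o(3)] lt unfolding sh by simp
        moreover have "U a' (t - l) \<in> modcls (cC \<union> cF)"
          using UB[of "t - l" a'] o lt by simp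
        ultimately have "app_l G (modcls (cC \<union> cF)) (U (a' + (t - l - 1)) (t - 1 - (t - l - 1)))"
          using l G_pred[OF o(1)] by (intro app_l_ses[OF scG, of "t - l - 1" "t - l" "t - 1"]) simp_all
        moreover have "U (a' + (t - l - 1)) (t - 1 - (t - l - 1)) = U a l"
          using U_cong[of "a + t * n" a l] lt unfolding sh by simp
        ultimately show ?thesis
          by simp
      qed
    qed
  qed
qed

section \<open>The three classes as additive hulls\<close>

lemma R_iff: "i \<in> {(d * j) mod n | j. True} \<longleftrightarrow> i < n \<and> d dvd i"
proof
  assume "i \<in> {(d * j) mod n | j. True}"
  then show "i < n \<and> d dvd i"
    using n_pos d_dvd(1) by (auto simp: dvd_mod)
next
  assume "i < n \<and> d dvd i"
  then show "i \<in> {(d * j) mod n | j. True}"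
    by (auto elim!: dvdE) (metis mod_less)
qed

lemma finite_pairs: "finite {(i, l). i < n \<and> Q i l \<and> 1 \<le> l \<and> l < t}"
  by (rule finite_subset[of _ "{..<n} \<times> {..<t}"]) auto

lemma add_class_C:
  "add_class A (direct_sum {..<n} (\<lambda>i. U i t) \<oplus>\<^sub>m
    direct_sum {(i, l). i < n \<and> i \<notin> {(d * j) mod n | j. True} \<and> 1 \<le> l \<and> l < t} (\<lambda>(i, l). U i l)) = \<C>"
proof (rule add_class_direct_sum)
  show "finite {(i, l). i < n \<and> i \<notin> {(d * j) mod n | j. True} \<and> 1 \<le> l \<and> l < t}"
    by (rule finite_pairs)
  fix a l assume *: "a < n" "1 \<le> l" "l \<le> t" "U a l \<in> \<C>"
  show "(\<exists>i\<in>{..<n}. retract A (U a l) (U i t)) \<or>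
    (\<exists>i\<in>{(i, l). i < n \<and> i \<notin> {(d * j) mod n | j. True} \<and> 1 \<le> l \<and> l < t}. retract A (U a l) (case i of (i, l) \<Rightarrow> U i l))"
  proof (cases "l = t")
    case True
    then show ?thesis
      using *(1) retract_refl by (intro disjI1 bexI[of _ a]) auto
  next
    case False
    then show ?thesis
      using * U_cC[OF *(2,3), of a] retract_refl unfolding R_iff by (intro disjI2 bexI[of _ "(a, l)"]) auto
  qed
next
  fix i j p q assume i: "i \<in> {(i, l). i < n \<and> i \<notin> {(d * j) mod n | j. True} \<and> 1 \<le> l \<and> l < t}" "(j, p, q) \<in> cC"
  obtain a l where al: "i = (a, l)" "1 \<le> l" "l \<le> t" "\<not> d dvd a"
    using i(1) unfolding R_iff by auto
  have "U a l \<in> \<C>"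
    using U_cC[OF al(2,3)] al(4) by simp
  then show "van j p q (case i of (i, l) \<Rightarrow> U i l)"
    using modcls_van[OF _ i(2)] al(1) by simp
next
  fix i j p q assume "(j, p, q) \<in> cC"
  then show "van j p q (U i t)"
    using U_cC[of t i] t_ge_2 by (intro modcls_van) simp_all
qed (auto intro!: U_fg)

lemma add_class_F:
  "add_class A (direct_sum {..<n} (\<lambda>i. U i t) \<oplus>\<^sub>m
    direct_sum {(i, l). i < n \<and> (i + l - 1) mod n \<notin> {(d * j) mod n | j. True} \<and> 1 \<le> l \<and> l < t} (\<lambda>(i, l). U i l)) = \<F>"
proof (rule add_class_direct_sum)
  have R: "(i + l - 1) mod n \<in> {(d * j) mod n | j. True} \<longleftrightarrow> d dvd i + (l - 1)" if "1 \<le> l" for i l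
    unfolding R_iff using that n_pos dvd_mod_iff[OF d_dvd(1), of "i + l - 1"] by simp
  show "finite {(i, l). i < n \<and> (i + l - 1) mod n \<notin> {(d * j) mod n | j. True} \<and> 1 \<le> l \<and> l < t}"
    by (rule finite_pairs)
  {
    fix a l assume *: "a < n" "1 \<le> l" "l \<le> t" "U a l \<in> \<F>"
    show "(\<exists>i\<in>{..<n}. retract A (U a l) (U i t)) \<or>
      (\<exists>i\<in>{(i, l). i < n \<and> (i + l - 1) mod n \<notin> {(d * j) mod n | j. True} \<and> 1 \<le> l \<and> l < t}.
        retract A (U a l) (case i of (i, l) \<Rightarrow> U i l))"
    proof (cases "l = t")
      case True
      then show ?thesis
        using *(1) retract_refl by (intro disjI1 bexI[of _ a]) auto
    next
      case False
      then have "(a + l - 1) mod n \<notin> {(d * j) mod n | j. True}"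
        using * U_cF[OF *(2,3), of a] R[OF *(2), of a] by simp
      then show ?thesis
        using * False retract_refl by (intro disjI2 bexI[of _ "(a, l)"]) auto
    qed
  next
    fix i j p q
    assume i: "i \<in> {(i, l). i < n \<and> (i + l - 1) mod n \<notin> {(d * j) mod n | j. True} \<and> 1 \<le> l \<and> l < t}" "(j, p, q) \<in> cF"
    obtain a l where al: "i = (a, l)" "1 \<le> l" "l \<le> t" "(a + l - 1) mod n \<notin> {(d * j) mod n | j. True}"
      using i(1) by auto
    have "U a l \<in> \<F>"
      using U_cF[OF al(2,3), of a] al(4) R[OF al(2), of a] by simp
    then show "van j p q (case i of (i, l) \<Rightarrow> U i l)"
      using modcls_van[OF _ i(2)] al(1) by simp
  next
    fix i j p q assume "(j, p, q) \<in> cF"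
    then show "van j p q (U i t)"
      using U_cF[of t i] t_ge_2 by (intro modcls_van) simp_all
  }
qed (auto intro!: U_fg)

lemma add_class_W:
  "add_class A (direct_sum {..<n} (\<lambda>i. U i t) \<oplus>\<^sub>m
    direct_sum {(d * j) mod n | j. True} (\<lambda>i. U i 1 \<oplus>\<^sub>m U (i + 1) (t - 1))) = \<W>"
proof (rule add_class_direct_sum)
  have t: "1 \<le> t" "t - 1 \<le> t" "1 \<le> t - 1"
    using t_ge_2 by simp_all
  note m = U_module[OF t(1)] U_module[OF t(2)]
  show "finite {(d * j) mod n | j. True}"
    by (rule finite_subset[of _ "{..<n}"]) (use n_pos in auto)
  {
    fix a l assume *: "a < n" "1 \<le> l" "l \<le> t" "U a l \<in> \<W>"
    consider "l = t" | "l = 1" "d dvd a" | "l = t - 1" "d dvd a + l"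
      using * U_cW[OF *(2,3), of a] by auto
    then show "(\<exists>i\<in>{..<n}. retract A (U a l) (U i t)) \<or>
      (\<exists>i\<in>{(d * j) mod n | j. True}. retract A (U a l) (U i 1 \<oplus>\<^sub>m U (i + 1) (t - 1)))"
    proof cases
      case 1
      then show ?thesis
        using *(1) retract_refl by (intro disjI1 bexI[of _ a]) auto
    next
      case 2
      have "retract A (U a 1) (U a 1 \<oplus>\<^sub>m U (a + 1) (t - 1))"
        by (rule retractI[OF direct_sum2_lhom(1)[OF m] direct_sum2_lhom(3)[OF m]]) simp
      then show ?thesis
        using 2 * by (intro disjI2 bexI[of _ a]) (simp_all only: R_iff)
    next
      case 3
      \<comment> \<open>The vertex before a. It is in R since adding t to it gives a + l modulo n,
        so U a l is the second summand belonging to \<open>?i\<close>.\<close>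
      let ?i = "(a + n - 1) mod n"
      have "a + n - 1 + t = a + l + n"
        using 3(1) t_ge_2 n_pos by simp
      then have "d dvd a + n - 1"
        using dvd_add_t[of "a + n - 1"] dvd_add_left_iff[OF d_dvd(1), of "a + l"] 3(2) by simp
      then have i: "?i < n \<and> d dvd ?i"
        using n_pos dvd_mod_iff[OF d_dvd(1)] by simp
      have "(?i + 1) mod n = (a + n - 1 + 1) mod n"
        by (rule mod_add_left_eq)
      also have "\<dots> = a mod n"
        using n_pos by simp
      finally have "(?i + 1) mod n = a mod n" .
      then have "U (?i + 1) (t - 1) = U a l"
        unfolding 3(1) by (rule U_cong)
      moreover have "retract A (U (?i + 1) (t - 1)) (U ?i 1 \<oplus>\<^sub>m U (?i + 1) (t - 1))"
        by (rule retractI[OF direct_sum2_lhom(2)[OF m] direct_sum2_lhom(4)[OF m]]) simp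
      ultimately show ?thesis
        using i by (intro disjI2 bexI[of _ ?i]) (simp_all only: R_iff)
    qed
  next
    fix i j p q assume i: "i \<in> {(d * j) mod n | j. True}" "(j, p, q) \<in> cW"
    then have di: "d dvd i"
      unfolding R_iff by simp
    have "U i 1 \<in> \<W>"
      using U_cW[OF order_refl t(1), of i] di by simp
    moreover have "U (i + 1) (t - 1) \<in> \<W>"
      using U_cW[OF t(3,2), of "i + 1"] di dvd_add_t[of i] t by simp
    ultimately show "van j p q (U i 1 \<oplus>\<^sub>m U (i + 1) (t - 1))"
      by (intro van_direct_sum2[OF m] modcls_van[OF _ i(2)])
  next
    fix i j p q assume "(j, p, q) \<in> cW"
    then show "van j p q (U i t)"
      using U_cW[of t i] t by (intro modcls_van) simp_all
  next
    fix i show "U i 1 \<oplus>\<^sub>m U (i + 1) (t - 1) \<in> fg_mods A"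
      by (rule direct_sum2_fg[OF U_fg[OF t(1)] U_fg[OF t(2)]])
  }
qed (auto intro!: U_fg)

end

theorem theoremA:
  fixes n t d :: nat and A :: "'k::alg_closed_field nak ring"
  assumes "n \<ge> 1" and "t \<ge> 2"
    and "A = nakayama_algebra n t" and "d = gcd n t"
  shows
    "((\<exists>\<C> \<F> \<W> :: 'k nak_mod set. exceptional A \<C> \<F> \<W>) \<longleftrightarrow> d \<ge> 2 \<and> t \<ge> 3) \<and>
     (d \<ge> 2 \<and> t \<ge> 3 \<longrightarrow>
       (let R = {(d * j) mod n | j. True};
            M = (\<lambda>(i, l). uniserial n i l :: 'k nak_mod);
            P = direct_sum {..<n} (\<lambda>i. M (i, t));
            \<C> = add_class A (P \<oplus>\<^sub>m direct_sum {(i, l). i < n \<and> i \<notin> R \<and> 1 \<le> l \<and> l < t} M) :: 'k nak_mod set;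
            \<F> = add_class A (P \<oplus>\<^sub>m direct_sum {(i, l). i < n \<and> (i + l - 1) mod n \<notin> R \<and> 1 \<le> l \<and> l < t} M)
                  :: 'k nak_mod set;
            \<W> = add_class A (P \<oplus>\<^sub>m direct_sum R (\<lambda>i. M (i, 1) \<oplus>\<^sub>m M (i + 1, t - 1))) :: 'k nak_mod set
        in exceptional A \<C> \<F> \<W> \<and>
           (type_I A \<C> \<F> \<W> \<longleftrightarrow> d = 2) \<and>
           (type_II A \<C> \<F> \<W> \<longleftrightarrow> d \<ge> 3)))"
proof -
  interpret nakayama n t A
    using assms by unfold_locales
  show ?thesis
  proof (cases "d \<ge> 2 \<and> t \<ge> 3")
    case True
    interpret exceptional_nakayama n t A d
      using True assms(4) by unfold_locales simp_all
    have "frobenius A (modcls cC \<inter> modcls cF) \<longleftrightarrow> d = 2"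
      using frobenius_2 not_frobenius True by fastforce
    then have "type_I A (modcls cC) (modcls cF) (modcls cW) \<longleftrightarrow> d = 2"
      "type_II A (modcls cC) (modcls cF) (modcls cW) \<longleftrightarrow> d \<ge> 3"
      using exceptional_triple True by (auto simp: type_I_def type_II_def)
    moreover have "\<exists>\<C> \<F> \<W> :: 'k nak_mod set. exceptional A \<C> \<F> \<W>"
      using exceptional_triple by (intro exI)
    ultimately show ?thesis
      using True exceptional_triple
      unfolding Let_def prod.case add_class_C add_class_F add_class_W by simp
  next
    case False
    have "gcd n t \<noteq> 0"
      using assms(1) by simp
    then have "gcd n t = 1 \<or> t = 2"
      using False assms(2,4) by linarith
    then have "coprime n t \<or> t = 2"
      by (simp add: coprime_iff_gcd_eq_1)
    then have "\<not> exceptional A \<C> \<F> \<W>" for \<C> \<F> \<W> :: "'k nak_mod set"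
      using hovey_frobenius_pair[of \<C> \<F> \<W>] by (auto simp: exceptional_def)
    then show ?thesis
      using False by simp
  qed
qed

end
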